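(* Let $m_+\in\mathcal P^+$. Suppose that $\mathcal M\subset\mathcal P$ is a finite set of distinct monomials such that: (i) $\{m_+\}=\mathcal P^+\cap\mathcal M$; (ii) for all $m\in\mathcal M$ and all $(i,a)\in I\times\mathbb C^*$, if $mA_{i,a}^{-1}\notin\mathcal M$ then $mA_{i,a}^{-1}A_{j,b}\notin\mathcal M$ for every $(j,b)\in I\times\mathbb C^*$ with $(j,b)\neq(i,a)$; (iii) for all $m\in\mathcal M$ and all $i\in I$ there exists an $i$-dominant $M\in\mathcal M$ such that $$\chi_q\big(L(\beta_i(M))\big)=\sum_{m'}\beta_i(m'),$$ where the sum is over all $m'\in\mathcal M$ such that $m'm^{-1}$ lies in the subgroup of $\mathcal P$ generated by $\{A_{i,a}:a\in\mathbb C^*\}$, and $L(\beta_i(M))$ denotes the simple $U_{q^{r_i}}(\widehat{\mathfrak{sl}}_2)$-module with highest $l$-weight $\beta_i(M)$. Then $$\chi_q(L(m_+))=\sum_{m\in\mathcal M}m,$$ and in particular the $U_q(\widehat{\mathfrak g})$-module $L(m_+)$ is thin and special.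
   Context: Let $\mathfrak g$ be a complex simple Lie algebra of rank $N$, $I=\{1,\dots,N\}$, with simple roots $\alpha_i$ and Cartan matrix $C_{ij}=2\langle\alpha_i,\alpha_j\rangle/\langle\alpha_i,\alpha_i\rangle$, the invariant form being normalized so that the maximal root has square length $2$. Let $r^\vee$ be the maximal number of edges connecting two vertices of the Dynkin diagram, $r_i=\frac12r^\vee\langle\alpha_i,\alpha_i\rangle$, $B_{ij}=r_iC_{ij}$. Fix $q\in\mathbb C^*$ not a root of unity; $[n]_q=\frac{q^n-q^{-n}}{q-q^{-1}}$. $U_q(\widehat{\mathfrak g})$ is the (untwisted) quantum affine algebra in Drinfeld's new realization, with generators $x^\pm_{i,n}$ ($n\in\mathbb Z$), $k_i^{\pm1}$, $h_{i,n}$ ($n\in\mathbb Z\setminus\{0\}$), $i\in I$, and central $c^{\pm1/2}$, normalized so that $k_ix^\pm_{j,n}k_i^{-1}=q^{\pm B_{ij}}x^\pm_{j,n}$, $[h_{i,n},x^\pm_{j,m}]=\pm\frac1n[nB_{ij}]_qc^{\mp|n|/2}x^\pm_{j,n+m}$, $[x^+_{i,n},x^-_{j,m}]=\delta_{ij}\frac{c^{(n-m)/2}\phi^+_{i,n+m}-c^{-(n-m)/2}\phi^-_{i,n+m}}{q^{r_i}-q^{-r_i}}$, where $\phi_i^\pm(u)=\sum_{n\ge0}\phi^\pm_{i,\pm n}u^{\pm n}=k_i^{\pm1}\exp\big(\pm(q-q^{-1})\sum_{m\ge1}h_{i,\pm m}u^{\pm m}\big)$. All modules are finite-dimensional and of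 type 1 ($c^{\pm1/2}$ acts as the identity and $V$ is the direct sum, over integral weights $\lambda$, of the spaces on which every $k_i$ acts by $q^{\langle\alpha_i,\lambda\rangle}$). $\mathcal P$ is the free abelian multiplicative group of monomials in formal variables $(Y_{i,a})_{i\in I,a\in\mathbb C^*}$. A monomial $m=\prod Y_{i,a}^{w_{i,a}-x_{i,a}}$ ($w_{i,a},x_{i,a}\ge0$) is identified with the $l$-weight $\boldsymbol\gamma(m)$ given by $\gamma(m)_i^\pm(u)=q^{r_i(\deg Q_i-\deg R_i)}\frac{Q_i(uq^{-r_i})R_i(uq^{r_i})}{Q_i(uq^{r_i})R_i(uq^{-r_i})}$ (expanded in powers of $u^{\pm1}$), $Q_i(u)=\prod_a(1-ua)^{w_{i,a}}$, $R_i(u)=\prod_a(1-ua)^{x_{i,a}}$. For a module $V$, $V_m$ denotes the generalized simultaneous eigenspace of the $\phi^\pm_{i,\pm r}$ with eigenvalues given by $\boldsymbol\gamma(m)$, and the $q$-character is $\chi_q(V)=\sum_{m\in\mathcal P}\dim(V_m)\,m\in\mathbb Z[Y_{i,a}^{\pm1}]_{i\in I,a\in\mathbb C^*}$. A monomial $\prod Y_{i,a}^{u_{i,a}}$ is $j$-dominant if $u_{j,a}\ge0$ for all $a$, and dominant if it is $j$-dominant for all $j\in I$; $\mathcal P^+$ is the set of dominant monomials. For $m\in\mathcal P^+$, $L(m)$ is the unique finite-dimensional irreducible module with highest $l$-weight $\boldsymbol\gamma(m)$ (i.e. generated by a vector annihilated by all $x^+_{i,r}$ on which the $\phi^\pm_{i,\pm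 r}$ act by $\gamma(m)^\pm_{i,\pm r}$). A module is thin if all its $l$-weight spaces have dimension at most $1$, and special if its $q$-character has exactly one dominant monomial. $A_{i,a}=Y_{i,aq^{r_i}}Y_{i,aq^{-r_i}}\prod_{C_{ji}=-1}Y_{j,a}^{-1}\prod_{C_{ji}=-2}Y_{j,aq}^{-1}Y_{j,aq^{-1}}^{-1}\prod_{C_{ji}=-3}Y_{j,aq^2}^{-1}Y_{j,a}^{-1}Y_{j,aq^{-2}}^{-1}$. For $i\in I$, $\beta_i:\mathbb Z[Y_{j,a}^{\pm1}]_{j\in I,a\in\mathbb C^*}\to\mathbb Z[Y_{i,a}^{\pm1}]_{a\in\mathbb C^*}$ is the ring homomorphism with $Y_{k,a}\mapsto1$ for $k\ne i$ and $Y_{i,a}\mapsto Y_{i,a}$. The copy of $U_{q^{r_i}}(\widehat{\mathfrak{sl}}_2)$ associated with $i$ is the subalgebra generated by $c^{\pm1/2}$, $x^\pm_{i,r}$, $\phi^\pm_{i,\pm r}$; monomials in $(Y_{i,a})_{a\in\mathbb C^*}$ are identified with its $l$-weights in the same way (with quantum parameter $q^{r_i}$), so that its $q$-characters lie in $\mathbb Z[Y_{i,a}^{\pm1}]_{a\in\mathbb C^*}$; for instance $\chi_q(L(Y_{i,a}))=Y_{i,a}+Y_{i,aq^{2r_i}}^{-1}$. *)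

theory Defs
  imports
    "HOL-Analysis.Euclidean_Space"
    "HOL-Combinatorics.Permutations"
    "HOL-Computational_Algebra.Computational_Algebra"
    "HOL-Library.Poly_Mapping"
begin

unbundle inner_syntax

section \<open>Root data of a complex simple Lie algebra\<close>

text \<open>
  A complex simple Lie algebra enters only through its (reduced, irreducible) root system
  with a chosen base; the invariant form is the inner product of the ambient Euclidean space.
\<close>

definition root_system :: "'e::euclidean_space set \<Rightarrow> bool" where
  "root_system \<Phi> \<longleftrightarrow> finite \<Phi> \<and> 0 \<notin> \<Phi> \<and>
     (\<forall>a\<in>\<Phi>. \<forall>b\<in>\<Phi>. b - (2 * (a \<bullet> b) / (a \<bullet> a)) *\<^sub>R a \<in> \<Phi>) \<and>
     (\<forall>a\<in>\<Phi>. \<forall>b\<in>\<Phi>. 2 * (a \<bullet> b) / (a \<bullet> a) \<in> \<int>) \<and>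
     (\<forall>a\<in>\<Phi>. \<forall>c::real. c *\<^sub>R a \<in> \<Phi> \<longrightarrow> c = 1 \<or> c = - 1)"

definition irreducible_root_system :: "'e::euclidean_space set \<Rightarrow> bool" where
  "irreducible_root_system \<Phi> \<longleftrightarrow> root_system \<Phi> \<and> \<Phi> \<noteq> {} \<and>
     \<not> (\<exists>\<Phi>1 \<Phi>2. \<Phi>1 \<noteq> {} \<and> \<Phi>2 \<noteq> {} \<and> \<Phi>1 \<union> \<Phi>2 = \<Phi> \<and> (\<forall>a\<in>\<Phi>1. \<forall>b\<in>\<Phi>2. a \<bullet> b = 0))"

definition simple_roots :: "nat \<Rightarrow> 'e::euclidean_space set \<Rightarrow> (nat \<Rightarrow> 'e) \<Rightarrow> bool" where
  "simple_roots N \<Phi> \<alpha> \<longleftrightarrow> \<alpha> ` {1..N} \<subseteq> \<Phi> \<and> inj_on \<alpha> {1..N} \<and> independent (\<alpha> ` {1..N}) \<and>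
     (\<forall>\<beta>\<in>\<Phi>. \<exists>c::nat \<Rightarrow> nat.
        \<beta> = (\<Sum>i=1..N. real (c i) *\<^sub>R \<alpha> i) \<or> \<beta> = - (\<Sum>i=1..N. real (c i) *\<^sub>R \<alpha> i))"

definition maximal_root :: "nat \<Rightarrow> 'e::euclidean_space set \<Rightarrow> (nat \<Rightarrow> 'e) \<Rightarrow> 'e \<Rightarrow> bool" where
  "maximal_root N \<Phi> \<alpha> \<theta> \<longleftrightarrow> \<theta> \<in> \<Phi> \<and>
     (\<forall>\<beta>\<in>\<Phi>. \<exists>c::nat \<Rightarrow> nat. \<theta> - \<beta> = (\<Sum>i=1..N. real (c i) *\<^sub>R \<alpha> i))"

text \<open>
  The vertices \<open>i \<noteq> j\<close> of the Dynkin diagram are joined by \<open>C i j * C j i\<close> edges. The element \<open>1\<close>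
  is inserted for type \<open>A\<^sub>1\<close>, whose diagram has no edge and for which the maximal number of edges
  is \<open>1\<close> by convention; it changes nothing in rank at least two.
\<close>

definition max_edges :: "nat \<Rightarrow> (nat \<Rightarrow> nat \<Rightarrow> int) \<Rightarrow> int" where
  "max_edges N C = Max (insert 1 {C i j * C j i | i j. i \<in> {1..N} \<and> j \<in> {1..N} \<and> i \<noteq> j})"

text \<open>
  \<open>C\<close> and \<open>r\<close> are determined on \<open>{1..N}\<close> by the last two conditions: the right-hand sides are always
  integers, respectively positive integers.
\<close>

definition simple_lie_data ::
  "nat \<Rightarrow> 'e::euclidean_space set \<Rightarrow> (nat \<Rightarrow> 'e) \<Rightarrow> (nat \<Rightarrow> nat \<Rightarrow> int) \<Rightarrow> (nat \<Rightarrow> nat) \<Rightarrow> bool" where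
  "simple_lie_data N \<Phi> \<alpha> C r \<longleftrightarrow>
     irreducible_root_system \<Phi> \<and> simple_roots N \<Phi> \<alpha> \<and>
     (\<exists>\<theta>. maximal_root N \<Phi> \<alpha> \<theta> \<and> \<theta> \<bullet> \<theta> = 2) \<and>
     (\<forall>i\<in>{1..N}. \<forall>j\<in>{1..N}. of_int (C i j) = 2 * (\<alpha> i \<bullet> \<alpha> j) / (\<alpha> i \<bullet> \<alpha> i)) \<and>
     (\<forall>i\<in>{1..N}. real (r i) = 1/2 * of_int (max_edges N C) * (\<alpha> i \<bullet> \<alpha> i))"


section \<open>Modules over the quantum affine algebra\<close>

text \<open>
  Parameters of the Drinfeld presentation: index set, Cartan matrix, the numbers \<open>r\<^sub>i\<close>, and \<open>q\<close>.
  Everything below is relative to such a record, so that it also applies to \<open>U\<^sub>q(sl\<^sub>2^)\<close>.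
\<close>

record qdata =
  Idx :: "nat set"
  Cart :: "nat \<Rightarrow> nat \<Rightarrow> int"
  rr :: "nat \<Rightarrow> nat"
  qq :: complex

text \<open>
  The subalgebra attached to \<open>i\<close>: one vertex, named \<open>i\<close> again, with quantum parameter \<open>q^(r\<^sub>i)\<close>.
\<close>

definition sl2_data :: "qdata \<Rightarrow> nat \<Rightarrow> qdata" where
  "sl2_data D i = \<lparr>Idx = {i}, Cart = (\<lambda>_ _. 2), rr = (\<lambda>_. 1), qq = qq D ^ rr D i\<rparr>"

definition symB :: "qdata \<Rightarrow> nat \<Rightarrow> nat \<Rightarrow> int" where
  "symB D i j = int (rr D i) * Cart D i j"

definition qint :: "complex \<Rightarrow> int \<Rightarrow> complex" where
  "qint q n = (q powi n - q powi (- n)) / (q - inverse q)"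

definition qfact :: "complex \<Rightarrow> nat \<Rightarrow> complex" where
  "qfact q n = (\<Prod>k=1..n. qint q (int k))"

definition qbinom :: "complex \<Rightarrow> nat \<Rightarrow> nat \<Rightarrow> complex" where
  "qbinom q n k = qfact q n / (qfact q k * qfact q (n - k))"

datatype sign = Pos | Neg

fun sg :: "sign \<Rightarrow> int" where
  "sg Pos = 1"
| "sg Neg = - 1"

text \<open>
  A module over an algebra given by generators and relations is a complex vector space with one
  operator for each generator, subject to the relations. The vector space is the subspace \<open>Car\<close> of
  an ambient complex vector space with scalar multiplication \<open>scl\<close>; the fields \<open>X s i n\<close>, \<open>K i\<close>,
  \<open>Kinv i\<close>, \<open>H i n\<close>, \<open>Ch\<close>, \<open>Chinv\<close> are the actions of \<open>x\<^sup>s\<^sub>i\<^sub>,\<^sub>n\<close>, \<open>k\<^sub>i\<close>, its inverse, \<open>h\<^sub>i\<^sub>,\<^sub>n\<close>,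
  \<open>c^(1/2)\<close> and \<open>c^(-1/2)\<close>. The values outside \<open>Car\<close>, at \<open>i \<notin> Idx\<close>, and \<open>H i 0\<close> carry no meaning.
\<close>

record 'v qmodule =
  Car :: "'v set"
  scl :: "complex \<Rightarrow> 'v \<Rightarrow> 'v"
  X :: "sign \<Rightarrow> nat \<Rightarrow> int \<Rightarrow> 'v \<Rightarrow> 'v"
  K :: "nat \<Rightarrow> 'v \<Rightarrow> 'v"
  Kinv :: "nat \<Rightarrow> 'v \<Rightarrow> 'v"
  H :: "nat \<Rightarrow> int \<Rightarrow> 'v \<Rightarrow> 'v"
  Ch :: "'v \<Rightarrow> 'v"
  Chinv :: "'v \<Rightarrow> 'v"

definition gens :: "qdata \<Rightarrow> 'v qmodule \<Rightarrow> ('v \<Rightarrow> 'v) set" where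
  "gens D V = {X V s i n | s i n. i \<in> Idx D} \<union> {K V i | i. i \<in> Idx D} \<union> {Kinv V i | i. i \<in> Idx D}
     \<union> {H V i n | i n. i \<in> Idx D \<and> n \<noteq> 0} \<union> {Ch V, Chinv V}"

text \<open>The action of \<open>c^(p/2)\<close>.\<close>

definition cpow :: "'v qmodule \<Rightarrow> int \<Rightarrow> 'v \<Rightarrow> 'v" where
  "cpow V p = (if p \<ge> 0 then Ch V ^^ nat p else Chinv V ^^ nat (- p))"

definition comp_ops :: "('v \<Rightarrow> 'v) list \<Rightarrow> 'v \<Rightarrow> 'v" where
  "comp_ops fs = foldr (\<circ>) fs id"

text \<open>
  \<open>phi D V s i p\<close> is the action of \<open>\<phi>\<^sup>s\<^sub>i\<^sub>,\<^sub>p\<close>, which vanishes when \<open>p\<close> has the sign opposite to \<open>s\<close>.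
  The sum over all compositions \<open>ms\<close> of \<open>\<bar>p\<bar>\<close> is the coefficient of \<open>u\<^sup>p\<close> in
  \<open>exp (\<plusminus>(q - q\<^sup>-\<^sup>1) \<Sum>m\<ge>1. h\<^sub>i\<^sub>,\<^sub>\<plusminus>\<^sub>m u^(\<plusminus>m))\<close>, the exponential series being multiplied out.
\<close>

definition phi :: "qdata \<Rightarrow> 'v::ab_group_add qmodule \<Rightarrow> sign \<Rightarrow> nat \<Rightarrow> int \<Rightarrow> 'v \<Rightarrow> 'v" where
  "phi D V s i p v =
     (if sg s * p < 0 then 0
      else (case s of Pos \<Rightarrow> K V i | Neg \<Rightarrow> Kinv V i)
        (\<Sum>ms\<in>{ms :: nat list. 0 \<notin> set ms \<and> int (sum_list ms) = sg s * p}.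
           scl V ((of_int (sg s) * (qq D - inverse (qq D))) ^ length ms / fact (length ms))
             (comp_ops (map (\<lambda>m. H V i (sg s * int m)) ms) v)))"

definition drinfeld_relations :: "qdata \<Rightarrow> 'v::ab_group_add qmodule \<Rightarrow> bool" where
  "drinfeld_relations D V \<longleftrightarrow>
     (let q = qq D; I = Idx D; B = symB D; sm = scl V in \<forall>v\<in>Car V.
       Ch V (Chinv V v) = v \<and> Chinv V (Ch V v) = v \<and>
       (\<forall>T\<in>gens D V. Ch V (T v) = T (Ch V v)) \<and>
       (\<forall>i\<in>I. K V i (Kinv V i v) = v \<and> Kinv V i (K V i v) = v) \<and>
       (\<forall>i\<in>I. \<forall>j\<in>I. K V i (K V j v) = K V j (K V i v)) \<and>
       (\<forall>i\<in>I. \<forall>j\<in>I. \<forall>n. n \<noteq> 0 \<longrightarrow> K V i (H V j n v) = H V j n (K V i v)) \<and>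
       (\<forall>i\<in>I. \<forall>j\<in>I. \<forall>n m. n \<noteq> 0 \<and> m \<noteq> 0 \<longrightarrow>
          H V i n (H V j m v) - H V j m (H V i n v) =
            (if n = - m
             then sm (1 / of_int n * qint q (n * B i j) / (q - inverse q))
                    (cpow V (2 * n) v - cpow V (- 2 * n) v)
             else 0)) \<and>
       (\<forall>s. \<forall>i\<in>I. \<forall>j\<in>I. \<forall>n.
          K V i (X V s j n (Kinv V i v)) = sm (q powi (sg s * B i j)) (X V s j n v)) \<and>
       (\<forall>s. \<forall>i\<in>I. \<forall>j\<in>I. \<forall>n m. n \<noteq> 0 \<longrightarrow>
          H V i n (X V s j m v) - X V s j m (H V i n v) =
            sm (of_int (sg s) / of_int n * qint q (n * B i j))
              (cpow V (- sg s * \<bar>n\<bar>) (X V s j (n + m) v))) \<and>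
       (\<forall>s. \<forall>i\<in>I. \<forall>j\<in>I. \<forall>n m.
          X V s i (n + 1) (X V s j m v) - sm (q powi (sg s * B i j)) (X V s j m (X V s i (n + 1) v)) =
          sm (q powi (sg s * B i j)) (X V s i n (X V s j (m + 1) v)) - X V s j (m + 1) (X V s i n v)) \<and>
       (\<forall>i\<in>I. \<forall>j\<in>I. \<forall>n m.
          X V Pos i n (X V Neg j m v) - X V Neg j m (X V Pos i n v) =
            (if i = j
             then sm (1 / (q ^ rr D i - inverse (q ^ rr D i)))
                    (cpow V (n - m) (phi D V Pos i (n + m) v) - cpow V (m - n) (phi D V Neg i (n + m) v))
             else 0)) \<and>
       (\<forall>s. \<forall>i\<in>I. \<forall>j\<in>I. \<forall>ns m. i \<noteq> j \<and> int (length ns) = 1 - Cart D i j \<longrightarrow>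
          (\<Sum>\<pi> | \<pi> permutes {..<length ns}. \<Sum>k\<le>length ns.
             sm ((- 1) ^ k * qbinom (q ^ rr D i) (length ns) k)
               (comp_ops (map (\<lambda>l. X V s i (ns ! \<pi> l)) [0..<k] @ [X V s j m] @
                          map (\<lambda>l. X V s i (ns ! \<pi> l)) [k..<length ns]) v)) = 0))"

definition is_module :: "qdata \<Rightarrow> 'v::ab_group_add qmodule \<Rightarrow> bool" where
  "is_module D V \<longleftrightarrow> vector_space (scl V) \<and> module.subspace (scl V) (Car V) \<and>
     (\<forall>T\<in>gens D V. (\<forall>v\<in>Car V. T v \<in> Car V) \<and>
        (\<forall>v\<in>Car V. \<forall>w\<in>Car V. T (v + w) = T v + T w) \<and>
        (\<forall>a. \<forall>v\<in>Car V. T (scl V a v) = scl V a (T v))) \<and>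
     drinfeld_relations D V"

definition fin_dim :: "'v::ab_group_add qmodule \<Rightarrow> bool" where
  "fin_dim V \<longleftrightarrow> (\<exists>E. finite E \<and> E \<subseteq> Car V \<and> module.span (scl V) E = Car V)"

text \<open>
  An integral weight \<open>\<lambda> = \<Sum>i. w i \<omega>\<^sub>i\<close> pairs with \<open>\<alpha>\<^sub>i\<close> to \<open>r\<^sub>i w i\<close> when the form is scaled such
  that \<open>\<langle>\<alpha>\<^sub>i, \<alpha>\<^sub>j\<rangle> = B\<^sub>i\<^sub>j\<close>, which is the scaling matching \<open>k\<^sub>i x\<^sup>\<plusminus>\<^sub>j\<^sub>,\<^sub>n k\<^sub>i\<^sup>-\<^sup>1 = q^(\<plusminus>B\<^sub>i\<^sub>j) x\<^sup>\<plusminus>\<^sub>j\<^sub>,\<^sub>n\<close> and the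
  constant term of the \<open>l\<close>-weights \<open>\<gamma>(m)\<close>. The sum of the weight spaces is automatically direct,
  because \<open>q\<close> is not a root of unity.
\<close>

definition weight_space :: "qdata \<Rightarrow> 'v qmodule \<Rightarrow> (nat \<Rightarrow> int) \<Rightarrow> 'v set" where
  "weight_space D V w =
     {v \<in> Car V. \<forall>i\<in>Idx D. K V i v = scl V (qq D powi (int (rr D i) * w i)) v}"

definition type1 :: "qdata \<Rightarrow> 'v::ab_group_add qmodule \<Rightarrow> bool" where
  "type1 D V \<longleftrightarrow> (\<forall>v\<in>Car V. Ch V v = v \<and> Chinv V v = v) \<and>
     module.span (scl V) (\<Union>w. weight_space D V w) = Car V"

definition submodule :: "qdata \<Rightarrow> 'v::ab_group_add qmodule \<Rightarrow> 'v set \<Rightarrow> bool" where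
  "submodule D V U \<longleftrightarrow> module.subspace (scl V) U \<and> U \<subseteq> Car V \<and> (\<forall>T\<in>gens D V. \<forall>v\<in>U. T v \<in> U)"

definition irreducible_module :: "qdata \<Rightarrow> 'v::ab_group_add qmodule \<Rightarrow> bool" where
  "irreducible_module D V \<longleftrightarrow> Car V \<noteq> {0} \<and> (\<forall>U. submodule D V U \<longrightarrow> U = {0} \<or> U = Car V)"


section \<open>Monomials and l-weights\<close>

text \<open>
  The monomial \<open>\<Prod> Y\<^sub>i\<^sub>,\<^sub>a^(u i a)\<close> is the finitely supported function \<open>(i, a) \<mapsto> u i a\<close>. The group
  of monomials is therefore written additively: \<open>m + m'\<close> is the product and \<open>m - m'\<close> the quotient.
\<close>

type_synonym monom = "(nat \<times> complex) \<Rightarrow>\<^sub>0 int"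

abbreviation expo :: "monom \<Rightarrow> nat \<Rightarrow> complex \<Rightarrow> int" where
  "expo m i a \<equiv> Poly_Mapping.lookup m (i, a)"

abbreviation Y :: "nat \<Rightarrow> complex \<Rightarrow> monom" where
  "Y i a \<equiv> Poly_Mapping.single (i, a) 1"

definition monoms :: "qdata \<Rightarrow> monom set" where
  "monoms D = {m. Poly_Mapping.keys m \<subseteq> Idx D \<times> (UNIV - {0})}"

definition j_dominant :: "nat \<Rightarrow> monom \<Rightarrow> bool" where
  "j_dominant j m \<longleftrightarrow> (\<forall>a. expo m j a \<ge> 0)"

definition dominant :: "qdata \<Rightarrow> monom \<Rightarrow> bool" where
  "dominant D m \<longleftrightarrow> (\<forall>j\<in>Idx D. j_dominant j m)"

definition dom_monoms :: "qdata \<Rightarrow> monom set" where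
  "dom_monoms D = {m \<in> monoms D. dominant D m}"

definition Amon :: "qdata \<Rightarrow> nat \<Rightarrow> complex \<Rightarrow> monom" where
  "Amon D i a = (let q = qq D in
     Y i (a * q ^ rr D i) + Y i (a / q ^ rr D i)
     - (\<Sum>j | j \<in> Idx D \<and> Cart D j i = - 1. Y j a)
     - (\<Sum>j | j \<in> Idx D \<and> Cart D j i = - 2. Y j (a * q) + Y j (a / q))
     - (\<Sum>j | j \<in> Idx D \<and> Cart D j i = - 3. Y j (a * q\<^sup>2) + Y j a + Y j (a / q\<^sup>2)))"

text \<open>
  With \<open>w\<close> and \<open>x\<close> the positive and negative parts of the exponents, \<open>Qpoly\<close> and \<open>Rpoly\<close> are the
  products of \<open>(1 - u a)^(w i a)\<close> and \<open>(1 - u a)^(x i a)\<close>; cancelling common factors of \<open>Q\<^sub>i\<close> and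
  \<open>R\<^sub>i\<close> does not change \<open>\<gamma>(m)\<close>.
\<close>

definition Qpoly :: "monom \<Rightarrow> nat \<Rightarrow> complex poly" where
  "Qpoly m i = (\<Prod>a | (i, a) \<in> Poly_Mapping.keys m. [:1, - a:] ^ nat (expo m i a))"

definition Rpoly :: "monom \<Rightarrow> nat \<Rightarrow> complex poly" where
  "Rpoly m i = (\<Prod>a | (i, a) \<in> Poly_Mapping.keys m. [:1, - a:] ^ nat (- expo m i a))"

text \<open>The polynomial \<open>p(u c)\<close> in \<open>u\<close>.\<close>

definition rescale :: "complex poly \<Rightarrow> complex \<Rightarrow> complex poly" where
  "rescale p c = pcompose p [:0, c:]"

definition gamma_num :: "qdata \<Rightarrow> monom \<Rightarrow> nat \<Rightarrow> complex poly" where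
  "gamma_num D m i = (let t = qq D ^ rr D i in
     rescale (Qpoly m i) (inverse t) * rescale (Rpoly m i) t)"

definition gamma_den :: "qdata \<Rightarrow> monom \<Rightarrow> nat \<Rightarrow> complex poly" where
  "gamma_den D m i = (let t = qq D ^ rr D i in
     rescale (Qpoly m i) t * rescale (Rpoly m i) (inverse t))"

text \<open>
  \<open>gamma D m s i n\<close> is the coefficient \<open>\<gamma>(m)\<^sup>s\<^sub>i\<^sub>,\<^sub>s\<^sub>n\<close> of \<open>u^(s n)\<close>, for \<open>n \<ge> 0\<close>. Numerator and
  denominator have the same degree \<open>d\<close>; for the expansion in powers of \<open>z = 1/u\<close> both are multiplied
  by \<open>z\<^sup>d\<close>, i.e. replaced by the reflected polynomials.
\<close>

definition gamma :: "qdata \<Rightarrow> monom \<Rightarrow> sign \<Rightarrow> nat \<Rightarrow> nat \<Rightarrow> complex" where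
  "gamma D m s i n =
     qq D powi (int (rr D i) * (int (degree (Qpoly m i)) - int (degree (Rpoly m i)))) *
     fps_nth
       (case s of
          Pos \<Rightarrow> fps_of_poly (gamma_num D m i) / fps_of_poly (gamma_den D m i)
        | Neg \<Rightarrow> fps_of_poly (reflect_poly (gamma_num D m i)) /
                 fps_of_poly (reflect_poly (gamma_den D m i))) n"


section \<open>q-characters\<close>

definition lweight_space ::
  "qdata \<Rightarrow> 'v::ab_group_add qmodule \<Rightarrow> (sign \<Rightarrow> nat \<Rightarrow> nat \<Rightarrow> complex) \<Rightarrow> 'v set" where
  "lweight_space D V g =
     {v \<in> Car V. \<forall>s. \<forall>i\<in>Idx D. \<forall>n. \<exists>k.
        ((\<lambda>w. phi D V s i (sg s * int n) w - scl V (g s i n) w) ^^ k) v = 0}"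

abbreviation lspace :: "qdata \<Rightarrow> 'v::ab_group_add qmodule \<Rightarrow> monom \<Rightarrow> 'v set" where
  "lspace D V m \<equiv> lweight_space D V (gamma D m)"

text \<open>
  An element \<open>\<Sum>m. c\<^sub>m m\<close> of \<open>\<int>[Y\<^sub>i\<^sub>,\<^sub>a\<^sup>\<plusminus>\<^sup>1]\<close> is the finitely supported function \<open>m \<mapsto> c\<^sub>m\<close>. The
  index set of the sum in \<open>qchar\<close> is finite for a finite-dimensional module.
\<close>

type_synonym laurent = "monom \<Rightarrow>\<^sub>0 int"

definition qchar :: "qdata \<Rightarrow> 'v::ab_group_add qmodule \<Rightarrow> laurent" where
  "qchar D V = (\<Sum>m | m \<in> monoms D \<and> lspace D V m \<noteq> {0}.
     Poly_Mapping.single m (int (vector_space.dim (scl V) (lspace D V m))))"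

text \<open>All \<open>l\<close>-weights count here, whether or not they come from a monomial.\<close>

definition thin :: "qdata \<Rightarrow> 'v::ab_group_add qmodule \<Rightarrow> bool" where
  "thin D V \<longleftrightarrow> (\<forall>g. vector_space.dim (scl V) (lweight_space D V g) \<le> 1)"

definition special :: "qdata \<Rightarrow> 'v::ab_group_add qmodule \<Rightarrow> bool" where
  "special D V \<longleftrightarrow> (\<exists>!m. m \<in> Poly_Mapping.keys (qchar D V) \<and> dominant D m)"

definition highest_lweight :: "qdata \<Rightarrow> 'v::ab_group_add qmodule \<Rightarrow> monom \<Rightarrow> bool" where
  "highest_lweight D V m \<longleftrightarrow> (\<exists>v\<in>Car V. v \<noteq> 0 \<and>
     (\<forall>i\<in>Idx D. \<forall>n. X V Pos i n v = 0) \<and>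
     (\<forall>s. \<forall>i\<in>Idx D. \<forall>n. phi D V s i (sg s * int n) v = scl V (gamma D m s i n) v) \<and>
     (\<forall>U. submodule D V U \<and> v \<in> U \<longrightarrow> U = Car V))"

text \<open>\<open>V\<close> is (a model of) the module \<open>L(m)\<close>, which is determined up to isomorphism.\<close>

definition is_L :: "qdata \<Rightarrow> monom \<Rightarrow> 'v::ab_group_add qmodule \<Rightarrow> bool" where
  "is_L D m V \<longleftrightarrow> is_module D V \<and> fin_dim V \<and> type1 D V \<and> irreducible_module D V \<and>
     highest_lweight D V m"

text \<open>
  The homomorphism \<open>\<beta>\<^sub>i\<close> on monomials. The variables \<open>Y\<^sub>i\<^sub>,\<^sub>a\<close> keep their name \<open>i\<close>, in accordance with
  \<open>Idx (sl2_data D i) = {i}\<close>.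
\<close>

definition beta :: "nat \<Rightarrow> monom \<Rightarrow> monom" where
  "beta i m = (\<Sum>a | (i, a) \<in> Poly_Mapping.keys m. Poly_Mapping.single (i, a) (expo m i a))"

text \<open>
  The equation \<open>\<chi>\<^sub>q(L(m)) = \<chi>\<close>, with \<open>L(m)\<close> realized inside a complex vector space of countable
  dimension, in which every finite-dimensional module has a copy.
\<close>

definition qchar_L_eq :: "qdata \<Rightarrow> monom \<Rightarrow> laurent \<Rightarrow> bool" where
  "qchar_L_eq D m \<chi> \<longleftrightarrow> (\<exists>W :: (nat \<Rightarrow>\<^sub>0 complex) qmodule. is_L D m W \<and> qchar D W = \<chi>)"

end

theory Submission
  imports Defs "HOL-Computational_Algebra.Fundamental_Theorem_Algebra" "HOL-Analysis.Linear_Algebra"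
begin

text \<open>
  Let \<open>v\<^sub>+\<close> be the highest weight vector of \<open>L(m\<^sub>+)\<close>. By induction on \<open>d\<close>, the vectors obtained from
  \<open>v\<^sub>+\<close> by \<open>d\<close> lowering operators span a space with a basis of joint eigenvectors of the \<open>h\<^sub>i\<^sub>,\<^sub>n\<close>, one
  for each \<open>m \<in> \<M>\<close> lying \<open>d\<close> levels below \<open>m\<^sub>+\<close>. An l-weight on the next level has the form \<open>m A\<^sub>i\<^sub>,\<^sub>a\<^sup>-\<^sup>1\<close>
  with \<open>m\<close> on the current one. Every \<open>m \<in> \<M>\<close> lies in the \<open>j\<close>-string of a \<open>j\<close>-dominant monomial \<open>M\<close>,
  and the submodule that the vector of \<open>M\<close> generates under the subalgebra of the vertex \<open>j\<close> maps onto
  the simple module \<open>L(\<beta>\<^sub>j(M))\<close>, whose l-weights are known from (iii); the kernel of this map is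
  killed by \<open>x\<^sup>+\<^sub>j\<close> as long as it vanishes on the previous level.

  If \<open>m A\<^sub>i\<^sub>,\<^sub>a\<^sup>-\<^sup>1 \<notin> \<M>\<close>, then an eigenvector with this l-weight lies in the kernel for \<open>j = i\<close>, hence is
  killed by \<open>x\<^sup>+\<^sub>i\<close>, and by (ii) it is killed by the other \<open>x\<^sup>+\<^sub>k\<close> as well: it generates a proper
  submodule. If \<open>m' = m A\<^sub>i\<^sub>,\<^sub>a\<^sup>-\<^sup>1 \<in> \<M>\<close> occurs with multiplicity at least two, choose \<open>j\<close> such that \<open>m'\<close>
  is not \<open>j\<close>-dominant, by (i); since the l-weight \<open>\<beta>\<^sub>j(m')\<close> of \<open>L(\<beta>\<^sub>j(M))\<close> is simple, some vector of
  l-weight \<open>m'\<close> is killed by \<open>x\<^sup>+\<^sub>j\<close>, and this forces \<open>m'\<close> to be \<open>j\<close>-dominant.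
\<close>

subsection \<open>Commuting operators on a finite-dimensional space\<close>

text \<open>A repeated l-weight m' yields two independent vectors, and both must lie in the module
  generated under the vertex j by the vector of M before multiplicity one in L(beta_j(M)) can be
  applied. This is proved modulo that module: a vector of l-weight m' outside it would be killed
  there by all x^+_j, and the criterion for j-dominance holds for vectors that are highest only
  modulo a stable subspace. Hence eigenvectors, currents and the criterion are all stated modulo a
  stable subspace \<open>U\<close>, and no quotient modules are formed. A repeated l-weight may also
  appear as a Jordan block, which the same formulation covers.

  The commuting operators are k_i and the h_{i,n} rescaled by q - q^-1: the eigenvalues of the
  latter are additive in the exponents of a monomial, and commuting them past x^s_{j,m} produces a
  single shifted current. The phi^s_{i,n}, which define l-weights, are recovered by an exponential
  formula. Levels are counted by a linear functional of the weight with value 1 on every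
  A_{i,a}.\<close>

context vector_space
begin

lemma dim_strict_mono_subspace:
  assumes E: "finite E" "S \<subseteq> span E" and S': "subspace S'" "S' \<subset> S"
  shows "dim S' < dim S"
proof -
  obtain B' where B': "B' \<subseteq> S'" "independent B'" "S' \<subseteq> span B'" "card B' = dim S'"
    using basis_exists by blast
  obtain B where B: "B \<subseteq> S" "independent B" "S \<subseteq> span B" "card B = dim S"
    using basis_exists by blast
  have finB: "finite B" using independent_span_bound[OF E(1) B(2)] B(1) E(2) by blast
  have finB': "finite B'" using independent_span_bound[OF E(1) B'(2)] B'(1) S'(2) E(2) by blast
  obtain a where a: "a \<in> S" "a \<notin> S'" using S'(2) by blast
  have "span B' = S'" using B' S'(1) by (simp add: span_subspace)
  with a have "a \<notin> span B'" by simp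
  then have ind: "independent (insert a B')" using B'(2) independent_insertI by blast
  have "insert a B' \<subseteq> span B" using a B'(1) S'(2) B(3) by blast
  then have "card (insert a B') \<le> card B" using independent_span_bound[OF finB ind] by blast
  moreover have "a \<notin> B'" using \<open>a \<notin> span B'\<close> span_base by blast
  ultimately show ?thesis using finB' B' B by simp
qed

lemma mem_subspace_cancel:
  assumes "subspace U" "x - y \<in> U" shows "x \<in> U \<longleftrightarrow> y \<in> U"
  using assms subspace_add[of U "x - y" y] subspace_diff[of U x "x - y"] by auto

lemma scale_mem_iff:
  assumes "subspace U" "c \<noteq> 0" shows "scale c x \<in> U \<longleftrightarrow> x \<in> U"
  using assms subspace_scale[of U x c] subspace_scale[of U "scale c x" "inverse c"] by auto

end

text \<open>The operators are linear on \<open>Car\<close> only, since the values of module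
  operators elsewhere carry no meaning. The label set is free so that the same facts serve the
  currents of all vertices, those of one vertex, the k_i alone and the phi^s_{i,n}.\<close>

locale lin_ops = vector_space scl for scl :: "complex \<Rightarrow> 'v::ab_group_add \<Rightarrow> 'v" +
  fixes Car :: "'v set" and A :: "'l set" and T :: "'l \<Rightarrow> 'v \<Rightarrow> 'v"
  assumes subspace_Car: "subspace Car"
    and finite_Car: "\<exists>E. finite E \<and> Car \<subseteq> span E"
    and T_in: "\<And>l v. l \<in> A \<Longrightarrow> v \<in> Car \<Longrightarrow> T l v \<in> Car"
    and T_add: "\<And>l v w. l \<in> A \<Longrightarrow> v \<in> Car \<Longrightarrow> w \<in> Car \<Longrightarrow> T l (v + w) = T l v + T l w"
    and T_scale: "\<And>l v c. l \<in> A \<Longrightarrow> v \<in> Car \<Longrightarrow> T l (scl c v) = scl c (T l v)"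
begin

definition stable :: "'v set \<Rightarrow> bool" where
  "stable S \<longleftrightarrow> subspace S \<and> S \<subseteq> Car \<and> (\<forall>l\<in>A. \<forall>v\<in>S. T l v \<in> S)"

text \<open>Congruence modulo \<open>U\<close> stands for equality in a quotient. The vector may
  itself lie in \<open>U\<close>, so non-triviality is always a separate condition
  \<open>v \<notin> U\<close>.\<close>

definition eig :: "'v set \<Rightarrow> ('l \<Rightarrow> complex) \<Rightarrow> 'v \<Rightarrow> bool" where
  "eig U \<eta> v \<longleftrightarrow> (\<forall>l\<in>A. T l v - scl (\<eta> l) v \<in> U)"

lemma T_zero [simp]: "l \<in> A \<Longrightarrow> T l 0 = 0"
  using T_scale[of l 0 0] subspace_0[OF subspace_Car] by simp

lemma T_diff: "l \<in> A \<Longrightarrow> v \<in> Car \<Longrightarrow> w \<in> Car \<Longrightarrow> T l (v - w) = T l v - T l w"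
  using T_add[of l v "scl (-1) w"] T_scale[of l w "-1"] subspace_scale[OF subspace_Car, of w "-1"] by simp

lemma T_sum: "l \<in> A \<Longrightarrow> (\<And>x. x \<in> F \<Longrightarrow> f x \<in> Car) \<Longrightarrow> T l (sum f F) = (\<Sum>x\<in>F. T l (f x))"
proof (induction F rule: infinite_finite_induct)
  case (insert x F)
  then show ?case using subspace_sum[OF subspace_Car, of F f] by (simp add: T_add)
qed auto

lemma eig_mono: "eig U \<eta> v \<Longrightarrow> U \<subseteq> U' \<Longrightarrow> eig U' \<eta> v"
  by (auto simp: eig_def)

lemma eig_scale: "subspace U \<Longrightarrow> v \<in> Car \<Longrightarrow> eig U \<eta> v \<Longrightarrow> eig U \<eta> (scl c v)"
  unfolding eig_def by (metis T_scale scale_left_commute scale_right_diff_distrib subspace_scale)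

lemma eig_add: "subspace U \<Longrightarrow> v \<in> Car \<Longrightarrow> w \<in> Car \<Longrightarrow> eig U \<eta> v \<Longrightarrow> eig U \<eta> w \<Longrightarrow> eig U \<eta> (v + w)"
proof -
  assume a: "subspace U" "v \<in> Car" "w \<in> Car" "eig U \<eta> v" "eig U \<eta> w"
  have "T l (v + w) - scl (\<eta> l) (v + w) = (T l v - scl (\<eta> l) v) + (T l w - scl (\<eta> l) w)" if "l \<in> A" for l
    using that a by (simp add: T_add scale_right_distrib)
  then show ?thesis using a unfolding eig_def by (metis subspace_add)
qed

lemma eig_diff: "subspace U \<Longrightarrow> v \<in> Car \<Longrightarrow> w \<in> Car \<Longrightarrow> eig U \<eta> v \<Longrightarrow> eig U \<eta> w \<Longrightarrow> eig U \<eta> (v - w)"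
  using eig_add[of U v "scl (-1) w" \<eta>] eig_scale[of U w \<eta> "-1"] subspace_scale[OF subspace_Car, of w "-1"]
  by simp

lemma eig_zero_D: "eig {0} \<eta> v \<Longrightarrow> l \<in> A \<Longrightarrow> T l v = scl (\<eta> l) v"
  by (auto simp: eig_def)

lemma stableD: "stable S \<Longrightarrow> subspace S" "stable S \<Longrightarrow> S \<subseteq> Car" "stable S \<Longrightarrow> l \<in> A \<Longrightarrow> v \<in> S \<Longrightarrow> T l v \<in> S"
  by (auto simp: stable_def)

lemma stable_zero: "stable {0}"
  using subspace_0[OF subspace_Car] by (auto simp: stable_def)

lemma stable_Car: "stable Car"
  using subspace_Car T_in by (auto simp: stable_def)

lemma eig_uniq:
  assumes U: "subspace U" and l: "l \<in> A" and e: "eig U \<eta> v" "eig U \<chi> v" and "v \<notin> U"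
  shows "\<eta> l = \<chi> l"
proof (rule ccontr)
  assume ne: "\<eta> l \<noteq> \<chi> l"
  have "(T l v - scl (\<eta> l) v) - (T l v - scl (\<chi> l) v) \<in> U"
    using e l subspace_diff[OF U] unfolding eig_def by blast
  then have "scl (\<chi> l - \<eta> l) v \<in> U" by (simp add: scale_left_diff_distrib)
  then show False using scale_mem_iff[OF U, of "\<chi> l - \<eta> l" v] ne \<open>v \<notin> U\<close> by simp
qed

text \<open>Eigenvectors with different characters are independent modulo \<open>U\<close>, by
  elimination: if l separates the character \<chi> of one vector of the combination from \<eta>,
  then T_l - \<chi>_l removes that vector modulo \<open>U\<close>, rescales the others and
  multiplies \<open>z\<close> by the nonzero number \<eta>_l - \<chi>_l.\<close>

lemma span_eigenvectors_other:
  assumes U: "stable U"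
    and SS: "\<And>s. s \<in> SS \<Longrightarrow> s \<in> Car \<and> (\<exists>\<chi>. eig U \<chi> s \<and> (\<exists>l\<in>A. \<chi> l \<noteq> \<eta> l))"
    and z: "z - y \<in> U" "y \<in> span SS" "z \<in> Car" "eig U \<eta> z"
  shows "z \<in> U"
proof -
  note sU = stableD(1)[OF U]
  have main: "z \<in> U" if "finite F" "F \<subseteq> SS" "z - (\<Sum>s\<in>F. scl (c s) s) \<in> U" "z \<in> Car" "eig U \<eta> z" for F c z
    using that
  proof (induction F arbitrary: c z rule: finite_induct)
    case empty
    then show ?case by simp
  next
    case (insert a F)
    from insert.prems SS obtain \<chi> l where \<chi>: "eig U \<chi> a" "l \<in> A" "\<chi> l \<noteq> \<eta> l" by blast
    define L where "L = (\<lambda>v. T l v - scl (\<chi> l) v)"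
    have aC: "a \<in> Car" and FC: "\<And>s. s \<in> F \<Longrightarrow> s \<in> Car" using insert.prems SS by auto
    have "\<forall>s\<in>F. \<exists>\<chi>. eig U \<chi> s" using insert.prems SS by blast
    then obtain X where X: "\<And>s. s \<in> F \<Longrightarrow> eig U (X s) s" by metis
    have sumC: "(\<Sum>s\<in>F. scl (c s) s) \<in> Car" using FC by (auto intro!: subspace_sum[OF subspace_Car] subspace_scale[OF subspace_Car])
    have caC: "scl (c a) a \<in> Car" using aC subspace_Car subspace_scale by blast
    have L_add: "L (v + w) = L v + L w" if "v \<in> Car" "w \<in> Car" for v w
      using that \<chi> by (simp add: L_def T_add scale_right_distrib)
    have L_diff: "L (v - w) = L v - L w" if "v \<in> Car" "w \<in> Car" for v w
      using that \<chi> by (simp add: L_def T_diff scale_right_diff_distrib)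
    have L_sc: "L (scl d v) = scl d (L v)" if "v \<in> Car" for v d
      using that \<chi> by (simp add: L_def T_scale scale_right_diff_distrib scale_left_commute)
    have L_U: "L v \<in> U" if "v \<in> U" for v
      using that \<chi>(2) stableD[OF U] by (simp add: L_def subspace_diff subspace_scale)
    have L_sum: "L (\<Sum>s\<in>F. scl (c s) s) = (\<Sum>s\<in>F. scl (c s) (L s))"
      using \<chi> FC by (simp add: L_def T_sum T_scale subspace_scale[OF subspace_Car] scale_right_diff_distrib
          sum_subtractf scale_sum_right scale_left_commute mult.commute)
    have 1: "L z - (\<Sum>s\<in>F. scl (c s) (L s)) \<in> U"
    proof -
      have "L (z - (scl (c a) a + (\<Sum>s\<in>F. scl (c s) s))) \<in> U"
        using insert.prems insert.hyps by (intro L_U) simp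
      then have "L z - (scl (c a) (L a) + (\<Sum>s\<in>F. scl (c s) (L s))) \<in> U"
        using insert.prems(3) caC sumC aC by (simp add: L_diff L_add L_sc L_sum subspace_add[OF subspace_Car])
      moreover have "scl (c a) (L a) \<in> U" using \<chi> by (auto simp: L_def eig_def intro: subspace_scale[OF sU])
      ultimately have "L z - (scl (c a) (L a) + (\<Sum>s\<in>F. scl (c s) (L s))) + scl (c a) (L a) \<in> U" 
        using sU subspace_add by blast
      then show ?thesis by (simp add: algebra_simps)
    qed
    have 2: "(\<Sum>s\<in>F. scl (c s) (L s)) - (\<Sum>s\<in>F. scl (c s * (X s l - \<chi> l)) s) \<in> U"
    proof -
      have "scl (c s) (L s) - scl (c s * (X s l - \<chi> l)) s \<in> U" if "s \<in> F" for s
      proof -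
        have "T l s - scl (X s l) s \<in> U" using X[OF that] \<chi>(2) by (simp add: eig_def)
        then have "scl (c s) (T l s - scl (X s l) s) \<in> U" using sU subspace_scale by blast
        then show ?thesis by (simp add: L_def algebra_simps)
      qed
      then show ?thesis by (simp add: sum_subtractf[symmetric] subspace_sum[OF sU])
    qed
    have 3: "L z - scl (\<eta> l - \<chi> l) z \<in> U"
      using insert.prems(4) \<chi>(2) by (simp add: eig_def L_def algebra_simps)
    define c' where "c' s = (c s * (X s l - \<chi> l)) / (\<eta> l - \<chi> l)" for s
    have e: "(\<Sum>s\<in>F. scl (c s * (X s l - \<chi> l)) s) = scl (\<eta> l - \<chi> l) (\<Sum>s\<in>F. scl (c' s) s)"
      using \<chi>(3) by (simp add: scale_sum_right c'_def)
    have "scl (\<eta> l - \<chi> l) (z - (\<Sum>s\<in>F. scl (c' s) s)) \<in> U"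
    proof -
      have "scl (\<eta> l - \<chi> l) z - scl (\<eta> l - \<chi> l) (\<Sum>s\<in>F. scl (c' s) s) =
         ((L z - (\<Sum>s\<in>F. scl (c s) (L s))) + ((\<Sum>s\<in>F. scl (c s) (L s)) - (\<Sum>s\<in>F. scl (c s * (X s l - \<chi> l)) s))) - (L z - scl (\<eta> l - \<chi> l) z)"
        unfolding e by simp
      also have "\<dots> \<in> U" using 1 2 3 sU subspace_add subspace_diff by blast
      finally show ?thesis by (simp add: scale_right_diff_distrib)
    qed
    then have "z - (\<Sum>s\<in>F. scl (c' s) s) \<in> U" using scale_mem_iff[OF sU] \<chi>(3) by simp
    then show ?case using insert by blast
  qed
  from z(2) obtain F c where "finite F" "F \<subseteq> SS" "y = (\<Sum>s\<in>F. scl (c s) s)"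
    by (auto simp: span_explicit)
  then show ?thesis using main z by blast
qed

definition pev :: "'l \<Rightarrow> complex poly \<Rightarrow> 'v \<Rightarrow> 'v" where
  "pev l p v = (\<Sum>i\<le>degree p. scl (coeff p i) ((T l ^^ i) v))"

lemma iter_in: "l \<in> A \<Longrightarrow> stable S \<Longrightarrow> v \<in> S \<Longrightarrow> (T l ^^ i) v \<in> S"
  by (induction i) (auto simp: stable_def)

lemma pev_in: "l \<in> A \<Longrightarrow> stable S \<Longrightarrow> v \<in> S \<Longrightarrow> pev l p v \<in> S"
  unfolding pev_def by (auto intro!: subspace_sum subspace_scale iter_in dest: stableD)

lemma pev_ext: "degree p \<le> n \<Longrightarrow> pev l p v = (\<Sum>i\<le>n. scl (coeff p i) ((T l ^^ i) v))"
  unfolding pev_def by (rule sum.mono_neutral_left) (auto simp: coeff_eq_0)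

lemma pev_add: "pev l (p + p') v = pev l p v + pev l p' v"
proof -
  define n where "n = max (degree p) (degree p')"
  have "degree (p + p') \<le> n" "degree p \<le> n" "degree p' \<le> n" by (auto simp: n_def degree_add_le_max)
  then show ?thesis by (simp add: pev_ext[of _ n] scale_left_distrib sum.distrib)
qed

lemma pev_smult: "pev l (smult c p) v = scl c (pev l p v)"
  by (simp add: pev_ext[OF degree_smult_le] pev_def scale_sum_right)

lemma pev_pCons0:
  assumes "l \<in> A" "v \<in> Car"
  shows "pev l (pCons 0 p) v = T l (pev l p v)"
proof -
  have C: "(T l ^^ i) v \<in> Car" for i using iter_in[OF assms(1) stable_Car assms(2)] .
  have "pev l (pCons 0 p) v = (\<Sum>i\<le>Suc (degree p). scl (coeff (pCons 0 p) i) ((T l ^^ i) v))"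
    by (rule pev_ext) (simp add: degree_pCons_le)
  also have "\<dots> = (\<Sum>i\<le>degree p. scl (coeff p i) (T l ((T l ^^ i) v)))"
    by (simp add: sum.atMost_Suc_shift del: sum.atMost_Suc)
  also have "\<dots> = T l (pev l p v)"
    unfolding pev_def using assms C by (simp add: T_sum T_scale subspace_scale[OF subspace_Car])
  finally show ?thesis .
qed

lemma pev_linear_factor:
  assumes "l \<in> A" "v \<in> Car"
  shows "pev l ([:- a, 1:] * p) v = T l (pev l p v) - scl a (pev l p v)"
proof -
  have "[:- a, 1:] * p = smult (- a) p + pCons 0 p" by simp
  then show ?thesis unfolding pev_add pev_smult pev_pCons0[OF assms] by (simp only: pev_add pev_smult pev_pCons0[OF assms]) simp
qed

lemma pev_pCons:
  assumes "l \<in> A" "v \<in> Car"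
  shows "pev l (pCons a p) v = scl a v + T l (pev l p v)"
proof -
  have "pCons a p = [:a:] + pCons 0 p" by simp
  moreover have "pev l [:a:] v = scl a v" by (simp add: pev_def)
  ultimately show ?thesis using pev_add[of l "[:a:]" "pCons 0 p" v] pev_pCons0[OF assms] by simp
qed

lemma annihilating_poly:
  assumes l: "l \<in> A" and v: "v \<in> Car"
  shows "\<exists>p. p \<noteq> 0 \<and> pev l p v = 0"
proof (rule ccontr)
  assume "\<not> ?thesis"
  then have np: "\<And>p. p \<noteq> 0 \<Longrightarrow> pev l p v \<noteq> 0" by blast
  obtain E where E: "finite E" "Car \<subseteq> span E" using finite_Car by blast
  define u where "u i = (T l ^^ i) v" for i
  have uC: "u i \<in> Car" for i using iter_in[OF l stable_Car v] by (simp add: u_def)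
  have nosum: "(\<Sum>i\<le>n. scl (c i) (u i)) = 0 \<Longrightarrow> \<forall>i\<le>n. c i = 0" for c and n :: nat
  proof -
    assume s: "(\<Sum>i\<le>n. scl (c i) (u i)) = 0"
    define p where "p = (\<Sum>i\<le>n. monom (c i) i)"
    have cp: "coeff p i = (if i \<le> n then c i else 0)" for i
      by (simp add: p_def coeff_sum if_distrib sum.delta cong: if_cong)
    have "degree p \<le> n" by (rule degree_le) (simp add: cp)
    then have "pev l p v = (\<Sum>i\<le>n. scl (c i) (u i))" by (simp add: pev_ext[of _ n] cp u_def)
    with s np have "p = 0" by metis
    then show ?thesis using cp by (metis coeff_0)
  qed
  \<comment> \<open>Two equal iterates would already be a nontrivial relation; injectivity ensures
    that the first \<open>card E + 1\<close> iterates form a set of that size.\<close>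
  have inj: "inj u"
  proof (rule injI, rule ccontr)
    fix i j assume ij: "u i = u j" "i \<noteq> j"
    define c where "c k = (if k = i then 1 else if k = j then -1 else 0 :: complex)" for k
    have "(\<Sum>k\<le>max i j. scl (c k) (u k)) = (\<Sum>k\<in>{i,j}. scl (c k) (u k))"
      by (rule sum.mono_neutral_right) (auto simp: c_def)
    also have "\<dots> = 0" using ij by (simp add: c_def)
    finally have "c i = 0" using nosum by force
    then show False by (simp add: c_def)
  qed
  have "independent (u ` {..n})" for n
  proof -
    have "\<forall>x\<in>u ` {..n}. c x = 0" if "(\<Sum>x\<in>u ` {..n}. scl (c x) x) = 0" for c
    proof -
      have "(\<Sum>i\<le>n. scl (c (u i)) (u i)) = 0"
        using that inj by (simp add: sum.reindex inj_on_subset)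
      then show ?thesis using nosum[of "\<lambda>i. c (u i)" n] by auto
    qed
    then show ?thesis by (subst dependent_finite) auto
  qed
  then have "independent (u ` {..card E})" .
  moreover have "u ` {..card E} \<subseteq> span E" using uC E(2) by blast
  ultimately have "card (u ` {..card E}) \<le> card E" using independent_span_bound[OF E(1)] by blast
  moreover have "card (u ` {..card E}) = Suc (card E)"
    using inj by (subst card_image) (auto intro: inj_on_subset)
  ultimately show False by simp
qed

text \<open>Among the nonzero polynomials p with p(T_l) z0 in \<open>U\<close> one has least degree;
  splitting off a linear factor over the complex numbers leaves a polynomial whose value at z0 is
  the required vector.\<close>

lemma single_eigenvector_mod:
  assumes l: "l \<in> A" and S: "stable S" and U: "stable U" and z0: "z0 \<in> S" "z0 \<notin> U"
  shows "\<exists>z\<in>S. z \<notin> U \<and> (\<exists>a. T l z - scl a z \<in> U)"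
proof -
  have z0C: "z0 \<in> Car" using S z0 stableD by blast
  define PP where "PP p \<longleftrightarrow> p \<noteq> 0 \<and> pev l p z0 \<in> U" for p
  have "\<exists>p. PP p" using annihilating_poly[OF l z0C] subspace_0[OF stableD(1)[OF U]] by (metis PP_def)
  then obtain p where p: "PP p" and mn: "\<And>p'. PP p' \<Longrightarrow> degree p \<le> degree p'"
    using ex_has_least_nat[of PP _ degree] by auto
  have "degree p \<noteq> 0"
  proof
    assume "degree p = 0"
    then obtain c where c: "p = [:c:]" using degree_eq_zeroE by blast
    then have "c \<noteq> 0" using p by (auto simp: PP_def)
    moreover have "scl c z0 \<in> U" using p c by (simp add: PP_def pev_def)
    ultimately show False using scale_mem_iff[OF stableD(1)[OF U]] z0 by blast
  qed
  then obtain a where "poly p a = 0"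
    using fundamental_theorem_of_algebra[of p] constant_degree[of p] by auto
  then obtain r where r: "p = [:- a, 1:] * r" using poly_eq_0_iff_dvd[of p a] by (auto simp: dvd_def)
  then have r0: "r \<noteq> 0" using p by (auto simp: PP_def)
  then have "degree p = Suc (degree r)" unfolding r by (subst degree_mult_eq) auto
  then have "\<not> PP r" using mn[of r] by auto
  then have "pev l r z0 \<notin> U" using r0 by (simp add: PP_def)
  moreover have "T l (pev l r z0) - scl a (pev l r z0) \<in> U"
    using p pev_linear_factor[OF l z0C] r by (simp add: PP_def)
  ultimately show ?thesis using pev_in[OF l S z0(1)] by blast
qed

end

locale comm_ops = lin_ops scl Car A T
  for scl :: "complex \<Rightarrow> 'v::ab_group_add \<Rightarrow> 'v" and Car :: "'v set" and A :: "'l set" and T :: "'l \<Rightarrow> 'v \<Rightarrow> 'v" +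
  assumes T_comm: "\<And>l l' v. l \<in> A \<Longrightarrow> l' \<in> A \<Longrightarrow> v \<in> Car \<Longrightarrow> T l (T l' v) = T l' (T l v)"
begin

lemma minimal_stable:
  assumes "stable S" "Q S"
  shows "\<exists>S0. stable S0 \<and> S0 \<subseteq> S \<and> Q S0 \<and> (\<forall>S'. stable S' \<longrightarrow> S' \<subseteq> S0 \<longrightarrow> Q S' \<longrightarrow> S' = S0)"
proof -
  let ?P = "\<lambda>S'. stable S' \<and> S' \<subseteq> S \<and> Q S'"
  obtain S0 where S0: "?P S0" "\<And>S'. ?P S' \<Longrightarrow> dim S0 \<le> dim S'"
    using ex_has_least_nat[of ?P S dim] assms by auto
  obtain E where E: "finite E" "Car \<subseteq> span E" using finite_Car by blast
  have "S' = S0" if "stable S'" "S' \<subseteq> S0" "Q S'" for S'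
  proof (rule ccontr)
    assume "S' \<noteq> S0"
    then have "S' \<subset> S0" using that by blast
    moreover have "S0 \<subseteq> span E" using S0(1) E(2) stableD(2) by blast
    ultimately have "dim S' < dim S0"
      using dim_strict_mono_subspace[OF E(1)] stableD(1)[OF that(1)] by blast
    moreover have "?P S'" using that S0(1) by blast
    ultimately show False using S0(2)[of S'] by linarith
  qed
  then show ?thesis using S0 by blast
qed

text \<open>Infinitely many operators are handled at once by minimality: on a minimal stable
  subspace not contained in \<open>U\<close>, the vectors on which one T_l acts modulo
  \<open>U\<close> by a fixed eigenvalue form a stable subspace, which must be everything.\<close>

lemma joint_eigenvector_mod:
  assumes S: "stable S" and U: "stable U" and SU: "\<not> S \<subseteq> U"
  shows "\<exists>z\<in>S. z \<notin> U \<and> (\<exists>\<eta>. eig U \<eta> z)"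
proof -
  obtain S0 where S0: "stable S0" "S0 \<subseteq> S" "\<not> S0 \<subseteq> U"
    and mn: "\<And>S'. stable S' \<Longrightarrow> S' \<subseteq> S0 \<Longrightarrow> \<not> S' \<subseteq> U \<Longrightarrow> S' = S0"
    using minimal_stable[of S "\<lambda>S. \<not> S \<subseteq> U"] S SU by metis
  note sU = stableD(1)[OF U] and sS = stableD(1)[OF S0(1)] and SC = stableD(2)[OF S0(1)]
  have "\<exists>a. \<forall>z\<in>S0. T l z - scl a z \<in> U" if l: "l \<in> A" for l
  proof -
    obtain z a where z: "z \<in> S0" "z \<notin> U" "T l z - scl a z \<in> U"
      using single_eigenvector_mod[OF l S0(1) U] S0(3) by blast
    define S' where "S' = {z \<in> S0. T l z - scl a z \<in> U}"
    have "stable S'"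
      unfolding stable_def
    proof (intro conjI ballI)
      show "subspace S'"
      proof (rule subspaceI)
        show "0 \<in> S'" using l subspace_0 sU sS by (simp add: S'_def)
        fix x y assume "x \<in> S'" "y \<in> S'"
        moreover have "T l (x + y) - scl a (x + y) = (T l x - scl a x) + (T l y - scl a y)"
          if "x \<in> S0" "y \<in> S0"
          using that SC l T_add[of l x y] by (auto simp: scale_right_distrib)
        ultimately show "x + y \<in> S'" using subspace_add sU sS by (auto simp: S'_def simp del: diff_add_eq)
      next
        fix c x assume "x \<in> S'"
        moreover have "T l (scl c x) - scl a (scl c x) = scl c (T l x - scl a x)" if "x \<in> S0"
          using that SC l T_scale[of l x c] by (auto simp: scale_right_diff_distrib scale_left_commute mult.commute)
        ultimately show "scl c x \<in> S'" using subspace_scale sU sS by (auto simp: S'_def)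
      qed
      show "S' \<subseteq> Car" using SC by (auto simp: S'_def)
      fix l' v assume l': "l' \<in> A" and v: "v \<in> S'"
      have vC: "v \<in> Car" "v \<in> S0" using v SC by (auto simp: S'_def)
      have "T l (T l' v) - scl a (T l' v) = T l' (T l v - scl a v)"
        using l l' vC T_comm[of l l' v] T_in subspace_scale[OF subspace_Car, of v a]
        by (simp add: T_diff T_scale)
      also have "\<dots> \<in> U" using v l' stableD(3)[OF U] by (simp add: S'_def)
      finally show "T l' v \<in> S'" using stableD(3)[OF S0(1) l' vC(2)] by (simp add: S'_def)
    qed
    moreover have "S' \<subseteq> S0" "\<not> S' \<subseteq> U" using z by (auto simp: S'_def)
    ultimately have "S' = S0" using mn by blast
    then show ?thesis by (auto simp: S'_def)
  qed
  then obtain \<eta> where \<eta>: "\<And>l z. l \<in> A \<Longrightarrow> z \<in> S0 \<Longrightarrow> T l z - scl (\<eta> l) z \<in> U" by metis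
  obtain z where "z \<in> S0" "z \<notin> U" using S0(3) by blast
  then show ?thesis using S0(2) \<eta> unfolding eig_def by blast
qed

lemma pev_comm:
  assumes l: "l \<in> A" "l' \<in> A" "v \<in> Car"
  shows "T l' (pev l p v) = pev l p (T l' v)"
proof -
  have it: "T l' ((T l ^^ i) v) = (T l ^^ i) (T l' v)" for i
    by (induction i) (use l iter_in[OF l(1) stable_Car l(3)] T_comm in auto)
  show ?thesis unfolding pev_def
    using l iter_in[OF l(1) stable_Car l(3)] it
    by (simp add: T_sum T_scale subspace_scale[OF subspace_Car])
qed

lemma pev_eig:
  assumes l: "l \<in> A" and U: "stable U" and z: "z \<in> Car" "T l z - scl a z \<in> U"
  shows "pev l p z - scl (poly p a) z \<in> U"
proof (induction p)
  case 0
  then show ?case using subspace_0[OF stableD(1)[OF U]] by (simp add: pev_def)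
next
  case (pCons c p)
  note sU = stableD(1)[OF U]
  have C: "pev l p z \<in> Car" using pev_in[OF l stable_Car z(1)] .
  have "T l (pev l p z - scl (poly p a) z) \<in> U" using pCons stableD(3)[OF U l] by blast
  then have 1: "T l (pev l p z) - scl (poly p a) (T l z) \<in> U"
    using l C z by (simp add: T_diff T_scale subspace_scale[OF subspace_Car])
  have 2: "scl (poly p a) (T l z - scl a z) \<in> U" using z(2) subspace_scale[OF sU] by blast
  have "pev l (pCons c p) z - scl (poly (pCons c p) a) z =
     (T l (pev l p z) - scl (poly p a) (T l z)) + scl (poly p a) (T l z - scl a z)"
    using l z by (simp add: pev_pCons algebra_simps)
  then show ?case using 1 2 subspace_add[OF sU] by metis
qed

definition shf :: "'l \<Rightarrow> complex \<Rightarrow> 'v \<Rightarrow> 'v" where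
  "shf l a v = T l v - scl a v"

lemma shf_in: "l \<in> A \<Longrightarrow> stable S \<Longrightarrow> v \<in> S \<Longrightarrow> shf l a v \<in> S"
  unfolding shf_def by (auto intro!: subspace_diff subspace_scale dest: stableD)

lemma shf_pow_in: "l \<in> A \<Longrightarrow> stable S \<Longrightarrow> v \<in> S \<Longrightarrow> (shf l a ^^ n) v \<in> S"
  by (induction n) (auto intro: shf_in)

lemma shf_pow_add:
  assumes "l \<in> A" "v \<in> Car" "w \<in> Car"
  shows "(shf l a ^^ n) (v + w) = (shf l a ^^ n) v + (shf l a ^^ n) w"
proof (induction n)
  case (Suc n)
  have C: "(shf l a ^^ n) v \<in> Car" "(shf l a ^^ n) w \<in> Car"
    using assms shf_pow_in[OF assms(1) stable_Car] by auto
  have "shf l a ((shf l a ^^ n) v + (shf l a ^^ n) w) = shf l a ((shf l a ^^ n) v) + shf l a ((shf l a ^^ n) w)"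
    unfolding shf_def[of l a "_ + _"] T_add[OF assms(1) C] by (simp add: shf_def scale_right_distrib)
  then show ?case using Suc by simp
qed simp

lemma shf_pow_scale:
  assumes "l \<in> A" "v \<in> Car"
  shows "(shf l a ^^ n) (scl c v) = scl c ((shf l a ^^ n) v)"
proof (induction n)
  case (Suc n)
  have C: "(shf l a ^^ n) v \<in> Car" using assms shf_pow_in[OF assms(1) stable_Car] by auto
  have "shf l a (scl c ((shf l a ^^ n) v)) = scl c (shf l a ((shf l a ^^ n) v))"
    unfolding shf_def[of l a "scl _ _"] T_scale[OF assms(1) C]
    by (simp add: shf_def scale_right_diff_distrib mult.commute)
  then show ?case using Suc by simp
qed simp

lemma shf_pow_comm:
  assumes "l \<in> A" "l' \<in> A" "v \<in> Car"
  shows "(shf l a ^^ n) (T l' v) = T l' ((shf l a ^^ n) v)"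
proof (induction n)
  case (Suc n)
  have C: "(shf l a ^^ n) v \<in> Car" using assms shf_pow_in[OF assms(1) stable_Car] by auto
  have "shf l a (T l' ((shf l a ^^ n) v)) = T l' (shf l a ((shf l a ^^ n) v))"
    unfolding shf_def[of l a "T _ _"] T_comm[OF assms(1,2) C]
    using C assms by (simp add: shf_def T_diff T_scale T_in subspace_scale[OF subspace_Car])
  then show ?case using Suc by simp
qed simp

lemma shf_zero: "l \<in> A \<Longrightarrow> (shf l a ^^ n) 0 = 0"
proof (induction n)
  case (Suc n)
  then show ?case unfolding funpow.simps o_apply Suc.IH[OF Suc.prems] by (simp add: shf_def)
qed simp

lemma pev_linear_power:
  assumes "l \<in> A" "v \<in> Car"
  shows "pev l ([:- a, 1:] ^ n * p) v = (shf l a ^^ n) (pev l p v)"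
proof (induction n)
  case (Suc n)
  show ?case unfolding power_Suc mult.assoc pev_linear_factor[OF assms] Suc by (simp only: funpow.simps o_apply shf_def[of l a "(shf l a ^^ n) (pev l p v)"])
qed simp

lemma shf_pow_eig:
  assumes l: "l \<in> A" and U: "stable U" and z: "z \<in> Car" "T l z - scl b z \<in> U"
  shows "(shf l a ^^ n) z - scl ((b - a) ^ n) z \<in> U"
  using pev_eig[OF l U z, of "[:- a, 1:] ^ n * 1"] pev_linear_power[OF l z(1), of a n 1]
  by (simp add: pev_def poly_power)

text \<open>
  A character that occurs in a subquotient of \<open>S\<close> occurs as that of a joint eigenvector modulo any
  smaller stable subspace: on a minimal stable subspace witnessing the character all \<open>T\<^sub>l - \<eta>\<^sub>l\<close> are
  nilpotent.
\<close>

lemma eig_lift: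
  assumes S: "stable S" and U: "stable U" and U0: "stable U0" "U0 \<subseteq> U"
    and z: "z \<in> S" "z \<notin> U" "eig U \<eta> z"
  shows "\<exists>z'\<in>S. z' \<notin> U0 \<and> eig U0 \<eta> z'"
proof -
  define Q where "Q S \<longleftrightarrow> (\<exists>z\<in>S. z \<notin> U \<and> eig U \<eta> z)" for S
  have "Q S" using z by (auto simp: Q_def)
  then obtain S0 where S0: "stable S0" "S0 \<subseteq> S" "Q S0"
    and mn: "\<And>S'. stable S' \<Longrightarrow> S' \<subseteq> S0 \<Longrightarrow> Q S' \<Longrightarrow> S' = S0"
    using minimal_stable[of S Q] S by metis
  note sU = stableD(1)[OF U] and sS = stableD(1)[OF S0(1)] and SC = stableD(2)[OF S0(1)]
  from S0(3) obtain y where y: "y \<in> S0" "y \<notin> U" "eig U \<eta> y" by (auto simp: Q_def)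
  have yC: "y \<in> Car" using y SC by blast
  have nil: "\<exists>n. (shf l (\<eta> l) ^^ n) v = 0" if l: "l \<in> A" and v: "v \<in> S0" for l v
  proof -
    define S' where "S' = {v \<in> S0. \<exists>n. (shf l (\<eta> l) ^^ n) v = 0}"
    have up: "(shf l (\<eta> l) ^^ (n + k)) v = 0" if "(shf l (\<eta> l) ^^ n) v = 0" for n k v
      using that shf_zero[OF l] by (simp add: funpow_add add.commute[of n])
    have "stable S'"
      unfolding stable_def
    proof (intro conjI ballI)
      show "subspace S'"
      proof (rule subspaceI)
        show "0 \<in> S'" using shf_zero[OF l] subspace_0[OF sS] by (auto simp: S'_def)
        fix v w assume "v \<in> S'" "w \<in> S'"
        then obtain n k where nk: "v \<in> S0" "w \<in> S0" "(shf l (\<eta> l) ^^ n) v = 0" "(shf l (\<eta> l) ^^ k) w = 0"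
          by (auto simp: S'_def)
        then have "(shf l (\<eta> l) ^^ (n + k)) (v + w) = 0"
          using SC l up[of n v k] up[of k w n] by (subst shf_pow_add) (auto simp: add.commute)
        then show "v + w \<in> S'" using nk subspace_add[OF sS] by (auto simp: S'_def)
      next
        fix c v assume "v \<in> S'"
        then show "scl c v \<in> S'" using SC l subspace_scale[OF sS] shf_pow_scale[OF l, of v]
          by (auto simp: S'_def) (metis scale_zero_right subsetD)
      qed
      show "S' \<subseteq> Car" using SC by (auto simp: S'_def)
      fix l' v assume l': "l' \<in> A" and v: "v \<in> S'"
      then obtain n where "v \<in> S0" "(shf l (\<eta> l) ^^ n) v = 0" by (auto simp: S'_def)
      then have "(shf l (\<eta> l) ^^ n) (T l' v) = 0" using shf_pow_comm[OF l l', of v] SC l' by auto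
      then show "T l' v \<in> S'" using stableD(3)[OF S0(1) l' \<open>v \<in> S0\<close>] by (auto simp: S'_def)
    qed
    moreover have "Q S'"
    proof -
      obtain p where p: "p \<noteq> 0" "pev l p y = 0" using annihilating_poly[OF l yC] by blast
      \<comment> \<open>Removing the full power of the factor at \<eta>_l leaves r with r(\<eta>_l)
        nonzero. Then r(T_l) y is congruent to a nonzero multiple of y, and a power of T_l -
        \<eta>_l kills it.\<close>
      obtain r where r: "p = [:- \<eta> l, 1:] ^ order (\<eta> l) p * r" "\<not> [:- \<eta> l, 1:] dvd r"
        using order_decomp[OF p(1)] by blast
      have r0: "poly r (\<eta> l) \<noteq> 0" using r(2) poly_eq_0_iff_dvd by blast
      define y' where "y' = pev l r y"
      have y'S: "y' \<in> S0" using pev_in[OF l S0(1) y(1)] by (simp add: y'_def)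
      have "(shf l (\<eta> l) ^^ order (\<eta> l) p) y' = 0"
        using p(2) pev_linear_power[OF l yC, of "\<eta> l" "order (\<eta> l) p" r] r(1) by (simp add: y'_def)
      then have "y' \<in> S'" using y'S by (auto simp: S'_def)
      moreover have "y' \<notin> U"
      proof -
        have "y' - scl (poly r (\<eta> l)) y \<in> U"
          using pev_eig[OF l U yC] y(3) l by (auto simp: y'_def eig_def)
        then show ?thesis using mem_subspace_cancel[OF sU] scale_mem_iff[OF sU r0] y(2) by blast
      qed
      moreover have "eig U \<eta> y'"
        unfolding eig_def
      proof
        fix l' assume l': "l' \<in> A"
        have "T l' y' - scl (\<eta> l') y' = pev l r (T l' y) - scl (\<eta> l') (pev l r y)"
          using pev_comm[OF l l' yC] by (simp add: y'_def)
        also have "\<dots> = pev l r (T l' y - scl (\<eta> l') y)"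
        proof -
          have lin: "(T l ^^ i) (T l' y - scl (\<eta> l') y) = (T l ^^ i) (T l' y) - scl (\<eta> l') ((T l ^^ i) y)" for i
            by (induction i) (use l l' yC T_in iter_in[OF l stable_Car] subspace_scale[OF subspace_Car] in \<open>auto simp: T_diff T_scale\<close>)
          show ?thesis unfolding pev_def lin by (simp add: scale_right_diff_distrib sum_subtractf scale_sum_right mult.commute)
        qed
        also have "\<dots> \<in> U" using pev_in[OF l U] y(3) l' by (auto simp: eig_def)
        finally show "T l' y' - scl (\<eta> l') y' \<in> U" .
      qed
      ultimately show ?thesis by (auto simp: Q_def)
    qed
    moreover have "S' \<subseteq> S0" by (auto simp: S'_def)
    ultimately have "S' = S0" using mn by blast
    then show ?thesis using v by (auto simp: S'_def)
  qed
  \<comment> \<open>Any joint eigenvector of \<open>S0\<close> modulo \<open>U0\<close> will do: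
    nilpotency of T_l - \<eta>_l on \<open>S0\<close> forces its character to be \<eta>.\<close>
  have "\<not> S0 \<subseteq> U0" using y U0 by blast
  then obtain x \<chi> where x: "x \<in> S0" "x \<notin> U0" "eig U0 \<chi> x"
    using joint_eigenvector_mod[OF S0(1) U0(1)] by blast
  have "\<chi> l = \<eta> l" if l: "l \<in> A" for l
  proof (rule ccontr)
    assume ne: "\<chi> l \<noteq> \<eta> l"
    obtain n where "(shf l (\<eta> l) ^^ n) x = 0" using nil[OF l x(1)] by blast
    then have "- scl ((\<chi> l - \<eta> l) ^ n) x \<in> U0"
      using shf_pow_eig[OF l U0(1), of x "\<chi> l" n "\<eta> l"] x SC l by (auto simp: eig_def)
    then have "scl ((\<chi> l - \<eta> l) ^ n) x \<in> U0" using subspace_neg[OF stableD(1)[OF U0(1)]] by fastforce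
    then show False using scale_mem_iff[OF stableD(1)[OF U0(1)], of "(\<chi> l - \<eta> l) ^ n" x] ne x(2) by simp
  qed
  then have "eig U0 \<eta> x" using x(3) by (simp add: eig_def)
  then show ?thesis using x S0 by blast
qed

end

subsection \<open>Exponentials\<close>

text \<open>The coefficient of u^n in the exponential of the sum of f_m u^m over m \<ge> 1, expanded
  over compositions exactly as \<open>phi\<close> is.\<close>

definition ecoef :: "(nat \<Rightarrow> complex) \<Rightarrow> nat \<Rightarrow> complex" where
  "ecoef f n = (\<Sum>ms\<in>{ms. 0 \<notin> set ms \<and> sum_list ms = n}. prod_list (map f ms) / fact (length ms))"

lemma length_le_sum_list: "0 \<notin> set ms \<Longrightarrow> length ms \<le> sum_list (ms :: nat list)"
  by (induction ms) auto

lemma mem_le_sum_list: "x \<in> set ms \<Longrightarrow> x \<le> sum_list (ms :: nat list)"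
  by (induction ms) auto

lemma finite_compositions: "finite {ms :: nat list. 0 \<notin> set ms \<and> sum_list ms = n}"
proof (rule finite_subset)
  show "{ms. 0 \<notin> set ms \<and> sum_list ms = n} \<subseteq> {ms. set ms \<subseteq> {..n} \<and> length ms \<le> n}"
    using length_le_sum_list mem_le_sum_list by fastforce
  show "finite {ms :: nat list. set ms \<subseteq> {..n} \<and> length ms \<le> n}" by (rule finite_lists_length_le) simp
qed

lemma compositions_0: "{ms :: nat list. 0 \<notin> set ms \<and> sum_list ms = 0} = {[]}"
proof -
  have "ms = []" if "0 \<notin> set ms" "sum_list ms = 0" for ms :: "nat list"
    using length_le_sum_list[OF that(1)] that(2) by simp
  then show ?thesis by auto
qed

lemma ecoef_0 [simp]: "ecoef f 0 = 1"
  unfolding ecoef_def compositions_0 by simp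

lemma compositions_split:
  assumes "0 < n"
  shows "{ms :: nat list. 0 \<notin> set ms \<and> sum_list ms = n} =
    insert [n] {ms. set ms \<subseteq> {0<..<n} \<and> sum_list ms = n}"
proof -
  have "ms = [n] \<or> set ms \<subseteq> {0<..<n}" if ms: "0 \<notin> set ms" "sum_list ms = n" for ms :: "nat list"
  proof (cases "n \<in> set ms")
    case True
    then obtain xs ys where e: "ms = xs @ n # ys" using split_list by fast
    then have "sum_list xs = 0" "sum_list ys = 0" using ms by auto
    then have "xs = []" "ys = []" using ms e by (metis Un_iff length_0_conv length_le_sum_list list.set_intros(2) le_zero_eq set_append)+
    then show ?thesis using e by simp
  next
    case False
    then show ?thesis using ms mem_le_sum_list[of _ ms] by (metis greaterThanLessThan_iff le_neq_implies_less neq0_conv subsetI)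
  qed
  then show ?thesis using assms by auto
qed

text \<open>Only the one-part composition involves f_n, so f_n enters linearly beside terms with
  smaller indices. This is what allows the exponential to be inverted recursively.\<close>

lemma ecoef_split:
  assumes "0 < n"
  shows "ecoef f n = f n + (\<Sum>ms | set ms \<subseteq> {0<..<n} \<and> sum_list ms = n. prod_list (map f ms) / fact (length ms))"
proof -
  have "finite {ms :: nat list. set ms \<subseteq> {0<..<n} \<and> sum_list ms = n}"
    by (rule finite_subset[OF _ finite_compositions[of n]]) auto
  then show ?thesis unfolding ecoef_def compositions_split[OF assms] by (subst sum.insert) auto
qed

text \<open>Compositions of a fixed length i collect to the i-th power of the series, and the factor
  1/i! is the coefficient of the exponential.\<close>

lemma ecoef_fps:
  "Abs_fps (ecoef f) = fps_exp 1 oo Abs_fps (\<lambda>m. if m = 0 then 0 else f m)"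
proof (rule fps_ext)
  fix n
  define b where "b = Abs_fps (\<lambda>m. if m = 0 then 0 else f m)"
  have pw: "b ^ i $ n = (\<Sum>v\<in>{v. 0 \<notin> set v \<and> sum_list v = n \<and> length v = i}. prod_list (map f v))" for i
  proof -
    have "b ^ i $ n = (\<Sum>v\<in>natpermute n i. prod_list (map (fps_nth b) v))"
    proof (cases i)
      case 0
      have "natpermute n 0 = (if n = 0 then {[]} else {})" by (auto simp: natpermute_def)
      then show ?thesis using 0 by simp
    next
      case (Suc k)
      have "prod_list (map (fps_nth b) v) = (\<Prod>j\<in>{0..k}. b $ (v ! j))" if "length v = Suc k" for v
        using that by (simp add: prod.list_conv_set_nth atLeastLessThanSuc_atLeastAtMost)
      then show ?thesis unfolding Suc fps_power_nth_Suc
        by (intro sum.cong refl) (auto simp: natpermute_def)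
    qed
    \<comment> \<open>\<open>natpermute\<close> admits zero entries; their products vanish because
      the series has no constant term.\<close>
    also have "\<dots> = (\<Sum>v\<in>{v. 0 \<notin> set v \<and> sum_list v = n \<and> length v = i}. prod_list (map (fps_nth b) v))"
    proof (rule sum.mono_neutral_right)
      show "finite (natpermute n i)" by (rule natpermute_finite)
      show "\<forall>v\<in>natpermute n i - {v. 0 \<notin> set v \<and> sum_list v = n \<and> length v = i}. prod_list (map (($) b) v) = 0"
        by (auto simp: natpermute_def prod_list_zero_iff b_def image_iff intro!: bexI[of _ 0])
    qed (auto simp: natpermute_def)
    also have "\<dots> = (\<Sum>v\<in>{v. 0 \<notin> set v \<and> sum_list v = n \<and> length v = i}. prod_list (map f v))"
    proof (rule sum.cong[OF refl])
      fix v assume "v \<in> {v. 0 \<notin> set v \<and> sum_list v = n \<and> length v = i}"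
      then have "map (fps_nth b) v = map f v" by (intro map_cong refl) (auto simp: b_def)
      then show "prod_list (map (fps_nth b) v) = prod_list (map f v)" by (simp only:)
    qed
    finally show ?thesis .
  qed
  have "(fps_exp 1 oo b) $ n = (\<Sum>i = 0..n. \<Sum>v\<in>{v. 0 \<notin> set v \<and> sum_list v = n \<and> length v = i}. prod_list (map f v) / fact (length v))"
    unfolding fps_compose_nth pw sum_distrib_left by (intro sum.cong refl) auto
  also have "\<dots> = ecoef f n"
    unfolding ecoef_def
  proof (subst sum.UNION_disjoint[symmetric])
    show "\<forall>i\<in>{0..n}. finite {v. 0 \<notin> set v \<and> sum_list v = n \<and> length v = i}"
      by (auto intro: finite_subset[OF _ finite_compositions[of n]])
    show "(\<Sum>v\<in>(\<Union>i\<in>{0..n}. {v. 0 \<notin> set v \<and> sum_list v = n \<and> length v = i}). prod_list (map f v) / fact (length v)) =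
      (\<Sum>ms | 0 \<notin> set ms \<and> sum_list ms = n. prod_list (map f ms) / fact (length ms))"
      using length_le_sum_list by (intro sum.cong refl) auto
  qed auto
  finally show "Abs_fps (ecoef f) $ n = (fps_exp 1 oo Abs_fps (\<lambda>m. if m = 0 then 0 else f m)) $ n"
    by (simp add: b_def)
qed

text \<open>The logarithmic derivative turns the products and quotients in \<gamma>(m) into sums,
  without a logarithm of power series.\<close>

definition has_dlog :: "complex fps \<Rightarrow> complex fps \<Rightarrow> bool" where
  "has_dlog f g \<longleftrightarrow> f $ 0 \<noteq> 0 \<and> fps_deriv f = f * g"

lemma has_dlog_mult: "has_dlog f g \<Longrightarrow> has_dlog f' g' \<Longrightarrow> has_dlog (f * f') (g + g')"
  by (simp add: has_dlog_def algebra_simps)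

lemma has_dlog_1: "has_dlog 1 0"
  by (simp add: has_dlog_def)

lemma has_dlog_power: "has_dlog f g \<Longrightarrow> has_dlog (f ^ n) (of_nat n * g)"
proof (induction n)
  case (Suc n)
  then show ?case using has_dlog_mult[of f g "f ^ n" "of_nat n * g"] by (simp add: algebra_simps)
qed (simp add: has_dlog_1)

lemma has_dlog_prod:
  "(\<And>x. x \<in> S \<Longrightarrow> has_dlog (f x) (g x)) \<Longrightarrow> has_dlog (prod f S) (sum g S)"
  by (induction S rule: infinite_finite_induct) (auto simp: has_dlog_1 intro: has_dlog_mult)

lemma has_dlog_inverse: "has_dlog f g \<Longrightarrow> has_dlog (inverse f) (- g)"
proof -
  assume f: "has_dlog f g"
  then have f0: "f $ 0 \<noteq> 0" by (simp add: has_dlog_def)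
  have "fps_deriv (inverse f) = - fps_deriv f * (inverse f)\<^sup>2" using f0 by (rule fps_inverse_deriv)
  also have "\<dots> = - g * (f * inverse f) * inverse f" using f by (simp add: has_dlog_def power2_eq_square)
  also have "f * inverse f = 1" using f0 inverse_mult_eq_1'[of f] by simp
  finally show ?thesis using f0 by (simp add: has_dlog_def)
qed

lemma has_dlog_divide: "has_dlog f g \<Longrightarrow> has_dlog f' g' \<Longrightarrow> has_dlog (f / f') (g - g')"
  using has_dlog_mult[of f g "inverse f'" "- g'"] has_dlog_inverse[of f' g']
  by (simp add: fps_divide_unit has_dlog_def)

lemma has_dlog_linear: "has_dlog (fps_of_poly [:1, - x:]) (Abs_fps (\<lambda>n. - (x ^ Suc n)))"
proof -
  have e: "fps_of_poly [:1, - x:] = 1 - fps_const x * fps_X"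
    by (simp add: fps_of_poly_pCons algebra_simps)
  have "(1 - fps_const x * fps_X) * Abs_fps (\<lambda>n. - (x ^ Suc n)) = - fps_const x"
  proof (rule fps_ext)
    fix n show "((1 - fps_const x * fps_X) * Abs_fps (\<lambda>n. - (x ^ Suc n))) $ n = (- fps_const x) $ n"
      by (cases n) (simp_all add: left_diff_distrib mult.assoc)
  qed
  then show ?thesis unfolding e by (simp add: has_dlog_def)
qed

text \<open>\<open>f\<close> and the exponential of the formal integral of \<open>g\<close> have the
  same logarithmic derivative, so their quotient has derivative zero and is a constant.\<close>

lemma has_dlog_eq_exp:
  assumes "has_dlog f g" "\<And>m. 0 < m \<Longrightarrow> l m = g $ (m - 1) / of_nat m"
  shows "f $ n = f $ 0 * ecoef l n"
proof -
  define L where "L = Abs_fps (\<lambda>m. if m = 0 then 0 else l m)"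
  define E where "E = fps_exp 1 oo L"
  have L': "fps_deriv L = g" by (rule fps_ext) (simp add: L_def assms(2) del: of_nat_Suc)
  have "L $ 0 = 0" by (simp add: L_def)
  then have E': "fps_deriv E = E * g"
    unfolding E_def by (simp add: fps_compose_deriv L' fps_exp_deriv)
  have E0: "E $ 0 = 1" by (simp add: E_def)
  have dE: "has_dlog E g" using E' E0 by (simp add: has_dlog_def)
  have "has_dlog (f / E) (g - g)" using has_dlog_divide[OF assms(1) dE] .
  then have "fps_deriv (f / E) = 0" by (simp add: has_dlog_def)
  then have "f / E = fps_const ((f / E) $ 0)" using fps_deriv_eq_0_iff by blast
  moreover have "(f / E) * E = f" using E0 by (simp add: fps_divide_unit mult.assoc inverse_mult_eq_1)
  ultimately have fE: "f = fps_const ((f / E) $ 0) * E" by metis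
  then have "f $ 0 = (f / E) $ 0" using E0 by (metis fps_mult_left_const_nth mult.right_neutral)
  then have "f $ n = f $ 0 * E $ n" using fE by (metis fps_mult_left_const_nth)
  moreover have "E $ n = ecoef l n" using ecoef_fps[of l] by (metis E_def L_def fps_nth_Abs_fps)
  ultimately show ?thesis by simp
qed

subsection \<open>Sums over the exponents of a monomial\<close>

text \<open>Weights and the eigenvalues of the h_{i,n} both have this form, which makes them
  additive on the group of monomials.\<close>

definition esum :: "nat \<Rightarrow> (complex \<Rightarrow> 'b) \<Rightarrow> monom \<Rightarrow> 'b::comm_ring_1" where
  "esum i \<phi> m = (\<Sum>a | (i, a) \<in> Poly_Mapping.keys m. of_int (expo m i a) * \<phi> a)"

lemma finite_slice: "finite {a. (i, a) \<in> Poly_Mapping.keys (m :: monom)}"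
  by (rule finite_subset[of _ "snd ` Poly_Mapping.keys m"]) force+

lemma esum_superset:
  assumes "finite F" "{a. (i, a) \<in> Poly_Mapping.keys m} \<subseteq> F"
  shows "esum i \<phi> m = (\<Sum>a\<in>F. of_int (expo m i a) * \<phi> a)"
  unfolding esum_def by (rule sum.mono_neutral_left) (use assms in \<open>auto simp: in_keys_iff\<close>)

lemma esum_add: "esum i \<phi> (m + m') = esum i \<phi> m + esum i \<phi> m'"
proof -
  define F where "F = {a. (i, a) \<in> Poly_Mapping.keys m} \<union> {a. (i, a) \<in> Poly_Mapping.keys m'}"
  have "finite F" by (simp add: F_def finite_slice)
  moreover have "{a. (i, a) \<in> Poly_Mapping.keys (m + m')} \<subseteq> F"
    using Poly_Mapping.keys_add[of m m'] by (auto simp: F_def)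
  moreover have "{a. (i, a) \<in> Poly_Mapping.keys m} \<subseteq> F" "{a. (i, a) \<in> Poly_Mapping.keys m'} \<subseteq> F" by (auto simp: F_def)
  ultimately show ?thesis by (simp add: esum_superset[of F] lookup_add distrib_right sum.distrib)
qed

lemma esum_uminus: "esum i \<phi> (- m) = - esum i \<phi> m"
  by (simp add: esum_def sum_negf in_keys_iff)

lemma esum_diff: "esum i \<phi> (m - m') = esum i \<phi> m - esum i \<phi> m'"
  using esum_add[of i \<phi> m "- m'"] by (simp add: esum_uminus)

lemma esum_0 [simp]: "esum i \<phi> 0 = 0"
  by (simp add: esum_def)

lemma esum_sum: "esum i \<phi> (sum f S) = (\<Sum>x\<in>S. esum i \<phi> (f x))"
  by (induction S rule: infinite_finite_induct) (auto simp: esum_add)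

lemma esum_Y: "esum i \<phi> (Y j a) = (if i = j then \<phi> a else 0)"
proof -
  have "esum i \<phi> (Y j a) = (\<Sum>x\<in>{a}. of_int (expo (Y j a) i x) * \<phi> x)"
    by (rule esum_superset) (auto simp: in_keys_iff lookup_single split: if_splits)
  then show ?thesis by (simp add: lookup_single when_def)
qed

lemma esum_cong:
  "(\<And>a. expo m i a = expo m' i a) \<Longrightarrow> esum i \<phi> m = esum i \<phi> m'"
  by (simp add: esum_def in_keys_iff)

text \<open>A Vandermonde argument. The hypotheses extend linearly to all polynomials divisible by
  x, and a polynomial vanishing on all of \<open>F\<close> except \<open>a\<close> isolates
  \<open>c a\<close>. As only positive powers are available, the point 0 has to be excluded.\<close>

lemma power_sums_zero:
  fixes c :: "complex \<Rightarrow> complex"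
  assumes F: "finite F" "0 \<notin> F" and s: "\<And>n. n > 0 \<Longrightarrow> (\<Sum>a\<in>F. c a * a ^ n) = 0" and a: "a \<in> F"
  shows "c a = 0"
proof -
  have P: "(\<Sum>x\<in>F. c x * x * poly p x) = 0" for p
  proof (induction p)
    case (pCons b p)
    have *: "(\<Sum>x\<in>F. c x * x * (x * poly q x)) = 0" for q
    proof -
      have "(\<Sum>x\<in>F. c x * x * (x * poly q x)) = (\<Sum>x\<in>F. \<Sum>i\<le>degree q. coeff q i * (c x * x ^ (i + 2)))"
        unfolding poly_altdef sum_distrib_left by (intro sum.cong refl) (simp add: mult_ac)
      also have "\<dots> = (\<Sum>i\<le>degree q. coeff q i * (\<Sum>x\<in>F. c x * x ^ (i + 2)))"
        by (subst sum.swap) (simp add: sum_distrib_left)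
      also have "(\<Sum>x\<in>F. c x * x ^ (i + 2)) = 0" for i using s[of "i + 2"] by simp
      then have "(\<Sum>i\<le>degree q. coeff q i * (\<Sum>x\<in>F. c x * x ^ (i + 2))) = 0" by (simp only: mult_zero_right sum.neutral_const)
      finally show ?thesis .
    qed
    have "(\<Sum>x\<in>F. c x * x * poly (pCons b p) x) = b * (\<Sum>x\<in>F. c x * x ^ 1) + (\<Sum>x\<in>F. c x * x * (x * poly p x))"
      unfolding sum_distrib_left sum.distrib[symmetric]
      by (intro sum.cong refl) (simp only: poly_pCons power_one_right algebra_simps)
    then show ?case using s[of 1] *[of p] by simp
  qed simp
  define p where "p = (\<Prod>b\<in>F - {a}. [:- b, 1:])"
  have pz: "poly p x = 0 \<longleftrightarrow> x \<in> F - {a}" for x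
    using F by (auto simp: p_def poly_prod)
  have "(\<Sum>x\<in>F. c x * x * poly p x) = c a * a * poly p a"
  proof -
    have "(\<Sum>x\<in>F - {a}. c x * x * poly p x) = 0" by (rule sum.neutral) (use pz in auto)
    then show ?thesis using sum.remove[OF F(1) a, of "\<lambda>x. c x * x * poly p x"] by simp
  qed
  then show ?thesis using P[of p] pz[of a] a F(2) by auto
qed

subsection \<open>The characters of the Cartan currents attached to monomials\<close>

definition wt :: "monom \<Rightarrow> nat \<Rightarrow> int" where
  "wt m i = esum i (\<lambda>_. 1) m"

text \<open>For n > 0 this is the coefficient of u^n in log((1 - u a/t)/(1 - u a t)), the
  contribution of one factor Y_{i,a} when t = q^(r_i).\<close>

definition hpow :: "complex \<Rightarrow> int \<Rightarrow> complex \<Rightarrow> complex" where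
  "hpow t n a = a powi n * (t powi n - t powi (- n)) / of_int n"

text \<open>
  On \<open>V\<^sub>m\<close> the operator \<open>(q - q\<^sup>-\<^sup>1) h\<^sub>i\<^sub>,\<^sub>n\<close> has the eigenvalue \<open>hchar D m i n\<close>; the slot \<open>n = 0\<close>, which
  is free, holds the eigenvalue of \<open>k\<^sub>i\<close>.
\<close>

definition hchar :: "qdata \<Rightarrow> monom \<Rightarrow> nat \<Rightarrow> int \<Rightarrow> complex" where
  "hchar D m i n = (if n = 0 then qq D powi (int (rr D i) * wt m i) else esum i (hpow (qq D ^ rr D i) n) m)"

lemma hpow_pos: "hpow t (int k) = (\<lambda>a. ((a * t) ^ k - (a * inverse t) ^ k) / of_nat k)"
  by (rule ext) (simp add: hpow_def power_int_minus power_mult_distrib power_inverse right_diff_distrib)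

lemma hpow_neg: "t \<noteq> 0 \<Longrightarrow> hpow t (- int k) = (\<lambda>a. - (((inverse (a * t)) ^ k - (inverse (a * inverse t)) ^ k) / of_nat k))"
  by (rule ext) (simp add: hpow_def power_int_minus power_mult_distrib power_inverse right_diff_distrib)

lemma esum_divide: "esum i (\<lambda>a. f a / c) m = esum i f m / (c :: 'a::field)"
  by (simp add: esum_def sum_divide_distrib)

lemma esum_minus: "esum i (\<lambda>a. - f a) m = - esum i f m"
  by (simp add: esum_def sum_negf)

lemma rescale_prod: "rescale (prod f S) c = (\<Prod>x\<in>S. rescale (f x) c)"
  by (simp add: rescale_def pcompose_prod)

lemma pcompose_power: "pcompose (p ^ n) q = pcompose p q ^ n"
proof (induction n)
  case 0
  show ?case by (metis one_pCons pcompose_const power_0)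
qed (simp add: pcompose_mult)

lemma rescale_linear_power: "rescale ([:1, - a:] ^ n) c = [:1, - (a * c):] ^ n"
  by (simp add: rescale_def pcompose_power pcompose_pCons mult.commute)

lemma rescale_Qpoly:
  "rescale (Qpoly m i) c = (\<Prod>a | (i, a) \<in> Poly_Mapping.keys m. [:1, - (a * c):] ^ nat (expo m i a))"
  by (simp add: Qpoly_def rescale_prod rescale_linear_power)

lemma rescale_Rpoly:
  "rescale (Rpoly m i) c = (\<Prod>a | (i, a) \<in> Poly_Mapping.keys m. [:1, - (a * c):] ^ nat (- expo m i a))"
  by (simp add: Rpoly_def rescale_prod rescale_linear_power)

lemma fps_of_poly_prod_power:
  "fps_of_poly (\<Prod>a\<in>S. p a ^ n a) = (\<Prod>a\<in>S. fps_of_poly (p a) ^ n a)"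
  by (simp add: fps_of_poly_prod fps_of_poly_power)

lemma of_int_nat_diff: "of_nat (nat x) - of_nat (nat (- x)) = (of_int x :: 'a::ring_1)"
  by (cases "x \<ge> 0") auto

lemma reflect_linear: "(x :: complex) \<noteq> 0 \<Longrightarrow> reflect_poly [:1, - x:] = smult (- x) [:1, - inverse x:]"
  by (rule poly_eqI) (auto simp: coeff_reflect_poly coeff_pCons split: nat.split)

lemma reflect_linear_power_prod:
  fixes x :: "'a \<Rightarrow> complex"
  shows "(\<And>a. a \<in> S \<Longrightarrow> x a \<noteq> 0) \<Longrightarrow> reflect_poly (\<Prod>a\<in>S. [:1, - x a:] ^ k a) =
    smult (\<Prod>a\<in>S. (- x a) ^ k a) (\<Prod>a\<in>S. [:1, - inverse (x a):] ^ k a)"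
proof (induction S rule: infinite_finite_induct)
  case (insert a S)
  then have "reflect_poly ([:1, - x a:] ^ k a) = smult ((- x a) ^ k a) ([:1, - inverse (x a):] ^ k a)"
    by (simp only: reflect_poly_power reflect_linear[OF insert.prems[OF insertI1]] smult_power)
  moreover have "reflect_poly (\<Prod>a\<in>S. [:1, - x a:] ^ k a) = smult (\<Prod>a\<in>S. (- x a) ^ k a) (\<Prod>a\<in>S. [:1, - inverse (x a):] ^ k a)"
    using insert by blast
  ultimately show ?case unfolding prod.insert[OF insert.hyps] reflect_poly_mult
    by (simp only: mult_smult_left mult_smult_right smult_smult mult.commute)
qed auto

lemma prod_powi: "(t :: 'a::field) \<noteq> 0 \<Longrightarrow> (\<Prod>x\<in>S. t powi f x) = t powi (\<Sum>x\<in>S. f x)"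
  by (induction S rule: infinite_finite_induct) (auto simp: power_int_add)

lemma coeff_0_linear_power_prod:
  "coeff (\<Prod>a\<in>S. [:1, - x a:] ^ k a) 0 = (1 :: complex)"
  by (simp add: poly_0_coeff_0[symmetric] poly_prod)

text \<open>The points \<open>x a\<close> and \<open>y a\<close> are arbitrary because both
  expansions of \<gamma>(m) use the lemma: with a/t and a t at u = 0, and with the inverses of these
  at infinity.\<close>

lemma dlog_exponent_prod:
  fixes m :: monom
  shows "has_dlog (fps_of_poly ((\<Prod>a | (i, a) \<in> Poly_Mapping.keys m. [:1, - x a:] ^ nat (expo m i a)) *
          (\<Prod>a | (i, a) \<in> Poly_Mapping.keys m. [:1, - y a:] ^ nat (- expo m i a))) /
       fps_of_poly ((\<Prod>a | (i, a) \<in> Poly_Mapping.keys m. [:1, - y a:] ^ nat (expo m i a)) *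
          (\<Prod>a | (i, a) \<in> Poly_Mapping.keys m. [:1, - x a:] ^ nat (- expo m i a))))
     (Abs_fps (\<lambda>n. esum i (\<lambda>a. y a ^ Suc n - x a ^ Suc n) m))"
proof -
  let ?S = "{a. (i, a) \<in> Poly_Mapping.keys m}"
  let ?G = "\<lambda>x. Abs_fps (\<lambda>n. - (x ^ Suc n)) :: complex fps"
  have 1: "has_dlog (fps_of_poly (\<Prod>a\<in>?S. [:1, - z a:] ^ k a)) (\<Sum>a\<in>?S. of_nat (k a) * ?G (z a))" for z k
    unfolding fps_of_poly_prod_power by (intro has_dlog_prod has_dlog_power has_dlog_linear)
  have 2: "(\<Sum>a\<in>?S. of_nat (nat (expo m i a)) * ?G (x a)) + (\<Sum>a\<in>?S. of_nat (nat (- expo m i a)) * ?G (y a)) -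
    ((\<Sum>a\<in>?S. of_nat (nat (expo m i a)) * ?G (y a)) + (\<Sum>a\<in>?S. of_nat (nat (- expo m i a)) * ?G (x a)))
    = Abs_fps (\<lambda>n. esum i (\<lambda>a. y a ^ Suc n - x a ^ Suc n) m)" (is "?l = _")
  proof -
    have "?l = (\<Sum>a\<in>?S. (of_nat (nat (expo m i a)) - of_nat (nat (- expo m i a))) * (?G (x a) - ?G (y a)))"
      by (simp only: sum.distrib[symmetric] sum_subtractf[symmetric]) (rule sum.cong[OF refl], simp only: algebra_simps)
    also have "\<dots> = (\<Sum>a\<in>?S. of_int (expo m i a) * (?G (x a) - ?G (y a)))" by (simp only: of_int_nat_diff)
    also have "\<dots> = Abs_fps (\<lambda>n. esum i (\<lambda>a. y a ^ Suc n - x a ^ Suc n) m)"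
    proof (rule fps_ext)
      fix n
      have "(of_int k * f) $ n = of_int k * f $ n" for k and f :: "complex fps"
        by (metis fps_mult_left_const_nth fps_of_int)
      then show "(\<Sum>a\<in>?S. of_int (expo m i a) * (?G (x a) - ?G (y a))) $ n =
         Abs_fps (\<lambda>n. esum i (\<lambda>a. y a ^ Suc n - x a ^ Suc n) m) $ n"
        by (simp add: fps_sum_nth esum_def)
    qed
    finally show ?thesis .
  qed
  show ?thesis unfolding 2[symmetric] fps_of_poly_mult
    by (intro has_dlog_divide has_dlog_mult 1)
qed

lemma degree_linear_power_prod:
  fixes k :: "complex \<Rightarrow> nat"
  assumes "finite S" "\<And>a. a \<in> S \<Longrightarrow> a \<noteq> 0"
  shows "degree (\<Prod>a\<in>S. [:1, - a:] ^ k a) = (\<Sum>a\<in>S. k a)"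
proof (subst degree_prod_eq_sum_degree)
  show "\<forall>a\<in>S. [:1, - a:] ^ k a \<noteq> 0" by simp
  show "(\<Sum>a\<in>S. degree ([:1, - a:] ^ k a)) = sum k S"
    using assms by (intro sum.cong refl) (simp add: degree_power_eq)
qed

lemma degree_Q_R:
  assumes m: "m \<in> monoms D"
  shows "int (degree (Qpoly m i)) - int (degree (Rpoly m i)) = wt m i"
proof -
  let ?S = "{a. (i, a) \<in> Poly_Mapping.keys m}"
  have nz: "\<And>a. a \<in> ?S \<Longrightarrow> a \<noteq> 0" using m by (auto simp: monoms_def)
  have "int (degree (Qpoly m i)) - int (degree (Rpoly m i)) =
     (\<Sum>a\<in>?S. int (nat (expo m i a))) - (\<Sum>a\<in>?S. int (nat (- expo m i a)))"
  proof -
    have "degree (\<Prod>a\<in>?S. [:1, - a:] ^ k a) = (\<Sum>a\<in>?S. k a)" for k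
      by (rule degree_linear_power_prod[OF finite_slice nz])
    then show ?thesis unfolding Qpoly_def Rpoly_def by (simp only: of_nat_sum)
  qed
  also have "\<dots> = wt m i" 
    unfolding wt_def esum_def by (simp add: sum_subtractf[symmetric]) (rule sum.cong, auto)
  finally show ?thesis .
qed

text \<open>This translates l-weights into eigenvalues of the h_{i,n}: \<gamma>(m) has the same
  exponential shape as the operator series phi, with prefactor the eigenvalue of k_i or its
  inverse.\<close>

lemma gamma_eq:
  assumes q: "qq D \<noteq> 0" and m: "m \<in> monoms D"
  shows "gamma D m s i n = qq D powi (int (rr D i) * (sg s * wt m i)) *
    ecoef (\<lambda>k. of_int (sg s) * hchar D m i (sg s * int k)) n"
proof -
  let ?S = "{a. (i, a) \<in> Poly_Mapping.keys m}"
  define t where "t = qq D ^ rr D i"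
  have t0: "t \<noteq> 0" using q by (simp add: t_def)
  have nz: "\<And>a. a \<in> ?S \<Longrightarrow> a \<noteq> 0" using m by (auto simp: monoms_def)
  have num: "gamma_num D m i = (\<Prod>a\<in>?S. [:1, - (a * inverse t):] ^ nat (expo m i a)) *
          (\<Prod>a\<in>?S. [:1, - (a * t):] ^ nat (- expo m i a))"
   and den: "gamma_den D m i = (\<Prod>a\<in>?S. [:1, - (a * t):] ^ nat (expo m i a)) *
          (\<Prod>a\<in>?S. [:1, - (a * inverse t):] ^ nat (- expo m i a))"
    by (simp_all add: gamma_num_def gamma_den_def t_def Let_def rescale_Qpoly rescale_Rpoly)
  have tp: "t powi k = qq D powi (int (rr D i) * k)" for k
    by (simp only: t_def power_int_mult power_int_of_nat)
  show ?thesis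
  proof (cases s)
    case Pos
    define f where "f = fps_of_poly (gamma_num D m i) / fps_of_poly (gamma_den D m i)"
    have dl: "has_dlog f (Abs_fps (\<lambda>n. esum i (\<lambda>a. (a * t) ^ Suc n - (a * inverse t) ^ Suc n) m))"
      unfolding f_def num den by (rule dlog_exponent_prod)
    have f0: "f $ 0 = 1"
      unfolding f_def num den by (subst fps_divide_unit) (simp_all add: coeff_0_linear_power_prod coeff_mult_0)
    have "f $ n = f $ 0 * ecoef (\<lambda>k. of_int (sg s) * hchar D m i (sg s * int k)) n"
    proof (rule has_dlog_eq_exp[OF dl])
      fix k :: nat assume "0 < k"
      then have k: "Suc (k - 1) = k" by simp
      show "of_int (sg s) * hchar D m i (sg s * int k) =
        Abs_fps (\<lambda>n. esum i (\<lambda>a. (a * t) ^ Suc n - (a * inverse t) ^ Suc n) m) $ (k - 1) / of_nat k"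
        unfolding fps_nth_Abs_fps k using \<open>0 < k\<close> by (simp add: Pos hchar_def hpow_pos esum_divide t_def[symmetric])
    qed
    then show ?thesis unfolding gamma_def degree_Q_R[OF m] by (simp add: f0 f_def[symmetric] Pos)
  next
    case Neg
    have rf: "reflect_poly (\<Prod>a\<in>?S. [:1, - (a * c):] ^ k a) =
       smult (\<Prod>a\<in>?S. (- (a * c)) ^ k a) (\<Prod>a\<in>?S. [:1, - inverse (a * c):] ^ k a)"
      if "c \<noteq> 0" for c and k :: "complex \<Rightarrow> nat"
      by (rule reflect_linear_power_prod) (use nz that in auto)
    define c where "c = (\<Prod>a\<in>?S. (- (a * t)) ^ nat (- expo m i a)) * (\<Prod>a\<in>?S. (- (a * inverse t)) ^ nat (expo m i a))"
    define d where "d = (\<Prod>a\<in>?S. (- (a * inverse t)) ^ nat (- expo m i a)) * (\<Prod>a\<in>?S. (- (a * t)) ^ nat (expo m i a))"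
    define num' where "num' = (\<Prod>a\<in>?S. [:1, - inverse (a * inverse t):] ^ nat (expo m i a)) *
          (\<Prod>a\<in>?S. [:1, - inverse (a * t):] ^ nat (- expo m i a))"
    define den' where "den' = (\<Prod>a\<in>?S. [:1, - inverse (a * t):] ^ nat (expo m i a)) *
          (\<Prod>a\<in>?S. [:1, - inverse (a * inverse t):] ^ nat (- expo m i a))"
    have rnum: "reflect_poly (gamma_num D m i) = smult c num'" and rden: "reflect_poly (gamma_den D m i) = smult d den'"
      unfolding num den reflect_poly_mult c_def d_def num'_def den'_def rf[OF t0] rf[OF nonzero_imp_inverse_nonzero[OF t0]]
        mult_smult_left mult_smult_right smult_smult by (rule refl)+
    have cd0: "c \<noteq> 0" "d \<noteq> 0" unfolding c_def d_def using nz t0 finite_slice[of i m] by (simp_all add: prod_zero_iff)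
    \<comment> \<open>Reflecting linear factors produces scalars. Their quotient t^(-2 wt) turns the
      prefactor q^(r_i wt) in \<open>gamma\<close> into q^(-r_i wt), the eigenvalue of the inverse
      of k_i.\<close>
    have cd: "c = t powi (- 2 * wt m i) * d"
    proof -
      have g: "(\<Prod>a\<in>?S. (- (a * inverse t)) ^ k a) = t powi (- 2 * (\<Sum>a\<in>?S. int (k a))) * (\<Prod>a\<in>?S. (- (a * t)) ^ k a)" for k
      proof -
        have "(- (a * inverse t)) ^ k a = t powi (- 2 * int (k a)) * (- (a * t)) ^ k a" for a
        proof -
          have "- (a * inverse t) = t powi (-2) * (- (a * t))"
            using t0 by (simp add: power_int_minus power2_eq_square field_simps)
          then have "(- (a * inverse t)) ^ k a = (t powi (-2)) powi int (k a) * (- (a * t)) ^ k a"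
            unfolding power_int_of_nat by (simp only: power_mult_distrib)
          then show ?thesis by (simp only: power_int_mult)
        qed
        then have "(\<Prod>a\<in>?S. (- (a * inverse t)) ^ k a) = (\<Prod>a\<in>?S. t powi (- 2 * int (k a))) * (\<Prod>a\<in>?S. (- (a * t)) ^ k a)"
          by (simp add: prod.distrib)
        also have "(\<Prod>a\<in>?S. t powi (- 2 * int (k a))) = t powi (\<Sum>a\<in>?S. - 2 * int (k a))"
          using t0 by (rule prod_powi)
        also have "(\<Sum>a\<in>?S. - 2 * int (k a)) = - 2 * (\<Sum>a\<in>?S. int (k a))" by (simp only: sum_distrib_left)
        finally show ?thesis .
      qed
      have w: "wt m i = (\<Sum>a\<in>?S. int (nat (expo m i a))) - (\<Sum>a\<in>?S. int (nat (- expo m i a)))"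
        unfolding wt_def esum_def by (simp add: sum_subtractf[symmetric]) (rule sum.cong, auto)
      let ?p = "\<Sum>a\<in>?S. int (nat (expo m i a))" and ?n = "\<Sum>a\<in>?S. int (nat (- expo m i a))"
      have "c = t powi (- 2 * ?p) * (\<Prod>a\<in>?S. (- (a * t)) ^ nat (expo m i a)) * (\<Prod>a\<in>?S. (- (a * t)) ^ nat (- expo m i a))"
        unfolding c_def g by (simp only: mult_ac)
      moreover have "t powi (- 2 * wt m i) * d = t powi (- 2 * wt m i) * (t powi (- 2 * ?n)) * (\<Prod>a\<in>?S. (- (a * t)) ^ nat (expo m i a)) * (\<Prod>a\<in>?S. (- (a * t)) ^ nat (- expo m i a))"
        unfolding d_def g by (simp only: mult_ac)
      moreover have "t powi (- 2 * wt m i) * (t powi (- 2 * ?n)) = t powi (- 2 * ?p)"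
        unfolding w power_int_add[symmetric, OF disjI1[OF t0]] by (simp add: algebra_simps)
      ultimately show ?thesis by (simp only:)
    qed
    define f where "f = fps_of_poly num' / fps_of_poly den'"
    have dl: "has_dlog f (Abs_fps (\<lambda>n. esum i (\<lambda>a. (inverse (a * t)) ^ Suc n - (inverse (a * inverse t)) ^ Suc n) m))"
      unfolding f_def num'_def den'_def by (rule dlog_exponent_prod)
    have d0: "fps_of_poly den' $ 0 = 1" "fps_of_poly num' $ 0 = 1"
      unfolding den'_def num'_def by (simp_all add: coeff_0_linear_power_prod coeff_mult_0 del: inverse_mult_distrib)
    then have f0: "f $ 0 = 1" by (simp add: f_def fps_divide_unit)
    have "f $ n = f $ 0 * ecoef (\<lambda>k. of_int (sg s) * hchar D m i (sg s * int k)) n"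
    proof (rule has_dlog_eq_exp[OF dl])
      fix k :: nat assume "0 < k"
      then have k: "Suc (k - 1) = k" by simp
      show "of_int (sg s) * hchar D m i (sg s * int k) =
        Abs_fps (\<lambda>n. esum i (\<lambda>a. (inverse (a * t)) ^ Suc n - (inverse (a * inverse t)) ^ Suc n) m) $ (k - 1) / of_nat k"
        unfolding fps_nth_Abs_fps k using \<open>0 < k\<close> by (simp add: Neg hchar_def hpow_neg[OF t0] esum_minus esum_divide t_def[symmetric] del: inverse_mult_distrib)
    qed
    moreover have "fps_of_poly (reflect_poly (gamma_num D m i)) / fps_of_poly (reflect_poly (gamma_den D m i)) =
      fps_const (t powi (- 2 * wt m i)) * f"
    proof -
      have "fps_of_poly (reflect_poly (gamma_num D m i)) / fps_of_poly (reflect_poly (gamma_den D m i)) =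
        (fps_const c * fps_of_poly num') * inverse (fps_const d * fps_of_poly den')"
        unfolding rnum rden fps_of_poly_smult using cd0 d0 by (intro fps_divide_unit) simp
      also have "\<dots> = fps_const (c * inverse d) * (fps_of_poly num' * inverse (fps_of_poly den'))"
        unfolding fps_inverse_mult fps_const_inverse fps_const_mult[symmetric] by (simp only: mult_ac)
      also have "c * inverse d = t powi (- 2 * wt m i)" using cd cd0 by simp
      also have "fps_of_poly num' * inverse (fps_of_poly den') = f"
        unfolding f_def using d0 by (subst fps_divide_unit) simp_all
      finally show ?thesis .
    qed
    moreover have "qq D powi (int (rr D i) * wt m i) * t powi (- 2 * wt m i) = qq D powi (int (rr D i) * (sg s * wt m i))"
      unfolding tp power_int_add[symmetric, OF disjI1[OF q]] by (simp add: Neg algebra_simps)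
    ultimately show ?thesis unfolding gamma_def degree_Q_R[OF m] by (simp add: f0 Neg)
  qed
qed

subsection \<open>Root data\<close>

text \<open>A linear functional with value 1 on the independent set is represented by the inner
  product; projecting its vector to the span changes no value on the set and later allows an
  expansion in simple roots.\<close>

lemma dual_functional:
  fixes S :: "'e::euclidean_space set"
  assumes "independent S"
  shows "\<exists>\<rho>\<in>span S. \<forall>s\<in>S. \<rho> \<bullet> s = 1"
proof -
  obtain g :: "'e \<Rightarrow> real" where g: "linear g" "\<And>s. s \<in> S \<Longrightarrow> g s = 1"
    using linear_independent_extend[OF assms, of "\<lambda>_. 1 :: real"] by auto
  define \<rho>0 where "\<rho>0 = (\<Sum>b\<in>Basis. g b *\<^sub>R b)"
  have g0: "g x = \<rho>0 \<bullet> x" for x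
  proof -
    have "g x = g (\<Sum>b\<in>Basis. (x \<bullet> b) *\<^sub>R b)" by (simp add: euclidean_representation)
    also have "\<dots> = (\<Sum>b\<in>Basis. (x \<bullet> b) * g b)" using g(1) by (simp add: linear_sum linear_scale)
    also have "\<dots> = \<rho>0 \<bullet> x" by (simp add: \<rho>0_def inner_sum_left inner_commute[of x] mult.commute)
    finally show ?thesis .
  qed
  obtain y z where yz: "y \<in> span S" "\<And>w. w \<in> span S \<Longrightarrow> orthogonal z w" "\<rho>0 = y + z"
    using orthogonal_subspace_decomp_exists[of S \<rho>0] by metis
  have "y \<bullet> s = 1" if "s \<in> S" for s
  proof -
    have "z \<bullet> s = 0" using yz(2)[OF span_base[OF that]] by (simp add: orthogonal_def)
    then show ?thesis using g(2)[OF that] g0[of s] yz(3) by (simp add: inner_add_left)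
  qed
  then show ?thesis using yz(1) by blast
qed

lemma inner_shift:
  fixes a b :: "'e::real_inner"
  shows "(b - c *\<^sub>R a) \<bullet> (b - c *\<^sub>R a) = b \<bullet> b - 2 * c * (a \<bullet> b) + c * (c * (a \<bullet> a))"
  by (simp add: inner_diff_left inner_diff_right inner_commute)

locale lie_data =
  fixes N :: nat and \<Phi> :: "'e::euclidean_space set" and \<alpha> C r
  assumes data: "simple_lie_data N \<Phi> \<alpha> C r"
begin

lemma root_sys: "root_system \<Phi>" and simple: "simple_roots N \<Phi> \<alpha>"
  using data by (auto simp: simple_lie_data_def irreducible_root_system_def)

lemma \<alpha>_root: "i \<in> {1..N} \<Longrightarrow> \<alpha> i \<in> \<Phi>"
  using simple by (auto simp: simple_roots_def)

lemma \<alpha>_pos: "i \<in> {1..N} \<Longrightarrow> \<alpha> i \<bullet> \<alpha> i > 0"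
proof -
  assume "i \<in> {1..N}"
  then have "\<alpha> i \<noteq> 0" using \<alpha>_root root_sys unfolding root_system_def by metis
  then show ?thesis by simp
qed

lemma reflect: "a \<in> \<Phi> \<Longrightarrow> b \<in> \<Phi> \<Longrightarrow> b - (2 * (a \<bullet> b) / (a \<bullet> a)) *\<^sub>R a \<in> \<Phi>"
  using root_sys by (auto simp: root_system_def)

lemma indep: "independent (\<alpha> ` {1..N})" and inj: "inj_on \<alpha> {1..N}"
  using simple by (auto simp: simple_roots_def)

lemma coeff_unique:
  assumes "(\<Sum>i=1..N. a i *\<^sub>R \<alpha> i) = (\<Sum>i=1..N. b i *\<^sub>R \<alpha> i)" "k \<in> {1..N}"
  shows "a k = b k"
proof -
  define u where "u v = a (the_inv_into {1..N} \<alpha> v) - b (the_inv_into {1..N} \<alpha> v)" for v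
  have "(\<Sum>v\<in>\<alpha> ` {1..N}. u v *\<^sub>R v) = (\<Sum>i=1..N. (a i - b i) *\<^sub>R \<alpha> i)"
    by (subst sum.reindex[OF inj]) (auto simp: u_def the_inv_into_f_f[OF inj] simp del: One_nat_def intro!: sum.cong)
  also have "\<dots> = 0" using assms(1) by (simp add: scaleR_left_diff_distrib sum_subtractf)
  finally have "u (\<alpha> k) = 0" using independentD[OF indep finite_imageI[of "{1..N}"] subset_refl, of u "\<alpha> k"] assms(2) by simp
  then show ?thesis using assms(2) by (simp add: u_def the_inv_into_f_f[OF inj] del: One_nat_def)
qed

lemma height_exists: "\<exists>\<rho>. \<rho> \<in> span (\<alpha> ` {1..N}) \<and> (\<forall>i\<in>{1..N}. \<rho> \<bullet> \<alpha> i = 1)"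
  using dual_functional[OF indep] by auto

lemma C_eq: "i \<in> {1..N} \<Longrightarrow> j \<in> {1..N} \<Longrightarrow> of_int (C i j) = 2 * (\<alpha> i \<bullet> \<alpha> j) / (\<alpha> i \<bullet> \<alpha> i)"
  using data by (auto simp: simple_lie_data_def)

lemma r_eq: "i \<in> {1..N} \<Longrightarrow> real (r i) = 1/2 * of_int (max_edges N C) * (\<alpha> i \<bullet> \<alpha> i)"
  using data by (auto simp: simple_lie_data_def)

lemma C_diag: "i \<in> {1..N} \<Longrightarrow> C i i = 2"
  using C_eq[of i i] \<alpha>_pos[of i] by simp

text \<open>Otherwise the reflection of \<alpha>_j in \<alpha>_i is a root with coefficient 1 at
  \<alpha>_j and a negative one at \<alpha>_i, whereas the coefficients of a root all have one
  sign.\<close>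

lemma simple_obtuse:
  assumes i: "i \<in> {1..N}" and j: "j \<in> {1..N}" and ij: "i \<noteq> j"
  shows "\<alpha> i \<bullet> \<alpha> j \<le> 0"
proof (rule ccontr)
  assume p: "\<not> ?thesis"
  define c where "c = 2 * (\<alpha> i \<bullet> \<alpha> j) / (\<alpha> i \<bullet> \<alpha> i)"
  have c: "c > 0" using p \<alpha>_pos[OF i] by (simp add: c_def)
  have "\<alpha> j - c *\<^sub>R \<alpha> i \<in> \<Phi>" using reflect[OF \<alpha>_root[OF i] \<alpha>_root[OF j]] by (simp add: c_def)
  then obtain d :: "nat \<Rightarrow> nat" where d: "\<alpha> j - c *\<^sub>R \<alpha> i = (\<Sum>i=1..N. real (d i) *\<^sub>R \<alpha> i) \<or>
      \<alpha> j - c *\<^sub>R \<alpha> i = - (\<Sum>i=1..N. real (d i) *\<^sub>R \<alpha> i)"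
    using simple unfolding simple_roots_def by blast
  define e where "e k = (if k = j then 1 else if k = i then - c else 0)" for k
  have e: "\<alpha> j - c *\<^sub>R \<alpha> i = (\<Sum>k=1..N. e k *\<^sub>R \<alpha> k)"
  proof -
    have "(\<Sum>k=1..N. e k *\<^sub>R \<alpha> k) = (\<Sum>k\<in>{i,j}. e k *\<^sub>R \<alpha> k)"
      using i j by (intro sum.mono_neutral_right) (auto simp: e_def)
    then show ?thesis using ij by (simp add: e_def)
  qed
  from d show False
  proof
    assume "\<alpha> j - c *\<^sub>R \<alpha> i = (\<Sum>i=1..N. real (d i) *\<^sub>R \<alpha> i)"
    then have "e i = real (d i)" using e coeff_unique[OF _ i] by metis
    then show False using c ij by (simp add: e_def)
  next
    assume "\<alpha> j - c *\<^sub>R \<alpha> i = - (\<Sum>i=1..N. real (d i) *\<^sub>R \<alpha> i)"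
    then have "(\<Sum>k=1..N. e k *\<^sub>R \<alpha> k) = (\<Sum>k=1..N. (- real (d k)) *\<^sub>R \<alpha> k)" using e by (simp add: sum_negf)
    then have "e j = - real (d j)" using coeff_unique[OF _ j] by metis
    then show False using ij by (simp add: e_def)
  qed
qed

text \<open>The bound is Cauchy-Schwarz, strict because two distinct simple roots are independent:
  it makes the product of the two entries less than 4.\<close>

lemma C_prod:
  assumes i: "i \<in> {1..N}" and j: "j \<in> {1..N}" and ij: "i \<noteq> j"
  shows "C i j \<le> 0" "C i j = 0 \<longleftrightarrow> C j i = 0" "C i j * C j i \<le> 3"
    "of_int (C i j) * (\<alpha> i \<bullet> \<alpha> i) = of_int (C j i) * (\<alpha> j \<bullet> \<alpha> j)"
proof -
  have ip: "\<alpha> i \<bullet> \<alpha> i > 0" and jp: "\<alpha> j \<bullet> \<alpha> j > 0" using \<alpha>_pos i j by auto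
  have 1: "of_int (C i j) * (\<alpha> i \<bullet> \<alpha> i) = 2 * (\<alpha> i \<bullet> \<alpha> j)" using C_eq[OF i j] ip by simp
  have 2: "of_int (C j i) * (\<alpha> j \<bullet> \<alpha> j) = 2 * (\<alpha> i \<bullet> \<alpha> j)" using C_eq[OF j i] jp by (simp add: inner_commute)
  show "of_int (C i j) * (\<alpha> i \<bullet> \<alpha> i) = of_int (C j i) * (\<alpha> j \<bullet> \<alpha> j)" using 1 2 by simp
  have "of_int (C i j) * (\<alpha> i \<bullet> \<alpha> i) \<le> 0" using 1 simple_obtuse[OF i j ij] by simp
  then have "(of_int (C i j) :: real) \<le> 0" using ip by (simp add: mult_le_0_iff)
  then show "C i j \<le> 0" by simp
  show "C i j = 0 \<longleftrightarrow> C j i = 0" using 1 2 ip jp by auto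
  have "(\<alpha> i \<bullet> \<alpha> j)\<^sup>2 < (\<alpha> i \<bullet> \<alpha> i) * (\<alpha> j \<bullet> \<alpha> j)"
  proof -
    define c where "c = (\<alpha> i \<bullet> \<alpha> j) / (\<alpha> i \<bullet> \<alpha> i)"
    have "\<alpha> j - c *\<^sub>R \<alpha> i \<noteq> 0"
    proof
      assume "\<alpha> j - c *\<^sub>R \<alpha> i = 0"
      then have "\<alpha> j \<in> span {\<alpha> i}" by (simp add: span_mul span_base)
      moreover have "{\<alpha> i} \<subseteq> \<alpha> ` {1..N} - {\<alpha> j}" using i ij inj_on_eq_iff[OF inj i j] by (simp add: imageI)
      ultimately have "\<alpha> j \<in> span (\<alpha> ` {1..N} - {\<alpha> j})" using span_mono by blast
      then show False using indep j by (auto simp: dependent_def)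
    qed
    then have "0 < (\<alpha> j - c *\<^sub>R \<alpha> i) \<bullet> (\<alpha> j - c *\<^sub>R \<alpha> i)" by simp
    also have "\<dots> = \<alpha> j \<bullet> \<alpha> j - (\<alpha> i \<bullet> \<alpha> j)\<^sup>2 / (\<alpha> i \<bullet> \<alpha> i)"
    proof -
      have "c * (\<alpha> i \<bullet> \<alpha> i) = \<alpha> i \<bullet> \<alpha> j" using ip by (simp add: c_def)
      then show ?thesis unfolding inner_shift by (simp add: c_def power2_eq_square)
    qed
    finally have "(\<alpha> i \<bullet> \<alpha> j)\<^sup>2 / (\<alpha> i \<bullet> \<alpha> i) < \<alpha> j \<bullet> \<alpha> j" by simp
    then show ?thesis using ip by (simp add: pos_divide_less_eq mult.commute)
  qed
  moreover have "of_int (C i j * C j i) * ((\<alpha> i \<bullet> \<alpha> i) * (\<alpha> j \<bullet> \<alpha> j)) = 4 * (\<alpha> i \<bullet> \<alpha> j)\<^sup>2"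
  proof -
    have "of_int (C i j * C j i) * ((\<alpha> i \<bullet> \<alpha> i) * (\<alpha> j \<bullet> \<alpha> j)) =
      (of_int (C i j) * (\<alpha> i \<bullet> \<alpha> i)) * (of_int (C j i) * (\<alpha> j \<bullet> \<alpha> j))" by simp
    then show ?thesis unfolding 1 2 by (simp add: power2_eq_square)
  qed
  ultimately have "of_int (C i j * C j i) * ((\<alpha> i \<bullet> \<alpha> i) * (\<alpha> j \<bullet> \<alpha> j)) < 4 * ((\<alpha> i \<bullet> \<alpha> i) * (\<alpha> j \<bullet> \<alpha> j))" by simp
  then have "(of_int (C i j * C j i) :: real) < 4" using ip jp by (metis mult_less_cancel_right_pos mult_pos_pos)
  then show "C i j * C j i \<le> 3" by linarith
qed

lemma C_range:
  assumes "i \<in> {1..N}" "j \<in> {1..N}" "i \<noteq> j"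
  shows "C i j \<in> {0, -1, -2, -3}" "C i j \<le> -2 \<Longrightarrow> C j i = -1"
proof -
  note a = C_prod(1-3)[OF assms] and b = C_prod(1)[OF assms(2,1) assms(3)[symmetric]]
  show "C i j \<in> {0, -1, -2, -3}"
  proof (rule ccontr)
    assume n: "C i j \<notin> {0, -1, -2, -3}"
    have "C i j \<noteq> 0" using n by simp
    then have "C j i \<le> -1" using a(2) b by linarith
    moreover have "C i j \<le> -4" using n a(1) by simp
    ultimately have "4 * 1 \<le> (- C i j) * (- C j i)" by (intro mult_mono) linarith+
    then show False using a(3) by simp
  qed
  assume c: "C i j \<le> -2"
  show "C j i = -1"
  proof (rule ccontr)
    assume n: "C j i \<noteq> -1"
    have "C j i \<noteq> 0" using a(2) c by linarith
    then have "C j i \<le> -2" using n b by linarith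
    then have "2 * 2 \<le> (- C i j) * (- C j i)" using c by (intro mult_mono) linarith+
    then show False using a(3) by simp
  qed
qed

lemma max_edges_bounds: "1 \<le> max_edges N C" "max_edges N C \<le> 3"
proof -
  let ?S = "{C i j * C j i | i j. i \<in> {1..N} \<and> j \<in> {1..N} \<and> i \<noteq> j}"
  have "?S \<subseteq> (\<lambda>(i, j). C i j * C j i) ` ({1..N} \<times> {1..N})"
  proof
    fix x assume "x \<in> ?S"
    then obtain i j where "x = C i j * C j i" "i \<in> {1..N}" "j \<in> {1..N}" by blast
    then show "x \<in> (\<lambda>(i, j). C i j * C j i) ` ({1..N} \<times> {1..N})" by (intro image_eqI[of _ _ "(i, j)"]) auto
  qed
  then have fin: "finite (insert 1 ?S)" by (simp add: finite_subset)
  show "1 \<le> max_edges N C" unfolding max_edges_def using fin by (intro Max_ge) blast+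
  show "max_edges N C \<le> 3" unfolding max_edges_def
  proof (rule Max.boundedI[OF fin])
    fix x assume "x \<in> insert 1 ?S"
    then consider "x = 1" | i j where "x = C i j * C j i" "i \<in> {1..N}" "j \<in> {1..N}" "i \<noteq> j" by blast
    then show "x \<le> 3" by cases (simp_all add: C_prod(3))
  qed blast
qed

text \<open>Among the roots as long as \<beta> take \<gamma> of maximal height. It is dominant,
  since a reflection keeps the length and would otherwise raise the height; \<theta> is dominant by
  maximality. As \<theta> - \<gamma> is a nonnegative combination of simple roots, pairing it with
  \<gamma> and with \<theta> compares the lengths.\<close>

lemma length_le: 
  assumes \<beta>: "\<beta> \<in> \<Phi>"
  shows "\<beta> \<bullet> \<beta> \<le> 2"
proof -
  obtain \<theta> where \<theta>: "maximal_root N \<Phi> \<alpha> \<theta>" "\<theta> \<bullet> \<theta> = 2" using data by (auto simp: simple_lie_data_def)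
  obtain \<rho> where \<rho>: "\<And>i. i \<in> {1..N} \<Longrightarrow> \<rho> \<bullet> \<alpha> i = 1" using height_exists by blast
  have nn: "0 \<le> x \<bullet> (\<Sum>i=1..N. real (c i) *\<^sub>R \<alpha> i)" if "\<And>i. i \<in> {1..N} \<Longrightarrow> 0 \<le> x \<bullet> \<alpha> i" for x and c :: "nat \<Rightarrow> nat"
    using that by (auto simp: inner_sum_right intro!: sum_nonneg mult_nonneg_nonneg)
  let ?R = "{\<gamma>\<in>\<Phi>. \<gamma> \<bullet> \<gamma> = \<beta> \<bullet> \<beta>}"
  have "finite \<Phi>" using root_sys unfolding root_system_def by blast
  then have "finite ?R" by simp
  moreover have "?R \<noteq> {}" using \<beta> by blast
  ultimately have "finite ?R" "?R \<noteq> {}" .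
  then obtain \<gamma> where \<gamma>: "\<gamma> \<in> ?R" and mx: "\<And>\<delta>. \<delta> \<in> ?R \<Longrightarrow> \<rho> \<bullet> \<delta> \<le> \<rho> \<bullet> \<gamma>"
  proof -
    assume f: "finite ?R" "?R \<noteq> {}"
      and th: "\<And>\<gamma>. \<gamma> \<in> ?R \<Longrightarrow> (\<And>\<delta>. \<delta> \<in> ?R \<Longrightarrow> \<rho> \<bullet> \<delta> \<le> \<rho> \<bullet> \<gamma>) \<Longrightarrow> thesis"
    have "Max ((\<bullet>) \<rho> ` ?R) \<in> (\<bullet>) \<rho> ` ?R" using f by (intro Max_in) blast+
    then obtain \<gamma> where "\<gamma> \<in> ?R" "\<rho> \<bullet> \<gamma> = Max ((\<bullet>) \<rho> ` ?R)" by force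
    then show thesis using th[of \<gamma>] Max_ge[of "(\<bullet>) \<rho> ` ?R"] f by simp
  qed
  have \<gamma>d: "0 \<le> \<gamma> \<bullet> \<alpha> i" if i: "i \<in> {1..N}" for i
  proof (rule ccontr)
    assume n: "\<not> ?thesis"
    define c where "c = 2 * (\<alpha> i \<bullet> \<gamma>) / (\<alpha> i \<bullet> \<alpha> i)"
    have ip: "\<alpha> i \<bullet> \<alpha> i > 0" using \<alpha>_pos[OF i] .
    have c: "c < 0" using n ip by (simp add: c_def inner_commute divide_neg_pos)
    have "\<gamma> - c *\<^sub>R \<alpha> i \<in> \<Phi>" using reflect[OF \<alpha>_root[OF i], of \<gamma>] \<gamma> by (simp add: c_def)
    moreover have "(\<gamma> - c *\<^sub>R \<alpha> i) \<bullet> (\<gamma> - c *\<^sub>R \<alpha> i) = \<gamma> \<bullet> \<gamma>"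
    proof -
      have "c * (\<alpha> i \<bullet> \<alpha> i) = 2 * (\<alpha> i \<bullet> \<gamma>)" using ip by (simp add: c_def)
      then show ?thesis unfolding inner_shift by simp
    qed
    ultimately have "\<rho> \<bullet> (\<gamma> - c *\<^sub>R \<alpha> i) \<le> \<rho> \<bullet> \<gamma>" using \<gamma> by (intro mx) auto
    then show False using c \<rho>[OF i] by (simp add: inner_diff_right)
  qed
  have \<theta>d: "0 \<le> \<theta> \<bullet> \<alpha> i" if i: "i \<in> {1..N}" for i
  proof (rule ccontr)
    assume n: "\<not> ?thesis"
    define c where "c = 2 * (\<alpha> i \<bullet> \<theta>) / (\<alpha> i \<bullet> \<alpha> i)"
    have c: "c < 0" using n \<alpha>_pos[OF i] by (simp add: c_def inner_commute divide_neg_pos)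
    have "\<theta> - c *\<^sub>R \<alpha> i \<in> \<Phi>" using reflect[OF \<alpha>_root[OF i], of \<theta>] \<theta> by (simp add: c_def maximal_root_def)
    then obtain d :: "nat \<Rightarrow> nat" where d: "\<theta> - (\<theta> - c *\<^sub>R \<alpha> i) = (\<Sum>i=1..N. real (d i) *\<^sub>R \<alpha> i)"
      using \<theta> unfolding maximal_root_def by blast
    have "\<rho> \<bullet> (\<theta> - (\<theta> - c *\<^sub>R \<alpha> i)) = c" using \<rho>[OF i] by simp
    then have "c = \<rho> \<bullet> (\<Sum>i=1..N. real (d i) *\<^sub>R \<alpha> i)" unfolding d by simp
    then show False using nn[of \<rho> d] \<rho> c by simp
  qed
  obtain d :: "nat \<Rightarrow> nat" where d: "\<theta> - \<gamma> = (\<Sum>i=1..N. real (d i) *\<^sub>R \<alpha> i)"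
    using \<theta> \<gamma> unfolding maximal_root_def by blast
  have "0 \<le> \<gamma> \<bullet> (\<theta> - \<gamma>)" "0 \<le> \<theta> \<bullet> (\<theta> - \<gamma>)" unfolding d using nn \<gamma>d \<theta>d by blast+
  then have "\<gamma> \<bullet> \<gamma> \<le> \<theta> \<bullet> \<theta>" by (simp add: inner_diff_right inner_commute)
  then show ?thesis using \<gamma> \<theta> by simp
qed

lemma r_pos: "i \<in> {1..N} \<Longrightarrow> 0 < r i"
proof -
  assume i: "i \<in> {1..N}"
  have "0 < real (r i)" unfolding r_eq[OF i] using max_edges_bounds \<alpha>_pos[OF i] by simp
  then show ?thesis by simp
qed

text \<open>Such an entry makes \<alpha>_j at least twice as long as \<alpha>_i in square length, so
  \<alpha>_i has square length at most 1 and r_i is a positive integer at most 3/2. In these cases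
  q^(r_i) = q, which is the shift occurring in \<open>Amon\<close>.\<close>

lemma r_short:
  assumes "i \<in> {1..N}" "j \<in> {1..N}" "i \<noteq> j" "C i j \<le> -2"
  shows "r i = 1"
proof -
  have "C j i = -1" using C_range(2)[OF assms(1-3)] assms(4) by simp
  then have e: "of_int (- C i j) * (\<alpha> i \<bullet> \<alpha> i) = \<alpha> j \<bullet> \<alpha> j" using C_prod(4)[OF assms(1-3)] by simp
  have "2 * (\<alpha> i \<bullet> \<alpha> i) \<le> of_int (- C i j) * (\<alpha> i \<bullet> \<alpha> i)"
    using assms(4) \<alpha>_pos[OF assms(1)] by (intro mult_right_mono) auto
  also have "\<dots> \<le> 2" using e length_le[OF \<alpha>_root[OF assms(2)]] by simp
  finally have l: "\<alpha> i \<bullet> \<alpha> i \<le> 1" by simp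
  have "real (r i) \<le> 1/2 * 3 * 1"
    unfolding r_eq[OF assms(1)] using max_edges_bounds l \<alpha>_pos[OF assms(1)] by (intro mult_mono) auto
  then have "r i \<le> 1" by linarith
  then show ?thesis using r_pos[OF assms(1)] by simp
qed

text \<open>In fundamental coordinates \<alpha>_j is the j-th column of the Cartan matrix. Expanding
  the height vector in simple roots gives the coordinates of the height functional in this
  description.\<close>

lemma height_weights: "\<exists>f :: nat \<Rightarrow> real. \<forall>j\<in>{1..N}. (\<Sum>i\<in>{1..N}. f i * of_int (C i j)) = 1"
proof -
  obtain \<rho> where \<rho>: "\<rho> \<in> span (\<alpha> ` {1..N})" "\<forall>i\<in>{1..N}. \<rho> \<bullet> \<alpha> i = 1" using height_exists by blast
  obtain u where "\<rho> = (\<Sum>v\<in>\<alpha> ` {1..N}. u v *\<^sub>R v)"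
    using \<rho>(1) unfolding span_finite[OF finite_imageI[OF finite_atLeastAtMost]] by blast
  then have u: "\<rho> = (\<Sum>i=1..N. u (\<alpha> i) *\<^sub>R \<alpha> i)" unfolding sum.reindex[OF inj] o_def .
  have "(\<Sum>i\<in>{1..N}. (u (\<alpha> i) * (\<alpha> i \<bullet> \<alpha> i) / 2) * of_int (C i j)) = 1" if j: "j \<in> {1..N}" for j
  proof -
    have "(\<Sum>i\<in>{1..N}. (u (\<alpha> i) * (\<alpha> i \<bullet> \<alpha> i) / 2) * of_int (C i j)) = (\<Sum>i=1..N. u (\<alpha> i) * (\<alpha> i \<bullet> \<alpha> j))"
    proof (rule sum.cong[OF refl])
      fix i assume i: "i \<in> {1..N}"
      show "u (\<alpha> i) * (\<alpha> i \<bullet> \<alpha> i) / 2 * real_of_int (C i j) = u (\<alpha> i) * (\<alpha> i \<bullet> \<alpha> j)"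
        unfolding C_eq[OF i j] using \<alpha>_pos[OF i] by simp
    qed
    also have "\<dots> = \<rho> \<bullet> \<alpha> j" by (subst u) (simp add: inner_sum_left)
    finally show ?thesis using \<rho>(2) j by simp
  qed
  then show ?thesis by (intro exI[of _ "\<lambda>i. u (\<alpha> i) * (\<alpha> i \<bullet> \<alpha> i) / 2"]) blast
qed

end

subsection \<open>The monomials A\<close>

text \<open>These consequences of the root data also hold for \<open>sl2_data\<close>, so that the
  theory of modules below applies to the full algebra and to the subalgebra of a vertex
  alike.\<close>

locale qdat =
  fixes D :: qdata
  assumes q_nz: "qq D \<noteq> 0" and q_nru: "\<And>n. 0 < n \<Longrightarrow> qq D ^ n \<noteq> 1"
    and fin_Idx: "finite (Idx D)"
    and rr_pos: "\<And>i. i \<in> Idx D \<Longrightarrow> 0 < rr D i"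
    and Cart_diag: "\<And>i. i \<in> Idx D \<Longrightarrow> Cart D i i = 2"
    and Cart_off: "\<And>i j. i \<in> Idx D \<Longrightarrow> j \<in> Idx D \<Longrightarrow> i \<noteq> j \<Longrightarrow> Cart D i j \<in> {0, -1, -2, -3}"
    and rr_short: "\<And>i j. i \<in> Idx D \<Longrightarrow> j \<in> Idx D \<Longrightarrow> i \<noteq> j \<Longrightarrow> Cart D i j \<le> -2 \<Longrightarrow> rr D i = 1"
    and heights: "\<exists>f :: nat \<Rightarrow> real. \<forall>j\<in>Idx D. (\<Sum>i\<in>Idx D. f i * of_int (Cart D i j)) = 1"
begin

abbreviation "q \<equiv> qq D"

definition qi :: "nat \<Rightarrow> complex" where "qi i = q ^ rr D i"

lemma q_powi_1: "q powi n = 1 \<longleftrightarrow> n = 0"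
proof
  assume a: "q powi n = 1"
  show "n = 0"
  proof (rule ccontr)
    assume "n \<noteq> 0"
    then consider "n > 0" | "- n > 0" by linarith
    then show False
    proof cases
      case 1
      then show False using a q_nru[of "nat n"] by (simp add: power_int_def)
    next
      case 2
      then have "q powi (- n) = 1" using a by (simp add: power_int_minus)
      then show False using 2 q_nru[of "nat (- n)"] by (simp add: power_int_def)
    qed
  qed
qed simp

lemma q_powi_inj: "q powi n = q powi k \<longleftrightarrow> n = k"
proof -
  have "q powi n = q powi k \<longleftrightarrow> q powi (n - k) = 1" using q_nz by (simp add: power_int_diff)
  then show ?thesis by (simp add: q_powi_1)
qed

lemma qi_powi: "qi i powi n = q powi (int (rr D i) * n)"
  by (simp only: qi_def power_int_mult power_int_of_nat)

lemma qi_nz: "qi i \<noteq> 0" using q_nz by (simp add: qi_def)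

lemma qi_powi_inj: "i \<in> Idx D \<Longrightarrow> qi i powi n = qi i powi k \<longleftrightarrow> n = k"
  using rr_pos[of i] by (simp add: qi_powi q_powi_inj)

lemma qi_diff_nz: "i \<in> Idx D \<Longrightarrow> n \<noteq> 0 \<Longrightarrow> qi i powi n - qi i powi (- n) \<noteq> 0"
  by (simp add: qi_powi_inj)

text \<open>Structure constants of the commutators of the normalized \<open>h\<^sub>i\<^sub>,\<^sub>n\<close> with \<open>x\<^sup>\<plusminus>\<^sub>j\<^sub>,\<^sub>m\<close>.\<close>

definition bc :: "nat \<Rightarrow> nat \<Rightarrow> int \<Rightarrow> complex" where
  "bc i j n = (q powi (n * symB D i j) - q powi (- (n * symB D i j))) / of_int n"

lemma bc_diag_nz: "i \<in> Idx D \<Longrightarrow> n \<noteq> 0 \<Longrightarrow> bc i i n \<noteq> 0"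
  using rr_pos[of i] by (simp add: bc_def q_powi_inj symB_def Cart_diag)

lemma Amon_esum:
  assumes i: "i \<in> Idx D" and j: "j \<in> Idx D"
  shows "esum i \<phi> (Amon D j a) =
    (if i = j then \<phi> (a * qi j) + \<phi> (a / qi j)
     else if Cart D i j = -1 then - \<phi> a
     else if Cart D i j = -2 then - (\<phi> (a * q) + \<phi> (a / q))
     else if Cart D i j = -3 then - (\<phi> (a * q\<^sup>2) + \<phi> a + \<phi> (a / q\<^sup>2)) else 0)"
proof -
  have S: "(\<Sum>k | k \<in> Idx D \<and> Cart D k j = c. (if i = k then g k else 0)) = (if Cart D i j = c then g i else 0)" for c and g :: "nat \<Rightarrow> 'a"
    using fin_Idx i by (simp add: sum.delta)
  have S': "(\<Sum>k | k \<in> Idx D \<and> Cart D k j = c. esum i \<phi> (f k)) = (if Cart D i j = c then g i else 0)"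
    if "\<And>k. esum i \<phi> (f k) = (if i = k then g k else 0)" for c f g
    unfolding that by (rule S)
  have "esum i \<phi> (Amon D j a) = (if i = j then \<phi> (a * qi j) + \<phi> (a / qi j) else 0)
    - (if Cart D i j = -1 then \<phi> a else 0)
    - (if Cart D i j = -2 then \<phi> (a * q) + \<phi> (a / q) else 0)
    - (if Cart D i j = -3 then \<phi> (a * q\<^sup>2) + \<phi> a + \<phi> (a / q\<^sup>2) else 0)"
    unfolding Amon_def Let_def esum_diff esum_sum
    by (subst (1 2 3) S') (auto simp: esum_add esum_Y qi_def)
  then show ?thesis using Cart_diag[OF i] by auto
qed

lemma wt_Amon: "i \<in> Idx D \<Longrightarrow> j \<in> Idx D \<Longrightarrow> wt (Amon D j a) i = Cart D i j"
  unfolding wt_def using Cart_off[of i j] Cart_diag by (auto simp: Amon_esum)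

text \<open>The shifts in A_{j,a} are those for which the sum telescopes to q^(n B_ij) - q^(-n
  B_ij), whatever the Cartan entry. For the entries -2 and -3 this uses q^(r_i) = q.\<close>

lemma hpow_Amon:
  assumes i: "i \<in> Idx D" and j: "j \<in> Idx D" and n: "n \<noteq> 0"
  shows "esum i (hpow (qi i) n) (Amon D j a) = bc i j n * a powi n"
proof -
  have p: "hpow t n (a * s) = a powi n * (s powi n * (t powi n - t powi (- n))) / of_int n" for t s
    by (simp add: hpow_def power_int_mult_distrib)
  have p': "hpow t n (a / s) = a powi n * (s powi (- n) * (t powi n - t powi (- n))) / of_int n" for t s
    by (simp add: hpow_def power_int_divide_distrib power_int_minus field_simps)
  have p0: "hpow t n a = a powi n * (t powi n - t powi (- n)) / of_int n" for t
    by (simp add: hpow_def)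
  have ad: "q powi x * q powi y = q powi (x + y)" for x y using q_nz by (simp add: power_int_add)
  consider "i = j" | "i \<noteq> j" "Cart D i j = 0" | "i \<noteq> j" "Cart D i j = -1" | "i \<noteq> j" "Cart D i j = -2" | "i \<noteq> j" "Cart D i j = -3"
    using Cart_off[OF i j] by auto
  then show ?thesis
  proof cases
    case 1
    have "qi j powi n * (qi j powi n - qi j powi (- n)) + qi j powi (- n) * (qi j powi n - qi j powi (- n))
        = q powi (n * symB D j j) - q powi (- (n * symB D j j))"
      using Cart_diag[OF j] by (simp add: qi_powi symB_def right_diff_distrib ad mult.commute mult.left_commute)
    then show ?thesis unfolding 1 Amon_esum[OF j j] bc_def p p'
      by (simp add: add_divide_distrib[symmetric] distrib_left[symmetric])
  next
    case 2
    then show ?thesis using i j by (simp add: Amon_esum bc_def symB_def)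
  next
    case 3
    then show ?thesis using i j by (simp add: Amon_esum bc_def symB_def p0 qi_powi algebra_simps diff_divide_distrib)
  next
    case 4
    then have r: "qi i = q" "symB D i j = - 2" using rr_short[OF i j] by (auto simp: qi_def symB_def)
    have "q powi n * (q powi n - q powi (- n)) + q powi (- n) * (q powi n - q powi (- n))
        = q powi (2 * n) - q powi (- (2 * n))"
      by (simp add: right_diff_distrib ad)
    then show ?thesis using 4 i j
      by (simp add: Amon_esum bc_def r p p' add_divide_distrib[symmetric] distrib_left[symmetric] mult.commute[of n])
        (simp add: algebra_simps diff_divide_distrib)
  next
    case 5
    then have r: "qi i = q" "symB D i j = - 3" using rr_short[OF i j] by (auto simp: qi_def symB_def)
    have q2: "q\<^sup>2 powi n = q powi (2 * n)" "q\<^sup>2 powi (- n) = q powi (- (2 * n))"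
      using power_int_mult[of q 2 n] power_int_mult[of q 2 "- n"] by simp_all
    have "q powi (2 * n) * (q powi n - q powi (- n)) + (q powi n - q powi (- n)) + q powi (- (2 * n)) * (q powi n - q powi (- n))
        = q powi (3 * n) - q powi (- (3 * n))"
      by (simp add: right_diff_distrib ad)
    then show ?thesis using 5 i j
      by (simp add: Amon_esum bc_def r p p' p0 q2 add_divide_distrib[symmetric] distrib_left[symmetric] mult.commute[of n])
        (simp add: algebra_simps diff_divide_distrib)
  qed
qed

text \<open>Multiplication by A_{j,a} or its inverse changes the eigenvalues as passing x^+_j or
  x^-_j does when the mode shift acts by a.\<close>

lemma hchar_shift:
  assumes i: "i \<in> Idx D" and j: "j \<in> Idx D"
  shows "hchar D (m + Amon D j a) i n = (if n = 0 then hchar D m i n * q powi symB D i j else hchar D m i n + bc i j n * a powi n)"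
    and "hchar D (m - Amon D j a) i n = (if n = 0 then hchar D m i n * q powi (- symB D i j) else hchar D m i n - bc i j n * a powi n)"
  using q_nz wt_Amon[OF i j, of a] hpow_Amon[OF i j, of n a]
  by (auto simp: hchar_def wt_def esum_add esum_diff qi_def[symmetric] symB_def power_int_add power_int_diff power_int_minus distrib_left right_diff_distrib divide_inverse)

text \<open>Up to nonzero factors the positive modes are the power sums of the points weighted by
  exponents, and these determine the exponents.\<close>

lemma expo_eqI:
  assumes m: "m \<in> monoms D" "m' \<in> monoms D" and j: "j \<in> Idx D"
    and e: "\<And>n. n > 0 \<Longrightarrow> hchar D m j (int n) = hchar D m' j (int n)"
  shows "expo m j a = expo m' j a"
proof -
  define F where "F = {a. (j, a) \<in> Poly_Mapping.keys m} \<union> {a. (j, a) \<in> Poly_Mapping.keys m'}"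
  have F: "finite F" "0 \<notin> F" using m by (auto simp: F_def finite_slice monoms_def)
  have sub: "{a. (j, a) \<in> Poly_Mapping.keys m} \<subseteq> F" "{a. (j, a) \<in> Poly_Mapping.keys m'} \<subseteq> F" by (auto simp: F_def)
  define c where "c a = (of_int (expo m j a - expo m' j a) :: complex)" for a
  have "(\<Sum>a\<in>F. c a * a ^ n) = 0" if n: "n > 0" for n
  proof -
    have "esum j (hpow (qi j) (int n)) m = esum j (hpow (qi j) (int n)) m'"
      using e[OF n] n by (simp add: hchar_def qi_def)
    then have "(\<Sum>a\<in>F. c a * hpow (qi j) (int n) a) = 0"
      by (simp add: esum_superset[OF F(1) sub(1)] esum_superset[OF F(1) sub(2)] c_def left_diff_distrib sum_subtractf)
    moreover have "hpow (qi j) (int n) a = a ^ n * ((qi j powi int n - qi j powi (- int n)) / of_nat n)" for a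
      by (simp add: hpow_def)
    ultimately have "(\<Sum>a\<in>F. c a * a ^ n) * ((qi j powi int n - qi j powi (- int n)) / of_nat n) = 0"
      unfolding sum_distrib_right mult.assoc by simp
    then show ?thesis using qi_diff_nz[OF j, of "int n"] n by simp
  qed
  then have "a \<in> F \<Longrightarrow> c a = 0" using power_sums_zero[OF F] by blast
  then show ?thesis by (cases "a \<in> F") (auto simp: c_def F_def in_keys_iff)
qed

lemma hchar_inj:
  assumes m: "m \<in> monoms D" "m' \<in> monoms D"
    and e: "\<And>i n. i \<in> Idx D \<Longrightarrow> n > 0 \<Longrightarrow> hchar D m i (int n) = hchar D m' i (int n)"
  shows "m = m'"
proof (rule poly_mapping_eqI)
  fix x :: "nat \<times> complex"
  obtain i a where x: "x = (i, a)" by fastforce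
  show "Poly_Mapping.lookup m x = Poly_Mapping.lookup m' x"
  proof (cases "i \<in> Idx D")
    case True
    then show ?thesis using expo_eqI[OF m True e] x by blast
  next
    case False
    then have "x \<notin> Poly_Mapping.keys m" "x \<notin> Poly_Mapping.keys m'" using m x by (auto simp: monoms_def)
    then show ?thesis by (simp add: in_keys_iff)
  qed
qed

lemma monoms_diff: "m \<in> monoms D \<Longrightarrow> m' \<in> monoms D \<Longrightarrow> m - m' \<in> monoms D"
  using Poly_Mapping.keys_diff[of m m'] by (auto simp: monoms_def)

lemma monoms_add: "m \<in> monoms D \<Longrightarrow> m' \<in> monoms D \<Longrightarrow> m + m' \<in> monoms D"
  using Poly_Mapping.keys_add[of m m'] by (auto simp: monoms_def)

lemma monoms_0: "0 \<in> monoms D"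
  by (simp add: monoms_def)

lemma monoms_sum: "(\<And>x. x \<in> S \<Longrightarrow> f x \<in> monoms D) \<Longrightarrow> sum f S \<in> monoms D"
  by (induction S rule: infinite_finite_induct) (auto intro: monoms_add monoms_0)

lemma monoms_Y: "i \<in> Idx D \<Longrightarrow> a \<noteq> 0 \<Longrightarrow> Y i a \<in> monoms D"
  by (auto simp: monoms_def)

lemma Amon_monoms: "j \<in> Idx D \<Longrightarrow> a \<noteq> 0 \<Longrightarrow> Amon D j a \<in> monoms D"
  unfolding Amon_def Let_def using q_nz
  by (intro monoms_diff monoms_add monoms_sum monoms_Y) auto

text \<open>The group is generated by differences, so the coefficients of two elements are merged on
  the union of their supports. Elements are described through additive functionals, which is the
  form used to compare eigenvalues and weights.\<close>

lemma closure_rep: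
  assumes j: "j \<in> Idx D" and g: "g \<in> group_closure {Amon D j a | a. a \<noteq> 0}"
  shows "\<exists>F c. finite F \<and> 0 \<notin> F \<and> g \<in> monoms D \<and>
    (\<forall>i\<in>Idx D. \<forall>\<phi> :: complex \<Rightarrow> complex. esum i \<phi> g = (\<Sum>a\<in>F. of_int (c a) * esum i \<phi> (Amon D j a))) \<and>
    (\<forall>i\<in>Idx D. wt g i = (\<Sum>a\<in>F. c a) * Cart D i j)"
  using g
proof induction
  case (base s)
  then consider "s = 0" | a where "s = Amon D j a" "a \<noteq> 0" by auto
  then show ?case
  proof cases
    case 1
    then show ?thesis by (intro exI[of _ "{}"]) (auto simp: wt_def monoms_def)
  next
    case 2
    then show ?thesis using j wt_Amon[OF _ j, of _ a] Amon_monoms[OF j, of a] by (intro exI[of _ "{a}"] exI[of _ "\<lambda>_. 1"]) auto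
  qed
next
  case (diff s t)
  from diff.IH(1) obtain F c where 1: "finite F" "0 \<notin> F" "s \<in> monoms D"
    "\<forall>i\<in>Idx D. \<forall>\<phi> :: complex \<Rightarrow> complex. esum i \<phi> s = (\<Sum>a\<in>F. of_int (c a) * esum i \<phi> (Amon D j a))"
    "\<forall>i\<in>Idx D. wt s i = (\<Sum>a\<in>F. c a) * Cart D i j"
    by blast
  from diff.IH(2) obtain F' c' where 2: "finite F'" "0 \<notin> F'" "t \<in> monoms D"
    "\<forall>i\<in>Idx D. \<forall>\<phi> :: complex \<Rightarrow> complex. esum i \<phi> t = (\<Sum>a\<in>F'. of_int (c' a) * esum i \<phi> (Amon D j a))"
    "\<forall>i\<in>Idx D. wt t i = (\<Sum>a\<in>F'. c' a) * Cart D i j" by blast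
  define d where "d a = (if a \<in> F then c a else 0) - (if a \<in> F' then c' a else 0)" for a
  have A: "(\<Sum>a\<in>F \<union> F'. of_int (d a) * f a) = (\<Sum>a\<in>F. of_int (c a) * f a) - (\<Sum>a\<in>F'. of_int (c' a) * f a)" for f :: "complex \<Rightarrow> complex"
  proof -
    have "(\<Sum>a\<in>F \<union> F'. of_int (d a) * f a) = (\<Sum>a\<in>F \<union> F'. (if a \<in> F then of_int (c a) * f a else 0)) - (\<Sum>a\<in>F \<union> F'. (if a \<in> F' then of_int (c' a) * f a else 0))"
      unfolding sum_subtractf[symmetric] by (rule sum.cong) (auto simp: d_def algebra_simps)
    then show ?thesis using 1(1) 2(1) by (simp add: sum.If_cases Int_absorb1 Int_absorb2 Un_Int_distrib2)
  qed
  have "(\<Sum>a\<in>F \<union> F'. d a) = (\<Sum>a\<in>F \<union> F'. (if a \<in> F then c a else 0)) - (\<Sum>a\<in>F \<union> F'. (if a \<in> F' then c' a else 0))"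
    unfolding sum_subtractf[symmetric] by (rule sum.cong) (auto simp: d_def)
  then have B: "(\<Sum>a\<in>F \<union> F'. d a) = (\<Sum>a\<in>F. c a) - (\<Sum>a\<in>F'. c' a)"
    using 1(1) 2(1) by (simp add: sum.If_cases Int_absorb1 Int_absorb2 Un_Int_distrib2)
  show ?case
  proof (intro exI conjI ballI allI)
    show "finite (F \<union> F')" "0 \<notin> F \<union> F'" using 1 2 by auto
    show "s - t \<in> monoms D" using 1 2 monoms_diff by blast
    fix i assume i: "i \<in> Idx D"
    show "esum i \<phi> (s - t) = (\<Sum>a\<in>F \<union> F'. of_int (d a) * esum i \<phi> (Amon D j a))" for \<phi> :: "complex \<Rightarrow> complex"
      unfolding A esum_diff using 1 2 i by simp
    show "wt (s - t) i = sum d (F \<union> F') * Cart D i j"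
      unfolding B using 1 2 i by (simp add: wt_def esum_diff left_diff_distrib)
  qed
qed

text \<open>The \<open>A\<^sub>j\<^sub>,\<^sub>a\<close> are algebraically independent, already after restriction to the variables \<open>Y\<^sub>j\<close>.\<close>

lemma string_inj:
  assumes j: "j \<in> Idx D" and g: "m - m' \<in> group_closure {Amon D j a | a. a \<noteq> 0}"
    and e: "\<And>n. n > 0 \<Longrightarrow> hchar D m j (int n) = hchar D m' j (int n)"
  shows "m = m'"
proof -
  from closure_rep[OF j g] obtain F c where F: "finite F" "0 \<notin> F" "m - m' \<in> monoms D" and
    r0: "\<forall>i\<in>Idx D. \<forall>\<phi> :: complex \<Rightarrow> complex. esum i \<phi> (m - m') = (\<Sum>a\<in>F. of_int (c a) * esum i \<phi> (Amon D j a))" by blast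
  note r = r0[rule_format]
  have "(\<Sum>a\<in>F. of_int (c a) * a ^ n) = (0 :: complex)" if n: "n > 0" for n
  proof -
    have "esum j (hpow (qi j) (int n)) (m - m') = 0"
      using e[OF n] n by (simp add: hchar_def qi_def esum_diff)
    then have "(\<Sum>a\<in>F. of_int (c a) * (bc j j (int n) * a powi int n)) = 0"
      using n unfolding r[OF j] by (simp add: hpow_Amon[OF j j])
    then have "bc j j (int n) * (\<Sum>a\<in>F. of_int (c a) * a ^ n) = 0"
      by (simp add: sum_distrib_left mult.left_commute)
    then show ?thesis using bc_diag_nz[OF j, of "int n"] n by simp
  qed
  then have "\<And>a. a \<in> F \<Longrightarrow> (of_int (c a) :: complex) = 0" using power_sums_zero[OF F(1,2), of "\<lambda>a. of_int (c a)"] by blast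
  then have z: "esum i \<phi> (m - m') = 0" if "i \<in> Idx D" for i and \<phi> :: "complex \<Rightarrow> complex" using r[OF that] by simp
  have "m - m' = 0"
  proof (rule hchar_inj[OF F(3)])
    show "0 \<in> monoms D" by (simp add: monoms_def)
    fix i n assume "i \<in> Idx D" "(n :: nat) > 0"
    then show "hchar D (m - m') i (int n) = hchar D 0 i (int n)" using z by (simp add: hchar_def)
  qed
  then show ?thesis by simp
qed

lemma closure_wt:
  assumes "j \<in> Idx D" "g \<in> group_closure {Amon D j a | a. a \<noteq> 0}"
  shows "\<exists>c. \<forall>i\<in>Idx D. wt g i = c * Cart D i j"
  using closure_rep[OF assms] by (elim exE conjE) (rule exI, assumption)

definition hf :: "nat \<Rightarrow> real" where
  "hf = (SOME f. \<forall>j\<in>Idx D. (\<Sum>i\<in>Idx D. f i * of_int (Cart D i j)) = 1)"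

lemma hf: "j \<in> Idx D \<Longrightarrow> (\<Sum>i\<in>Idx D. hf i * of_int (Cart D i j)) = 1"
  using someI_ex[OF heights] by (simp add: hf_def)

text \<open>The height of a weight in fundamental coordinates. Every A_{j,a} has height 1, so the
  height counts levels below m_+.\<close>

definition ht :: "(nat \<Rightarrow> int) \<Rightarrow> real" where
  "ht w = (\<Sum>i\<in>Idx D. hf i * of_int (w i))"

lemma ht_cong: "(\<And>i. i \<in> Idx D \<Longrightarrow> w i = w' i) \<Longrightarrow> ht w = ht w'"
  by (simp add: ht_def)

lemma ht_shift: "j \<in> Idx D \<Longrightarrow> ht (\<lambda>i. w i - k * Cart D i j) = ht w - of_int k"
  using hf[of j] by (simp add: ht_def right_diff_distrib sum_subtractf mult.left_commute flip: sum_distrib_left)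

lemma ht_Amon: "j \<in> Idx D \<Longrightarrow> ht (wt (m - Amon D j a)) = ht (wt m) - 1"
  using ht_shift[of j "wt m" 1] ht_cong[of "wt (m - Amon D j a)" "\<lambda>i. wt m i - 1 * Cart D i j"]
  by (simp add: wt_def esum_diff) (simp add: wt_Amon[unfolded wt_def])

text \<open>The weight of an element of the subgroup is a multiple of the j-th Cartan column; as
  C_jj = 2, its j-th coordinate determines the multiple.\<close>

lemma ht_string:
  assumes j: "j \<in> Idx D" and g: "m - m' \<in> group_closure {Amon D j a | a. a \<noteq> 0}" and w: "wt m j = wt m' j - 2 * k"
  shows "ht (wt m) = ht (wt m') - of_int k" and "i \<in> Idx D \<Longrightarrow> wt m i = wt m' i - k * Cart D i j"
proof -
  obtain c where r: "\<forall>i\<in>Idx D. wt (m - m') i = c * Cart D i j" using closure_wt[OF j g] by blast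
  have d: "wt (m - m') i = wt m i - wt m' i" for i by (simp add: wt_def esum_diff)
  have "c = - k" using r j d[of j] w Cart_diag[OF j] by simp
  then have e: "wt m i = wt m' i - k * Cart D i j" if "i \<in> Idx D" for i using r that d[of i] by simp
  then show "i \<in> Idx D \<Longrightarrow> wt m i = wt m' i - k * Cart D i j" .
  show "ht (wt m) = ht (wt m') - of_int k" using ht_cong[of "wt m" "\<lambda>i. wt m' i - k * Cart D i j"] e ht_shift[OF j] by simp
qed

end

lemma (in lie_data) qdat:
  assumes "q \<noteq> 0" "\<And>n::nat. n > 0 \<Longrightarrow> q ^ n \<noteq> 1"
  shows "qdat \<lparr>Idx = {1..N}, Cart = C, rr = r, qq = q\<rparr>"
  by unfold_locales (use assms r_pos C_diag C_range(1) r_short height_weights in auto)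

lemma (in qdat) qdat_sl2: "i \<in> Idx D \<Longrightarrow> qdat (sl2_data D i)"
proof unfold_locales
  assume i: "i \<in> Idx D"
  fix n :: nat assume "0 < n"
  then show "qq (sl2_data D i) ^ n \<noteq> 1"
    using q_nru[of "rr D i * n"] rr_pos[OF i] by (simp add: sl2_data_def power_mult)
next
  show "\<exists>f::nat \<Rightarrow> real. \<forall>j\<in>Idx (sl2_data D i). (\<Sum>k\<in>Idx (sl2_data D i). f k * of_int (Cart (sl2_data D i) k j)) = 1"
    \<comment> \<open>The Cartan matrix is (2), so the simple root has height 1 when the single
      coordinate is weighted by 1/2.\<close>
    by (rule exI[of _ "\<lambda>_. 1/2"]) (simp add: sl2_data_def)
qed (use q_nz in \<open>auto simp: sl2_data_def\<close>)

subsection \<open>Modules\<close>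

locale qmod = qdat D for D +
  fixes V :: "'v::ab_group_add qmodule"
  assumes is_mod: "is_module D V" and fin_dim_V: "fin_dim V" and type1_V: "type1 D V"
begin

abbreviation "sc \<equiv> scl V"

sublocale vs: vector_space sc
  using is_mod by (simp add: is_module_def)

lemma subC: "vs.subspace (Car V)"
  using is_mod by (simp add: is_module_def)

lemma gen_lin:
  assumes "T \<in> gens D V"
  shows "v \<in> Car V \<Longrightarrow> T v \<in> Car V"
    and "v \<in> Car V \<Longrightarrow> w \<in> Car V \<Longrightarrow> T (v + w) = T v + T w"
    and "v \<in> Car V \<Longrightarrow> T (sc a v) = sc a (T v)"
  using is_mod assms unfolding is_module_def by blast+

lemma X_gen: "i \<in> Idx D \<Longrightarrow> X V s i n \<in> gens D V"
  and K_gen: "i \<in> Idx D \<Longrightarrow> K V i \<in> gens D V"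
  and Kinv_gen: "i \<in> Idx D \<Longrightarrow> Kinv V i \<in> gens D V"
  and H_gen: "i \<in> Idx D \<Longrightarrow> n \<noteq> 0 \<Longrightarrow> H V i n \<in> gens D V"
  by (auto simp: gens_def)

lemmas X_in = gen_lin(1)[OF X_gen] and X_add = gen_lin(2)[OF X_gen] and X_scale = gen_lin(3)[OF X_gen]
lemmas K_in = gen_lin(1)[OF K_gen] and K_add = gen_lin(2)[OF K_gen] and K_scale = gen_lin(3)[OF K_gen]
lemmas Kinv_in = gen_lin(1)[OF Kinv_gen] and Kinv_add = gen_lin(2)[OF Kinv_gen] and Kinv_scale = gen_lin(3)[OF Kinv_gen]
lemmas H_in = gen_lin(1)[OF H_gen] and H_add = gen_lin(2)[OF H_gen] and H_scale = gen_lin(3)[OF H_gen]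

lemma Ch_id: "v \<in> Car V \<Longrightarrow> Ch V v = v" "v \<in> Car V \<Longrightarrow> Chinv V v = v"
  using type1_V by (auto simp: type1_def)

lemma cpow_id: "v \<in> Car V \<Longrightarrow> cpow V p v = v"
proof -
  assume v: "v \<in> Car V"
  have "(Ch V ^^ n) v = v" "(Chinv V ^^ n) v = v" for n
    by (induction n) (use v Ch_id in auto)
  then show ?thesis by (simp add: cpow_def)
qed

lemma rels: "drinfeld_relations D V"
  using is_mod by (simp add: is_module_def)

lemmas rels_at = rels[unfolded drinfeld_relations_def Let_def, THEN bspec]
lemmas rels_from4 = rels_at[THEN conjunct2, THEN conjunct2, THEN conjunct2]
lemmas rels_from7 = rels_from4[THEN conjunct2, THEN conjunct2, THEN conjunct2]
lemmas rels_from10 = rels_from7[THEN conjunct2, THEN conjunct2, THEN conjunct2]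

lemmas K_Kinv = rels_from4[THEN conjunct1, rule_format, THEN conjunct1]
  and Kinv_K = rels_from4[THEN conjunct1, rule_format, THEN conjunct2]
  and K_K = rels_from4[THEN conjunct2, THEN conjunct1, rule_format]
  and K_H = rels_from4[THEN conjunct2, THEN conjunct2, THEN conjunct1, rule_format]
  and H_H_rel = rels_from7[THEN conjunct1, rule_format]
  and K_X0 = rels_from7[THEN conjunct2, THEN conjunct1, rule_format]
  and H_X_rel = rels_from7[THEN conjunct2, THEN conjunct2, THEN conjunct1, rule_format]
  and X_X = rels_from10[THEN conjunct1, rule_format]
  and Xpos_Xneg_rel = rels_from10[THEN conjunct2, THEN conjunct1, rule_format]

lemma H_H: 
  assumes "i \<in> Idx D" "j \<in> Idx D" "n \<noteq> 0" "m \<noteq> 0" "v \<in> Car V"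
  shows "H V i n (H V j m v) = H V j m (H V i n v)"
proof -
  have "H V i n (H V j m v) - H V j m (H V i n v) =
     (if n = - m
             then sc (1 / of_int n * qint q (n * symB D i j) / (q - inverse q))
                    (cpow V (2 * n) v - cpow V (- 2 * n) v)
             else 0)"
    using H_H_rel[of v i j n m] assms by blast
  then show ?thesis using assms(5) by (simp add: cpow_id split: if_splits)
qed

lemma K_X:
  assumes "i \<in> Idx D" "j \<in> Idx D" "v \<in> Car V"
  shows "K V i (X V s j n v) = sc (q powi (sg s * symB D i j)) (X V s j n (K V i v))"
  using K_X0[OF K_in[OF assms(1,3)] assms(1,2)] Kinv_K[OF assms(3,1)] by simp

lemma q_qinv: "q - inverse q \<noteq> 0"
  using q_powi_inj[of 1 "-1"] by (simp add: power_int_minus)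

lemma H_X:
  assumes "i \<in> Idx D" "j \<in> Idx D" "v \<in> Car V" "n \<noteq> 0"
  shows "H V i n (X V s j m v) = X V s j m (H V i n v) + sc (of_int (sg s) * bc i j n / (q - inverse q)) (X V s j (n + m) v)"
proof -
  have "H V i n (X V s j m v) - X V s j m (H V i n v) =
            sc (of_int (sg s) / of_int n * qint q (n * symB D i j))
              (cpow V (- sg s * \<bar>n\<bar>) (X V s j (n + m) v))"
    using H_X_rel[of v i j n s m] assms by blast
  also have "\<dots> = sc (of_int (sg s) * bc i j n / (q - inverse q)) (X V s j (n + m) v)"
    using assms X_in by (simp add: cpow_id qint_def bc_def)
  finally show ?thesis by (simp add: algebra_simps)
qed

text \<open>Slot 0 carries k_i, in parallel with \<open>hchar\<close>; the factor q - q^-1 cancels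
  the denominators of the commutators and leaves the constants \<open>bc\<close>.\<close>

definition hh :: "nat \<times> int \<Rightarrow> 'v \<Rightarrow> 'v" where
  "hh l v = (case l of (i, n) \<Rightarrow> if n = 0 then K V i v else sc (q - inverse q) (H V i n v))"

lemma hh_in: "i \<in> Idx D \<Longrightarrow> v \<in> Car V \<Longrightarrow> hh (i, n) v \<in> Car V"
  using K_in H_in vs.subspace_scale[OF subC] by (simp add: hh_def)

lemma hh_add: "i \<in> Idx D \<Longrightarrow> v \<in> Car V \<Longrightarrow> w \<in> Car V \<Longrightarrow> hh (i, n) (v + w) = hh (i, n) v + hh (i, n) w"
  by (simp add: hh_def K_add H_add vs.scale_right_distrib)

lemma hh_scale: "i \<in> Idx D \<Longrightarrow> v \<in> Car V \<Longrightarrow> hh (i, n) (sc c v) = sc c (hh (i, n) v)"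
  by (simp add: hh_def K_scale H_scale vs.scale_left_commute)

lemma hh_comm:
  assumes "i \<in> Idx D" "j \<in> Idx D" "v \<in> Car V"
  shows "hh (i, n) (hh (j, m) v) = hh (j, m) (hh (i, n) v)"
  using assms by (auto simp: hh_def K_K K_H H_H H_in K_scale H_scale vs.scale_left_commute)

lemma Kinv_hh:
  assumes i: "i \<in> Idx D" "j \<in> Idx D" "v \<in> Car V"
  shows "Kinv V i (hh (j, m) v) = hh (j, m) (Kinv V i v)"
proof -
  have "hh (j, m) (Kinv V i v) = Kinv V i (hh (i, 0) (hh (j, m) (Kinv V i v)))"
    using i Kinv_in hh_in by (simp add: hh_def[of "(i, 0)"] Kinv_K)
  also have "\<dots> = Kinv V i (hh (j, m) v)"
    using i Kinv_in by (subst hh_comm) (simp_all add: hh_def[of "(i, 0)"] K_Kinv)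
  finally show ?thesis by simp
qed

lemma hh_X:
  assumes "i \<in> Idx D" "j \<in> Idx D" "v \<in> Car V"
  shows "hh (i, n) (X V s j m v) = (if n = 0 then sc (q powi (sg s * symB D i j)) (X V s j m (hh (i, n) v))
    else X V s j m (hh (i, n) v) + sc (of_int (sg s) * bc i j n) (X V s j (n + m) v))"
  using assms q_qinv H_in X_in by (auto simp: hh_def K_X H_X X_scale vs.scale_right_distrib)

lemma Kinv_X:
  assumes "i \<in> Idx D" "j \<in> Idx D" "v \<in> Car V"
  shows "Kinv V i (X V s j n v) = sc (q powi (- (sg s * symB D i j))) (X V s j n (Kinv V i v))"
proof -
  let ?c = "q powi (sg s * symB D i j)"
  have X: "X V s j n v \<in> Car V" "X V s j n (Kinv V i v) \<in> Car V" using assms X_in Kinv_in by auto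
  have "X V s j n (Kinv V i v) = Kinv V i (sc ?c (X V s j n v))"
    using K_X0[OF assms(3,1,2)] Kinv_K[OF X(2) assms(1)] by simp
  then have "X V s j n (Kinv V i v) = sc ?c (Kinv V i (X V s j n v))"
    using X assms Kinv_scale by simp
  then show ?thesis using q_nz by (simp add: power_int_minus)
qed

lemma fin_Car: "\<exists>E. finite E \<and> Car V \<subseteq> vs.span E"
  using fin_dim_V by (auto simp: fin_dim_def)

lemma comm_ops_sub: "B \<subseteq> Idx D \<Longrightarrow> comm_ops sc (Car V) (B \<times> (UNIV :: int set)) hh"
  by unfold_locales (use fin_Car subC hh_in hh_add hh_scale in \<open>auto intro!: hh_comm\<close>)

sublocale comm_ops sc "Car V" "Idx D \<times> (UNIV :: int set)" hh
  by (rule comm_ops_sub) simp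

lemma X_zero: "i \<in> Idx D \<Longrightarrow> X V s i n 0 = 0"
  using X_scale[of i 0 s n 0] vs.subspace_0[OF subC] by simp

lemma X_diff: "i \<in> Idx D \<Longrightarrow> v \<in> Car V \<Longrightarrow> w \<in> Car V \<Longrightarrow> X V s i n (v - w) = X V s i n v - X V s i n w"
  using X_add[of i v "sc (-1) w"] X_scale[of i w s n "-1"] vs.subspace_scale[OF subC, of w "-1"] by simp

lemma X_sum: "i \<in> Idx D \<Longrightarrow> (\<And>x. x \<in> F \<Longrightarrow> f x \<in> Car V) \<Longrightarrow> X V s i n (sum f F) = (\<Sum>x\<in>F. X V s i n (f x))"
proof (induction F rule: infinite_finite_induct)
  case (insert x F)
  then show ?case using vs.subspace_sum[OF subC, of F f] by (simp add: X_add)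
qed (auto simp: X_zero)

lemma Kinv_zero: "i \<in> Idx D \<Longrightarrow> Kinv V i 0 = 0"
  using Kinv_scale[of i 0 0] vs.subspace_0[OF subC] by simp

lemma Kinv_diff: "i \<in> Idx D \<Longrightarrow> v \<in> Car V \<Longrightarrow> w \<in> Car V \<Longrightarrow> Kinv V i (v - w) = Kinv V i v - Kinv V i w"
  using Kinv_add[of i v "sc (-1) w"] Kinv_scale[of i w "-1"] vs.subspace_scale[OF subC, of w "-1"] by simp

text \<open>The inverse of k_i is listed separately because it is not among the operators
  \<open>hh\<close>, while phi^-_i contains it.\<close>

definition stab1 :: "nat \<Rightarrow> 'v set \<Rightarrow> bool" where
  "stab1 i U \<longleftrightarrow> vs.subspace U \<and> U \<subseteq> Car V \<and> (\<forall>n. \<forall>u\<in>U. hh (i, n) u \<in> U) \<and> (\<forall>u\<in>U. Kinv V i u \<in> U)"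

lemma stab1_zero: "i \<in> Idx D \<Longrightarrow> stab1 i {0}"
  using vs.subspace_0[OF subC] T_zero[of "(i, _)"] by (auto simp: stab1_def Kinv_zero)

lemma stab1_Car: "i \<in> Idx D \<Longrightarrow> stab1 i (Car V)"
  using subC hh_in Kinv_in by (auto simp: stab1_def)

subsection \<open>The operators phi\<close>

definition hcomp :: "nat \<Rightarrow> sign \<Rightarrow> nat list \<Rightarrow> 'v \<Rightarrow> 'v" where
  "hcomp i s ms = comp_ops (map (\<lambda>m. hh (i, sg s * int m)) ms)"

lemma comp_ops_Cons: "comp_ops (f # fs) v = f (comp_ops fs v)"
  and comp_ops_Nil: "comp_ops [] v = v"
  by (simp_all add: comp_ops_def)

lemma hcomp_Cons: "hcomp i s (m # ms) v = hh (i, sg s * int m) (hcomp i s ms v)"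
  and hcomp_Nil: "hcomp i s [] v = v"
  by (simp_all add: hcomp_def comp_ops_Cons comp_ops_Nil)

lemma hcomp_in: "stab1 i U \<Longrightarrow> v \<in> U \<Longrightarrow> hcomp i s ms v \<in> U"
  by (induction ms) (auto simp: hcomp_Cons hcomp_Nil stab1_def)

lemma hcomp_H:
  assumes i: "i \<in> Idx D" and v: "v \<in> Car V"
  shows "0 \<notin> set ms \<Longrightarrow> comp_ops (map (\<lambda>m. H V i (sg s * int m)) ms) v \<in> Car V \<and>
    hcomp i s ms v = sc ((q - inverse q) ^ length ms) (comp_ops (map (\<lambda>m. H V i (sg s * int m)) ms) v)"
proof (induction ms)
  case Nil
  then show ?case using v by (simp add: hcomp_Nil comp_ops_Nil)
next
  case (Cons m ms)
  have nz: "sg s * int m \<noteq> 0" using Cons.prems by (cases s) auto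
  let ?w = "comp_ops (map (\<lambda>m. H V i (sg s * int m)) ms) v"
  have w: "?w \<in> Car V" "hcomp i s ms v = sc ((q - inverse q) ^ length ms) ?w" using Cons by auto
  then show ?case using nz i by (simp add: hcomp_Cons comp_ops_Cons hh_def H_in H_scale mult.commute)
qed

definition Ks :: "sign \<Rightarrow> nat \<Rightarrow> 'v \<Rightarrow> 'v" where
  "Ks s i = (case s of Pos \<Rightarrow> K V i | Neg \<Rightarrow> Kinv V i)"

lemma Ks_add: "i \<in> Idx D \<Longrightarrow> v \<in> Car V \<Longrightarrow> w \<in> Car V \<Longrightarrow> Ks s i (v + w) = Ks s i v + Ks s i w"
  and Ks_scale: "i \<in> Idx D \<Longrightarrow> v \<in> Car V \<Longrightarrow> Ks s i (sc c v) = sc c (Ks s i v)"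
  by (cases s; simp add: Ks_def K_add Kinv_add K_scale Kinv_scale)+

lemma Ks_diff: "i \<in> Idx D \<Longrightarrow> v \<in> Car V \<Longrightarrow> w \<in> Car V \<Longrightarrow> Ks s i (v - w) = Ks s i v - Ks s i w"
  using Ks_add[of i v "sc (-1) w"] Ks_scale[of i w s "-1"] vs.subspace_scale[OF subC, of w "-1"] by simp

lemma Ks_inj: "i \<in> Idx D \<Longrightarrow> v \<in> Car V \<Longrightarrow> w \<in> Car V \<Longrightarrow> Ks s i v = Ks s i w \<Longrightarrow> v = w"
  by (cases s) (auto simp: Ks_def dest: arg_cong[of _ _ "K V i"] arg_cong[of _ _ "Kinv V i"] simp: K_Kinv Kinv_K)

lemma Ks_stab: "stab1 i U \<Longrightarrow> u \<in> U \<Longrightarrow> Ks s i u \<in> U"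
proof (cases s)
  case Pos
  assume "stab1 i U" "u \<in> U"
  then have "hh (i, 0) u \<in> U" by (auto simp: stab1_def)
  then show ?thesis using Pos by (simp add: Ks_def hh_def)
qed (auto simp: Ks_def stab1_def)

lemma sg_sq [simp]: "sg s * (sg s * n) = n" "sg s * sg s = 1"
  by (cases s; simp)+

text \<open>The exponential factor of phi, without k_i or its inverse, rewritten in the normalized
  operators \<open>hh\<close>.\<close>

definition phisum :: "sign \<Rightarrow> nat \<Rightarrow> nat \<Rightarrow> 'v \<Rightarrow> 'v" where
  "phisum s i n v = (\<Sum>ms | 0 \<notin> set ms \<and> sum_list ms = n. sc (of_int (sg s) ^ length ms / fact (length ms)) (hcomp i s ms v))"

lemma phi_Ks:
  assumes i: "i \<in> Idx D" and v: "v \<in> Car V"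
  shows "phi D V s i (sg s * int n) v = Ks s i (phisum s i n v)"
proof -
  have "\<not> sg s * (sg s * int n) < 0" by simp
  then have "phi D V s i (sg s * int n) v = Ks s i (\<Sum>ms | 0 \<notin> set ms \<and> sum_list ms = n.
      sc ((of_int (sg s) * (q - inverse q)) ^ length ms / fact (length ms)) (comp_ops (map (\<lambda>m. H V i (sg s * int m)) ms) v))"
    unfolding phi_def Ks_def by (simp only: if_False sg_sq of_nat_eq_iff)
  also have "\<dots> = Ks s i (phisum s i n v)"
    unfolding phisum_def
  proof (rule arg_cong[of _ _ "Ks s i"], rule sum.cong[OF refl])
    fix ms assume "ms \<in> {ms. 0 \<notin> set ms \<and> sum_list ms = n}"
    then have "hcomp i s ms v = sc ((q - inverse q) ^ length ms) (comp_ops (map (\<lambda>m. H V i (sg s * int m)) ms) v)"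
      using hcomp_H[OF i v] by blast
    then show "sc ((of_int (sg s) * (q - inverse q)) ^ length ms / fact (length ms)) (comp_ops (map (\<lambda>m. H V i (sg s * int m)) ms) v) =
      sc (of_int (sg s) ^ length ms / fact (length ms)) (hcomp i s ms v)"
      by (simp add: power_mult_distrib)
  qed
  finally show ?thesis .
qed

lemma phisum_in: "stab1 i U \<Longrightarrow> v \<in> U \<Longrightarrow> phisum s i n v \<in> U"
  unfolding phisum_def using hcomp_in by (auto intro!: vs.subspace_sum vs.subspace_scale simp: stab1_def)

lemma phi_in_pos: "i \<in> Idx D \<Longrightarrow> stab1 i U \<Longrightarrow> v \<in> U \<Longrightarrow> phi D V s i (sg s * int n) v \<in> U"
  using phi_Ks[of i v s n] Ks_stab[OF _ phisum_in[of i U v s n]] by (auto simp: stab1_def)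

lemma phi_neg_zero: "sg s * p < 0 \<Longrightarrow> phi D V s i p v = 0"
  by (simp add: phi_def)

lemma phi_in: "i \<in> Idx D \<Longrightarrow> stab1 i U \<Longrightarrow> v \<in> U \<Longrightarrow> phi D V s i p v \<in> U"
proof -
  assume a: "i \<in> Idx D" "stab1 i U" "v \<in> U"
  show ?thesis
  proof (cases "sg s * p < 0")
    case True
    then show ?thesis using a phi_neg_zero[OF True] vs.subspace_0[of U] by (simp add: stab1_def)
  next
    case False
    then obtain n where "sg s * p = int n" using nonneg_int_cases[of "sg s * p"] by force
    then have "p = sg s * int n" using sg_sq(1)[of s p] by simp
    then show ?thesis using phi_in_pos a by simp
  qed
qed

lemma phi_0: "i \<in> Idx D \<Longrightarrow> v \<in> Car V \<Longrightarrow> phi D V s i 0 v = Ks s i v"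
proof -
  assume a: "i \<in> Idx D" "v \<in> Car V"
  have "phisum s i 0 v = v" unfolding phisum_def compositions_0 by (simp add: hcomp_Nil)
  then show ?thesis using phi_Ks[OF a, of s 0] by simp
qed

lemma hcomp_eig:
  assumes i: "i \<in> Idx D" and U: "stab1 i U" and v: "v \<in> Car V"
    and e: "\<And>n. n \<noteq> 0 \<Longrightarrow> hh (i, n) v - sc (\<chi> n) v \<in> U"
  shows "0 \<notin> set ms \<Longrightarrow> hcomp i s ms v - sc (prod_list (map (\<lambda>m. \<chi> (sg s * int m)) ms)) v \<in> U"
proof (induction ms)
  case Nil
  then show ?case using U vs.subspace_0 by (auto simp: hcomp_Nil stab1_def)
next
  case (Cons m ms)
  have nz: "sg s * int m \<noteq> 0" using Cons.prems by (cases s) auto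
  let ?p = "prod_list (map (\<lambda>m. \<chi> (sg s * int m)) ms)" and ?l = "sg s * int m"
  have sU: "vs.subspace U" using U by (simp add: stab1_def)
  have C: "hcomp i s ms v \<in> Car V" using hcomp_in[OF stab1_Car[OF i] v] .
  have "hh (i, ?l) (hcomp i s ms v - sc ?p v) \<in> U" using Cons U by (auto simp: stab1_def)
  then have 1: "hh (i, ?l) (hcomp i s ms v) - sc ?p (hh (i, ?l) v) \<in> U"
    using T_diff[of "(i, ?l)" "hcomp i s ms v" "sc ?p v"] i C v vs.subspace_scale[OF subC] hh_scale by simp
  have 2: "sc ?p (hh (i, ?l) v - sc (\<chi> ?l) v) \<in> U" using e[OF nz] vs.subspace_scale[OF sU] by blast
  have "hcomp i s (m # ms) v - sc (prod_list (map (\<lambda>m. \<chi> (sg s * int m)) (m # ms))) v =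
    (hh (i, ?l) (hcomp i s ms v) - sc ?p (hh (i, ?l) v)) + sc ?p (hh (i, ?l) v - sc (\<chi> ?l) v)"
    by (simp add: hcomp_Cons vs.scale_right_diff_distrib mult.commute)
  then show ?case using vs.subspace_add[OF sU 1 2] by simp
qed

lemma phisum_eig:
  assumes i: "i \<in> Idx D" and U: "stab1 i U" and v: "v \<in> Car V"
    and e: "\<And>n. n \<noteq> 0 \<Longrightarrow> hh (i, n) v - sc (\<chi> n) v \<in> U"
  shows "phisum s i n v - sc (ecoef (\<lambda>m. of_int (sg s) * \<chi> (sg s * int m)) n) v \<in> U"
proof -
  have sU: "vs.subspace U" using U by (simp add: stab1_def)
  have pl: "prod_list (map (\<lambda>m. c * f m) ms) = c ^ length ms * prod_list (map f ms)" for c :: complex and f :: "nat \<Rightarrow> complex" and ms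
    by (induction ms) auto
  have "phisum s i n v - sc (ecoef (\<lambda>m. of_int (sg s) * \<chi> (sg s * int m)) n) v =
    (\<Sum>ms | 0 \<notin> set ms \<and> sum_list ms = n. sc (of_int (sg s) ^ length ms / fact (length ms))
       (hcomp i s ms v - sc (prod_list (map (\<lambda>m. \<chi> (sg s * int m)) ms)) v))"
    unfolding phisum_def ecoef_def pl
    by (simp add: vs.scale_sum_left vs.scale_right_diff_distrib sum_subtractf)
  also have "\<dots> \<in> U"
    using hcomp_eig[OF i U v e] by (intro vs.subspace_sum[OF sU] vs.subspace_scale[OF sU]) auto
  finally show ?thesis .
qed

lemma phi_eig:
  assumes i: "i \<in> Idx D" and U: "stab1 i U" and v: "v \<in> Car V" and m: "m \<in> monoms D"
    and e: "\<And>n. hh (i, n) v - sc (hchar D m i n) v \<in> U"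
  shows "phi D V s i (sg s * int n) v - sc (gamma D m s i n) v \<in> U"
proof -
  have sU: "vs.subspace U" using U by (simp add: stab1_def)
  let ?k = "q powi (int (rr D i) * wt m i)" and ?e = "ecoef (\<lambda>k. of_int (sg s) * hchar D m i (sg s * int k)) n"
  have k0: "?k \<noteq> 0" using q_nz by simp
  have K1: "K V i v - sc ?k v \<in> U" using e[of 0] by (simp add: hh_def hchar_def)
  have Ksv: "Ks s i v - sc (q powi (int (rr D i) * (sg s * wt m i))) v \<in> U"
  proof (cases s)
    case Pos
    then show ?thesis using K1 by (simp add: Ks_def)
  next
    case Neg
    have "Kinv V i (K V i v - sc ?k v) \<in> U" using K1 U by (simp add: stab1_def)
    then have "v - sc ?k (Kinv V i v) \<in> U"
      using i v by (simp add: Kinv_diff Kinv_K K_in Kinv_scale vs.subspace_scale[OF subC])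
    then have "sc (- inverse ?k) (v - sc ?k (Kinv V i v)) \<in> U" using vs.subspace_scale[OF sU] by blast
    then show ?thesis using k0 by (simp add: Neg Ks_def vs.scale_right_diff_distrib power_int_minus)
  qed
  have "phisum s i n v - sc ?e v \<in> U" by (rule phisum_eig[OF i U v]) (use e in auto)
  then have "Ks s i (phisum s i n v - sc ?e v) \<in> U" by (rule Ks_stab[OF U])
  then have 1: "phi D V s i (sg s * int n) v - sc ?e (Ks s i v) \<in> U"
    using i v phisum_in[OF stab1_Car[OF i] v] by (simp add: Ks_diff Ks_scale vs.subspace_scale[OF subC] phi_Ks)
  have 2: "sc ?e (Ks s i v - sc (q powi (int (rr D i) * (sg s * wt m i))) v) \<in> U" using Ksv vs.subspace_scale[OF sU] by blast
  have "phi D V s i (sg s * int n) v - sc (gamma D m s i n) v = (phi D V s i (sg s * int n) v - sc ?e (Ks s i v)) +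
    sc ?e (Ks s i v - sc (q powi (int (rr D i) * (sg s * wt m i))) v)"
    unfolding gamma_eq[OF q_nz m] by (simp add: vs.scale_right_diff_distrib mult.commute)
  then show ?thesis using vs.subspace_add[OF sU 1 2] by (simp only:)
qed

lemma phi_eigen:
  assumes "i \<in> Idx D" "v \<in> Car V" "m \<in> monoms D" "\<And>n. hh (i, n) v = sc (hchar D m i n) v"
  shows "phi D V s i (sg s * int n) v = sc (gamma D m s i n) v"
  using phi_eig[OF assms(1) stab1_zero[OF assms(1)] assms(2,3)] assms(4) by simp

text \<open>The exponential is inverted by strong induction: the k-th coefficient is the k-th mode
  up to sign plus products of lower modes, whose eigenvalues are already known, and k_i can be
  cancelled.\<close>

lemma hh_of_phi:
  assumes i: "i \<in> Idx D" and v: "v \<in> Car V" and m: "m \<in> monoms D"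
    and e: "\<And>s n. phi D V s i (sg s * int n) v = sc (gamma D m s i n) v"
  shows "hh (i, n) v = sc (hchar D m i n) v"
proof (cases "n = 0")
  case True
  have "Ks Pos i v = sc (gamma D m Pos i 0) v" using e[of Pos 0] phi_0[OF i v, of Pos] by simp
  then show ?thesis using True unfolding gamma_eq[OF q_nz m] by (simp add: Ks_def hh_def hchar_def)
next
  case False
  have Kv: "K V i v = sc (q powi (int (rr D i) * wt m i)) v"
    using e[of Pos 0] phi_0[OF i v, of Pos] gamma_eq[OF q_nz m, of Pos i 0] by (simp add: Ks_def)
  have Ksv: "Ks s i v = sc (q powi (int (rr D i) * (sg s * wt m i))) v" for s
    using e[of s 0] phi_0[OF i v, of s] gamma_eq[OF q_nz m, of s i 0] by simp
  have main: "0 < k \<Longrightarrow> hh (i, sg s * int k) v = sc (hchar D m i (sg s * int k)) v" for s k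
  proof (induction k rule: less_induct)
    case (less k)
    let ?f = "\<lambda>k. of_int (sg s) * hchar D m i (sg s * int k)"
    have hc: "hcomp i s ms v = sc (prod_list (map (\<lambda>m'. hchar D m i (sg s * int m')) ms)) v" if "set ms \<subseteq> {0<..<k}" for ms
      using that by (induction ms) (use i v less.IH in \<open>auto simp: hcomp_Cons hcomp_Nil hh_scale mult.commute\<close>)
    have fin: "finite {ms :: nat list. set ms \<subseteq> {0<..<k} \<and> sum_list ms = k}"
      by (rule finite_subset[OF _ finite_compositions[of k]]) auto
    have pl: "prod_list (map (\<lambda>m. c * f m) ms) = c ^ length ms * prod_list (map f ms)" for c :: complex and f :: "nat \<Rightarrow> complex" and ms
      by (induction ms) auto
    define R where "R = (\<Sum>ms | set ms \<subseteq> {0<..<k} \<and> sum_list ms = k. prod_list (map ?f ms) / fact (length ms))"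
    have "phisum s i k v = sc (of_int (sg s)) (hh (i, sg s * int k) v) +
       (\<Sum>ms | set ms \<subseteq> {0<..<k} \<and> sum_list ms = k. sc (of_int (sg s) ^ length ms / fact (length ms)) (hcomp i s ms v))"
      unfolding phisum_def compositions_split[OF less.prems] using fin
      by (subst sum.insert) (auto simp: hcomp_Cons hcomp_Nil)
    also have "(\<Sum>ms | set ms \<subseteq> {0<..<k} \<and> sum_list ms = k. sc (of_int (sg s) ^ length ms / fact (length ms)) (hcomp i s ms v)) = sc R v"
      unfolding R_def pl vs.scale_sum_left by (rule sum.cong[OF refl]) (simp add: hc)
    finally have 1: "phisum s i k v = sc (of_int (sg s)) (hh (i, sg s * int k) v) + sc R v" .
    have "Ks s i (phisum s i k v) = sc (gamma D m s i k) v" using e[of s k] phi_Ks[OF i v] by simp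
    also have "gamma D m s i k = (?f k + R) * q powi (int (rr D i) * (sg s * wt m i))"
      unfolding gamma_eq[OF q_nz m] R_def ecoef_split[OF less.prems] by simp
    also have "sc \<dots> v = Ks s i (sc (?f k + R) v)" using i v by (simp add: Ks_scale Ksv)
    finally have "phisum s i k v = sc (?f k + R) v"
      using Ks_inj[OF i] phisum_in[OF stab1_Car[OF i] v] vs.subspace_scale[OF subC v] by blast
    then have "sc (of_int (sg s)) (hh (i, sg s * int k) v) = sc (?f k) v" using 1 by (simp add: vs.scale_left_distrib)
    then have "sc (of_int (sg s)) (hh (i, sg s * int k) v) = sc (of_int (sg s)) (sc (hchar D m i (sg s * int k)) v)" by simp
    then show ?case by (cases s) auto
  qed
  show ?thesis using main[of "nat \<bar>n\<bar>" "if n > 0 then Pos else Neg"] False by (cases "n > 0") auto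
qed

end

context qmod
begin

subsection \<open>Currents and l-weights\<close>

definition mc :: "monom \<Rightarrow> nat \<times> int \<Rightarrow> complex" where
  "mc m l = hchar D m (fst l) (snd l)"

lemma eig_cong: "(\<And>l. l \<in> Idx D \<times> UNIV \<Longrightarrow> \<eta> l = \<eta>' l) \<Longrightarrow> eig U \<eta> v \<longleftrightarrow> eig U \<eta>' v"
  by (simp add: eig_def)

lemma mc_inj: "m \<in> monoms D \<Longrightarrow> m' \<in> monoms D \<Longrightarrow> (\<And>l. l \<in> Idx D \<times> UNIV \<Longrightarrow> mc m l = mc m' l) \<Longrightarrow> m = m'"
  by (rule hchar_inj) (auto simp: mc_def)

definition mshift :: "sign \<Rightarrow> monom \<Rightarrow> nat \<Rightarrow> complex \<Rightarrow> monom" where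
  "mshift s m j a = (case s of Pos \<Rightarrow> m + Amon D j a | Neg \<Rightarrow> m - Amon D j a)"

lemma mshift_monoms: "m \<in> monoms D \<Longrightarrow> j \<in> Idx D \<Longrightarrow> a \<noteq> 0 \<Longrightarrow> mshift s m j a \<in> monoms D"
  by (cases s) (auto simp: mshift_def intro: monoms_add monoms_diff Amon_monoms)

lemma mc_mshift:
  assumes "i \<in> Idx D" "j \<in> Idx D"
  shows "mc (mshift s m j a) (i, n) = (if n = 0 then mc m (i, n) * q powi (sg s * symB D i j)
     else mc m (i, n) + of_int (sg s) * bc i j n * a powi n)"
  by (cases s) (simp_all add: mshift_def mc_def hchar_shift[OF assms])

lemma eig_subspace_elem: "stable U \<Longrightarrow> u \<in> U \<Longrightarrow> eig U \<eta> u"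
  unfolding eig_def by (blast intro: vs.subspace_diff vs.subspace_scale dest: stableD)

lemma eig_transfer:
  assumes U: "stable U" and z: "z \<in> Car V" "y \<in> Car V" "z - y \<in> U" "eig U \<eta> z"
  shows "eig U \<eta> y"
proof -
  have "eig U \<eta> (z - (z - y))"
    using eig_diff[OF stableD(1)[OF U] z(1) _ z(4) eig_subspace_elem[OF U z(3)]] vs.subspace_diff[OF subC z(1,2)] by blast
  then show ?thesis by simp
qed

text \<open>
  The operator \<open>x\<^sub>j\<^sub>,\<^sub>n v \<mapsto> x\<^sub>j\<^sub>,\<^sub>n\<^sub>+\<^sub>1 v\<close> is a combination of \<open>h\<^sub>j\<^sub>,\<^sub>1\<close> and the identity; the number \<open>a\<close> is
  its eigenvalue on \<open>z\<close>.
\<close>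

lemma current_eigenvector:
  assumes j: "j \<in> Idx D" and U: "stable U"
    and U': "\<And>n u. u \<in> U' \<Longrightarrow> X V s j n u \<in> U" "U' \<subseteq> Car V" and v: "v \<in> Car V" "eig U' (mc m) v"
    and z: "z \<in> Car V" "z \<notin> U" "eig U \<eta> z" "z - y \<in> U" "y \<in> vs.span (range (\<lambda>n. X V s j n v))"
  shows "\<exists>a. a \<noteq> 0 \<and> (\<forall>l\<in>Idx D \<times> UNIV. \<eta> l = mc (mshift s m j a) l)"
proof -
  note sU = stableD(1)[OF U]
  obtain t r where t: "finite t" "t \<subseteq> range (\<lambda>n. X V s j n v)" "y = (\<Sum>w\<in>t. sc (r w) w)"
    using z(5) by (auto simp: vs.span_explicit)
  then have "\<forall>w\<in>t. \<exists>n. w = X V s j n v" by blast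
  then obtain k where k: "\<And>w. w \<in> t \<Longrightarrow> X V s j (k w) v = w" by metis
  \<comment> \<open>The mode shift need not be well defined on vectors, so it is applied to a chosen
    combination representing \<open>y\<close>; \<open>E n\<close> shifts every mode of it by
    n.\<close>
  define E where "E n = (\<Sum>w\<in>t. sc (r w) (X V s j (k w + n) v))" for n
  have E0: "E 0 = y" using k t(3) by (simp add: E_def)
  have EC: "E n \<in> Car V" for n
    unfolding E_def using X_in[OF j v(1)] by (intro vs.subspace_sum[OF subC] vs.subspace_scale[OF subC])
  have yC: "y \<in> Car V" using EC[of 0] E0 by simp
  have eigE: "eig U \<eta> (E 0)" using eig_transfer[OF U z(1) yC z(4,3)] E0 by simp
  have E0U: "E 0 \<notin> U" using vs.mem_subspace_cancel[OF sU z(4)] z(2) E0 by simp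
  have scE: "\<alpha> = \<beta>" if "sc \<alpha> (E 0) - sc \<beta> (E 0) \<in> U" for \<alpha> \<beta>
  proof (rule ccontr)
    assume "\<alpha> \<noteq> \<beta>"
    moreover have "sc (\<alpha> - \<beta>) (E 0) \<in> U" using that by (simp add: vs.scale_left_diff_distrib)
    ultimately show False using vs.scale_mem_iff[OF sU, of "\<alpha> - \<beta>"] E0U by simp
  qed
  define cc where "cc i n = (if n = 0 then q powi (sg s * symB D i j) else 1)" for i and n :: int
  define b where "b i n = (if n = 0 then 0 else of_int (sg s) * bc i j n)" for i n
  have hX: "hh (i, n) (X V s j l v) - sc (cc i n * mc m (i, n)) (X V s j l v) - sc (b i n) (X V s j (l + n) v) \<in> U"
    if i: "i \<in> Idx D" for i n l
  proof -
    let ?u = "hh (i, n) v - sc (mc m (i, n)) v"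
    have u: "?u \<in> U'" using v(2) i by (simp add: eig_def)
    have uC: "?u \<in> Car V" using u U'(2) by blast
    have Xu: "X V s j l ?u = X V s j l (hh (i, n) v) - sc (mc m (i, n)) (X V s j l v)"
      using X_diff[OF j hh_in[OF i v(1)] vs.subspace_scale[OF subC v(1)]] by (simp add: X_scale[OF j v(1)])
    have "hh (i, n) (X V s j l v) - sc (cc i n * mc m (i, n)) (X V s j l v) - sc (b i n) (X V s j (l + n) v) = sc (cc i n) (X V s j l ?u)"
      unfolding Xu hh_X[OF i j v(1)] cc_def b_def by (simp add: vs.scale_right_diff_distrib add.commute)
    then show ?thesis using U'(1)[OF u] vs.subspace_scale[OF sU] by simp
  qed
  have A: "hh (i, n) (E l) - sc (cc i n * mc m (i, n)) (E l) - sc (b i n) (E (l + n)) \<in> U" if i: "i \<in> Idx D" for i n l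
  proof -
    have "hh (i, n) (E l) = (\<Sum>w\<in>t. sc (r w) (hh (i, n) (X V s j (k w + l) v)))"
      unfolding E_def using i X_in[OF j v(1)]
      by (subst T_sum) (auto simp: hh_scale intro: vs.subspace_scale[OF subC])
    then have "hh (i, n) (E l) - sc (cc i n * mc m (i, n)) (E l) - sc (b i n) (E (l + n)) =
      (\<Sum>w\<in>t. sc (r w) (hh (i, n) (X V s j (k w + l) v) - sc (cc i n * mc m (i, n)) (X V s j (k w + l) v) - sc (b i n) (X V s j (k w + l + n) v)))"
      by (simp add: E_def vs.scale_sum_right vs.scale_right_diff_distrib sum_subtractf mult.commute add.assoc)
    also have "\<dots> \<in> U" by (intro vs.subspace_sum[OF sU] vs.subspace_scale[OF sU] hX[OF i])
    finally show ?thesis .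
  qed
  have B: "sc (\<eta> (i, n) - cc i n * mc m (i, n)) (E 0) - sc (b i n) (E n) \<in> U" if i: "i \<in> Idx D" for i n
  proof -
    have "hh (i, n) (E 0) - sc (\<eta> (i, n)) (E 0) \<in> U" using eigE i by (simp add: eig_def)
    from vs.subspace_diff[OF sU A[OF i, of n 0] this] show ?thesis
      by (simp add: vs.scale_left_diff_distrib algebra_simps)
  qed
  have bj: "b j n \<noteq> 0" if "n \<noteq> 0" for n using that bc_diag_nz[OF j] by (cases s) (simp_all add: b_def)
  \<comment> \<open>The factor by which the shift by n multiplies \<open>E 0\<close> modulo
    \<open>U\<close>, solved from the commutator with h_{j,n}; its coefficient
    \<open>bc j j n\<close> is nonzero.\<close>
  define \<alpha> where "\<alpha> n = (if n = 0 then 1 else (\<eta> (j, n) - cc j n * mc m (j, n)) / b j n)" for n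
  have E\<alpha>: "E n - sc (\<alpha> n) (E 0) \<in> U" for n
  proof (cases "n = 0")
    case True
    then show ?thesis using vs.subspace_0[OF sU] by (simp add: \<alpha>_def)
  next
    case False
    have "sc (- inverse (b j n)) (sc (\<eta> (j, n) - cc j n * mc m (j, n)) (E 0) - sc (b j n) (E n)) \<in> U"
      using B[OF j] vs.subspace_scale[OF sU] by blast
    then show ?thesis using bj[OF False] False
      by (simp add: vs.scale_right_diff_distrib \<alpha>_def divide_inverse mult.commute)
  qed
  have rec: "\<alpha> (n + 1) = \<alpha> n * \<alpha> 1" for n
  proof (rule scE)
    have "hh (j, 1) (E n - sc (\<alpha> n) (E 0)) \<in> U" using E\<alpha> j stableD(3)[OF U] by simp
    then have 1: "hh (j, 1) (E n) - sc (\<alpha> n) (hh (j, 1) (E 0)) \<in> U"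
      using j EC T_diff[of "(j, 1)"] vs.subspace_scale[OF subC] by (simp add: hh_scale)
    let ?x = "mc m (j, 1)"
    note 2 = A[OF j, of 1 n] and 3 = vs.subspace_scale[OF sU A[OF j, of 1 0], of "\<alpha> n"]
    have c1: "cc j 1 = 1" by (simp add: cc_def)
    have 4: "sc ?x (E n - sc (\<alpha> n) (E 0)) \<in> U" using E\<alpha> vs.subspace_scale[OF sU] by blast
    have "sc (b j 1) (E (n + 1) - sc (\<alpha> n) (E 1)) = (hh (j, 1) (E n) - sc (\<alpha> n) (hh (j, 1) (E 0)))
       - (hh (j, 1) (E n) - sc (cc j 1 * ?x) (E n) - sc (b j 1) (E (n + 1)))
       + sc (\<alpha> n) (hh (j, 1) (E 0) - sc (cc j 1 * ?x) (E 0) - sc (b j 1) (E (0 + 1))) - sc ?x (E n - sc (\<alpha> n) (E 0))"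
      by (simp add: c1 vs.scale_right_diff_distrib mult.commute)
    also have "\<dots> \<in> U" by (intro vs.subspace_diff[OF sU] vs.subspace_add[OF sU] 1 2 3 4)
    finally have 5: "E (n + 1) - sc (\<alpha> n) (E 1) \<in> U" using vs.scale_mem_iff[OF sU bj[of 1]] by simp
    have 6: "sc (\<alpha> n) (E 1 - sc (\<alpha> 1) (E 0)) \<in> U" using E\<alpha>[of 1] vs.subspace_scale[OF sU] by blast
    have "sc (\<alpha> (n + 1)) (E 0) - sc (\<alpha> n * \<alpha> 1) (E 0) =
      (E (n + 1) - sc (\<alpha> n) (E 1)) + sc (\<alpha> n) (E 1 - sc (\<alpha> 1) (E 0)) - (E (n + 1) - sc (\<alpha> (n + 1)) (E 0))"
      by (simp add: vs.scale_right_diff_distrib)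
    also have "\<dots> \<in> U" by (intro vs.subspace_diff[OF sU] vs.subspace_add[OF sU] 5 6 E\<alpha>)
    finally show "sc (\<alpha> (n + 1)) (E 0) - sc (\<alpha> n * \<alpha> 1) (E 0) \<in> U" .
  qed
  define a where "a = \<alpha> 1"
  \<comment> \<open>The shifts by 1 and by -1 are mutually inverse: their factors multiply to that
    of the shift by 0, which is 1.\<close>
  have a0: "a \<noteq> 0" using rec[of "-1"] by (auto simp: \<alpha>_def[of 0] a_def)
  have pw: "\<alpha> n = a powi n" for n
  proof (induction n rule: int_induct[of _ 0])
    case base
    then show ?case by (simp add: \<alpha>_def)
  next
    case (step1 i)
    then show ?case using rec[of i] a0 by (simp add: power_int_add_1 a_def[symmetric])
  next
    case (step2 i)
    then show ?case using rec[of "i - 1"] a0 by (simp add: power_int_diff a_def[symmetric] field_simps)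
  qed
  have "\<eta> (i, n) = mc (mshift s m j a) (i, n)" if i: "i \<in> Idx D" for i n
  proof -
    have "sc (\<eta> (i, n)) (E 0) - sc (cc i n * mc m (i, n) + b i n * \<alpha> n) (E 0) =
      (sc (\<eta> (i, n) - cc i n * mc m (i, n)) (E 0) - sc (b i n) (E n)) + sc (b i n) (E n - sc (\<alpha> n) (E 0))"
      by (simp add: vs.scale_right_diff_distrib vs.scale_left_diff_distrib vs.scale_left_distrib)
    also have "\<dots> \<in> U" using B[OF i] E\<alpha> by (intro vs.subspace_add[OF sU] vs.subspace_scale[OF sU])
    finally have "\<eta> (i, n) = cc i n * mc m (i, n) + b i n * \<alpha> n" by (rule scE)
    then show ?thesis unfolding mc_mshift[OF i j] by (simp add: cc_def b_def pw)
  qed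
  then show ?thesis using a0 by auto
qed

lemma subspace_sum_span: "vs.subspace U \<Longrightarrow> z \<in> vs.span (U \<union> W) \<longleftrightarrow> (\<exists>y\<in>vs.span W. z - y \<in> U)"
proof -
  assume U: "vs.subspace U"
  then have sp: "vs.span U = U" by simp
  have e: "z \<in> vs.span (U \<union> W) \<longleftrightarrow> (\<exists>x y. z = x + y \<and> x \<in> U \<and> y \<in> vs.span W)"
    unfolding vs.span_Un sp by blast
  show ?thesis
  proof
    assume "z \<in> vs.span (U \<union> W)"
    then obtain x y where "z = x + y" "x \<in> U" "y \<in> vs.span W" using e by blast
    then show "\<exists>y\<in>vs.span W. z - y \<in> U" by (intro bexI[of _ y]) auto
  next
    assume "\<exists>y\<in>vs.span W. z - y \<in> U"
    then obtain y where "y \<in> vs.span W" "z - y \<in> U" by blast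
    then show "z \<in> vs.span (U \<union> W)" unfolding e by (intro exI[of _ "z - y"] exI[of _ y]) auto
  qed
qed

lemma span_induct_mem [consumes 1, case_names base step]:
  assumes "y \<in> vs.span W" "P 0" "\<And>c x y. x \<in> W \<Longrightarrow> y \<in> vs.span W \<Longrightarrow> P y \<Longrightarrow> P (sc c x + y)"
  shows "P y"
proof -
  have "y \<in> vs.span W \<and> P y" using assms(1)
  proof (induction rule: vs.span_induct_alt)
    case (step c x y)
    then show ?case using assms(3) vs.span_base[of x W] by (auto intro: vs.span_add vs.span_scale)
  qed (use assms(2) vs.span_zero in auto)
  then show ?thesis ..
qed

lemma span_stable:
  assumes W: "W \<subseteq> Car V" and h: "\<And>w l. w \<in> W \<Longrightarrow> l \<in> Idx D \<times> UNIV \<Longrightarrow> hh l w \<in> vs.span W"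
  shows "stable (vs.span W)"
  unfolding stable_def
proof (intro conjI ballI)
  show WC: "vs.span W \<subseteq> Car V" by (rule vs.span_minimal[OF W subC])
  fix l v assume l: "l \<in> Idx D \<times> (UNIV :: int set)" and v: "v \<in> vs.span W"
  show "hh l v \<in> vs.span W" using v
  proof (induction rule: span_induct_mem)
    case base
    then show ?case using l vs.span_zero by simp
  next
    case (step c x y)
    have "x \<in> Car V" "y \<in> Car V" using step WC W by auto
    moreover have "sc c x \<in> Car V" using calculation vs.subspace_scale[OF subC] by blast
    ultimately show ?case using step h[OF _ l] l
      by (simp add: T_add T_scale vs.span_add vs.span_scale)
  qed
qed simp

lemma current_span_hh:
  assumes j: "j \<in> Idx D" and v: "v \<in> Car V" "eig {0} \<chi> v" and l: "l \<in> Idx D \<times> (UNIV :: int set)"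
  shows "hh l (X V s j n v) \<in> vs.span (range (\<lambda>n. X V s j n v))"
proof -
  obtain i k where l': "l = (i, k)" "i \<in> Idx D" using l by auto
  have e: "hh (i, k) v = sc (\<chi> (i, k)) v" using eig_zero_D[OF v(2) l] l' by simp
  have X: "X V s j n v \<in> vs.span (range (\<lambda>n. X V s j n v))" for n by (rule vs.span_base) simp
  show ?thesis unfolding l'(1) hh_X[OF l'(2) j v(1)] e X_scale[OF j v(1)]
    using X by (auto intro!: vs.span_add vs.span_scale)
qed

lemma span_current_stable:
  assumes j: "j \<in> Idx D" and v: "v \<in> Car V" "eig {0} \<chi> v"
  shows "stable (vs.span (range (\<lambda>n. X V s j n v)))"
  by (rule span_stable) (use X_in[OF j v(1)] current_span_hh[OF j v] in auto)

lemma stable_sum: "stable U \<Longrightarrow> stable S \<Longrightarrow> stable (vs.span (U \<union> S))"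
  by (rule span_stable) (auto dest: stableD intro: vs.span_base)

text \<open>The current spans are added to \<open>U\<close> one at a time. When \<open>z\<close>
  first enters the enlarged subspace, it is congruent to an element of a single current span, to
  which the previous lemma on currents applies.\<close>

lemma level_eigenvector:
  assumes P: "finite P" "\<And>p. p \<in> P \<Longrightarrow> fst p \<in> Idx D \<and> vm (snd p) \<in> Car V \<and> eig {0} (mc (snd p)) (vm (snd p))"
    and U: "stable U" and z: "z \<in> vs.span (U \<union> (\<Union>p\<in>P. range (\<lambda>n. X V s (fst p) n (vm (snd p)))))" "z \<notin> U" "eig U \<eta> z"
  shows "\<exists>p\<in>P. \<exists>a. a \<noteq> 0 \<and> (\<forall>l\<in>Idx D \<times> UNIV. \<eta> l = mc (mshift s (snd p) (fst p) a) l)"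
  using P U z
proof (induction P arbitrary: U rule: finite_induct)
  case empty
  then have "z \<in> vs.span U" by simp
  moreover have "vs.span U = U" using stableD(1)[OF empty(2)] by simp
  ultimately show ?case using empty by simp
next
  case (insert p P)
  let ?W = "\<lambda>p. range (\<lambda>n. X V s (fst p) n (vm (snd p)))"
  have p: "fst p \<in> Idx D" "vm (snd p) \<in> Car V" "eig {0} (mc (snd p)) (vm (snd p))" using insert.prems(1) by auto
  note stW = span_current_stable[OF p, of s]
  define U1 where "U1 = vs.span (U \<union> vs.span (?W p))"
  have U1: "stable U1" unfolding U1_def by (rule stable_sum[OF insert.prems(2) stW])
  have UU1: "U \<subseteq> U1" unfolding U1_def using vs.span_superset by blast
  show ?case
  proof (cases "z \<in> U1")
    case True
    then obtain y where y: "y \<in> vs.span (vs.span (?W p))" "z - y \<in> U"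
      unfolding U1_def using subspace_sum_span[OF stableD(1)[OF insert.prems(2)]] by blast
    then have y1: "y \<in> vs.span (?W p)" by (simp add: vs.span_span)
    have zC: "z \<in> Car V" using True stableD(2)[OF U1] by blast
    have "X V s (fst p) n u \<in> U" if "u \<in> {0}" for n u
      using that X_zero[OF p(1)] vs.subspace_0[OF stableD(1)[OF insert.prems(2)]] by simp
    from current_eigenvector[OF p(1) insert.prems(2) this _ p(2,3) zC insert.prems(4,5) y(2) y1]
    show ?thesis using vs.subspace_0[OF subC] by blast
  next
    case False
    have "U \<union> (\<Union>p\<in>insert p P. ?W p) \<subseteq> U1 \<union> (\<Union>p\<in>P. ?W p)"
      using UU1 vs.span_superset[of "?W p"] vs.span_superset[of "U \<union> vs.span (?W p)"] unfolding U1_def by blast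
    then have "z \<in> vs.span (U1 \<union> (\<Union>p\<in>P. ?W p))" using insert.prems(3) vs.span_mono by blast
    then show ?thesis using insert.IH[OF _ U1 _ False eig_mono[OF insert.prems(5) UU1]] insert.prems(1) by auto
  qed
qed

subsection \<open>Words in the lowering operators\<close>

text \<open>With \<open>J\<close> all of I these are the levels of the highest weight module; with a
  single vertex they are the levels of the module generated under the subalgebra of that
  vertex.\<close>

primrec low :: "nat set \<Rightarrow> 'v \<Rightarrow> nat \<Rightarrow> 'v set" where
  "low J g 0 = vs.span {g}"
| "low J g (Suc d) = vs.span {X V Neg j n u | j n u. j \<in> J \<and> u \<in> low J g d}"

lemma low_subspace: "vs.subspace (low J g d)"
  by (cases d) simp_all

lemma low_Car:
  assumes "J \<subseteq> Idx D" "g \<in> Car V"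
  shows "low J g d \<subseteq> Car V"
proof (induction d)
  case (Suc d)
  have "{X V Neg j n u | j n u. j \<in> J \<and> u \<in> low J g d} \<subseteq> Car V" using Suc assms X_in by blast
  then show ?case using vs.span_minimal[OF _ subC] by simp
qed (use assms vs.span_minimal[OF _ subC, of "{g}"] in simp)

lemma low_X: "j \<in> J \<Longrightarrow> u \<in> low J g d \<Longrightarrow> X V Neg j n u \<in> low J g (Suc d)"
  by (auto intro!: vs.span_base)

lemma X_span_into:
  assumes k: "k \<in> Idx D" and W: "W \<subseteq> Car V" and S: "vs.subspace S" and h: "\<And>w. w \<in> W \<Longrightarrow> X V s k n w \<in> S" and u: "u \<in> vs.span W"
  shows "X V s k n u \<in> S"
  using u
proof (induction rule: span_induct_mem)
  case base
  then show ?case using k S vs.subspace_0 X_zero by simp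
next
  case (step c x y)
  have "x \<in> Car V" "y \<in> Car V" using step W vs.span_minimal[OF W subC] by auto
  moreover have "sc c x \<in> Car V" using calculation vs.subspace_scale[OF subC] by blast
  ultimately show ?case using step h k S
    by (simp add: X_add X_scale vs.subspace_add vs.subspace_scale)
qed

lemma low_stable:
  assumes J: "J \<subseteq> Idx D" and g: "g \<in> Car V" "eig {0} \<chi> g"
  shows "stable (low J g d)"
proof (induction d)
  case 0
  have "stable (vs.span {g})"
    by (rule span_stable) (use g eig_zero_D[OF g(2)] in \<open>auto intro: vs.span_scale vs.span_base\<close>)
  then show ?case by simp
next
  case (Suc d)
  have "stable (vs.span {X V Neg j n u | j n u. j \<in> J \<and> u \<in> low J g d})"
  proof (rule span_stable)
    show "{X V Neg j n u | j n u. j \<in> J \<and> u \<in> low J g d} \<subseteq> Car V" using low_Car[OF J g(1)] X_in J by blast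
    fix w and l :: "nat \<times> int" assume "w \<in> {X V Neg j n u | j n u. j \<in> J \<and> u \<in> low J g d}" and l: "l \<in> Idx D \<times> UNIV"
    then obtain j n u where w: "w = X V Neg j n u" "j \<in> J" "u \<in> low J g d" by blast
    obtain i k where l': "l = (i, k)" "i \<in> Idx D" using l by auto
    have uC: "u \<in> Car V" and j: "j \<in> Idx D" using w low_Car[OF J g(1)] J by auto
    have hu: "hh (i, k) u \<in> low J g d" using stableD(3)[OF Suc l w(3)] l' by simp
    have X: "X V Neg j n u' \<in> low J g (Suc d)" if "u' \<in> low J g d" for u' n using low_X[OF w(2) that] .
    show "hh l w \<in> vs.span {X V Neg j n u | j n u. j \<in> J \<and> u \<in> low J g d}"
      unfolding l'(1) w(1) hh_X[OF l'(2) j uC] using X[OF hu] X[OF w(3)]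
      by (auto intro!: vs.span_add vs.span_diff vs.span_scale)
  qed
  then show ?case by simp
qed

lemma Kinv_span:
  assumes i: "i \<in> Idx D" and W: "W \<subseteq> Car V" and h: "\<And>w. w \<in> W \<Longrightarrow> Kinv V i w \<in> vs.span W" and u: "u \<in> vs.span W"
  shows "Kinv V i u \<in> vs.span W"
  using u
proof (induction rule: span_induct_mem)
  case base
  then show ?case using i Kinv_zero vs.span_zero by simp
next
  case (step c x y)
  have "x \<in> Car V" "y \<in> Car V" using step W vs.span_minimal[OF W subC] by auto
  moreover have "sc c x \<in> Car V" using calculation vs.subspace_scale[OF subC] by blast
  ultimately show ?case using step h i by (simp add: Kinv_add Kinv_scale vs.span_add vs.span_scale)
qed

lemma Kinv_eig:
  assumes "i \<in> Idx D" "g \<in> Car V" "K V i g = sc c g" "c \<noteq> 0"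
  shows "Kinv V i g = sc (inverse c) g"
proof -
  have "g = sc c (Kinv V i g)" using Kinv_K[OF assms(2,1)] assms Kinv_scale by simp
  then have "sc (inverse c) g = sc (inverse c * c) (Kinv V i g)" by (metis vs.scale_scale)
  then show ?thesis using assms(4) by simp
qed

lemma low_Kinv:
  assumes J: "J \<subseteq> Idx D" and g: "g \<in> Car V" "eig {0} (mc m) g" and i: "i \<in> Idx D" and u: "u \<in> low J g d"
  shows "Kinv V i u \<in> low J g d"
  using u
proof (induction d arbitrary: u)
  case 0
  have "K V i g = sc (mc m (i, 0)) g" using eig_zero_D[OF g(2), of "(i, 0)"] i by (simp add: hh_def)
  moreover have "mc m (i, 0) \<noteq> 0" using q_nz by (simp add: mc_def hchar_def)
  ultimately have "Kinv V i g = sc (inverse (mc m (i, 0))) g" using Kinv_eig[OF i g(1)] by blast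
  then show ?case using Kinv_span[OF i, of "{g}" u] g 0 by (auto intro: vs.span_scale vs.span_base)
next
  case (Suc d)
  show ?case unfolding low.simps
  proof (rule Kinv_span[OF i])
    show "{X V Neg j n u | j n u. j \<in> J \<and> u \<in> low J g d} \<subseteq> Car V" using low_Car[OF J g(1)] X_in J by blast
    show "u \<in> vs.span {X V Neg j n u | j n u. j \<in> J \<and> u \<in> low J g d}" using Suc.prems by simp
    fix w assume "w \<in> {X V Neg j n u | j n u. j \<in> J \<and> u \<in> low J g d}"
    then obtain j n u where w: "w = X V Neg j n u" "j \<in> J" "u \<in> low J g d" by blast
    have "Kinv V i w = sc (q powi (- (sg Neg * symB D i j))) (X V Neg j n (Kinv V i u))"
      unfolding w(1) using w low_Car[OF J g(1)] J by (intro Kinv_X[OF i]) auto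
    moreover have "X V Neg j n (Kinv V i u) \<in> low J g (Suc d)" using low_X[OF w(2) Suc.IH[OF w(3)]] .
    ultimately show "Kinv V i w \<in> vs.span {X V Neg j n u | j n u. j \<in> J \<and> u \<in> low J g d}"
      by (auto intro: vs.span_scale)
  qed
qed

lemma low_stab1:
  assumes "J \<subseteq> Idx D" "g \<in> Car V" "eig {0} (mc m) g" "i \<in> Idx D"
  shows "stab1 i (low J g d)"
  unfolding stab1_def
proof (intro conjI allI ballI)
  show "vs.subspace (low J g d)" "low J g d \<subseteq> Car V" by (rule low_subspace, rule low_Car[OF assms(1,2)])
  fix u assume u: "u \<in> low J g d"
  show "hh (i, n) u \<in> low J g d" for n by (rule stableD(3)[OF low_stable[OF assms(1-3)] _ u]) (use assms(4) in simp)
  show "Kinv V i u \<in> low J g d" by (rule low_Kinv[OF assms u])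
qed

lemma Xpos_Xneg:
  assumes "i \<in> Idx D" "j \<in> Idx D" "v \<in> Car V"
  shows "X V Pos i n (X V Neg j m v) = X V Neg j m (X V Pos i n v) +
    (if i = j then sc (1 / (qi i - inverse (qi i))) (phi D V Pos i (n + m) v - phi D V Neg i (n + m) v) else 0)"
proof -
  have "phi D V s i p v \<in> Car V" for s p using phi_in[OF assms(1) stab1_Car[OF assms(1)] assms(3)] .
  then show ?thesis using Xpos_Xneg_rel[OF assms(3,1,2), of n m] by (auto simp: cpow_id qi_def algebra_simps)
qed

text \<open>The raising operator is moved to the right through one lowering operator at a time; the
  commutators are phi operators, which preserve a level.\<close>

lemma low_Xpos:
  assumes J: "J \<subseteq> Idx D" and g: "g \<in> Car V" "eig {0} (mc m) g" and k: "k \<in> Idx D" "\<And>n. X V Pos k n g = 0"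
    and u: "u \<in> low J g d"
  shows "case d of 0 \<Rightarrow> X V Pos k n u = 0 | Suc e \<Rightarrow> X V Pos k n u \<in> low J g e"
  using u
proof (induction d arbitrary: u n)
  case 0
  then show ?case using X_span_into[OF k(1), of "{g}" "{0}"] k(2) g(1) by auto
next
  case (Suc d)
  have "X V Pos k n u \<in> low J g d"
  proof (rule X_span_into[OF k(1)])
    show "{X V Neg j n u | j n u. j \<in> J \<and> u \<in> low J g d} \<subseteq> Car V" using low_Car[OF J g(1)] X_in J by blast
    show "u \<in> vs.span {X V Neg j n u | j n u. j \<in> J \<and> u \<in> low J g d}" using Suc.prems by simp
    show "vs.subspace (low J g d)" by (rule low_subspace)
    fix w assume "w \<in> {X V Neg j n u | j n u. j \<in> J \<and> u \<in> low J g d}"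
    then obtain j n' u where w: "w = X V Neg j n' u" "j \<in> J" "u \<in> low J g d" by blast
    have uC: "u \<in> Car V" and j: "j \<in> Idx D" using w low_Car[OF J g(1)] J by auto
    have 1: "X V Neg j n' (X V Pos k n u) \<in> low J g d"
    proof (cases d)
      case 0
      then show ?thesis using Suc.IH[OF w(3), of n] X_zero[OF j] vs.span_zero by simp
    next
      case (Suc e)
      then show ?thesis using Suc.IH[OF w(3), of n] low_X[OF w(2)] by simp
    qed
    have ph: "phi D V s k p u \<in> low J g d" for s p by (rule phi_in[OF k(1) low_stab1[OF J g k(1)] w(3)])
    show "X V Pos k n w \<in> low J g d"
      unfolding w(1) Xpos_Xneg[OF k(1) j uC] using 1 ph
      by (auto intro!: vs.subspace_add[OF low_subspace] vs.subspace_scale[OF low_subspace] vs.subspace_diff[OF low_subspace] simp: vs.subspace_0[OF low_subspace])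
  qed
  then show ?case by simp
qed

definition ltot :: "nat set \<Rightarrow> 'v \<Rightarrow> 'v set" where
  "ltot J g = vs.span (\<Union>d. low J g d)"

lemma low_ltot: "u \<in> low J g d \<Longrightarrow> u \<in> ltot J g"
  unfolding ltot_def by (rule vs.span_base) blast

lemma ltot_stable:
  assumes "J \<subseteq> Idx D" "g \<in> Car V" "eig {0} \<chi> g"
  shows "stable (ltot J g)"
  unfolding ltot_def
proof (rule span_stable)
  show "(\<Union>d. low J g d) \<subseteq> Car V" using low_Car[OF assms(1,2)] by blast
  fix w and l :: "nat \<times> int" assume "w \<in> (\<Union>d. low J g d)" and l: "l \<in> Idx D \<times> UNIV"
  then obtain d where "w \<in> low J g d" by blast
  then have "hh l w \<in> low J g d" using stableD(3)[OF low_stable[OF assms] l] by blast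
  then show "hh l w \<in> vs.span (\<Union>d. low J g d)" by (intro vs.span_base) blast
qed

lemma ltot_Xneg:
  assumes "J \<subseteq> Idx D" "g \<in> Car V" "j \<in> J" "u \<in> ltot J g"
  shows "X V Neg j n u \<in> ltot J g"
proof (rule X_span_into[of j "\<Union>d. low J g d"])
  show "j \<in> Idx D" using assms by blast
  show "(\<Union>d. low J g d) \<subseteq> Car V" using low_Car[OF assms(1,2)] by blast
  show "vs.subspace (ltot J g)" "u \<in> vs.span (\<Union>d. low J g d)" using assms(4) by (simp_all add: ltot_def)
  show "X V Neg j n w \<in> ltot J g" if "w \<in> (\<Union>d. low J g d)" for w using that low_X[OF assms(3)] low_ltot by blast
qed

lemma ltot_Xpos:
  assumes "J \<subseteq> Idx D" "g \<in> Car V" "eig {0} (mc m) g" "k \<in> Idx D" "\<And>n. X V Pos k n g = 0" "u \<in> ltot J g"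
  shows "X V Pos k n u \<in> ltot J g"
proof (rule X_span_into[OF assms(4), of "\<Union>d. low J g d"])
  show "(\<Union>d. low J g d) \<subseteq> Car V" using low_Car[OF assms(1,2)] by blast
  show "vs.subspace (ltot J g)" "u \<in> vs.span (\<Union>d. low J g d)" using assms(6) by (simp_all add: ltot_def)
  fix w assume "w \<in> (\<Union>d. low J g d)"
  then obtain d where w: "w \<in> low J g d" by blast
  show "X V Pos k n w \<in> ltot J g"
    using low_Xpos[OF assms(1-5) w, of n] low_ltot vs.subspace_0[of "ltot J g"] by (cases d) (auto simp: ltot_def)
qed

lemma ltot_Kinv:
  assumes "J \<subseteq> Idx D" "g \<in> Car V" "eig {0} (mc m) g" "i \<in> Idx D" "u \<in> ltot J g"
  shows "Kinv V i u \<in> ltot J g"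
  unfolding ltot_def
proof (rule Kinv_span[OF assms(4)])
  show "(\<Union>d. low J g d) \<subseteq> Car V" using low_Car[OF assms(1,2)] by blast
  show "u \<in> vs.span (\<Union>d. low J g d)" using assms(5) by (simp add: ltot_def)
  show "Kinv V i w \<in> vs.span (\<Union>d. low J g d)" if "w \<in> (\<Union>d. low J g d)" for w
    using that low_Kinv[OF assms(1-4)] by (auto intro: vs.span_base)
qed

lemma submoduleI:
  assumes S: "stable S" and X: "\<And>s i n u. i \<in> Idx D \<Longrightarrow> u \<in> S \<Longrightarrow> X V s i n u \<in> S"
    and Ki: "\<And>i u. i \<in> Idx D \<Longrightarrow> u \<in> S \<Longrightarrow> Kinv V i u \<in> S"
  shows "submodule D V S"
  unfolding submodule_def
proof (intro conjI ballI)
  show "vs.subspace S" "S \<subseteq> Car V" using stableD[OF S] by auto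
  fix T v assume "T \<in> gens D V" and v: "v \<in> S"
  then consider s i n where "T = X V s i n" "i \<in> Idx D" | i where "T = K V i" "i \<in> Idx D" | i where "T = Kinv V i" "i \<in> Idx D"
    | i n where "T = H V i n" "i \<in> Idx D" "n \<noteq> 0" | "T = Ch V" | "T = Chinv V" unfolding gens_def by blast
  then show "T v \<in> S"
  proof cases
    case 2
    then show ?thesis using stableD(3)[OF S, of "(i, 0)" v] v by (simp add: hh_def)
  next
    case 4
    then have "sc (q - inverse q) (T v) \<in> S" using stableD(3)[OF S, of "(i, n)" v] v by (simp add: hh_def)
    then show ?thesis using vs.scale_mem_iff[OF stableD(1)[OF S] q_qinv] by blast
  qed (use v X Ki Ch_id stableD(2)[OF S] in auto)
qed

lemma ltot_submodule:
  assumes g: "g \<in> Car V" "eig {0} (mc m) g" and e: "\<And>i n. i \<in> Idx D \<Longrightarrow> X V Pos i n g = 0"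
  shows "submodule D V (ltot (Idx D) g)"
proof (rule submoduleI)
  show "stable (ltot (Idx D) g)" by (rule ltot_stable[OF _ g]) simp
  fix i u assume iu: "i \<in> Idx D" "u \<in> ltot (Idx D) g"
  show "X V s i n u \<in> ltot (Idx D) g" for s n
    using ltot_Xneg[OF _ g(1), of "Idx D" i u] ltot_Xpos[OF _ g, of "Idx D" i u] iu e by (cases s) auto
  show "Kinv V i u \<in> ltot (Idx D) g" using ltot_Kinv[OF _ g iu(1), of "Idx D" u] iu by simp
qed

lemma low1_weight:
  assumes j: "j \<in> Idx D" and g: "g \<in> Car V" "eig {0} (mc m) g" and i: "i \<in> Idx D" and u: "u \<in> low {j} g d"
  shows "K V i u = sc (q powi (int (rr D i) * (wt m i - int d * Cart D i j))) u"
proof -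
  have J: "{j} \<subseteq> Idx D" using j by simp
  have span: "K V i u = sc c u" if W: "W \<subseteq> Car V" "\<And>w. w \<in> W \<Longrightarrow> K V i w = sc c w" "u \<in> vs.span W" for W c u
    using that(3)
  proof (induction rule: span_induct_mem)
    case base
    then show ?case using T_zero[of "(i, 0)"] i by (simp add: hh_def)
  next
    case (step e x y)
    have "x \<in> Car V" "y \<in> Car V" using step W(1) vs.span_minimal[OF W(1) subC] by auto
    moreover have "sc e x \<in> Car V" using calculation vs.subspace_scale[OF subC] by blast
    ultimately show ?case using step W(2) i
      by (simp add: K_add K_scale vs.scale_right_distrib vs.scale_left_commute)
  qed
  show ?thesis using u
  proof (induction d arbitrary: u)
    case 0
    have "K V i g = sc (mc m (i, 0)) g" using eig_zero_D[OF g(2), of "(i, 0)"] i by (simp add: hh_def)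
    then show ?case using span[of "{g}" _ u] 0 g by (simp add: mc_def hchar_def)
  next
    case (Suc d)
    show ?case
    proof (rule span)
      show "{X V Neg k n u | k n u. k \<in> {j} \<and> u \<in> low {j} g d} \<subseteq> Car V" using low_Car[OF J g(1)] X_in j by blast
      show "u \<in> vs.span {X V Neg k n u | k n u. k \<in> {j} \<and> u \<in> low {j} g d}" using Suc.prems by simp
      fix w assume "w \<in> {X V Neg k n u | k n u. k \<in> {j} \<and> u \<in> low {j} g d}"
      then obtain n u where w: "w = X V Neg j n u" "u \<in> low {j} g d" by blast
      have uC: "u \<in> Car V" using w low_Car[OF J g(1)] by blast
      have "q powi (sg Neg * symB D i j) * q powi (int (rr D i) * (wt m i - int d * Cart D i j)) =
        q powi (int (rr D i) * (wt m i - int (Suc d) * Cart D i j))"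
        unfolding power_int_add[symmetric, OF disjI1[OF q_nz]] by (simp add: symB_def algebra_simps)
      then show "K V i w = sc (q powi (int (rr D i) * (wt m i - int (Suc d) * Cart D i j))) w"
        unfolding w(1) K_X[OF i j uC] Suc.IH[OF w(2)] X_scale[OF j uC] by simp
    qed
  qed
qed

lemma low_weights:
  assumes g: "g \<in> Car V" "eig {0} (mc m) g"
  shows "low (Idx D) g d \<subseteq> vs.span (\<Union>w\<in>{w. ht w = ht (wt m) - real d}. weight_space D V w)"
proof (induction d)
  case 0
  have "g \<in> weight_space D V (wt m)"
    using eig_zero_D[OF g(2), of "(_, 0)"] g(1) by (auto simp: weight_space_def hh_def mc_def hchar_def)
  then have "{g} \<subseteq> (\<Union>w\<in>{w. ht w = ht (wt m) - real 0}. weight_space D V w)" by force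
  then show ?case using vs.span_mono by simp
next
  case (Suc d)
  let ?Wd = "\<lambda>d. \<Union>w\<in>{w. ht w = ht (wt m) - real d}. weight_space D V w"
  have WC: "?Wd d \<subseteq> Car V" by (auto simp: weight_space_def)
  have "X V Neg j n u \<in> vs.span (?Wd (Suc d))" if j: "j \<in> Idx D" and u: "u \<in> low (Idx D) g d" for j n u
  proof (rule X_span_into[OF j WC])
    show "u \<in> vs.span (?Wd d)" using Suc u by blast
    fix x assume "x \<in> ?Wd d"
    then obtain w where w: "ht w = ht (wt m) - real d" "x \<in> weight_space D V w" by blast
    define w' where "w' i = w i - 1 * Cart D i j" for i
    have "ht w' = ht (wt m) - real (Suc d)" unfolding w'_def ht_shift[OF j] using w(1) by simp
    moreover have "X V Neg j n x \<in> weight_space D V w'"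
    proof -
      have xC: "x \<in> Car V" using w(2) by (simp add: weight_space_def)
      have "K V i (X V Neg j n x) = sc (q powi (int (rr D i) * w' i)) (X V Neg j n x)" if i: "i \<in> Idx D" for i
      proof -
        have "K V i x = sc (q powi (int (rr D i) * w i)) x" using w(2) i by (simp add: weight_space_def)
        moreover have "q powi (sg Neg * symB D i j) * q powi (int (rr D i) * w i) = q powi (int (rr D i) * w' i)"
          unfolding power_int_add[symmetric, OF disjI1[OF q_nz]] by (simp add: symB_def w'_def algebra_simps)
        ultimately show ?thesis unfolding K_X[OF i j xC] by (simp add: X_scale[OF j xC])
      qed
      then show ?thesis using X_in[OF j xC] by (simp add: weight_space_def)
    qed
    ultimately show "X V Neg j n x \<in> vs.span (?Wd (Suc d))" by (intro vs.span_base) blast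
  qed simp
  then have "{X V Neg j n u | j n u. j \<in> Idx D \<and> u \<in> low (Idx D) g d} \<subseteq> vs.span (?Wd (Suc d))" by blast
  then show ?case unfolding low.simps by (rule vs.span_minimal) simp
qed

text \<open>Level d consists of weights of height d below the top. Since q is not a root of unity,
  the k_i separate weights of different heights, so the top weight cannot occur in a sum of lower
  levels.\<close>

lemma low_top:
  assumes g: "g \<in> Car V" "eig {0} (mc m) g" and u: "u \<in> vs.span (\<Union>d\<in>{0<..}. low (Idx D) g d)" "u \<in> low (Idx D) g 0"
  shows "u = 0"
proof -
  interpret Kf: lin_ops sc "Car V" "Idx D" "K V"
    by unfold_locales (use fin_Car subC K_in K_add K_scale in auto)
  let ?SS = "\<Union>d\<in>{0<..}. \<Union>w\<in>{w. ht w = ht (wt m) - real d}. weight_space D V w"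
  define \<eta> where "\<eta> i = q powi (int (rr D i) * wt m i)" for i
  have "low (Idx D) g d \<subseteq> vs.span ?SS" if "0 < d" for d
  proof -
    have "(\<Union>w\<in>{w. ht w = ht (wt m) - real d}. weight_space D V w) \<subseteq> ?SS" using that by blast
    then show ?thesis using low_weights[OF g, of d] vs.span_mono by blast
  qed
  then have "vs.span (\<Union>d\<in>{0<..}. low (Idx D) g d) \<subseteq> vs.span ?SS" by (intro vs.span_minimal) auto
  then have uS: "u \<in> vs.span ?SS" using u(1) by blast
  have uC: "u \<in> Car V" using u(2) low_Car[OF subset_refl g(1)] by blast
  obtain c where c: "u = sc c g" using u(2) by (auto simp: vs.span_singleton)
  have "u \<in> {0}"
  proof (rule Kf.span_eigenvectors_other[where SS = ?SS and \<eta> = \<eta> and y = u])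
    show "Kf.stable {0}" by (rule Kf.stable_zero)
    show "u - u \<in> {0}" by simp
    show "u \<in> vs.span ?SS" "u \<in> Car V" by fact+
    have "K V i g = sc (\<eta> i) g" if "i \<in> Idx D" for i
      using eig_zero_D[OF g(2), of "(i, 0)"] that by (simp add: hh_def mc_def hchar_def \<eta>_def)
    then show "Kf.eig {0} \<eta> u" unfolding Kf.eig_def c using g(1) by (simp add: K_scale vs.scale_left_commute)
    fix s assume "s \<in> ?SS"
    then obtain d w where s: "0 < d" "ht w = ht (wt m) - real d" "s \<in> weight_space D V w" by blast
    define \<chi> where "\<chi> i = q powi (int (rr D i) * w i)" for i
    have "Kf.eig {0} \<chi> s" using s(3) by (simp add: Kf.eig_def weight_space_def \<chi>_def)
    moreover have "\<exists>i\<in>Idx D. \<chi> i \<noteq> \<eta> i"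
    proof (rule ccontr)
      assume "\<not> ?thesis"
      then have "w i = wt m i" if "i \<in> Idx D" for i
        using that rr_pos[OF that] by (auto simp: \<chi>_def \<eta>_def q_powi_inj)
      then have "ht w = ht (wt m)" by (rule ht_cong)
      then show False using s by simp
    qed
    ultimately show "s \<in> Car V \<and> (\<exists>\<chi>. Kf.eig {0} \<chi> s \<and> (\<exists>i\<in>Idx D. \<chi> i \<noteq> \<eta> i))"
      using s(3) by (auto simp: weight_space_def)
  qed
  then show ?thesis by simp
qed

text \<open>The levels have distinct k_j eigenvalues, so an eigenvector has a component in one level
  only. The pieces \<open>S d\<close> are arbitrary subsets of the levels, since the lemma is also
  applied to a possible kernel inside each level.\<close>

lemma low1_proj:
  assumes j: "j \<in> Idx D" and g: "g \<in> Car V" "eig {0} (mc m) g" and S: "\<And>d. S d \<subseteq> low {j} g d"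
    and z: "z \<in> vs.span (\<Union>d. S d)" "z \<noteq> 0" "K V j z = sc (q powi (int (rr D j) * w)) z"
  shows "\<exists>k. w = wt m j - 2 * int k \<and> z \<in> vs.span (S k)"
proof -
  interpret Kf: lin_ops sc "Car V" "{j}" "K V"
    by unfold_locales (use fin_Car subC K_in K_add K_scale j in auto)
  have J: "{j} \<subseteq> Idx D" using j by simp
  have SC: "S d \<subseteq> Car V" for d using S low_Car[OF J g(1)] by blast
  have zC: "z \<in> Car V" using z(1) vs.span_minimal[OF _ subC, of "\<Union>d. S d"] SC by blast
  have Kd: "K V j u = sc (q powi (int (rr D j) * (wt m j - 2 * int d))) u" if "u \<in> S d" for u d
    using low1_weight[OF j g j] that S Cart_diag[OF j] by (metis mult.commute subsetD)
  define \<eta> where "\<eta> (i::nat) = q powi (int (rr D j) * w)" for i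
  have eigz: "Kf.eig U \<eta> z" if "vs.subspace U" for U using z(3) vs.subspace_0[OF that] by (simp add: Kf.eig_def \<eta>_def)
  show ?thesis
  proof (cases "\<exists>k. w = wt m j - 2 * int k")
    case True
    then obtain k where k: "w = wt m j - 2 * int k" by blast
    let ?U = "vs.span (S k)"
    have "z \<in> ?U"
    proof (rule Kf.span_eigenvectors_other[where SS = "\<Union>d\<in>-{k}. S d" and \<eta> = \<eta>])
      show st: "Kf.stable ?U"
        unfolding Kf.stable_def
      proof (intro conjI ballI)
        show UC: "?U \<subseteq> Car V" using vs.span_minimal[OF SC subC] .
        fix l v assume "l \<in> {j}" and v: "v \<in> ?U"
        have "v \<in> low {j} g k" using v vs.span_minimal[OF S low_subspace] by blast
        then have "K V j v = sc (q powi (int (rr D j) * (wt m j - int k * Cart D j j))) v" by (rule low1_weight[OF j g j])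
        then show "K V l v \<in> ?U" using v \<open>l \<in> {j}\<close> vs.span_scale by simp
      qed simp
      have "z \<in> vs.span (?U \<union> (\<Union>d\<in>-{k}. S d))"
      proof -
        have "(\<Union>d. S d) \<subseteq> ?U \<union> (\<Union>d\<in>-{k}. S d)" using vs.span_superset[of "S k"] by blast
        then show ?thesis using z(1) vs.span_mono by blast
      qed
      then obtain y where "y \<in> vs.span (\<Union>d\<in>-{k}. S d)" "z - y \<in> ?U"
        using subspace_sum_span[of ?U z] by auto
      then show "z - (SOME y. y \<in> vs.span (\<Union>d\<in>-{k}. S d) \<and> z - y \<in> ?U) \<in> ?U"
        "(SOME y. y \<in> vs.span (\<Union>d\<in>-{k}. S d) \<and> z - y \<in> ?U) \<in> vs.span (\<Union>d\<in>-{k}. S d)"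
        using someI_ex[of "\<lambda>y. y \<in> vs.span (\<Union>d\<in>-{k}. S d) \<and> z - y \<in> ?U"] by blast+
      show "z \<in> Car V" by fact
      show "Kf.eig ?U \<eta> z" using eigz by simp
      fix s assume "s \<in> (\<Union>d\<in>-{k}. S d)"
      then obtain d where d: "d \<noteq> k" "s \<in> S d" by blast
      then show "s \<in> Car V \<and> (\<exists>\<chi>. Kf.eig ?U \<chi> s \<and> (\<exists>l\<in>{j}. \<chi> l \<noteq> \<eta> l))"
        using SC Kd[OF d(2)] k rr_pos[OF j] vs.span_zero[of "S k"]
        by (intro conjI exI[of _ "\<lambda>_. q powi (int (rr D j) * (wt m j - 2 * int d))"]) (auto simp: Kf.eig_def \<eta>_def q_powi_inj)
    qed
    then show ?thesis using k by blast
  next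
    case False
    have "z \<in> {0}"
    proof (rule Kf.span_eigenvectors_other[where SS = "\<Union>d. S d" and \<eta> = \<eta> and y = z])
      fix s assume "s \<in> (\<Union>d. S d)"
      then obtain d where d: "s \<in> S d" by blast
      then show "s \<in> Car V \<and> (\<exists>\<chi>. Kf.eig {0} \<chi> s \<and> (\<exists>l\<in>{j}. \<chi> l \<noteq> \<eta> l))"
        using SC Kd[OF d] False rr_pos[OF j]
        by (intro conjI exI[of _ "\<lambda>_. q powi (int (rr D j) * (wt m j - 2 * int d))"]) (auto simp: Kf.eig_def \<eta>_def q_powi_inj)
    qed (use z eigz zC Kf.stable_zero in auto)
    then show ?thesis using z(2) by simp
  qed
qed

end

subsection \<open>The Drinfeld polynomial of an l-weight\<close>

lemma fps_scale_mult:
  "Abs_fps (\<lambda>n. t ^ n * (f * g) $ n) = Abs_fps (\<lambda>n. t ^ n * f $ n) * Abs_fps (\<lambda>n. t ^ n * g $ n)"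
  for f g :: "complex fps"
proof (rule fps_ext)
  fix n
  have "t ^ n * (\<Sum>i=0..n. f $ i * g $ (n - i)) = (\<Sum>i=0..n. (t ^ i * f $ i) * (t ^ (n - i) * g $ (n - i)))"
    unfolding sum_distrib_left
  proof (rule sum.cong[OF refl])
    fix i assume "i \<in> {0..n}"
    then have "t ^ n = t ^ i * t ^ (n - i)" by (simp add: power_add[symmetric])
    then show "t ^ n * (f $ i * g $ (n - i)) = (t ^ i * f $ i) * (t ^ (n - i) * g $ (n - i))" by simp
  qed
  then show "Abs_fps (\<lambda>n. t ^ n * (f * g) $ n) $ n = (Abs_fps (\<lambda>n. t ^ n * f $ n) * Abs_fps (\<lambda>n. t ^ n * g $ n)) $ n"
    by (simp add: fps_mult_nth)
qed

lemma coeff_rescale: "coeff (rescale p c) n = c ^ n * coeff p n"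
  by (simp add: rescale_def coeff_pcompose_linear)

text \<open>The series P(u) = Q(t u)/R(t u). For t = q^(r_j) it satisfies \<gamma>(u) = const P(t^-2
  u)/P(u), so it plays the part of the Drinfeld polynomial before it is known to be a
  polynomial.\<close>

definition Pfps :: "complex \<Rightarrow> monom \<Rightarrow> nat \<Rightarrow> complex fps" where
  "Pfps t m j = fps_of_poly (rescale (Qpoly m j) t) / fps_of_poly (rescale (Rpoly m j) t)"

lemma Q_R_unit: "fps_of_poly (rescale (Qpoly m j) c) $ 0 = 1" "fps_of_poly (rescale (Rpoly m j) c) $ 0 = 1"
  unfolding rescale_Qpoly rescale_Rpoly by (simp_all add: coeff_0_linear_power_prod)

lemma Pfps_mult: "Pfps t m j * fps_of_poly (rescale (Rpoly m j) t) = fps_of_poly (rescale (Qpoly m j) t)"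
  using Q_R_unit[of m j t] by (simp add: Pfps_def fps_divide_unit mult.assoc inverse_mult_eq_1)

lemma Pfps_0: "Pfps t m j $ 0 = 1"
  using Q_R_unit[of m j t] by (simp add: Pfps_def fps_divide_unit)

text \<open>A terminating series is a polynomial p with p R = Q after rescaling. A negative exponent
  at a gives R, hence Q, the root 1/(a t), so the exponent at the same a would also be
  positive.\<close>

lemma j_dominant_Pfps:
  assumes m: "m \<in> monoms D" and t: "t \<noteq> 0" and P: "\<And>r. r0 \<le> r \<Longrightarrow> Pfps t m j $ r = 0"
  shows "j_dominant j m"
  unfolding j_dominant_def
proof (rule allI, rule ccontr)
  fix a assume "\<not> 0 \<le> expo m j a"
  then have neg: "expo m j a < 0" by simp
  then have key: "(j, a) \<in> Poly_Mapping.keys m" by (simp add: in_keys_iff)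
  have a0: "a \<noteq> 0" using key m by (auto simp: monoms_def)
  define p where "p = (\<Sum>r<r0. monom (Pfps t m j $ r) r)"
  have cp: "coeff p r = Pfps t m j $ r" for r
    using P[of r] by (auto simp: p_def coeff_sum if_distrib sum.delta cong: if_cong)
  then have "fps_of_poly p = Pfps t m j" by (intro fps_ext) simp
  then have "fps_of_poly (p * rescale (Rpoly m j) t) = fps_of_poly (rescale (Qpoly m j) t)"
    using Pfps_mult[of t m j] by (simp add: fps_of_poly_mult)
  then have e: "p * rescale (Rpoly m j) t = rescale (Qpoly m j) t" by simp
  define u where "u = inverse (a * t)"
  have ut: "u * (a * t) = 1" using a0 t by (simp add: u_def del: inverse_mult_distrib)
  have "poly (rescale (Rpoly m j) t) u = 0"
    unfolding rescale_Rpoly poly_prod using key neg a0 t finite_slice[of j m]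
    by (intro prod_zero bexI[of _ a]) (simp_all add: ut)
  then have "poly (rescale (Qpoly m j) t) u = 0" unfolding e[symmetric] by simp
  then obtain b where b: "(j, b) \<in> Poly_Mapping.keys m" "poly ([:1, - (b * t):] ^ nat (expo m j b)) u = 0"
    unfolding rescale_Qpoly poly_prod using finite_slice[of j m] by (auto simp: prod_zero_iff)
  then have "1 - u * (b * t) = 0" "nat (expo m j b) \<noteq> 0" by (auto simp: power_0_left split: if_splits)
  then have "b = a" using a0 t by (simp add: u_def field_simps)
  then show False using \<open>nat (expo m j b) \<noteq> 0\<close> neg by simp
qed

text \<open>The identity \<gamma>(u) P(u) = const P(q_j^-2 u) in coefficients, the form in which it
  meets the operator series phi(u) applied to P(u) g.\<close>

lemma (in qdat) gamma_Pfps: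
  "(\<Sum>i\<le>n. gamma D m Pos j i * Pfps (qi j) m j $ (n - i)) =
    q powi (int (rr D j) * (int (degree (Qpoly m j)) - int (degree (Rpoly m j)))) * (inverse (qi j ^ 2) ^ n * Pfps (qi j) m j $ n)"
proof -
  let ?F = "\<lambda>p c. fps_of_poly (rescale p c)" and ?t = "inverse (qi j ^ 2)"
  let ?Q = "Qpoly m j" and ?R = "Rpoly m j" and ?c = "q powi (int (rr D j) * (int (degree (Qpoly m j)) - int (degree (Rpoly m j))))"
  have ti: "inverse (qi j) = ?t * qi j" using qi_nz by (simp add: power2_eq_square)
  have sF: "?F p (inverse (qi j)) = Abs_fps (\<lambda>n. ?t ^ n * ?F p (qi j) $ n)" for p
    by (rule fps_ext) (simp only: fps_of_poly_nth fps_nth_Abs_fps coeff_rescale ti power_mult_distrib mult.assoc)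
  define S where "S = Abs_fps (\<lambda>n. ?t ^ n * Pfps (qi j) m j $ n)"
  have SR: "S * ?F ?R (inverse (qi j)) = ?F ?Q (inverse (qi j))"
    unfolding S_def sF fps_scale_mult[symmetric] Pfps_mult ..
  define G where "G = fps_of_poly (gamma_num D m j) / fps_of_poly (gamma_den D m j)"
  have gn: "fps_of_poly (gamma_num D m j) = ?F ?Q (inverse (qi j)) * ?F ?R (qi j)"
    and gd: "fps_of_poly (gamma_den D m j) = ?F ?Q (qi j) * ?F ?R (inverse (qi j))"
    by (simp_all add: gamma_num_def gamma_den_def qi_def Let_def fps_of_poly_mult)
  have u: "?F ?Q c $ 0 = 1" "?F ?R c $ 0 = 1" for c by (rule Q_R_unit)+
  have nz: "?F ?Q c \<noteq> 0" "?F ?R c \<noteq> 0" for c using u[of c] by (metis fps_zero_nth zero_neq_one)+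
  have gd0: "fps_of_poly (gamma_den D m j) $ 0 = 1" unfolding gd by (simp add: u fps_mult_nth_0 del: fps_of_poly_nth)
  have GD: "G * fps_of_poly (gamma_den D m j) = fps_of_poly (gamma_num D m j)"
    unfolding G_def using gd0 by (subst fps_divide_unit) (simp_all add: mult.assoc inverse_mult_eq_1)
  have "(G * Pfps (qi j) m j) * (?F ?Q (qi j) * ?F ?R (inverse (qi j)) * ?F ?R (qi j)) =
     (G * (?F ?Q (qi j) * ?F ?R (inverse (qi j)))) * (Pfps (qi j) m j * ?F ?R (qi j))" by (simp only: mult_ac)
  also have "\<dots> = (?F ?Q (inverse (qi j)) * ?F ?R (qi j)) * ?F ?Q (qi j)" using GD unfolding gd gn Pfps_mult by simp
  also have "\<dots> = S * (?F ?Q (qi j) * ?F ?R (inverse (qi j)) * ?F ?R (qi j))" unfolding SR[symmetric] by (simp only: mult_ac)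
  finally have GS: "G * Pfps (qi j) m j = S" using nz by simp
  have "(\<Sum>i\<le>n. gamma D m Pos j i * Pfps (qi j) m j $ (n - i)) = ?c * (\<Sum>i\<le>n. G $ i * Pfps (qi j) m j $ (n - i))"
    by (simp add: gamma_def G_def sum_distrib_left mult.assoc)
  also have "(\<Sum>i\<le>n. G $ i * Pfps (qi j) m j $ (n - i)) = (G * Pfps (qi j) m j) $ n"
    by (simp add: fps_mult_nth atMost_atLeast0)
  finally show ?thesis unfolding GS by (simp add: S_def)
qed

subsection \<open>Half currents\<close>

lemma sum_atMost_rev: "(\<Sum>i\<le>s. g i) = (\<Sum>i\<le>s. g (s - i))" for g :: "nat \<Rightarrow> 'a::comm_monoid_add"
  by (rule sum.reindex_bij_witness[where i = "\<lambda>i. s - i" and j = "\<lambda>i. s - i"]) auto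

context vector_space
begin

text \<open>The hypothesis is the symmetric quadratic relation for modes of total degree s. A
  weighted sum of its halves equals its own mirror image, so twice that sum is a combination of
  relations and vanishes; regrouping by \<open>y b\<close> leaves the stated coefficients times 1 -
  t.\<close>

lemma quadratic_sum:
  fixes y :: "nat \<Rightarrow> 'b"
  assumes t: "t \<noteq> 1" "(2 :: 'a) \<noteq> 0" and y: "\<And>a. a < s \<Longrightarrow> y (Suc a) + y (s - a) = scale t (y a + y (s - 1 - a))"
  shows "(\<Sum>i\<le>s. scale (1 - (1 + t) * t ^ i + t ^ Suc s) (y i)) = 0"
proof -
  \<comment> \<open>This weight is invariant under a -> s - 1 - a. It vanishes at a = s, as does its
    shifted form \<open>m'\<close> at 0, so both halves of \<open>G\<close> extend to sums over all
    b \<le> s.\<close>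
  define m where "m a = t ^ Suc s + 1 - t ^ Suc a - t ^ (s - a)" for a
  define G where "G = (\<Sum>a<s. scale (m a) (y (Suc a) - scale t (y a)))"
  have "G = (\<Sum>a<s. scale (m (s - Suc a)) (y (Suc (s - Suc a)) - scale t (y (s - Suc a))))"
    unfolding G_def by (rule sum.nat_diff_reindex[symmetric])
  also have "\<dots> = (\<Sum>a<s. scale (m a) (y (s - a) - scale t (y (s - 1 - a))))"
  proof (rule sum.cong[OF refl])
    fix a assume a: "a \<in> {..<s}"
    then have "Suc (s - Suc a) = s - a" "s - (s - Suc a) = Suc a" by auto
    then show "scale (m (s - Suc a)) (y (Suc (s - Suc a)) - scale t (y (s - Suc a))) = scale (m a) (y (s - a) - scale t (y (s - 1 - a)))"
      by (simp add: m_def algebra_simps)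
  qed
  finally have "G + G = (\<Sum>a<s. scale (m a) ((y (Suc a) + y (s - a)) - scale t (y a + y (s - 1 - a))))"
    by (subst (1) G_def) (simp add: sum.distrib[symmetric] algebra_simps)
  also have "\<dots> = 0" by (rule sum.neutral) (use y in auto)
  finally have "scale 2 G = 0" by (simp add: scale_left_distrib[of 1 1, simplified])
  then have G0: "G = 0" using t by simp
  define m' where "m' b = t ^ Suc s + 1 - t ^ b - t ^ (Suc s - b)" for b
  have "(\<Sum>a<s. scale (m a) (y (Suc a))) = (\<Sum>b\<le>s. scale (m' b) (y b))"
  proof (cases s)
    case (Suc s')
    have "(\<Sum>b\<le>s. scale (m' b) (y b)) = scale (m' 0) (y 0) + (\<Sum>a\<le>s'. scale (m' (Suc a)) (y (Suc a)))"
      unfolding Suc by (rule sum.atMost_Suc_shift)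
    then show ?thesis unfolding Suc lessThan_Suc_atMost by (simp add: m'_def m_def)
  qed (simp add: m'_def)
  moreover have "(\<Sum>a<s. scale (m a * t) (y a)) = (\<Sum>b\<le>s. scale (m b * t) (y b))"
    by (simp add: lessThan_Suc_atMost[symmetric] m_def)
  ultimately have "G = (\<Sum>b\<le>s. scale (m' b - m b * t) (y b))"
    unfolding G_def by (simp add: scale_right_diff_distrib sum_subtractf scale_left_diff_distrib)
  also have "\<dots> = (\<Sum>b\<le>s. scale ((1 - t) * (1 - (1 + t) * t ^ b + t ^ Suc s)) (y b))"
  proof (rule sum.cong[OF refl])
    fix b assume "b \<in> {..s}"
    then have "Suc s - b = Suc (s - b)" by auto
    then have "m' b - m b * t = (1 - t) * (1 - (1 + t) * t ^ b + t ^ Suc s)"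
      by (simp add: m'_def m_def algebra_simps)
    then show "scale (m' b - m b * t) (y b) = scale ((1 - t) * (1 - (1 + t) * t ^ b + t ^ Suc s)) (y b)" by simp
  qed
  also have "\<dots> = scale (1 - t) (\<Sum>b\<le>s. scale (1 - (1 + t) * t ^ b + t ^ Suc s) (y b))"
    by (simp add: scale_sum_right)
  finally show ?thesis using G0 t by simp
qed

text \<open>Here \<alpha> stands for the products phi x and \<beta> for x phi of a fixed total
  degree. The closed form of \<alpha>_k is carried along because \<alpha>_k is the increment of the
  partial sum.\<close>

lemma linear_recursion_sum:
  fixes \<alpha> \<beta> :: "nat \<Rightarrow> 'b"
  assumes "\<alpha> 0 = scale t (\<beta> 0)" "\<And>i. i < s \<Longrightarrow> \<alpha> (Suc i) = scale t (\<alpha> i) + scale t (\<beta> (Suc i)) - \<beta> i"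
  shows "k \<le> s \<Longrightarrow> \<alpha> k = scale t (\<beta> k) + (\<Sum>l<k. scale ((t\<^sup>2 - 1) * t ^ (k - Suc l)) (\<beta> l)) \<and>
    (\<Sum>i\<le>k. \<alpha> i) = (\<Sum>l\<le>k. scale ((1 + t) * t ^ (k - l) - 1) (\<beta> l))"
proof (induction k)
  case 0
  then show ?case using assms(1) by simp
next
  case (Suc k)
  then have IH: "\<alpha> k = scale t (\<beta> k) + (\<Sum>l<k. scale ((t\<^sup>2 - 1) * t ^ (k - Suc l)) (\<beta> l))"
    "(\<Sum>i\<le>k. \<alpha> i) = (\<Sum>l\<le>k. scale ((1 + t) * t ^ (k - l) - 1) (\<beta> l))" and k: "k < s" by auto
  have "(\<Sum>l<k. scale (t * ((t\<^sup>2 - 1) * t ^ (k - Suc l))) (\<beta> l)) = (\<Sum>l<k. scale ((t\<^sup>2 - 1) * t ^ (k - l)) (\<beta> l))"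
  proof (rule sum.cong[OF refl])
    fix l assume "l \<in> {..<k}"
    then have "k - l = Suc (k - Suc l)" by auto
    then show "scale (t * ((t\<^sup>2 - 1) * t ^ (k - Suc l))) (\<beta> l) = scale ((t\<^sup>2 - 1) * t ^ (k - l)) (\<beta> l)" by (simp add: mult_ac)
  qed
  then have 1: "\<alpha> (Suc k) = scale t (\<beta> (Suc k)) + (\<Sum>l<Suc k. scale ((t\<^sup>2 - 1) * t ^ (Suc k - Suc l)) (\<beta> l))"
    using assms(2)[OF k] unfolding IH(1)
    by (simp add: scale_right_distrib scale_sum_right power2_eq_square scale_left_diff_distrib)
  have 2: "(\<Sum>i\<le>Suc k. \<alpha> i) = (\<Sum>l\<le>Suc k. scale ((1 + t) * t ^ (Suc k - l) - 1) (\<beta> l))"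
  proof -
    have "(\<Sum>i\<le>Suc k. \<alpha> i) = (\<Sum>l\<le>k. scale ((1 + t) * t ^ (k - l) - 1) (\<beta> l)) +
      (\<Sum>l\<le>k. scale ((t\<^sup>2 - 1) * t ^ (k - l)) (\<beta> l)) + scale t (\<beta> (Suc k))"
      using IH(2) 1 by (simp add: lessThan_Suc_atMost algebra_simps)
    also have "\<dots> = (\<Sum>l\<le>k. scale ((1 + t) * t ^ (Suc k - l) - 1) (\<beta> l)) + scale t (\<beta> (Suc k))"
      unfolding sum.distrib[symmetric] scale_left_distrib[symmetric]
    proof (intro arg_cong2[of _ _ _ _ "(+)"] sum.cong refl)
      fix l assume "l \<in> {..k}"
      then have "Suc k - l = Suc (k - l)" by auto
      then have "(1 + t) * t ^ (k - l) - 1 + (t\<^sup>2 - 1) * t ^ (k - l) = (1 + t) * t ^ (Suc k - l) - 1"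
        by (simp add: power2_eq_square algebra_simps)
      then show "scale ((1 + t) * t ^ (k - l) - 1 + (t\<^sup>2 - 1) * t ^ (k - l)) (\<beta> l) = scale ((1 + t) * t ^ (Suc k - l) - 1) (\<beta> l)" by simp
    qed
    finally show ?thesis by simp
  qed
  show ?case using 1 2 by blast
qed

end

text \<open>
  Sequences \<open>f\<close> of vectors stand for power series \<open>\<Sum> f\<^sub>n u\<^sup>n\<close>; \<open>cv a\<close> is multiplication by the
  operator valued series \<open>\<Sum> a\<^sub>i u\<^sup>i\<close>.
\<close>

context qmod
begin

definition seq :: "(nat \<Rightarrow> 'v) \<Rightarrow> bool" where
  "seq f \<longleftrightarrow> (\<forall>n. f n \<in> Car V)"

definition cv :: "(nat \<Rightarrow> 'v \<Rightarrow> 'v) \<Rightarrow> (nat \<Rightarrow> 'v) \<Rightarrow> nat \<Rightarrow> 'v" where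
  "cv a f n = (\<Sum>i\<le>n. a i (f (n - i)))"

definition lop :: "('v \<Rightarrow> 'v) \<Rightarrow> bool" where
  "lop T \<longleftrightarrow> (\<forall>v\<in>Car V. T v \<in> Car V) \<and> (\<forall>v\<in>Car V. \<forall>w\<in>Car V. T (v + w) = T v + T w) \<and>
     (\<forall>v\<in>Car V. \<forall>c. T (sc c v) = sc c (T v))"

definition sop :: "((nat \<Rightarrow> 'v) \<Rightarrow> nat \<Rightarrow> 'v) \<Rightarrow> bool" where
  "sop L \<longleftrightarrow> (\<forall>f. seq f \<longrightarrow> seq (L f)) \<and>
     (\<forall>f g a b. seq f \<longrightarrow> seq g \<longrightarrow> L (\<lambda>n. sc a (f n) + sc b (g n)) = (\<lambda>n. sc a (L f n) + sc b (L g n)))"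

lemma seq_comb: "seq f \<Longrightarrow> seq g \<Longrightarrow> seq (\<lambda>n. sc a (f n) + sc b (g n))"
  using vs.subspace_add[OF subC] vs.subspace_scale[OF subC] by (simp add: seq_def)

lemma sop_seq: "sop L \<Longrightarrow> seq f \<Longrightarrow> seq (L f)"
  and sop_lin: "sop L \<Longrightarrow> seq f \<Longrightarrow> seq g \<Longrightarrow> L (\<lambda>n. sc a (f n) + sc b (g n)) = (\<lambda>n. sc a (L f n) + sc b (L g n))"
  by (auto simp: sop_def)

lemma sop_diff: "sop L \<Longrightarrow> seq f \<Longrightarrow> seq g \<Longrightarrow> L (\<lambda>n. sc a (f n) - sc b (g n)) = (\<lambda>n. sc a (L f n) - sc b (L g n))"
  using sop_lin[of L f g a "- b"] by simp

lemma sop_scale: "sop L \<Longrightarrow> seq f \<Longrightarrow> L (\<lambda>n. sc a (f n)) = (\<lambda>n. sc a (L f n))"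
  using sop_lin[of L f f a 0] by simp

lemma sop_pow: "sop L \<Longrightarrow> sop (L ^^ k)"
proof (induction k)
  case 0
  then show ?case by (simp add: sop_def)
next
  case (Suc k)
  then have s: "sop (L ^^ k)" by blast
  show ?case unfolding sop_def funpow.simps o_apply
    using sop_seq[OF Suc.prems] sop_seq[OF s] sop_lin[OF s] sop_lin[OF Suc.prems] by simp
qed

lemma lop_sum: "lop T \<Longrightarrow> (\<And>x. x \<in> F \<Longrightarrow> f x \<in> Car V) \<Longrightarrow> T (sum f F) = (\<Sum>x\<in>F. T (f x))"
proof (induction F rule: infinite_finite_induct)
  case (insert x F)
  then show ?case using vs.subspace_sum[OF subC, of F f] by (simp add: lop_def)
next
  case empty
  then have "T (sc 0 0) = sc 0 (T 0)" using vs.subspace_0[OF subC] unfolding lop_def by blast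
  then show ?case by simp
next
  case (infinite F)
  then have "T (sc 0 0) = sc 0 (T 0)" using vs.subspace_0[OF subC] unfolding lop_def by blast
  then show ?case using infinite by simp
qed

lemma cv_sop: "(\<And>i. lop (a i)) \<Longrightarrow> sop (cv a)"
  unfolding sop_def
proof (intro conjI allI impI)
  assume a: "\<And>i. lop (a i)"
  fix f g b c
  show "seq (cv a f)" if "seq f"
    using that a unfolding seq_def cv_def lop_def by (intro allI vs.subspace_sum[OF subC]) blast
  assume fg: "seq f" "seq g"
  show "cv a (\<lambda>n. sc b (f n) + sc c (g n)) = (\<lambda>n. sc b (cv a f n) + sc c (cv a g n))"
  proof
    fix n
    have "a i (sc b (f k) + sc c (g k)) = sc b (a i (f k)) + sc c (a i (g k))" for i k
      using a[of i] fg vs.subspace_scale[OF subC] unfolding lop_def seq_def by simp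
    then show "cv a (\<lambda>n. sc b (f n) + sc c (g n)) n = sc b (cv a f n) + sc c (cv a g n)"
      by (simp add: cv_def sum.distrib vs.scale_sum_right)
  qed
qed

lemma cv_cv:
  assumes a: "\<And>i. lop (a i)" and b: "\<And>i. lop (b i)" and f: "seq f"
  shows "cv a (cv b f) n = (\<Sum>s\<le>n. \<Sum>i\<le>s. a i (b (s - i) (f (n - s))))"
proof -
  have C: "b k (f l) \<in> Car V" for k l using b f by (simp add: lop_def seq_def)
  have "cv a (cv b f) n = (\<Sum>i\<le>n. \<Sum>k\<le>n - i. a i (b k (f (n - (i + k)))))"
    unfolding cv_def by (intro sum.cong refl) (subst lop_sum[OF a], use C in \<open>auto simp: diff_diff_left\<close>)
  also have "\<dots> = (\<Sum>(i, k)\<in>{(i, k). i + k \<le> n}. a i (b k (f (n - (i + k)))))"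
    by (subst sum.Sigma) (auto intro!: sum.cong)
  also have "\<dots> = (\<Sum>s\<le>n. \<Sum>i\<le>s. a i (b (s - i) (f (n - (i + (s - i))))))"
    by (rule sum.triangle_reindex_eq)
  finally show ?thesis by simp
qed

end

locale qmod_vertex = qmod D V for D and V :: "'v::ab_group_add qmodule" +
  fixes j assumes j: "j \<in> Idx D"
begin

definition "tj = inverse (qi j ^ 2)"
definition "x n = X V Neg j n"
definition "ph n = phi D V Pos j (int n)"
text \<open>The commutator of x^+_{j,p} and x^-_{j,m} for any p + m = N. It joins phi^+ and phi^-,
  which both contribute at N = 0.\<close>

definition "\<Psi> N v = sc (1 / (qi j - inverse (qi j))) (phi D V Pos j N v - phi D V Neg j N v)"

text \<open>These are the half current X(u), the sum of x^-_{j,i+1} u^i over i \<ge> 0, the same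
  current X(t u) with t = q_j^-2, and phi^+_j(u).\<close>

abbreviation "XX \<equiv> cv (\<lambda>i. x (int i + 1))"
abbreviation "XT \<equiv> cv (\<lambda>(i::nat) v. sc (tj ^ i) (x (int i + 1) v))"
abbreviation "PH \<equiv> cv ph"

lemma tj_powi: "tj = q powi (- symB D j j)"
proof -
  have "qi j powi (-2) = q powi (int (rr D j) * (-2))" by (rule qi_powi)
  then show ?thesis using Cart_diag[OF j] by (simp add: tj_def symB_def power_int_minus)
qed

lemma tj_nz: "tj \<noteq> 0" using qi_nz by (simp add: tj_def)

lemma tj_pow: "tj ^ n = 1 \<longleftrightarrow> n = 0"
proof -
  have "tj ^ n = q powi (- symB D j j * int n)" unfolding tj_powi power_int_mult power_int_of_nat ..
  then show ?thesis using rr_pos[OF j] Cart_diag[OF j] by (simp add: q_powi_1 symB_def)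
qed

lemma tj_1: "tj \<noteq> 1" using tj_pow[of 1] by simp

lemma qjj: "qi j - inverse (qi j) \<noteq> 0"
  using qi_diff_nz[OF j, of 1] by (simp add: power_int_minus)

lemma x_lop: "lop (x n)"
  using j by (simp add: lop_def x_def X_in X_add X_scale)

lemma lop_scale: "lop T \<Longrightarrow> lop (\<lambda>v. sc c (T v))"
  using vs.subspace_scale[OF subC] by (auto simp: lop_def vs.scale_right_distrib vs.scale_left_commute)

lemma ph_0: "v \<in> Car V \<Longrightarrow> ph 0 v = K V j v"
  using phi_0[OF j, of v Pos] by (simp add: ph_def Ks_def)

lemma comm: "v \<in> Car V \<Longrightarrow> X V Pos j p (x m v) = x m (X V Pos j p v) + \<Psi> (p + m) v"
  using Xpos_Xneg[OF j j, of v p m] by (simp add: x_def \<Psi>_def)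

lemma \<Psi>_lop: "lop (\<Psi> N)"
proof -
  have e: "\<Psi> N v = X V Pos j N (x 0 v) - x 0 (X V Pos j N v)" if "v \<in> Car V" for v
    using comm[OF that, of N 0] by simp
  have C: "x 0 v \<in> Car V" "X V Pos j N v \<in> Car V" if "v \<in> Car V" for v using that j X_in by (simp_all add: x_def)
  show ?thesis unfolding lop_def
    using e C vs.subspace_add[OF subC] vs.subspace_scale[OF subC] vs.subspace_diff[OF subC] j
    by (simp add: x_def X_add X_scale X_in vs.scale_right_diff_distrib)
qed

lemma \<Psi>_pos: "0 < N \<Longrightarrow> v \<in> Car V \<Longrightarrow> \<Psi> (int N) v = sc (1 / (qi j - inverse (qi j))) (ph N v)"
  by (simp add: \<Psi>_def ph_def phi_neg_zero)

lemma \<Psi>_0: "v \<in> Car V \<Longrightarrow> \<Psi> 0 v = sc (1 / (qi j - inverse (qi j))) (ph 0 v - Kinv V j v)"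
  using phi_0[OF j, of v Neg] by (simp add: \<Psi>_def ph_def Ks_def)

lemma ph_lop: "lop (ph n)"
proof (cases "n = 0")
  case True
  then show ?thesis using j by (simp add: lop_def ph_0 K_in K_add K_scale vs.subspace_add[OF subC] vs.subspace_scale[OF subC])
next
  case False
  have "ph n v = sc (qi j - inverse (qi j)) (\<Psi> (int n) v)" if "v \<in> Car V" for v
    using \<Psi>_pos[of n v] False that qjj by simp
  then show ?thesis using lop_scale[OF \<Psi>_lop, of "qi j - inverse (qi j)"]
      vs.subspace_add[OF subC] vs.subspace_scale[OF subC] by (simp add: lop_def)
qed

lemma quad: "v \<in> Car V \<Longrightarrow> x (n + 1) (x m v) - sc tj (x m (x (n + 1) v)) = sc tj (x n (x (m + 1) v)) - x (m + 1) (x n v)"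
  using X_X[OF _ j j, of v Neg n m] by (simp add: x_def tj_powi)

lemma lop_simps:
  assumes "lop T" "v \<in> Car V"
  shows "T v \<in> Car V" "w \<in> Car V \<Longrightarrow> T (v + w) = T v + T w" "T (sc c v) = sc c (T v)" "w \<in> Car V \<Longrightarrow> T (v - w) = T v - T w"
proof -
  show "T v \<in> Car V" "w \<in> Car V \<Longrightarrow> T (v + w) = T v + T w" "T (sc c v) = sc c (T v)" using assms by (auto simp: lop_def)
  show "T (v - w) = T v - T w" if w: "w \<in> Car V"
  proof -
    have "sc (-1) w \<in> Car V" using w vs.subspace_scale[OF subC] by blast
    then have "T (v + sc (-1) w) = T v + T (sc (-1) w)" using assms unfolding lop_def by blast
    also have "T (sc (-1) w) = sc (-1) (T w)" using assms w unfolding lop_def by blast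
    finally show ?thesis by simp
  qed
qed

text \<open>Applying a raising mode to both sides of the quadratic relation for adjacent lowering
  modes gives a relation between phi and x^-, with the raised terms cancelling.\<close>

lemma \<Psi>_x:
  assumes v: "v \<in> Car V"
  shows "\<Psi> N (x m v) + x (m + 1) (\<Psi> (N - 1) v) = sc tj (\<Psi> (N - 1) (x (m + 1) v) + x m (\<Psi> N v))"
proof -
  \<comment> \<open>With this mode the commutators with x_m and x_{m+1} are \<Psi>_{N-1} and
    \<Psi>_N.\<close>
  define p where "p = N - m - 1"
  let ?E = "X V Pos j p"
  have xC: "\<And>n v. v \<in> Car V \<Longrightarrow> x n v \<in> Car V" and EC: "\<And>v. v \<in> Car V \<Longrightarrow> ?E v \<in> Car V"
    using j X_in by (auto simp: x_def)
  have Elop: "lop ?E" using j by (simp add: lop_def X_in X_add X_scale)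
  \<comment> \<open>For equal indices the quadratic relation states the same identity twice, hence
    the division by 2.\<close>
  have r: "x (m + 1) (x m w) = sc tj (x m (x (m + 1) w))" if "w \<in> Car V" for w
  proof -
    have two: "sc 2 z = z + z" for z using vs.scale_left_distrib[of 1 1 z] by simp
    have "sc 2 (x (m + 1) (x m w)) = sc 2 (sc tj (x m (x (m + 1) w)))"
      unfolding two using quad[OF that, of m m] by (simp only: diff_eq_eq) (simp add: algebra_simps)
    then show ?thesis by (simp only: vs.scale_cancel_left) simp
  qed
  have 1: "?E (x (m + 1) (x m v)) = x (m + 1) (x m (?E v)) + x (m + 1) (\<Psi> (N - 1) v) + \<Psi> N (x m v)"
    using comm[OF xC[OF v], of p "m + 1"] comm[OF v, of p m] lop_simps(2)[OF x_lop xC[OF EC[OF v]] lop_simps(1)[OF \<Psi>_lop v]]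
    by (simp add: p_def)
  have 2: "?E (x m (x (m + 1) v)) = x m (x (m + 1) (?E v)) + x m (\<Psi> N v) + \<Psi> (N - 1) (x (m + 1) v)"
    using comm[OF xC[OF v], of p m] comm[OF v, of p "m + 1"] lop_simps(2)[OF x_lop xC[OF EC[OF v]] lop_simps(1)[OF \<Psi>_lop v]]
    by (simp add: p_def)
  have "?E (x (m + 1) (x m v)) = sc tj (?E (x m (x (m + 1) v)))"
    using r[OF v] lop_simps(3)[OF Elop xC[OF xC[OF v]]] by simp
  then show ?thesis unfolding 1 2 using r[OF EC[OF v]] by (simp add: vs.scale_right_distrib add_ac)
qed

text \<open>This recursion moves phi past x^- while raising the mode of x^-. It keeps all modes of
  the half current positive, which the commutators with single h_{j,n} would not show
  directly.\<close>

lemma ph_x: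
  assumes v: "v \<in> Car V"
  shows "ph 0 (x m v) = sc tj (x m (ph 0 v))"
    and "ph (Suc n) (x m v) = sc tj (ph n (x (m + 1) v)) + sc tj (x m (ph (Suc n) v)) - x (m + 1) (ph n v)"
proof -
  have xC: "\<And>n v. v \<in> Car V \<Longrightarrow> x n v \<in> Car V" using j X_in by (auto simp: x_def)
  have p0: "ph 0 (x m v) = sc tj (x m (ph 0 v))" for m
    unfolding ph_0[OF v] ph_0[OF xC[OF v]] using K_X[OF j j v, of Neg m] by (simp add: x_def tj_powi)
  then show "ph 0 (x m v) = sc tj (x m (ph 0 v))" .
  have phC: "ph n v \<in> Car V" for n using lop_simps(1)[OF ph_lop v] .
  let ?c = "1 / (qi j - inverse (qi j))"
  have S: "\<Psi> (int n + 1) w = sc ?c (ph (Suc n) w)" if "w \<in> Car V" for w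
    using \<Psi>_pos[of "Suc n" w] that by (simp add: add.commute)
  show "ph (Suc n) (x m v) = sc tj (ph n (x (m + 1) v)) + sc tj (x m (ph (Suc n) v)) - x (m + 1) (ph n v)"
  proof (cases "n = 0")
    case False
    have P: "\<Psi> (int n) w = sc ?c (ph n w)" if "w \<in> Car V" for w
      using \<Psi>_pos[of n w] that False by simp
    have "sc ?c (ph (Suc n) (x m v)) + sc ?c (x (m + 1) (ph n v)) = sc ?c (sc tj (ph n (x (m + 1) v)) + sc tj (x m (ph (Suc n) v)))"
      using \<Psi>_x[OF v, of "int n + 1" m] xC v phC
      by (simp add: S P lop_simps(3)[OF x_lop] vs.scale_right_distrib mult.commute)
    then have "ph (Suc n) (x m v) + x (m + 1) (ph n v) = sc tj (ph n (x (m + 1) v)) + sc tj (x m (ph (Suc n) v))"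
      using qjj by (simp only: vs.scale_right_distrib[symmetric] vs.scale_cancel_left) simp
    then show ?thesis by (simp add: algebra_simps)
  next
    \<comment> \<open>The relation now involves \<Psi>_0, which also contains the inverse of k_j.
      Passing that inverse across x^- contributes 1/t, and its two occurrences cancel.\<close>
    case True
    have KiC: "Kinv V j v \<in> Car V" using Kinv_in[OF j v] .
    have Ki: "Kinv V j (x (m + 1) v) = sc (inverse tj) (x (m + 1) (Kinv V j v))"
      using Kinv_X[OF j j v, of Neg "m + 1"] by (simp add: x_def tj_powi power_int_minus)
    have P: "\<Psi> 0 w = sc ?c (ph 0 w - Kinv V j w)" if "w \<in> Car V" for w
      using \<Psi>_0[OF that] .
    have "sc ?c (ph (Suc 0) (x m v)) + sc ?c (x (m + 1) (ph 0 v) - x (m + 1) (Kinv V j v)) =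
       sc ?c (sc tj (ph 0 (x (m + 1) v) - Kinv V j (x (m + 1) v)) + sc tj (x m (ph (Suc 0) v)))"
      using \<Psi>_x[OF v, of "int 0 + 1" m] xC v phC KiC S True vs.subspace_diff[OF subC]
      by (simp add: P lop_simps(3,4)[OF x_lop] vs.scale_right_distrib mult.commute)
    then have "ph (Suc 0) (x m v) + (x (m + 1) (ph 0 v) - x (m + 1) (Kinv V j v)) =
       sc tj (ph 0 (x (m + 1) v) - Kinv V j (x (m + 1) v)) + sc tj (x m (ph (Suc 0) v))"
      using qjj by (simp only: vs.scale_right_distrib[symmetric] vs.scale_cancel_left) simp
    then show ?thesis unfolding True Ki using tj_nz by (simp add: vs.scale_right_diff_distrib algebra_simps)
  qed
qed

lemma XX_sop: "sop XX" and XT_sop: "sop XT" and PH_sop: "sop PH"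
  by (rule cv_sop, rule x_lop) (rule cv_sop, rule lop_scale, rule x_lop, rule cv_sop, rule ph_lop)

text \<open>In series form: X(u) X(u) = (1 + t) X(t u) X(u) - t X(t u) X(t u). Each total degree of
  the modes is one instance of the symmetric sum above.\<close>

lemma XX_XX:
  assumes f: "seq f"
  shows "XX (XX f) = (\<lambda>n. sc (1 + tj) (XT (XX f) n) - sc tj (XT (XT f) n))"
proof
  fix n
  have C: "f k \<in> Car V" for k using f by (simp add: seq_def)
  have xC: "\<And>n v. v \<in> Car V \<Longrightarrow> x n v \<in> Car V" using j X_in by (auto simp: x_def)
  define y where "y s i = x (int i + 1) (x (int (s - i) + 1) (f (n - s)))" for s i
  have 1: "XX (XX f) n = (\<Sum>s\<le>n. \<Sum>i\<le>s. y s i)" by (simp add: cv_cv[OF x_lop x_lop f] y_def)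
  have 2: "XT (XX f) n = (\<Sum>s\<le>n. \<Sum>i\<le>s. sc (tj ^ i) (y s i))"
    using cv_cv[OF lop_scale[OF x_lop] x_lop f] by (simp add: y_def)
  have 3: "XT (XT f) n = (\<Sum>s\<le>n. \<Sum>i\<le>s. sc (tj ^ s) (y s i))"
  proof -
    have "XT (XT f) n = (\<Sum>s\<le>n. \<Sum>i\<le>s. sc (tj ^ i) (x (int i + 1) (sc (tj ^ (s - i)) (x (int (s - i) + 1) (f (n - s))))))"
      by (rule cv_cv[OF lop_scale[OF x_lop] lop_scale[OF x_lop] f])
    also have "\<dots> = (\<Sum>s\<le>n. \<Sum>i\<le>s. sc (tj ^ s) (y s i))"
    proof (intro sum.cong refl)
      fix s i :: nat assume "i \<in> {..s}"
      then have "tj ^ i * tj ^ (s - i) = tj ^ s" by (simp add: power_add[symmetric])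
      then show "sc (tj ^ i) (x (int i + 1) (sc (tj ^ (s - i)) (x (int (s - i) + 1) (f (n - s))))) = sc (tj ^ s) (y s i)"
        by (simp add: y_def lop_simps(3)[OF x_lop xC[OF C]])
    qed
    finally show ?thesis .
  qed
  have "(\<Sum>i\<le>s. sc (1 - (1 + tj) * tj ^ i + tj ^ Suc s) (y s i)) = 0" for s
  proof (rule vs.quadratic_sum[OF tj_1])
    fix a assume a: "a < s"
    have e: "int (s - a) = int s - int a" "int (s - Suc a) = int s - int a - 1" "int (s - 1 - a) = int s - int a - 1" "s - (s - a) = a" "s - (s - 1 - a) = Suc a"
      using a by (auto simp: of_nat_diff)
    have "x (int a + 1 + 1) (x (int s - int a) (f (n - s))) - sc tj (x (int s - int a) (x (int a + 1 + 1) (f (n - s)))) =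
      sc tj (x (int a + 1) (x (int s - int a + 1) (f (n - s)))) - x (int s - int a + 1) (x (int a + 1) (f (n - s)))"
      by (rule quad[OF C])
    then show "y s (Suc a) + y s (s - a) = sc tj (y s a + y s (s - 1 - a))"
      unfolding y_def e by (simp add: vs.scale_right_distrib algebra_simps)
  qed simp
  then have "(\<Sum>s\<le>n. \<Sum>i\<le>s. sc (1 - (1 + tj) * tj ^ i + tj ^ Suc s) (y s i)) = 0" by simp
  then have "(\<Sum>s\<le>n. \<Sum>i\<le>s. y s i) - (\<Sum>s\<le>n. \<Sum>i\<le>s. sc ((1 + tj) * tj ^ i) (y s i)) + (\<Sum>s\<le>n. \<Sum>i\<le>s. sc (tj ^ Suc s) (y s i)) = 0"
    unfolding sum_subtractf[symmetric] sum.distrib[symmetric] by (simp only: vs.scale_left_distrib vs.scale_left_diff_distrib vs.scale_one)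
  then show "XX (XX f) n = sc (1 + tj) (XT (XX f) n) - sc tj (XT (XT f) n)"
    unfolding 1 2 3 by (simp add: vs.scale_sum_right algebra_simps)
qed

text \<open>In series form: phi(u) X(u) = (1 + t) X(t u) phi(u) - X(u) phi(u), again degree by
  degree.\<close>

lemma PH_XX:
  assumes f: "seq f"
  shows "PH (XX f) = (\<lambda>n. sc (1 + tj) (XT (PH f) n) - sc 1 (XX (PH f) n))"
proof
  fix n
  have C: "f k \<in> Car V" for k using f by (simp add: seq_def)
  define \<alpha> where "\<alpha> s i = ph i (x (int (s - i) + 1) (f (n - s)))" for s i
  define \<beta> where "\<beta> s l = x (int (s - l) + 1) (ph l (f (n - s)))" for s l
  have 1: "PH (XX f) n = (\<Sum>s\<le>n. \<Sum>i\<le>s. \<alpha> s i)" by (simp add: cv_cv[OF ph_lop x_lop f] \<alpha>_def)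
  have 2: "XX (PH f) n = (\<Sum>s\<le>n. \<Sum>l\<le>s. \<beta> s l)"
    unfolding cv_cv[OF x_lop ph_lop f] \<beta>_def
    by (rule sum.cong[OF refl], subst sum_atMost_rev) (rule sum.cong, auto)
  have 3: "XT (PH f) n = (\<Sum>s\<le>n. \<Sum>l\<le>s. sc (tj ^ (s - l)) (\<beta> s l))"
    unfolding cv_cv[OF lop_scale[OF x_lop] ph_lop f] \<beta>_def
    by (rule sum.cong[OF refl], subst sum_atMost_rev) (rule sum.cong, auto)
  have "(\<Sum>i\<le>s. \<alpha> s i) = (\<Sum>l\<le>s. sc ((1 + tj) * tj ^ (s - l) - 1) (\<beta> s l))" for s
  proof (rule conjunct2[OF vs.linear_recursion_sum])
    show "\<alpha> s 0 = sc tj (\<beta> s 0)" using ph_x(1)[OF C] by (simp add: \<alpha>_def \<beta>_def)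
    fix i assume i: "i < s"
    then have e: "int (s - Suc i) + 1 = int (s - i)" by simp
    show "\<alpha> s (Suc i) = sc tj (\<alpha> s i) + sc tj (\<beta> s (Suc i)) - \<beta> s i"
      unfolding \<alpha>_def \<beta>_def e using ph_x(2)[OF C, of i "int (s - i)"] by simp
  qed simp
  then show "PH (XX f) n = sc (1 + tj) (XT (PH f) n) - sc 1 (XX (PH f) n)"
    unfolding 1 2 3 by (simp add: vs.scale_sum_right vs.scale_left_diff_distrib sum_subtractf)
qed

text \<open>The t-integer of k; it is nonzero for k > 0 because t = q_j^-2 is not a root of
  unity.\<close>

definition "bj k = (\<Sum>i<k. tj ^ i)"

lemma bj_Suc: "bj (Suc k) = 1 + tj * bj k"
  unfolding bj_def sum.lessThan_Suc_shift by (simp add: sum_distrib_left)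

lemma bj_0: "bj 0 = 0" by (simp add: bj_def)

lemma bj_nz: "0 < k \<Longrightarrow> bj k \<noteq> 0"
proof
  assume "0 < k" "bj k = 0"
  moreover have "(1 - tj) * bj k = 1 - tj ^ k" unfolding bj_def by (rule one_diff_power_eq[symmetric])
  ultimately show False using tj_pow[of k] by auto
qed

lemma seq_pow: "seq f \<Longrightarrow> seq ((XX ^^ k) f)" "seq f \<Longrightarrow> seq ((XT ^^ k) f)" "seq f \<Longrightarrow> seq (PH f)" "seq f \<Longrightarrow> seq (XX f)" "seq f \<Longrightarrow> seq (XT f)"
  using sop_seq[OF sop_pow[OF XX_sop]] sop_seq[OF sop_pow[OF XT_sop]] sop_seq[OF PH_sop] sop_seq[OF XX_sop] sop_seq[OF XT_sop] by blast+

text \<open>Iterating the quadratic relation moves all but at most one of the factors X(u) to the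
  argument t u on the left. This form can absorb the phi terms in the commutator with a power of
  X(u).\<close>

lemma XX_pow:
  "seq f \<Longrightarrow> (XX ^^ Suc k) f = (\<lambda>n. sc (bj (Suc k)) ((XT ^^ k) (XX f) n) - sc (bj (Suc k) - 1) ((XT ^^ Suc k) f n))"
proof (induction k arbitrary: f)
  case 0
  then show ?case by (simp add: bj_Suc bj_0)
next
  case (Suc k)
  note f = seq_pow[OF Suc.prems]
  have "(XX ^^ Suc (Suc k)) f = (XX ^^ Suc k) (XX f)" by (simp only: funpow_Suc_right o_apply)
  also have "\<dots> = (\<lambda>n. sc (bj (Suc k)) ((XT ^^ k) (XX (XX f)) n) - sc (bj (Suc k) - 1) ((XT ^^ Suc k) (XX f) n))"
    by (rule Suc.IH[OF f(4)])
  also have "(XT ^^ k) (XX (XX f)) = (\<lambda>n. sc (1 + tj) ((XT ^^ k) (XT (XX f)) n) - sc tj ((XT ^^ k) (XT (XT f)) n))"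
    unfolding XX_XX[OF Suc.prems] by (rule sop_diff[OF sop_pow[OF XT_sop] seq_pow(5)[OF f(4)] seq_pow(5)[OF f(5)]])
  also have "(XT ^^ k) (XT (XX f)) = (XT ^^ Suc k) (XX f)" by (simp only: funpow_Suc_right o_apply)
  also have "(XT ^^ k) (XT (XT f)) = (XT ^^ Suc (Suc k)) f" by (simp only: funpow_Suc_right o_apply)
  finally show ?case
    by (rule trans) (rule ext, simp add: bj_Suc[of "Suc k"] algebra_simps vs.scale_left_distrib vs.scale_left_diff_distrib vs.scale_right_diff_distrib vs.scale_right_distrib del: funpow.simps)
qed

text \<open>The operator (q_j - q_j^-1) u x^+_{j,0}. The factor u aligns degrees: the commutator
  with x^-_{j,i+1} is phi_{i+1}, whereas x^-_{j,i+1} stands at u^i in X(u).\<close>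

definition DD :: "(nat \<Rightarrow> 'v) \<Rightarrow> nat \<Rightarrow> 'v" where
  "DD f n = (case n of 0 \<Rightarrow> 0 | Suc k \<Rightarrow> sc (qi j - inverse (qi j)) (X V Pos j 0 (f k)))"

abbreviation "KK f \<equiv> (\<lambda>n. K V j (f n))"

lemma KK_seq: "seq f \<Longrightarrow> seq (KK f)" and DD_seq: "seq f \<Longrightarrow> seq (DD f)"
  using j K_in X_in vs.subspace_scale[OF subC] vs.subspace_0[OF subC] by (auto simp: seq_def DD_def split: nat.split)

lemma KK_XX: "seq f \<Longrightarrow> KK (XX f) = (\<lambda>n. sc tj (XX (KK f) n))"
proof
  fix n assume "seq f"
  then have C: "f k \<in> Car V" for k by (simp add: seq_def)
  have xC: "\<And>n v. v \<in> Car V \<Longrightarrow> x n v \<in> Car V" using j X_in by (auto simp: x_def)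
  have "K V j (XX f n) = (\<Sum>i\<le>n. K V j (x (int i + 1) (f (n - i))))"
  proof -
    have "hh (j, 0) (\<Sum>i\<le>n. x (int i + 1) (f (n - i))) = (\<Sum>i\<le>n. hh (j, 0) (x (int i + 1) (f (n - i))))"
      by (rule T_sum) (use j xC C in auto)
    then show ?thesis by (simp add: hh_def cv_def)
  qed
  then show "K V j (XX f n) = sc tj (XX (KK f) n)"
    using ph_x(1)[OF C] xC C by (simp add: cv_def vs.scale_sum_right ph_0)
qed

text \<open>The commutator of D with X(u) is phi(u) - k_j, the series phi^+ without its constant
  term.\<close>

lemma DD_XX:
  assumes f: "seq f"
  shows "DD (XX f) = (\<lambda>n. XX (DD f) n + PH f n - K V j (f n))"
proof
  fix n
  have C: "f k \<in> Car V" for k using f by (simp add: seq_def)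
  have xC: "\<And>n v. v \<in> Car V \<Longrightarrow> x n v \<in> Car V" using j X_in by (auto simp: x_def)
  have EC: "X V Pos j 0 v \<in> Car V" if "v \<in> Car V" for v using that j X_in by blast
  let ?c = "qi j - inverse (qi j)"
  show "DD (XX f) n = XX (DD f) n + PH f n - K V j (f n)"
  proof (cases n)
    case 0
    have "x 1 0 = 0" using X_zero[OF j] by (simp add: x_def)
    then show ?thesis using 0 C by (simp add: DD_def cv_def ph_0)
  next
    case (Suc k)
    have "sc ?c (X V Pos j 0 (x (int i + 1) v)) = x (int i + 1) (sc ?c (X V Pos j 0 v)) + ph (Suc i) v" if "v \<in> Car V" for i v
    proof -
      have "\<Psi> (0 + (int i + 1)) v = sc (1 / ?c) (ph (Suc i) v)" using \<Psi>_pos[of "Suc i" v] that by (simp add: add.commute)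
      then show ?thesis
        using comm[OF that, of 0 "int i + 1"] qjj lop_simps(3)[OF x_lop EC[OF that]] by (simp add: vs.scale_right_distrib)
    qed
    note e = this
    have "DD (XX f) n = (\<Sum>i\<le>k. sc ?c (X V Pos j 0 (x (int i + 1) (f (k - i)))))"
    proof -
      have "X V Pos j 0 (\<Sum>i\<le>k. x (int i + 1) (f (k - i))) = (\<Sum>i\<le>k. X V Pos j 0 (x (int i + 1) (f (k - i))))"
        by (rule X_sum[OF j]) (use xC C in auto)
      then show ?thesis by (simp add: Suc DD_def cv_def vs.scale_sum_right)
    qed
    also have "\<dots> = (\<Sum>i\<le>k. x (int i + 1) (sc ?c (X V Pos j 0 (f (k - i))))) + (\<Sum>i\<le>k. ph (Suc i) (f (k - i)))"
      by (simp add: e[OF C] sum.distrib)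
    also have "(\<Sum>i\<le>k. x (int i + 1) (sc ?c (X V Pos j 0 (f (k - i))))) = XX (DD f) n"
    proof -
      have z: "x m 0 = 0" for m using X_zero[OF j] by (simp add: x_def)
      have "XX (DD f) n = (\<Sum>i\<le>k. x (int i + 1) (DD f (Suc k - i)))" unfolding Suc cv_def by (simp add: DD_def z)
      also have "\<dots> = (\<Sum>i\<le>k. x (int i + 1) (sc ?c (X V Pos j 0 (f (k - i)))))"
        by (intro sum.cong refl) (simp add: DD_def Suc_diff_le)
      finally show ?thesis by simp
    qed
    also have "(\<Sum>i\<le>k. ph (Suc i) (f (k - i))) = PH f n - K V j (f n)"
      unfolding Suc cv_def sum.atMost_Suc_shift using C by (simp add: ph_0)
    finally show ?thesis by simp
  qed
qed

text \<open>With b the t-integer of k + 1: D X(u)^(k+1) = X(u)^(k+1) D + b (X(t u)^k phi(u) - X(u)^k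
  k_j). In the induction step the mixed term X(t u)^k X(u) phi(u) is cancelled by the formula for
  powers.\<close>

lemma DD_XX_pow:
  "seq f \<Longrightarrow> DD ((XX ^^ Suc k) f) = (\<lambda>n. (XX ^^ Suc k) (DD f) n + sc (bj (Suc k)) ((XT ^^ k) (PH f) n - (XX ^^ k) (KK f) n))"
proof (induction k arbitrary: f)
  case 0
  then show ?case using DD_XX[OF 0] by (simp add: bj_Suc bj_0 algebra_simps)
next
  case (Suc k)
  note f = seq_pow[OF Suc.prems]
  note s1 = sop_pow[OF XX_sop] and s2 = sop_pow[OF XT_sop]
  have "DD ((XX ^^ Suc (Suc k)) f) = DD ((XX ^^ Suc k) (XX f))" by (simp only: funpow_Suc_right o_apply)
  also have "\<dots> = (\<lambda>n. (XX ^^ Suc k) (DD (XX f)) n + sc (bj (Suc k)) ((XT ^^ k) (PH (XX f)) n - (XX ^^ k) (KK (XX f)) n))"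
    by (rule Suc.IH[OF f(4)])
  also have "(XX ^^ Suc k) (DD (XX f)) = (\<lambda>n. (XX ^^ Suc (Suc k)) (DD f) n + (XX ^^ Suc k) (PH f) n - (XX ^^ Suc k) (KK f) n)"
  proof -
    have "DD (XX f) = (\<lambda>n. sc 1 (sc 1 (XX (DD f) n) + sc 1 (PH f n)) - sc 1 (KK f n))" using DD_XX[OF Suc.prems] by simp
    then have "(XX ^^ Suc k) (DD (XX f)) = (\<lambda>n. sc 1 ((XX ^^ Suc k) (\<lambda>n. sc 1 (XX (DD f) n) + sc 1 (PH f n)) n) - sc 1 ((XX ^^ Suc k) (KK f) n))"
      using sop_diff[OF s1 seq_comb[OF seq_pow(4)[OF DD_seq[OF Suc.prems]] f(3)] KK_seq[OF Suc.prems], of "Suc k" 1 1 1 1] by (simp only:)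
    also have "(XX ^^ Suc k) (\<lambda>n. sc 1 (XX (DD f) n) + sc 1 (PH f n)) = (\<lambda>n. sc 1 ((XX ^^ Suc k) (XX (DD f)) n) + sc 1 ((XX ^^ Suc k) (PH f) n))"
      by (rule sop_lin[OF s1 seq_pow(4)[OF DD_seq[OF Suc.prems]] f(3)])
    also have "(XX ^^ Suc k) (XX (DD f)) = (XX ^^ Suc (Suc k)) (DD f)" by (simp only: funpow_Suc_right o_apply)
    finally show ?thesis by (simp only: vs.scale_one)
  qed
  also have "(XT ^^ k) (PH (XX f)) = (\<lambda>n. sc (1 + tj) ((XT ^^ Suc k) (PH f) n) - sc 1 ((XT ^^ k) (XX (PH f)) n))"
    unfolding PH_XX[OF Suc.prems] sop_diff[OF s2 seq_pow(5)[OF f(3)] seq_pow(4)[OF f(3)]] by (simp only: funpow_Suc_right o_apply)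
  also have "(XX ^^ k) (KK (XX f)) = (\<lambda>n. sc tj ((XX ^^ Suc k) (KK f) n))"
    unfolding KK_XX[OF Suc.prems] sop_scale[OF s1 seq_pow(4)[OF KK_seq[OF Suc.prems]]] by (simp only: funpow_Suc_right o_apply)
  finally have e: "DD ((XX ^^ Suc (Suc k)) f) = (\<lambda>n. (XX ^^ Suc (Suc k)) (DD f) n + (XX ^^ Suc k) (PH f) n - (XX ^^ Suc k) (KK f) n +
    sc (bj (Suc k)) (sc (1 + tj) ((XT ^^ Suc k) (PH f) n) - sc 1 ((XT ^^ k) (XX (PH f)) n) - sc tj ((XX ^^ Suc k) (KK f) n)))" .
  show ?case
  proof
    fix n
    have p: "(XX ^^ Suc k) (PH f) n = sc (bj (Suc k)) ((XT ^^ k) (XX (PH f)) n) - sc (bj (Suc k) - 1) ((XT ^^ Suc k) (PH f) n)"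
      using fun_cong[OF XX_pow[OF f(3), of k]] .
    show "DD ((XX ^^ Suc (Suc k)) f) n = (XX ^^ Suc (Suc k)) (DD f) n + sc (bj (Suc (Suc k))) ((XT ^^ Suc k) (PH f) n - (XX ^^ Suc k) (KK f) n)"
      unfolding e p bj_Suc[of "Suc k"]
      by (simp add: algebra_simps vs.scale_left_distrib vs.scale_left_diff_distrib vs.scale_right_diff_distrib vs.scale_right_distrib del: funpow.simps)
  qed
qed

end

section \<open>Distinct eigenvalues and generalized eigenspaces\<close>

context lin_ops
begin

lemma distinct_eigenvalues_finite:
  assumes l: "l \<in> A" and u: "\<And>n :: nat. u n \<in> Car" "\<And>n. T l (u n) = scl (\<kappa> n) (u n)" and k: "inj \<kappa>"
  shows "\<exists>n. u n = 0"
proof (rule ccontr)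
  assume "\<not> ?thesis"
  then have nz: "u n \<noteq> 0" for n by blast
  interpret S: lin_ops scl Car "{l}" T
  proof unfold_locales
    show "subspace Car" by (rule subspace_Car)
    show "\<exists>E. finite E \<and> Car \<subseteq> span E" by (rule finite_Car)
    fix l' v w c assume "l' \<in> {l}"
    then have l': "l' \<in> A" using l by simp
    show "v \<in> Car \<Longrightarrow> T l' v \<in> Car" by (rule T_in[OF l'])
    show "v \<in> Car \<Longrightarrow> w \<in> Car \<Longrightarrow> T l' (v + w) = T l' v + T l' w" by (rule T_add[OF l'])
    show "v \<in> Car \<Longrightarrow> T l' (scl c v) = scl c (T l' v)" by (rule T_scale[OF l'])
  qed
  have new: "u n \<notin> span (u ` {..<n})" for n
  proof
    assume "u n \<in> span (u ` {..<n})"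
    note un = this
    have "u n \<in> {0}"
    proof (rule S.span_eigenvectors_other[where \<eta> = "\<lambda>_. \<kappa> n" and SS = "u ` {..<n}" and y = "u n"])
      show "S.stable {0}" by (rule S.stable_zero)
      fix s assume "s \<in> u ` {..<n}"
      then obtain i where i: "i < n" "s = u i" by blast
      then show "s \<in> Car \<and> (\<exists>\<chi>. S.eig {0} \<chi> s \<and> (\<exists>l\<in>{l}. \<chi> l \<noteq> \<kappa> n))"
        using u inj_eq[OF k, of i n] by (intro conjI exI[of _ "\<lambda>_. \<kappa> i"]) (simp_all add: S.eig_def)
    qed (use u un in \<open>simp_all add: S.eig_def\<close>)
    then show False using nz by simp
  qed
  have "independent (u ` {..<n}) \<and> card (u ` {..<n}) = n" for n
  proof (induction n)
    case (Suc n)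
    have e: "u ` {..<Suc n} = insert (u n) (u ` {..<n})" by (simp add: lessThan_Suc)
    have "u n \<notin> u ` {..<n}" using new[of n] span_base[of "u n" "u ` {..<n}"] by argo
    moreover have "independent (insert (u n) (u ` {..<n}))" using Suc new[of n] by (intro independent_insertI) auto
    ultimately show ?case unfolding e using Suc by simp
  qed (simp add: independent_empty)
  then have ind: "independent (u ` {..<n})" "card (u ` {..<n}) = n" for n by auto
  obtain E where E: "finite E" "Car \<subseteq> span E" using finite_Car by blast
  have "u ` {..<Suc (card E)} \<subseteq> span E" using u(1) E(2) by blast
  then have "card (u ` {..<Suc (card E)}) \<le> card E" using independent_span_bound[OF E(1) ind(1)] by blast
  then show False using ind(2)[of "Suc (card E)"] by simp
qed

end

context comm_ops
begin

definition gen :: "('l \<Rightarrow> complex) \<Rightarrow> 'v set" where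
  "gen \<eta> = {v \<in> Car. \<forall>l\<in>A. \<exists>n. (shf l (\<eta> l) ^^ n) v = 0}"

lemma shf_pow_mono: "l \<in> A \<Longrightarrow> (shf l a ^^ n) v = 0 \<Longrightarrow> (shf l a ^^ (n + k)) v = 0"
proof -
  assume a: "l \<in> A" "(shf l a ^^ n) v = 0"
  have "(shf l a ^^ (k + n)) v = 0" unfolding funpow_add o_apply a(2) by (rule shf_zero[OF a(1)])
  then show ?thesis by (simp only: add.commute)
qed

lemma gen_stable: "stable (gen \<eta>)"
  unfolding stable_def
proof (intro conjI ballI)
  show "subspace (gen \<eta>)"
  proof (rule subspaceI)
    show "0 \<in> gen \<eta>" using shf_zero subspace_0[OF subspace_Car] by (auto simp: gen_def)
    fix v w assume vw: "v \<in> gen \<eta>" "w \<in> gen \<eta>"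
    have "\<exists>n. (shf l (\<eta> l) ^^ n) (v + w) = 0" if l: "l \<in> A" for l
    proof -
      obtain n k where nk: "(shf l (\<eta> l) ^^ n) v = 0" "(shf l (\<eta> l) ^^ k) w = 0" using vw l unfolding gen_def by blast
      have "(shf l (\<eta> l) ^^ (n + k)) (v + w) = 0"
      proof -
        have C: "v \<in> Car" "w \<in> Car" using vw by (simp_all add: gen_def)
        have "(shf l (\<eta> l) ^^ (n + k)) w = 0" using shf_pow_mono[OF l nk(2), of n] by (simp only: add.commute)
        then show ?thesis using shf_pow_mono[OF l nk(1), of k] by (simp only: shf_pow_add[OF l C] add_0)
      qed
      then show ?thesis by blast
    qed
    then show "v + w \<in> gen \<eta>" using vw subspace_add[OF subspace_Car] by (simp add: gen_def)
  next
    fix c v assume v: "v \<in> gen \<eta>"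
    have "\<exists>n. (shf l (\<eta> l) ^^ n) (scl c v) = 0" if l: "l \<in> A" for l
    proof -
      obtain n where "(shf l (\<eta> l) ^^ n) v = 0" using v l by (auto simp: gen_def)
      then have "(shf l (\<eta> l) ^^ n) (scl c v) = 0" using shf_pow_scale[OF l, of v] v by (simp add: gen_def)
      then show ?thesis by blast
    qed
    then show "scl c v \<in> gen \<eta>" using v subspace_scale[OF subspace_Car] by (simp add: gen_def)
  qed
  show "gen \<eta> \<subseteq> Car" by (auto simp: gen_def)
  fix l' v assume l': "l' \<in> A" and v: "v \<in> gen \<eta>"
  have "\<exists>n. (shf l (\<eta> l) ^^ n) (T l' v) = 0" if l: "l \<in> A" for l
  proof -
    obtain n where "(shf l (\<eta> l) ^^ n) v = 0" using v l by (auto simp: gen_def)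
    then have "(shf l (\<eta> l) ^^ n) (T l' v) = 0" using shf_pow_comm[OF l l', of v] v l' by (simp add: gen_def)
    then show ?thesis by blast
  qed
  then show "T l' v \<in> gen \<eta>" using v l' T_in by (simp add: gen_def)
qed

lemma gen_eigenvector:
  assumes "v \<in> gen \<eta>" "v \<noteq> 0"
  shows "\<exists>z\<in>gen \<eta>. z \<noteq> 0 \<and> eig {0} \<eta> z"
proof -
  have "\<not> gen \<eta> \<subseteq> {0}" using assms by blast
  then obtain z \<chi> where z: "z \<in> gen \<eta>" "z \<notin> {0}" "eig {0} \<chi> z"
    using joint_eigenvector_mod[OF gen_stable stable_zero] by blast
  have "\<chi> l = \<eta> l" if l: "l \<in> A" for l
  proof (rule ccontr)
    assume ne: "\<chi> l \<noteq> \<eta> l"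
    obtain n where n: "(shf l (\<eta> l) ^^ n) z = 0" using z l by (auto simp: gen_def)
    have "z \<in> Car" "T l z - scl (\<chi> l) z \<in> {0}" using z l by (auto simp: gen_def eig_def)
    then have "(shf l (\<eta> l) ^^ n) z - scl ((\<chi> l - \<eta> l) ^ n) z \<in> {0}" by (rule shf_pow_eig[OF l stable_zero])
    then have "scl ((\<chi> l - \<eta> l) ^ n) z = 0" using n by simp
    then show False using ne z(2) by simp
  qed
  then have "eig {0} \<eta> z" using z(3) by (simp add: eig_def)
  then show ?thesis using z by blast
qed

end

context qmod_vertex
begin

text \<open>
  If \<open>g\<close> is an l-weight vector modulo \<open>U\<close> killed by \<open>x\<^sup>+\<^sub>0\<close>, then \<open>(x\<^sup>+\<^sub>0)\<^sup>r (x\<^sup>-\<^sub>1)\<^sup>r g\<close> is a nonzero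
  multiple of \<open>P\<^sub>r g\<close>, where \<open>P = Q(q\<^sub>j u) / R(q\<^sub>j u)\<close>. Since \<open>x\<^sup>-\<^sub>1\<close> acts nilpotently, \<open>P\<close> is a
  polynomial, so that \<open>R = 1\<close>.
\<close>

lemma highest_j_dominant:
  assumes m: "m \<in> monoms D" and U: "stab1 j U" and UX: "\<And>n u. u \<in> U \<Longrightarrow> x n u \<in> U" "\<And>u. u \<in> U \<Longrightarrow> X V Pos j 0 u \<in> U"
    and g: "g \<in> Car V" "g \<notin> U" "X V Pos j 0 g \<in> U" "\<And>n. hh (j, n) g - sc (hchar D m j n) g \<in> U" "K V j g = sc \<kappa> g"
  shows "j_dominant j m"
proof -
  have sU: "vs.subspace U" and UC: "U \<subseteq> Car V" using U by (auto simp: stab1_def)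
  define P where "P = Pfps (qi j) m j"
  \<comment> \<open>The series P(u) g. Modulo \<open>U\<close>, phi(u) maps it to k' P(t u) g, so
    each coefficient of P is only rescaled; this is the reason for multiplying by P.\<close>
  define f where "f n = sc (P $ n) g" for n
  define k' where "k' = q powi (int (rr D j) * wt m j)"
  have k'0: "k' \<noteq> 0" using q_nz by (simp add: k'_def)
  have f: "seq f" using g(1) vs.subspace_scale[OF subC] by (simp add: seq_def f_def)
  have uXX1: "\<forall>n. XX h n \<in> U" if "\<forall>n. h n \<in> U" for h
    unfolding cv_def using that by (intro allI vs.subspace_sum[OF sU] UX(1)) blast
  have uXT1: "\<forall>n. XT h n \<in> U" if "\<forall>n. h n \<in> U" for h
    unfolding cv_def using that by (intro allI vs.subspace_sum[OF sU] vs.subspace_scale[OF sU] UX(1)) blast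
  have uXX: "\<forall>n. (XX ^^ k) h n \<in> U" if "\<forall>n. h n \<in> U" for h k
  proof (induction k)
    case (Suc k)
    then show ?case unfolding funpow.simps o_apply by (rule uXX1)
  qed (use that in simp)
  have uXT: "\<forall>n. (XT ^^ k) h n \<in> U" if "\<forall>n. h n \<in> U" for h k
  proof (induction k)
    case (Suc k)
    then show ?case unfolding funpow.simps o_apply by (rule uXT1)
  qed (use that in simp)
  have cong: "(L ^^ k) a n - (L ^^ k) b n \<in> U"
    if L: "sop L" "\<And>h. \<forall>n. h n \<in> U \<Longrightarrow> \<forall>n. (L ^^ k) h n \<in> U" and ab: "seq a" "seq b" "\<And>n. a n - b n \<in> U" for L k a b n
  proof -
    have "(L ^^ k) (\<lambda>n. sc 1 (a n) - sc 1 (b n)) = (\<lambda>n. sc 1 ((L ^^ k) a n) - sc 1 ((L ^^ k) b n))"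
      by (rule sop_diff[OF sop_pow[OF L(1)] ab(1,2)])
    then have "(L ^^ k) (\<lambda>n. a n - b n) n = (L ^^ k) a n - (L ^^ k) b n" by (simp add: fun_eq_iff)
    moreover have "\<forall>n. (L ^^ k) (\<lambda>n. a n - b n) n \<in> U" by (rule L(2)) (use ab(3) in blast)
    ultimately show ?thesis by metis
  qed
  have uDD: "DD f n \<in> U" for n
    using vs.subspace_0[OF sU] vs.subspace_scale[OF sU g(3)] vs.subspace_scale[OF sU]
    by (cases n) (simp_all add: DD_def f_def X_scale[OF j g(1)])
  have phg: "ph i g - sc (gamma D m Pos j i) g \<in> U" for i
    using phi_eig[OF j U g(1) m g(4), of Pos i] by (simp add: ph_def)
  have PHf: "PH f n - sc k' (sc (tj ^ n) (f n)) \<in> U" for n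
  proof -
    have "(\<Sum>i\<le>n. gamma D m Pos j i * P $ (n - i)) = k' * (tj ^ n * P $ n)"
      unfolding P_def gamma_Pfps degree_Q_R[OF m] k'_def tj_def ..
    then have "sc k' (sc (tj ^ n) (f n)) = (\<Sum>i\<le>n. sc (P $ (n - i)) (sc (gamma D m Pos j i) g))"
      by (simp add: f_def vs.scale_sum_left[symmetric] mult.commute)
    moreover have "PH f n = (\<Sum>i\<le>n. sc (P $ (n - i)) (ph i g))"
      unfolding cv_def f_def using lop_simps(3)[OF ph_lop g(1)] by simp
    ultimately have "PH f n - sc k' (sc (tj ^ n) (f n)) = (\<Sum>i\<le>n. sc (P $ (n - i)) (ph i g - sc (gamma D m Pos j i) g))"
      by (simp only: sum_subtractf[symmetric] vs.scale_right_diff_distrib)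
    also have "\<dots> \<in> U" using phg by (intro vs.subspace_sum[OF sU] vs.subspace_scale[OF sU])
    finally show ?thesis .
  qed
  have KKf: "K V j (f n) - sc k' (f n) \<in> U" for n
  proof -
    have "sc (P $ n) (hh (j, 0) g - sc (hchar D m j 0) g) \<in> U" using g(4) vs.subspace_scale[OF sU] by blast
    then show ?thesis using j g(1) by (simp add: f_def hh_def hchar_def k'_def K_scale vs.scale_right_diff_distrib mult.commute)
  qed
  have XTS: "XT (\<lambda>n. sc (tj ^ n) (h n)) = (\<lambda>n. sc (tj ^ n) (XX h n))" if "seq h" for h
  proof
    fix n
    have "sc (tj ^ i) (x (int i + 1) (sc (tj ^ (n - i)) (h (n - i)))) = sc (tj ^ n) (x (int i + 1) (h (n - i)))" if "i \<le> n" for i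
    proof -
      have "tj ^ i * tj ^ (n - i) = tj ^ n" using that by (simp add: power_add[symmetric])
      moreover have "h (n - i) \<in> Car V" using \<open>seq h\<close> by (simp add: seq_def)
      ultimately show ?thesis by (simp add: lop_simps(3)[OF x_lop])
    qed
    then show "XT (\<lambda>n. sc (tj ^ n) (h n)) n = sc (tj ^ n) (XX h n)"
      unfolding cv_def vs.scale_sum_right by (intro sum.cong refl) simp
  qed
  have XTS_pow: "(XT ^^ k) (\<lambda>n. sc (tj ^ n) (h n)) = (\<lambda>n. sc (tj ^ n) ((XX ^^ k) h n))" if "seq h" for h k
    using that
  proof (induction k arbitrary: h)
    case (Suc k)
    then show ?case unfolding funpow_Suc_right o_apply XTS[OF Suc.prems] using Suc.IH[OF seq_pow(4)[OF Suc.prems]] by simp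
  qed simp
  have Sf: "seq (\<lambda>n. sc (tj ^ n) (f n))" "seq (\<lambda>n. sc k' (sc (tj ^ n) (f n)))" "seq (\<lambda>n. sc k' (f n))"
    using f vs.subspace_scale[OF subC] by (simp_all add: seq_def)
  have alg: "(a + sc b (p - c)) - sc (b * k' * (e - 1)) F = a + sc b ((p - sc k' (sc e F)) - (c - sc k' F))" for a p c F b e
    by (simp add: vs.scale_right_diff_distrib vs.scale_left_diff_distrib right_diff_distrib mult.assoc)
  have main: "DD ((XX ^^ Suc k) f) n - sc (bj (Suc k) * k' * (tj ^ n - 1)) ((XX ^^ k) f n) \<in> U" for k n
  proof -
    have 1: "(XX ^^ Suc k) (DD f) n \<in> U" using uXX uDD by blast
    have "(XT ^^ k) (PH f) n - (XT ^^ k) (\<lambda>n. sc k' (sc (tj ^ n) (f n))) n \<in> U"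
      by (rule cong[OF XT_sop uXT seq_pow(3)[OF f] Sf(2) PHf])
    then have 2: "(XT ^^ k) (PH f) n - sc k' (sc (tj ^ n) ((XX ^^ k) f n)) \<in> U"
      unfolding sop_scale[OF sop_pow[OF XT_sop] Sf(1)] XTS_pow[OF f] .
    have "(XX ^^ k) (KK f) n - (XX ^^ k) (\<lambda>n. sc k' (f n)) n \<in> U"
      by (rule cong[OF XX_sop uXX KK_seq[OF f] Sf(3) KKf])
    then have 3: "(XX ^^ k) (KK f) n - sc k' ((XX ^^ k) f n) \<in> U"
      unfolding sop_scale[OF sop_pow[OF XX_sop] f] .
    have "DD ((XX ^^ Suc k) f) n - sc (bj (Suc k) * k' * (tj ^ n - 1)) ((XX ^^ k) f n) =
      (XX ^^ Suc k) (DD f) n + sc (bj (Suc k)) (((XT ^^ k) (PH f) n - sc k' (sc (tj ^ n) ((XX ^^ k) f n)))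
         - ((XX ^^ k) (KK f) n - sc k' ((XX ^^ k) f n)))"
      unfolding DD_XX_pow[OF f] by (rule alg)
    also have "\<dots> \<in> U" by (intro vs.subspace_add[OF sU 1] vs.subspace_scale[OF sU] vs.subspace_diff[OF sU] 2 3)
    finally show ?thesis .
  qed
  \<comment> \<open>As x^+_0 preserves \<open>U\<close>, the relation trades one factor X(u) for one
    degree in u. The scalar is nonzero since neither the t-integer nor t^(n+1) - 1 vanishes.\<close>
  have step: "(XX ^^ k) f (Suc n) \<in> U" if a: "(XX ^^ Suc k) f n \<in> U" for k n
  proof -
    have "DD ((XX ^^ Suc k) f) (Suc n) \<in> U"
      using UX(2)[OF a] vs.subspace_scale[OF sU] by (simp add: DD_def del: funpow.simps)
    then have "sc (bj (Suc k) * k' * (tj ^ Suc n - 1)) ((XX ^^ k) f (Suc n)) \<in> U"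
      using vs.mem_subspace_cancel[OF sU main[of k "Suc n"]] by blast
    moreover have "bj (Suc k) * k' * (tj ^ Suc n - 1) \<noteq> 0" using bj_nz[of "Suc k"] k'0 tj_pow[of "Suc n"] by simp
    ultimately show ?thesis using vs.scale_mem_iff[OF sU] by blast
  qed
  have down: "(XX ^^ k) f n \<in> U \<Longrightarrow> f (n + k) \<in> U" for k n
  proof (induction k arbitrary: n)
    case (Suc k)
    show ?case using Suc.IH[OF step[OF Suc.prems]] by simp
  qed simp
  \<comment> \<open>The constant coefficient sees only the first mode of X(u) and P(0) = 1, so it is
    the power of x^-_1 applied to g.\<close>
  have XX0: "(XX ^^ k) f 0 = (x 1 ^^ k) g" for k
  proof (induction k)
    case (Suc k)
    have "(XX ^^ Suc k) f 0 = x 1 ((XX ^^ k) f 0)"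
      by (subst funpow.simps, subst o_apply, subst cv_def) simp
    then show ?case using Suc by simp
  qed (simp add: f_def P_def Pfps_0)
  have xpC: "(x 1 ^^ k) g \<in> Car V" for k by (induction k) (use g(1) j X_in in \<open>auto simp: x_def\<close>)
  have xpK: "K V j ((x 1 ^^ k) g) = sc (\<kappa> * tj ^ k) ((x 1 ^^ k) g)" for k
  proof (induction k)
    case (Suc k)
    then show ?case using ph_x(1)[OF xpC[of k], of 1] xpC[of "Suc k"] xpC[of k]
      by (simp add: ph_0 lop_simps(3)[OF x_lop] mult_ac)
  qed (use g(5) in simp)
  have k0: "\<kappa> \<noteq> 0"
  proof
    assume "\<kappa> = 0"
    then have "g = 0" using g(5) Kinv_K[OF g(1) j] Kinv_zero[OF j] by simp
    then show False using g(2) vs.subspace_0[OF sU] by simp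
  qed
  have "tj ^ a \<noteq> tj ^ b" if "a < b" for a b
  proof
    assume "tj ^ a = tj ^ b"
    moreover have "tj ^ b = tj ^ a * tj ^ (b - a)" using that by (simp add: power_add[symmetric])
    ultimately have "tj ^ (b - a) = 1" using tj_nz by simp
    then show False using tj_pow[of "b - a"] that by simp
  qed
  note ne = this
  \<comment> \<open>The vectors obtained by powers of x^-_1 have pairwise different k_j eigenvalues,
    so finite dimension forces one of them to vanish.\<close>
  have "inj (\<lambda>k. \<kappa> * tj ^ k)"
  proof (rule injI)
    fix a b assume "\<kappa> * tj ^ a = \<kappa> * tj ^ b"
    then have "tj ^ a = tj ^ b" using k0 by simp
    then show "a = b" using ne[of a b] ne[of b a] by (cases a b rule: linorder_cases) auto
  qed
  then have "\<exists>n. (x 1 ^^ n) g = 0"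
    using distinct_eigenvalues_finite[of "(j, 0)" "\<lambda>k. (x 1 ^^ k) g" "\<lambda>k. \<kappa> * tj ^ k"] j xpC xpK by (simp add: hh_def)
  then obtain r0 where r0: "(x 1 ^^ r0) g = 0" by blast
  have "P $ r = 0" if "r0 \<le> r" for r
  proof -
    have "(x 1 ^^ (r0 + k)) g = 0" for k
      by (induction k) (use r0 X_zero[OF j] in \<open>auto simp: x_def\<close>)
    then have "(x 1 ^^ r) g = 0" using that by (metis le_add_diff_inverse)
    then have "(XX ^^ r) f 0 \<in> U" using XX0 vs.subspace_0[OF sU] by simp
    then have "f r \<in> U" using down[of r 0] by simp
    then show ?thesis using vs.scale_mem_iff[OF sU] g(2) unfolding f_def by blast
  qed
  then show ?thesis using j_dominant_Pfps[OF m qi_nz, of r0 j] by (simp add: P_def)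
qed

end

section \<open>The operators phi as a commuting family and l-weight spaces\<close>

context qmod
begin

lemma hcomp_comm:
  assumes i: "i \<in> Idx D" and T: "\<And>v. v \<in> Car V \<Longrightarrow> S v \<in> Car V" "\<And>n v. v \<in> Car V \<Longrightarrow> S (hh (i, n) v) = hh (i, n) (S v)" and v: "v \<in> Car V"
  shows "S (hcomp i s ms v) = hcomp i s ms (S v)"
  by (induction ms) (use hcomp_in[OF stab1_Car[OF i] v] T(2) in \<open>auto simp: hcomp_Cons hcomp_Nil\<close>)

lemma phi_comm_op:
  assumes i: "i \<in> Idx D" and S: "lop S" "\<And>n v. v \<in> Car V \<Longrightarrow> S (hh (i, n) v) = hh (i, n) (S v)"
    "\<And>v. v \<in> Car V \<Longrightarrow> S (Kinv V i v) = Kinv V i (S v)" and v: "v \<in> Car V"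
  shows "S (phi D V s i (sg s * int n) v) = phi D V s i (sg s * int n) (S v)"
proof -
  have C: "\<And>v. v \<in> Car V \<Longrightarrow> S v \<in> Car V" using S(1) by (simp add: lop_def)
  have Ks: "S (Ks s i v) = Ks s i (S v)" if "v \<in> Car V" for v
    using S(2)[OF that, of 0] S(3)[OF that] by (cases s) (simp_all add: Ks_def hh_def)
  have "S (phisum s i n v) = (\<Sum>ms | 0 \<notin> set ms \<and> sum_list ms = n. S (sc (of_int (sg s) ^ length ms / fact (length ms)) (hcomp i s ms v)))"
    unfolding phisum_def
    by (rule lop_sum[OF S(1)]) (use hcomp_in[OF stab1_Car[OF i] v] vs.subspace_scale[OF subC] in blast)
  also have "\<dots> = phisum s i n (S v)"
    unfolding phisum_def
  proof (rule sum.cong[OF refl])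
    fix ms
    have "S (sc c (hcomp i s ms v)) = sc c (S (hcomp i s ms v))" for c
      using S(1) hcomp_in[OF stab1_Car[OF i] v] unfolding lop_def by blast
    then show "S (sc (of_int (sg s) ^ length ms / fact (length ms)) (hcomp i s ms v)) = sc (of_int (sg s) ^ length ms / fact (length ms)) (hcomp i s ms (S v))"
      using hcomp_comm[OF i C S(2) v] by simp
  qed
  finally show ?thesis unfolding phi_Ks[OF i v] phi_Ks[OF i C[OF v]] using Ks[OF phisum_in[OF stab1_Car[OF i] v]] by simp
qed

lemma hh_lop: "i \<in> Idx D \<Longrightarrow> lop (hh (i, n))" and Kinv_lop: "i \<in> Idx D \<Longrightarrow> lop (Kinv V i)"
  by (simp_all add: lop_def hh_in hh_add hh_scale Kinv_in Kinv_add Kinv_scale)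

lemma Kinv_Kinv: "i \<in> Idx D \<Longrightarrow> k \<in> Idx D \<Longrightarrow> v \<in> Car V \<Longrightarrow> Kinv V i (Kinv V k v) = Kinv V k (Kinv V i v)"
proof -
  assume a: "i \<in> Idx D" "k \<in> Idx D" "v \<in> Car V"
  have "Kinv V i (Kinv V k v) = Kinv V k (K V k (Kinv V i (Kinv V k v)))" using a by (simp add: Kinv_K Kinv_in)
  also have "K V k (Kinv V i (Kinv V k v)) = Kinv V i (K V k (Kinv V k v))"
    using Kinv_hh[of i k "Kinv V k v" 0] a Kinv_in by (simp add: hh_def)
  also have "\<dots> = Kinv V i v" using a by (simp add: K_Kinv)
  finally show ?thesis .
qed

definition phis :: "sign \<times> nat \<times> nat \<Rightarrow> 'v \<Rightarrow> 'v" where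
  "phis l = (case l of (s, i, n) \<Rightarrow> phi D V s i (sg s * int n))"

lemma hh_phi: "i \<in> Idx D \<Longrightarrow> k \<in> Idx D \<Longrightarrow> v \<in> Car V \<Longrightarrow> hh (k, l) (phi D V s i (sg s * int n) v) = phi D V s i (sg s * int n) (hh (k, l) v)"
  by (rule phi_comm_op) (auto simp: hh_lop hh_comm Kinv_hh)

lemma Kinv_phi: "i \<in> Idx D \<Longrightarrow> k \<in> Idx D \<Longrightarrow> v \<in> Car V \<Longrightarrow> Kinv V k (phi D V s i (sg s * int n) v) = phi D V s i (sg s * int n) (Kinv V k v)"
  by (rule phi_comm_op) (auto simp: Kinv_lop Kinv_hh Kinv_Kinv)

lemma phi_lop: "i \<in> Idx D \<Longrightarrow> lop (phi D V s i (sg s * int n))"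
proof -
  assume i: "i \<in> Idx D"
  have C: "phi D V s i (sg s * int n) v \<in> Car V" if "v \<in> Car V" for v using phi_in[OF i stab1_Car[OF i] that] .
  have hl: "lop (hcomp i s ms)" for ms
  proof (induction ms)
    case (Cons m ms)
    then show ?case using hh_lop[OF i, of "sg s * int m"] by (simp add: lop_def hcomp_Cons)
  qed (simp add: lop_def hcomp_Nil)
  have "phisum s i n (v + w) = phisum s i n v + phisum s i n w" if "v \<in> Car V" "w \<in> Car V" for v w
    unfolding phisum_def using hl that by (simp add: lop_def vs.scale_right_distrib sum.distrib)
  moreover have "phisum s i n (sc c v) = sc c (phisum s i n v)" if "v \<in> Car V" for c v
    unfolding phisum_def using hl that by (simp add: lop_def vs.scale_sum_right mult.commute)
  ultimately show ?thesis unfolding lop_def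
    using C i phisum_in[OF stab1_Car[OF i]] by (simp add: phi_Ks Ks_add Ks_scale vs.subspace_add[OF subC] vs.subspace_scale[OF subC])
qed

sublocale ph: comm_ops sc "Car V" "UNIV \<times> Idx D \<times> UNIV" phis
proof unfold_locales
  fix l l' :: "sign \<times> nat \<times> nat" and v w c
  assume "l \<in> UNIV \<times> Idx D \<times> UNIV"
  then obtain s i n where l: "l = (s, i, n)" "i \<in> Idx D" by auto
  show "v \<in> Car V \<Longrightarrow> phis l v \<in> Car V" "v \<in> Car V \<Longrightarrow> w \<in> Car V \<Longrightarrow> phis l (v + w) = phis l v + phis l w"
    "v \<in> Car V \<Longrightarrow> phis l (sc c v) = sc c (phis l v)"
    using phi_lop[OF l(2), of s n] by (simp_all add: phis_def l(1) lop_def)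
  assume "l' \<in> UNIV \<times> Idx D \<times> UNIV" and v: "v \<in> Car V"
  then obtain s' i' n' where l': "l' = (s', i', n')" "i' \<in> Idx D" by auto
  show "phis l (phis l' v) = phis l' (phis l v)"
    unfolding phis_def l(1) l'(1) prod.case
    by (rule phi_comm_op[OF l'(2) phi_lop[OF l(2)] _ _ v]) (simp_all add: hh_phi Kinv_phi l(2) l'(2))
qed (use fin_Car subC in auto)

lemma lweight_space_gen: "lweight_space D V g = ph.gen (\<lambda>(s, i, n). g s i n)"
proof -
  have e: "ph.shf (s, i, n) (g s i n) = (\<lambda>w. phi D V s i (sg s * int n) w - sc (g s i n) w)" for s i n
    by (rule ext) (simp add: ph.shf_def phis_def)
  show ?thesis unfolding lweight_space_def ph.gen_def by (auto simp: e)
qed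

text \<open>A nonzero generalized eigenspace of the commuting phi contains a true joint eigenvector,
  and inverting the exponential makes it an eigenvector of the h_{i,n}.\<close>

lemma lspace_eigenvector:
  assumes m: "m \<in> monoms D" and nz: "lspace D V m \<noteq> {0}"
  shows "\<exists>y\<in>Car V. y \<noteq> 0 \<and> eig {0} (mc m) y"
proof -
  have "0 \<in> ph.gen (\<lambda>(s, i, n). gamma D m s i n)" using ph.stableD(1)[OF ph.gen_stable] vs.subspace_0 by blast
  then obtain v where "v \<in> ph.gen (\<lambda>(s, i, n). gamma D m s i n)" "v \<noteq> 0" using nz unfolding lweight_space_gen by blast
  then obtain y where y: "y \<in> ph.gen (\<lambda>(s, i, n). gamma D m s i n)" "y \<noteq> 0" "ph.eig {0} (\<lambda>(s, i, n). gamma D m s i n) y"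
    using ph.gen_eigenvector by blast
  then have yC: "y \<in> Car V" by (auto simp: ph.gen_def)
  have "phi D V s i (sg s * int n) y = sc (gamma D m s i n) y" if "i \<in> Idx D" for s i n
    using y(3) that unfolding ph.eig_def phis_def by force
  then have "hh (i, n) y = sc (hchar D m i n) y" if "i \<in> Idx D" for i n using hh_of_phi[OF that yC m] that by blast
  then have "eig {0} (mc m) y" by (auto simp: eig_def mc_def)
  then show ?thesis using yC y by blast
qed

text \<open>This covers a Jordan block of size two: phi - \<gamma> maps y into the line of b and
  kills b, so its square kills y.\<close>

lemma eigenvector_lspace:
  assumes m: "m \<in> monoms D" and b: "b \<in> Car V" "eig {0} (mc m) b" and y: "y \<in> Car V" "eig (vs.span {b}) (mc m) y"
  shows "y \<in> lspace D V m"
proof -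
  have st: "stab1 i (vs.span {b})" if i: "i \<in> Idx D" for i
    using low_stab1[OF subset_refl b i, of 0] by simp
  have bphi: "phi D V s i (sg s * int n) b = sc (gamma D m s i n) b" if i: "i \<in> Idx D" for s i n
    using phi_eigen[OF i b(1) m] eig_zero_D[OF b(2), of "(i, _)"] i by (simp add: mc_def)
  have "((\<lambda>w. phi D V s i (sg s * int n) w - sc (gamma D m s i n) w) ^^ 2) y = 0" if i: "i \<in> Idx D" for s i n
  proof -
    have "phi D V s i (sg s * int n) y - sc (gamma D m s i n) y \<in> vs.span {b}"
      by (rule phi_eig[OF i st[OF i] y(1) m]) (use y(2) i in \<open>auto simp: eig_def mc_def\<close>)
    then obtain c where c: "phi D V s i (sg s * int n) y - sc (gamma D m s i n) y = sc c b" by (auto simp: vs.span_singleton)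
    have "phi D V s i (sg s * int n) (sc c b) = sc c (phi D V s i (sg s * int n) b)"
      using phi_lop[OF i] b(1) unfolding lop_def by blast
    then show ?thesis using bphi[OF i] by (simp add: numeral_2_eq_2 c mult.commute)
  qed
  then show ?thesis using y(1) unfolding lweight_space_def by blast
qed

end

section \<open>Subspaces spanned by joint eigenvectors\<close>

context comm_ops
begin

lemma eigspan_stable:
  assumes "\<And>n. n \<in> F \<Longrightarrow> f n \<in> Car \<and> eig {0} (\<chi> n) (f n)"
  shows "stable (span (f ` F))"
  unfolding stable_def
proof (intro conjI ballI)
  have C: "f ` F \<subseteq> Car" using assms by blast
  show WC: "span (f ` F) \<subseteq> Car" by (rule span_minimal[OF C subspace_Car])
  fix l v assume l: "l \<in> A" and v: "v \<in> span (f ` F)"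
  have "v \<in> span (f ` F) \<and> T l v \<in> span (f ` F)" using v
  proof (induction rule: span_induct_alt)
    case base
    then show ?case using l span_zero by simp
  next
    case (step c x y)
    then obtain n where n: "n \<in> F" "x = f n" by blast
    have x: "x \<in> span (f ` F)" using step span_base by blast
    have "T l x = scl (\<chi> n l) x" using eig_zero_D[of "\<chi> n" x l] assms[OF n(1)] l n(2) by blast
    moreover have xy: "x \<in> Car" "y \<in> Car" using x step WC by auto
    moreover have "scl c x \<in> Car" using subspace_scale[OF subspace_Car xy(1)] .
    ultimately show ?case using l x step by (simp add: T_add T_scale span_add span_scale)
  qed
  then show "T l v \<in> span (f ` F)" ..
qed simp

lemma eig_in_span:
  assumes f: "\<And>n. n \<in> F \<Longrightarrow> f n \<in> Car \<and> eig {0} (\<chi> n) (f n)"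
    and U: "stable U" and z: "z \<in> Car" "z \<notin> U" "eig U \<eta> z" "z - y \<in> U" "y \<in> span (f ` F)"
  shows "\<exists>n\<in>F. f n \<notin> U \<and> (\<forall>l\<in>A. \<chi> n l = \<eta> l)"
proof (rule ccontr)
  assume n: "\<not> ?thesis"
  note sU = stableD(1)[OF U]
  let ?SS = "f ` {n \<in> F. f n \<notin> U}"
  have "f ` F \<subseteq> span (U \<union> ?SS)" by (auto intro: span_base)
  then have "y \<in> span (U \<union> ?SS)" using z(5) span_minimal[of "f ` F" "span (U \<union> ?SS)"] by blast
  moreover have "span U = U" using sU by simp
  ultimately obtain u y' where uy: "y = u + y'" "u \<in> U" "y' \<in> span ?SS" unfolding span_Un by blast
  have "z \<in> U"
  proof (rule span_eigenvectors_other[OF U _ _ uy(3) z(1,3)])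
    have "z - y' = (z - y) + u" using uy by simp
    moreover have "(z - y) + u \<in> U" by (rule subspace_add[OF sU z(4) uy(2)])
    ultimately show "z - y' \<in> U" by (simp only:)
    fix s assume "s \<in> ?SS"
    then obtain m where m: "m \<in> F" "f m \<notin> U" "s = f m" by blast
    have "eig U (\<chi> m) s" using f[OF m(1)] m(3) eig_mono[of "{0}" "\<chi> m" s U] subspace_0[OF sU] by simp
    moreover have "\<exists>l\<in>A. \<chi> m l \<noteq> \<eta> l" using n m(1,2) by blast
    moreover have "s \<in> Car" using f[OF m(1)] m(3) by simp
    ultimately show "s \<in> Car \<and> (\<exists>\<chi>. eig U \<chi> s \<and> (\<exists>l\<in>A. \<chi> l \<noteq> \<eta> l))" by blast
  qed
  then show False using z(2) by blast
qed

lemma eig_multiple: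
  assumes f: "\<And>n. n \<in> F \<Longrightarrow> f n \<in> Car \<and> eig {0} (\<chi> n) (f n)"
    and ds: "\<And>n n'. n \<in> F \<Longrightarrow> n' \<in> F \<Longrightarrow> (\<forall>l\<in>A. \<chi> n l = \<chi> n' l) \<Longrightarrow> n = n'"
    and z: "z \<in> span (f ` F)" "eig {0} \<eta> z" and n: "n \<in> F" "\<And>l. l \<in> A \<Longrightarrow> \<chi> n l = \<eta> l"
  shows "z \<in> span {f n}"
proof (rule ccontr)
  assume zn: "z \<notin> span {f n}"
  have "stable (span (f ` {n}))" by (rule eigspan_stable[where \<chi> = \<chi>]) (use f[OF n(1)] in simp)
  then have U: "stable (span {f n})" by simp
  have zC: "z \<in> Car" by (rule subsetD[OF stableD(2)[OF eigspan_stable[where \<chi> = \<chi>, OF f]] z(1)])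
  have z0: "z - z \<in> span {f n}" "{0} \<subseteq> span {f n}" using span_zero[of "{f n}"] by simp_all
  obtain n' where n': "n' \<in> F" "f n' \<notin> span {f n}" "\<forall>l\<in>A. \<chi> n' l = \<eta> l"
    using eig_in_span[OF f U zC zn eig_mono[OF z(2) z0(2)] z0(1) z(1)] by blast
  have "\<forall>l\<in>A. \<chi> n' l = \<chi> n l" using n'(3) n(2) by simp
  then have "n' = n" by (rule ds[OF n'(1) n(1)])
  then show False using n'(2) span_base[of "f n" "{f n}"] by simp
qed

text \<open>A joint eigenvector of \<open>S\<close> modulo the span of the chosen \<open>f n\<close>
  has the character of some \<open>f n\<close> outside \<open>S\<close>. Lifted to a true
  eigenvector in \<open>S\<close>, it is a multiple of that \<open>f n\<close>, since the characters
  are pairwise different, and so \<open>f n\<close> lies in \<open>S\<close>.\<close>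

lemma stable_span_eigenvectors:
  assumes f: "\<And>n. n \<in> F \<Longrightarrow> f n \<in> Car \<and> eig {0} (\<chi> n) (f n)"
    and ds: "\<And>n n'. n \<in> F \<Longrightarrow> n' \<in> F \<Longrightarrow> (\<forall>l\<in>A. \<chi> n l = \<chi> n' l) \<Longrightarrow> n = n'"
    and S: "stable S" "S \<subseteq> span (f ` F)"
  shows "S \<subseteq> span (f ` {n \<in> F. f n \<in> S})"
proof (rule ccontr)
  let ?U = "span (f ` {n \<in> F. f n \<in> S})"
  assume "\<not> S \<subseteq> ?U"
  have U: "stable ?U" by (rule eigspan_stable[where \<chi> = \<chi>]) (rule f, simp)
  obtain z \<eta> where z: "z \<in> S" "z \<notin> ?U" "eig ?U \<eta> z"
    using joint_eigenvector_mod[OF S(1) U \<open>\<not> S \<subseteq> ?U\<close>] by blast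
  have zC: "z \<in> Car" by (rule subsetD[OF stableD(2)[OF S(1)] z(1)])
  obtain n where n: "n \<in> F" "f n \<notin> ?U" "\<forall>l\<in>A. \<chi> n l = \<eta> l"
  proof -
    have 0: "z - z \<in> ?U" using span_zero[of "f ` {n \<in> F. f n \<in> S}"] by simp
    show thesis using that eig_in_span[OF f U zC z(2,3) 0 subsetD[OF S(2) z(1)]] by blast
  qed
  have fn: "f n \<notin> S"
  proof
    assume "f n \<in> S"
    then have "f n \<in> f ` {n \<in> F. f n \<in> S}" using n(1) by blast
    then have "f n \<in> ?U" by (rule span_base)
    then show False using n(2) by simp
  qed
  have "{0} \<subseteq> ?U" using span_zero[of "f ` {n \<in> F. f n \<in> S}"] by simp
  then obtain z' where z': "z' \<in> S" "z' \<notin> {0}" "eig {0} \<eta> z'"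
    using eig_lift[OF S(1) U stable_zero \<open>{0} \<subseteq> ?U\<close> z] by blast
  have "z' \<in> span {f n}"
  proof (rule eig_multiple[OF f ds _ z'(3) n(1)])
    show "z' \<in> span (f ` F)" using z'(1) S(2) by blast
    show "\<chi> n l = \<eta> l" if "l \<in> A" for l using n(3) that by blast
  qed
  then obtain c where c: "z' = scl c (f n)" by (auto simp: span_singleton)
  then have "c \<noteq> 0" using z'(2) by auto
  then have "f n \<in> S" using z'(1) c scale_mem_iff[OF stableD(1)[OF S(1)]] by blast
  then show False using fn by simp
qed

end

section \<open>Restriction to one vertex\<close>

lemma expo_beta: "expo (beta j m) i a = (if i = j then expo m j a else 0)"
proof -
  have "expo (beta j m) i a = (\<Sum>b | (j, b) \<in> Poly_Mapping.keys m. if b = a then (if i = j then expo m j a else 0) else 0)"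
    unfolding beta_def lookup_sum by (rule sum.cong) (auto simp: lookup_single when_def)
  also have "\<dots> = (if (j, a) \<in> Poly_Mapping.keys m then (if i = j then expo m j a else 0) else 0)"
    using finite_slice[of j m] by (simp add: sum.delta')
  finally show ?thesis by (auto simp: in_keys_iff)
qed

context qdat
begin

lemma sl2_simps [simp]: "Idx (sl2_data D j) = {j}" "rr (sl2_data D j) i = 1" "qq (sl2_data D j) = qi j" "symB (sl2_data D j) i k = 2"
  by (simp_all add: sl2_data_def qi_def symB_def)

lemma wt_beta: "wt (beta j m) j = wt m j"
  unfolding wt_def by (rule esum_cong) (simp add: expo_beta)

lemma hchar_beta: "hchar (sl2_data D j) (beta j m) j n = hchar D m j n"
proof -
  have "esum j (hpow (qi j) n) (beta j m) = esum j (hpow (qi j) n) m" by (rule esum_cong) (simp add: expo_beta)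
  then show ?thesis unfolding hchar_def sl2_simps power_one_right wt_beta by (simp add: qi_powi qi_def[symmetric])
qed

lemma beta_monoms: "m \<in> monoms D \<Longrightarrow> beta j m \<in> monoms (sl2_data D j)"
  by (auto simp: monoms_def in_keys_iff expo_beta split: if_splits)

lemma j_dominant_beta: "beta j m = beta j m' \<Longrightarrow> j_dominant j m \<longleftrightarrow> j_dominant j m'"
  unfolding j_dominant_def by (metis expo_beta)

lemma beta_string_inj:
  assumes "j \<in> Idx D" "m - m' \<in> group_closure {Amon D j a | a. a \<noteq> 0}" "beta j m = beta j m'"
  shows "m = m'"
  by (rule string_inj[OF assms(1,2)]) (metis hchar_beta assms(3))

end

context qmod
begin

lemma highest_vector:
  assumes m: "m \<in> monoms D" and h: "highest_lweight D V m"
  shows "\<exists>v\<in>Car V. v \<noteq> 0 \<and> (\<forall>i\<in>Idx D. \<forall>n. X V Pos i n v = 0) \<and> eig {0} (mc m) v \<and>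
    (\<forall>U. submodule D V U \<and> v \<in> U \<longrightarrow> U = Car V)"
proof -
  obtain v where v: "v \<in> Car V" "v \<noteq> 0" "\<forall>i\<in>Idx D. \<forall>n. X V Pos i n v = 0"
    "\<forall>s. \<forall>i\<in>Idx D. \<forall>n. phi D V s i (sg s * int n) v = sc (gamma D m s i n) v"
    "\<forall>U. submodule D V U \<and> v \<in> U \<longrightarrow> U = Car V" using h unfolding highest_lweight_def by blast
  have "hh (i, n) v = sc (hchar D m i n) v" if "i \<in> Idx D" for i n
    using hh_of_phi[OF that v(1) m] v(4) that by blast
  then have "eig {0} (mc m) v" by (auto simp: eig_def mc_def)
  then show ?thesis using v by blast
qed

lemma eig1: "j \<in> Idx D \<Longrightarrow> eig {0} (mc m) v \<Longrightarrow> hh (j, n) v = sc (hchar D m j n) v"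
  using eig_zero_D[of "mc m" v "(j, n)"] by (simp add: mc_def)

lemma ltot_Car:
  assumes "v \<in> Car V" "eig {0} (mc m) v" "\<And>i n. i \<in> Idx D \<Longrightarrow> X V Pos i n v = 0"
    and "\<And>U. submodule D V U \<Longrightarrow> v \<in> U \<Longrightarrow> U = Car V"
  shows "ltot (Idx D) v = Car V"
proof (rule assms(4))
  show "submodule D V (ltot (Idx D) v)" by (rule ltot_submodule[OF assms(1-3)])
  show "v \<in> ltot (Idx D) v" by (rule low_ltot[of _ _ _ 0]) (simp add: vs.span_base)
qed

end

subsection \<open>Comparison with a simple module of the vertex subalgebra\<close>

locale qpair = qmod_vertex D V j + W: qmod "sl2_data D j" W
  for D and V :: "'v::ab_group_add qmodule" and j and W :: "'w::ab_group_add qmodule" +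
  fixes M v w
  assumes M: "M \<in> monoms D"
    and v: "v \<in> Car V" "v \<noteq> 0" "eig {0} (mc M) v" "\<And>n. X V Pos j n v = 0"
    and w: "w \<in> Car W" "w \<noteq> 0" "W.eig {0} (W.mc (beta j M)) w" "\<And>n. X W Pos j n w = 0"
    and w_gen: "\<And>U. submodule (sl2_data D j) W U \<Longrightarrow> w \<in> U \<Longrightarrow> U = Car W"
    and W_irr: "irreducible_module (sl2_data D j) W"
begin

abbreviation "Dj \<equiv> sl2_data D j"

lemma J: "{j} \<subseteq> Idx D" and jW: "j \<in> Idx Dj" and JW: "{j} \<subseteq> Idx Dj"
  using j by simp_all

text \<open>Combinations of words in x^-_j applied to \<open>v\<close> are paired with the same
  combinations applied to \<open>w\<close>. A relation graded by word length is used because it is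
  not known beforehand that v -> w extends to a map.\<close>

inductive G :: "nat \<Rightarrow> 'v \<Rightarrow> 'w \<Rightarrow> bool" where
  base: "G 0 (sc c v) (W.sc c w)"
| zero: "G (Suc k) 0 0"
| step: "G k a b \<Longrightarrow> G (Suc k) a' b' \<Longrightarrow> G (Suc k) (sc c (X V Neg j n a) + a') (W.sc c (X W Neg j n b) + b')"

lemma G_low: "G k a b \<Longrightarrow> a \<in> low {j} v k \<and> b \<in> W.low {j} w k"
proof (induction rule: G.induct)
  case (base c)
  then show ?case by (simp add: vs.span_scale vs.span_base W.vs.span_scale W.vs.span_base)
next
  case (zero k)
  then show ?case by (simp add: vs.span_zero W.vs.span_zero)
next
  case (step k a b a' b' c n)
  have "X V Neg j n a \<in> low {j} v (Suc k)" "X W Neg j n b \<in> W.low {j} w (Suc k)"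
    using step low_X[of j "{j}" a v k n] W.low_X[of j "{j}" b w k n] by simp_all
  then show ?case using step low_subspace[of "{j}" v "Suc k"] W.low_subspace[of "{j}" w "Suc k"]
    by (simp only: vs.subspace_add vs.subspace_scale W.vs.subspace_add W.vs.subspace_scale simp_thms)
qed

lemma G_Car: "G k a b \<Longrightarrow> a \<in> Car V" "G k a b \<Longrightarrow> b \<in> Car W"
  using G_low low_Car[OF J v(1)] W.low_Car[OF JW w(1)] by blast+

lemma G_0: "G k 0 0"
  using G.base[of 0] G.zero by (cases k) simp_all

lemma G_0_iff: "G 0 a b \<longleftrightarrow> (\<exists>c. a = sc c v \<and> b = W.sc c w)"
  by (auto elim: G.cases intro: G.base)

lemma G_add: "G k a b \<Longrightarrow> G k a' b' \<Longrightarrow> G k (a + a') (b + b')"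
proof (induction arbitrary: a' b' rule: G.induct)
  case (base c)
  then obtain c' where "a' = sc c' v" "b' = W.sc c' w" unfolding G_0_iff by blast
  then show ?case using G.base[of "c + c'"] by (simp add: vs.scale_left_distrib W.vs.scale_left_distrib)
next
  case (step k a b a1 b1 c n)
  then show ?case using G.step[OF step.hyps(1) step.IH(2)[OF step.prems], of c n] by (simp add: add.assoc)
qed simp

lemma G_scale: "G k a b \<Longrightarrow> G k (sc d a) (W.sc d b)"
proof (induction rule: G.induct)
  case (base c)
  then show ?case using G.base[of "d * c"] by simp
next
  case (zero k)
  then show ?case by (simp add: G.zero)
next
  case (step k a b a' b' c n)
  then show ?case using G.step[OF step.hyps(1) step.IH(2), of "d * c" n] by (simp add: vs.scale_right_distrib W.vs.scale_right_distrib)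
qed

lemma G_diff: "G k a b \<Longrightarrow> G k a' b' \<Longrightarrow> G k (a - a') (b - b')"
  using G_add[of k a b "sc (-1) a'" "W.sc (-1) b'"] G_scale[of k a' b' "-1"] by simp

lemma G_sum: "(\<And>x. x \<in> F \<Longrightarrow> G k (f x) (g x)) \<Longrightarrow> G k (sum f F) (sum g F)"
  by (induction F rule: infinite_finite_induct) (auto intro: G_0 G_add)

lemma G_Xneg: "G k a b \<Longrightarrow> G (Suc k) (X V Neg j n a) (X W Neg j n b)"
  using G.step[OF _ G.zero, of k a b 1 n] by simp

lemma G_dom: "a \<in> low {j} v k \<Longrightarrow> \<exists>b. G k a b"
proof (induction k arbitrary: a)
  case 0
  then show ?case unfolding G_0_iff by (auto simp: vs.span_singleton)
next
  case (Suc k)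
  then have "a \<in> vs.span {X V Neg i n u | i n u. i \<in> {j} \<and> u \<in> low {j} v k}" by simp
  then show ?case
  proof (induction rule: span_induct_mem)
    case base
    then show ?case using G_0 by blast
  next
    case (step c x y)
    then obtain n u where u: "x = X V Neg j n u" "u \<in> low {j} v k" by blast
    then show ?case using Suc.IH[OF u(2)] step.IH G.step by blast
  qed
qed

lemma G_ran: "b \<in> W.low {j} w k \<Longrightarrow> \<exists>a. G k a b"
proof (induction k arbitrary: b)
  case 0
  then show ?case unfolding G_0_iff by (auto simp: W.vs.span_singleton)
next
  case (Suc k)
  then have "b \<in> W.vs.span {X W Neg i n u | i n u. i \<in> {j} \<and> u \<in> W.low {j} w k}" by simp
  then show ?case
  proof (induction rule: W.span_induct_mem)
    case base
    then show ?case using G_0 by blast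
  next
    case (step c x y)
    then obtain n u where u: "x = X W Neg j n u" "u \<in> W.low {j} w k" by blast
    then show ?case using Suc.IH[OF u(2)] step.IH G.step by blast
  qed
qed

lemma W_q [simp]: "W.qi j = qi j"
  by (simp add: W.qi_def)

lemma W_powi: "qi j powi (c * 2) = q powi (c * symB D j j)"
  using Cart_diag[OF j] by (simp add: qi_powi symB_def mult_ac)

lemma W_bc: "W.bc j j n = bc j j n"
  using W_powi[of n] W_powi[of "- n"] by (simp add: W.bc_def bc_def)

lemma G_hh: "G k a b \<Longrightarrow> G k (hh (j, n) a) (W.hh (j, n) b)"
proof (induction rule: G.induct)
  case (base c)
  have "hh (j, n) v = sc (hchar D M j n) v" by (rule eig1[OF j v(3)])
  moreover have "W.hh (j, n) w = W.sc (hchar D M j n) w" using W.eig1[OF jW w(3), of n] by (simp add: hchar_beta)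
  ultimately show ?case using G.base[of "c * hchar D M j n"] j v(1) w(1) by (simp add: hh_scale W.hh_scale)
next
  case (zero k)
  then show ?case using T_zero[of "(j, n)"] W.T_zero[of "(j, n)"] j G.zero by simp
next
  case (step k a b a' b' c l)
  have C: "a \<in> Car V" "a' \<in> Car V" "b \<in> Car W" "b' \<in> Car W" using G_Car step by blast+
  have X: "X V Neg j l a \<in> Car V" "X W Neg j l b \<in> Car W" using X_in[OF j C(1)] W.X_in[OF jW C(3)] by auto
  have e: "hh (j, n) (sc c (X V Neg j l a) + a') = sc c (hh (j, n) (X V Neg j l a)) + hh (j, n) a'"
    "W.hh (j, n) (W.sc c (X W Neg j l b) + b') = W.sc c (W.hh (j, n) (X W Neg j l b)) + W.hh (j, n) b'"
    using X C j vs.subspace_scale[OF subC X(1)] W.vs.subspace_scale[OF W.subC X(2)] by (simp_all add: hh_add hh_scale W.hh_add W.hh_scale)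
  have "G (Suc k) (hh (j, n) (X V Neg j l a)) (W.hh (j, n) (X W Neg j l b))"
    unfolding hh_X[OF j j C(1)] W.hh_X[OF jW jW C(3)] W_bc
    using G_scale[OF G_Xneg[OF step.IH(1)], of "q powi (sg Neg * symB D j j)" l]
      G_add[OF G_Xneg[OF step.IH(1)] G_scale[OF G_Xneg[OF step.hyps(1)]], of l "of_int (sg Neg) * bc j j n" "n + l"]
      W_powi[of "-1"] by (cases "n = 0") simp_all
  then show ?case unfolding e using G_add[OF G_scale step.IH(2)] by blast
qed

lemma G_Kinv: "G k a b \<Longrightarrow> G k (Kinv V j a) (Kinv W j b)"
proof (induction rule: G.induct)
  case (base c)
  have h0: "hchar D M j 0 \<noteq> 0" using q_nz by (simp add: hchar_def)
  have "Kinv V j v = sc (inverse (hchar D M j 0)) v"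
    using Kinv_eig[OF j v(1) _ h0] eig1[OF j v(3), of 0] by (simp add: hh_def)
  moreover have "Kinv W j w = W.sc (inverse (hchar D M j 0)) w"
    using W.Kinv_eig[OF jW w(1) _ h0] W.eig1[OF jW w(3), of 0] by (simp add: W.hh_def hchar_beta)
  ultimately show ?case using G.base[of "c * inverse (hchar D M j 0)"] j v(1) w(1) by (simp add: Kinv_scale W.Kinv_scale)
next
  case (zero k)
  then show ?case using Kinv_zero[OF j] W.Kinv_zero[OF jW] G.zero by simp
next
  case (step k a b a' b' c l)
  have C: "a \<in> Car V" "a' \<in> Car V" "b \<in> Car W" "b' \<in> Car W" using G_Car step by blast+
  have X: "X V Neg j l a \<in> Car V" "X W Neg j l b \<in> Car W" using X_in[OF j C(1)] W.X_in[OF jW C(3)] by auto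
  have e: "Kinv V j (sc c (X V Neg j l a) + a') = sc c (Kinv V j (X V Neg j l a)) + Kinv V j a'"
    "Kinv W j (W.sc c (X W Neg j l b) + b') = W.sc c (Kinv W j (X W Neg j l b)) + Kinv W j b'"
    using X C j vs.subspace_scale[OF subC X(1)] W.vs.subspace_scale[OF W.subC X(2)] by (simp_all add: Kinv_add Kinv_scale W.Kinv_add W.Kinv_scale)
  have "G (Suc k) (Kinv V j (X V Neg j l a)) (Kinv W j (X W Neg j l b))"
    unfolding Kinv_X[OF j j C(1)] W.Kinv_X[OF jW jW C(3)]
    using G_scale[OF G_Xneg[OF step.IH(1)], of "q powi (- (sg Neg * symB D j j))" l] W_powi[of 1] by simp
  then show ?case unfolding e using G_add[OF G_scale step.IH(2)] by blast
qed

lemma G_phi: "G k a b \<Longrightarrow> G k (phi D V s j p a) (phi Dj W s j p b)"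
proof (cases "sg s * p < 0")
  case True
  then show ?thesis by (simp add: phi_neg_zero W.phi_neg_zero G_0)
next
  case False
  assume ab: "G k a b"
  from False obtain n where "sg s * p = int n" using nonneg_int_cases[of "sg s * p"] by force
  then have p: "p = sg s * int n" using sg_sq(1)[of s p] by simp
  have hc: "G k (hcomp j s ms a) (W.hcomp j s ms b)" for ms
    by (induction ms) (use ab G_hh in \<open>auto simp: hcomp_Cons hcomp_Nil W.hcomp_Cons W.hcomp_Nil\<close>)
  have "G k (phisum s j n a) (W.phisum s j n b)"
    unfolding phisum_def W.phisum_def by (rule G_sum) (rule G_scale[OF hc])
  then have "G k (Ks s j (phisum s j n a)) (W.Ks s j (W.phisum s j n b))"
    using G_hh[of k _ _ 0] G_Kinv by (cases s) (simp_all add: Ks_def W.Ks_def hh_def W.hh_def)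
  then show ?thesis unfolding p phi_Ks[OF j G_Car(1)[OF ab]] W.phi_Ks[OF jW G_Car(2)[OF ab]] .
qed

lemma G_Xpos: "G k a b \<Longrightarrow> (case k of 0 \<Rightarrow> X V Pos j n a = 0 \<and> X W Pos j n b = 0 | Suc e \<Rightarrow> G e (X V Pos j n a) (X W Pos j n b))"
proof (induction arbitrary: n rule: G.induct)
  case (base c)
  then show ?case using X_scale[OF j v(1)] W.X_scale[OF jW w(1)] v(4) w(4) by simp
next
  case (zero k)
  then show ?case using X_zero[OF j] W.X_zero[OF jW] G_0 by simp
next
  case (step k a b a' b' c l)
  have C: "a \<in> Car V" "a' \<in> Car V" "b \<in> Car W" "b' \<in> Car W" using G_Car step by blast+
  have X: "X V Neg j l a \<in> Car V" "X W Neg j l b \<in> Car W" using X_in[OF j C(1)] W.X_in[OF jW C(3)] by auto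
  have e: "X V Pos j n (sc c (X V Neg j l a) + a') = sc c (X V Pos j n (X V Neg j l a)) + X V Pos j n a'"
    "X W Pos j n (W.sc c (X W Neg j l b) + b') = W.sc c (X W Pos j n (X W Neg j l b)) + X W Pos j n b'"
    using X C j vs.subspace_scale[OF subC X(1)] W.vs.subspace_scale[OF W.subC X(2)] by (simp_all add: X_add X_scale W.X_add W.X_scale)
  have 1: "G k (X V Neg j l (X V Pos j n a)) (X W Neg j l (X W Pos j n b))"
  proof (cases k)
    case 0
    then show ?thesis using step.IH(1)[of n] X_zero[OF j] W.X_zero[OF jW] G_0 by simp
  next
    case (Suc k')
    then show ?thesis using step.IH(1)[of n] G_Xneg by simp
  qed
  have "G k (X V Pos j n (X V Neg j l a)) (X W Pos j n (X W Neg j l b))"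
    unfolding Xpos_Xneg[OF j j C(1)] W.Xpos_Xneg[OF jW jW C(3)] W_q
    using G_add[OF 1 G_scale[OF G_diff[OF G_phi[OF step.hyps(1)] G_phi[OF step.hyps(1)]]]] by simp
  then show ?case unfolding e using G_add[OF G_scale] step.IH(2)[of n] by simp
qed

lemma G_Xpos_Suc: "G (Suc k) a b \<Longrightarrow> G k (X V Pos j n a) (X W Pos j n b)"
  using G_Xpos[of "Suc k" a b n] by simp

text \<open>Irreducibility of \<open>W\<close> makes \<open>G\<close> the graph of a homomorphism.\<close>

lemma G_single:
  assumes "G k 0 b" shows "b = 0"
proof -
  define N where "N = W.vs.span (\<Union>k. {b. G k 0 b})"
  have NC: "(\<Union>k. {b. G k 0 b}) \<subseteq> Car W" using G_Car(2) by blast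
  have mem: "b \<in> N" if "G k 0 b" for k b unfolding N_def by (rule W.vs.span_base) (use that in blast)
  have "submodule Dj W N"
  proof (rule W.submoduleI)
    show "W.stable N" unfolding N_def
    proof (rule W.span_stable[OF NC])
      fix b and l :: "nat \<times> int" assume "b \<in> (\<Union>k. {b. G k 0 b})" and l: "l \<in> Idx Dj \<times> UNIV"
      then obtain k n where b: "G k 0 b" "l = (j, n)" by auto
      have "G k 0 (W.hh l b)" using G_hh[OF b(1), of n] T_zero[of "(j, n)"] j b(2) by simp
      then show "W.hh l b \<in> W.vs.span (\<Union>k. {b. G k 0 b})" using mem N_def by simp
    qed
    fix i u assume i: "i \<in> Idx Dj" and u: "u \<in> N"
    have ij: "i = j" using i by simp
    show "Kinv W i u \<in> N" unfolding N_def ij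
    proof (rule W.Kinv_span[OF jW NC _ u[unfolded N_def]])
      fix b assume "b \<in> (\<Union>k. {b. G k 0 b})"
      then show "Kinv W j b \<in> W.vs.span (\<Union>k. {b. G k 0 b})" using G_Kinv Kinv_zero[OF j] mem N_def by fastforce
    qed
    show "X W s i n u \<in> N" for s n unfolding ij
    proof (rule W.X_span_into[OF jW NC _ _ u[unfolded N_def]])
      show "W.vs.subspace N" by (simp add: N_def)
      fix b assume "b \<in> (\<Union>k. {b. G k 0 b})"
      then obtain k where b: "G k 0 b" by blast
      show "X W s j n b \<in> N"
      proof (cases s)
        case Neg
        then show ?thesis using G_Xneg[OF b, of n] X_zero[OF j] mem by simp
      next
        case Pos
        show ?thesis
        proof (cases k)
          case 0
          then obtain c where "0 = sc c v" "b = W.sc c w" using b G_0_iff by blast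
          then have "b = 0" using v(2) by auto
          then show ?thesis using W.X_zero[OF jW] W.vs.span_zero by (simp add: N_def)
        next
          case (Suc e)
          then have "G e (X V Pos j n 0) (X W Pos j n b)" using G_Xpos_Suc b by blast
          then show ?thesis using X_zero[OF j] mem Pos by simp
        qed
      qed
    qed
  qed
  then consider "N = {0}" | "N = Car W" using W_irr unfolding irreducible_module_def by blast
  then show ?thesis
  proof cases
    case 1
    then show ?thesis using mem[OF assms] by simp
  next
    case 2
    \<comment> \<open>If \<open>N\<close> were all of \<open>W\<close>, it would contain
      \<open>w\<close>, which by its weight would lie in the span of the level 0 part of
      \<open>N\<close>; that part is zero because \<open>v\<close> is nonzero.\<close>
    have Kw: "K W j w = W.sc (qq Dj powi (int (rr Dj j) * wt (beta j M) j)) w"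
      using W.eig1[OF jW w(3), of 0] by (simp add: W.hh_def hchar_def)
    have "w \<in> W.vs.span (\<Union>k. {b. G k 0 b})" using 2 w(1) by (simp add: N_def)
    then obtain k where k: "wt (beta j M) j = wt (beta j M) j - 2 * int k" "w \<in> W.vs.span {b. G k 0 b}"
      using W.low1_proj[OF jW w(1,3), of "\<lambda>k. {b. G k 0 b}" w "wt (beta j M) j"] G_low w(2) Kw by blast
    then have "k = 0" by simp
    moreover have "{b. G 0 0 b} \<subseteq> {0}" using v(2) by (auto simp: G_0_iff)
    ultimately have "w \<in> W.vs.span {0}" using k(2) W.vs.span_mono by blast
    then show ?thesis using w(2) by simp
  qed
qed

lemma G_uniq: "G k a b \<Longrightarrow> G k a b' \<Longrightarrow> b = b'"
  using G_single[of k "b - b'"] G_diff[of k a b a b'] by simp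

lemma W_total: "W.ltot {j} w = Car W"
  using W.ltot_Car[OF w(1,3)] w(4) w_gen by simp

lemma W_level:
  assumes y: "y \<in> Car W" "y \<noteq> 0" "\<And>n. W.hh (j, n) y = W.sc (hchar D m j n) y"
  shows "\<exists>k. wt m j = wt M j - 2 * int k \<and> y \<in> W.low {j} w k"
proof -
  have "y \<in> W.vs.span (\<Union>k. W.low {j} w k)" using y(1) W_total unfolding W.ltot_def by simp
  moreover have "K W j y = W.sc (qq Dj powi (int (rr Dj j) * wt m j)) y"
    using y(3)[of 0] by (simp add: W.hh_def hchar_def qi_powi)
  ultimately obtain k where k: "wt m j = wt (beta j M) j - 2 * int k" "y \<in> W.vs.span (W.low {j} w k)"
    using W.low1_proj[OF jW w(1,3) order_refl _ y(2)] by blast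
  have sp: "W.vs.span (W.low {j} w k) = W.low {j} w k" using W.low_subspace by simp
  have "y \<in> W.low {j} w k" using k(2) unfolding sp .
  then show ?thesis using k(1) by (auto simp: wt_beta)
qed

lemma G_eig: "G k a b \<Longrightarrow> hh (j, n) a = sc c a \<Longrightarrow> W.hh (j, n) b = W.sc c b"
  using G_uniq[OF G_hh, of k a b n "W.sc c b"] G_scale[of k a b c] by simp

sublocale Jf: comm_ops sc "Car V" "{j} \<times> (UNIV :: int set)" hh
  by (rule comm_ops_sub[OF J])

text \<open>The kernel of the homomorphism to \<open>W\<close>, level by level. A priori it is
  stable only under the currents of the vertex j, the only ones that also act on
  \<open>W\<close>.\<close>

definition "Kr k = {a. G k a 0}"

lemma Kr_low: "Kr k \<subseteq> low {j} v k"
  using G_low by (auto simp: Kr_def)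

lemma Kr_stable: "Jf.stable (Kr k)"
  unfolding Jf.stable_def
proof (intro conjI ballI)
  show "vs.subspace (Kr k)"
    by (rule vs.subspaceI) (use G_0 G_add[of k _ 0 _ 0] G_scale[of k _ 0] in \<open>auto simp: Kr_def\<close>)
  show "Kr k \<subseteq> Car V" using G_Car by (auto simp: Kr_def)
  fix l a assume "l \<in> {j} \<times> (UNIV :: int set)" and a: "a \<in> Kr k"
  then obtain n where "l = (j, n)" by auto
  then show "hh l a \<in> Kr k" using a G_hh[of k a 0 n] W.T_zero[of "(j, n)"] by (simp add: Kr_def)
qed

lemma low_Jf: "Jf.stable (low {j} v k)"
  using low_stable[OF J v(1,3), of k] j unfolding Jf.stable_def stable_def by blast

end

context qdat
begin

definition Acl :: "nat \<Rightarrow> monom set" where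
  "Acl j = group_closure {Amon D j a | a. a \<noteq> 0}"

lemma Acl_A: "a \<noteq> 0 \<Longrightarrow> Amon D j a \<in> Acl j"
  unfolding Acl_def by (rule group_closure.base) blast

lemma Acl_add: "g \<in> Acl j \<Longrightarrow> g' \<in> Acl j \<Longrightarrow> g + g' \<in> Acl j"
  and Acl_diff: "g \<in> Acl j \<Longrightarrow> g' \<in> Acl j \<Longrightarrow> g - g' \<in> Acl j"
  and Acl_0: "0 \<in> Acl j"
  unfolding Acl_def by (auto intro: group_closure_add group_closure.diff)

lemma Acl_trans: "m - m' \<in> Acl j \<Longrightarrow> m' - m'' \<in> Acl j \<Longrightarrow> m - m'' \<in> Acl j"
  using Acl_add[of "m - m'" j "m' - m''"] by simp

lemma Acl_sym: "m - m' \<in> Acl j \<Longrightarrow> m' - m \<in> Acl j"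
  using Acl_diff[OF Acl_0, of "m - m'"] by simp

end

subsection \<open>Strings of monomials\<close>

text \<open>The induction hypothesis up to level d as seen from the string of \<open>M\<close>,
  whose own level is \<open>dM\<close>.\<close>

locale string_data = qpair D V j W M v w
  for D and V :: "'v::ab_group_add qmodule" and j and W :: "'w::ab_group_add qmodule" and M v w +
  fixes vp and mp :: monom and \<M> :: "monom set" and vm :: "monom \<Rightarrow> 'v" and d dM :: nat
  assumes vp: "vp \<in> Car V" "eig {0} (mc mp) vp" "\<And>i n. i \<in> Idx D \<Longrightarrow> X V Pos i n vp = 0"
    and \<M>: "\<M> \<subseteq> monoms D"
    and Mv: "M \<in> \<M>" "v = vm M" "ht (wt M) = ht (wt mp) - real dM" "dM \<le> d"
    and lev: "\<And>e. e \<le> d \<Longrightarrow> low (Idx D) vp e \<subseteq> vs.span (vm ` {n \<in> \<M>. ht (wt n) = ht (wt mp) - real e})"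
    and vm: "\<And>n e. n \<in> \<M> \<Longrightarrow> e \<le> d \<Longrightarrow> ht (wt n) = ht (wt mp) - real e \<Longrightarrow>
      vm n \<noteq> 0 \<and> vm n \<in> low (Idx D) vp e \<and> eig {0} (mc n) (vm n)"
    and W_str: "\<And>n. n \<in> \<M> \<Longrightarrow> n - M \<in> Acl j \<Longrightarrow> lspace (sl2_data D j) W (beta j n) \<noteq> {0}"
    and fin\<M>: "finite \<M>"
begin

definition "lv e = {n \<in> \<M>. ht (wt n) = ht (wt mp) - real e}"
definition "str e = {n \<in> lv e. n - M \<in> Acl j}"

lemma lev': "e \<le> d \<Longrightarrow> low (Idx D) vp e \<subseteq> vs.span (vm ` lv e)"
  using lev by (simp add: lv_def)

lemma vm': "n \<in> lv e \<Longrightarrow> e \<le> d \<Longrightarrow> vm n \<in> Car V \<and> eig {0} (mc n) (vm n)"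
  and vm_nz: "n \<in> lv e \<Longrightarrow> e \<le> d \<Longrightarrow> vm n \<noteq> 0"
  using vm[of n e] low_Car[OF subset_refl vp(1), of e] by (auto simp: lv_def)

lemma lv_distinct: "n \<in> lv e \<Longrightarrow> n' \<in> lv e' \<Longrightarrow> (\<forall>l\<in>Idx D \<times> UNIV. mc n l = mc n' l) \<Longrightarrow> n = n'"
  using mc_inj[of n n'] \<M> unfolding lv_def by blast

lemma low_sub: "low {j} v k \<subseteq> low (Idx D) vp (dM + k)"
proof (induction k)
  case 0
  have "v \<in> low (Idx D) vp dM" using vm[OF Mv(1,4,3)] Mv(2) by simp
  then show ?case using vs.span_minimal[of "{v}" "low (Idx D) vp dM"] low_subspace by simp
next
  case (Suc k)
  have "{X V Neg i n u | i n u. i \<in> {j} \<and> u \<in> low {j} v k} \<subseteq> low (Idx D) vp (Suc (dM + k))"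
    using Suc low_X[OF j] by blast
  then have "low {j} v (Suc k) \<subseteq> low (Idx D) vp (Suc (dM + k))"
    unfolding low.simps(2)[of "{j}"] by (rule vs.span_minimal[OF _ low_subspace])
  then show ?case by (simp only: add_Suc_right)
qed

lemma low_step_span:
  assumes "low {j} v k \<subseteq> vs.span (vm ` F)" "\<And>n. n \<in> F \<Longrightarrow> vm n \<in> Car V"
  shows "low {j} v (Suc k) \<subseteq> vs.span ({0} \<union> (\<Union>p\<in>{j} \<times> F. range (\<lambda>n. X V Neg (fst p) n (vm (snd p)))))"
proof -
  let ?T = "vs.span ({0} \<union> (\<Union>p\<in>{j} \<times> F. range (\<lambda>n. X V Neg (fst p) n (vm (snd p)))))"
  have "X V Neg j n u \<in> ?T" if "u \<in> low {j} v k" for n u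
  proof (rule X_span_into[OF j])
    show "vm ` F \<subseteq> Car V" using assms(2) by blast
    show "vs.subspace ?T" by simp
    show "u \<in> vs.span (vm ` F)" using that assms(1) by blast
    fix x assume "x \<in> vm ` F"
    then obtain n' where "n' \<in> F" "x = vm n'" by blast
    then show "X V Neg j n x \<in> ?T" by (intro vs.span_base) force
  qed
  then have "{X V Neg i n u | i n u. i \<in> {j} \<and> u \<in> low {j} v k} \<subseteq> ?T" by blast
  then show ?thesis unfolding low.simps by (rule vs.span_minimal) simp
qed

text \<open>The l-weights of a level follow from the basis of the level above it. Hence the
  statement on characters reaches level \<open>Suc d\<close>, one further than the statement on
  bases.\<close>

lemma string_chars:
  "dM + k \<le> Suc d \<Longrightarrow>
    (\<forall>z\<in>low {j} v k. \<forall>\<eta>. z \<noteq> 0 \<longrightarrow> eig {0} \<eta> z \<longrightarrow> (\<exists>n\<in>monoms D. n - M \<in> Acl j \<and> (\<forall>l\<in>Idx D \<times> UNIV. \<eta> l = mc n l))) \<and>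
    (dM + k \<le> d \<longrightarrow> low {j} v k \<subseteq> vs.span (vm ` {n \<in> str (dM + k). vm n \<in> low {j} v k}))"
proof (induction k)
  case 0
  have Mlv: "M \<in> str dM" using Mv Acl_0 by (simp add: str_def lv_def)
  have "\<exists>n\<in>monoms D. n - M \<in> Acl j \<and> (\<forall>l\<in>Idx D \<times> UNIV. \<eta> l = mc n l)" if z: "z \<in> low {j} v 0" "z \<noteq> 0" "eig {0} \<eta> z" for z \<eta>
  proof -
    obtain c where c: "z = sc c v" using z(1) by (auto simp: vs.span_singleton)
    have "eig {0} (mc M) z" unfolding c using eig_scale[of "{0}" v] v by simp
    then have "\<forall>l\<in>Idx D \<times> UNIV. \<eta> l = mc M l" using eig_uniq[of "{0}" _ \<eta> z "mc M"] z by auto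
    then show ?thesis using M Acl_0 by (intro bexI[of _ M]) auto
  qed
  moreover have "low {j} v 0 \<subseteq> vs.span (vm ` {n \<in> str (dM + 0). vm n \<in> low {j} v 0})"
  proof -
    have "v \<in> vm ` {n \<in> str (dM + 0). vm n \<in> low {j} v 0}" using Mlv Mv(2) vs.span_base[of v "{v}"] by (intro image_eqI[of _ _ M]) auto
    then show ?thesis using vs.span_mono[of "{v}"] by simp
  qed
  ultimately show ?case by blast
next
  case (Suc k)
  then have IH: "low {j} v k \<subseteq> vs.span (vm ` {n \<in> str (dM + k). vm n \<in> low {j} v k})" and kd: "dM + k \<le> d" by auto
  let ?F = "{n \<in> str (dM + k). vm n \<in> low {j} v k}"
  have FC: "vm n \<in> Car V \<and> eig {0} (mc n) (vm n)" if "n \<in> ?F" for n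
    using that vm'[OF _ kd] by (simp add: str_def)
  have finF: "finite ({j} \<times> ?F)" using fin\<M> by (simp add: str_def lv_def)
  have C: "\<exists>n\<in>monoms D. n - M \<in> Acl j \<and> (\<forall>l\<in>Idx D \<times> UNIV. \<eta> l = mc n l)"
    if z: "z \<in> low {j} v (Suc k)" "z \<noteq> 0" "eig {0} \<eta> z" for z \<eta>
  proof -
    have zs: "z \<in> vs.span ({0} \<union> (\<Union>p\<in>{j} \<times> ?F. range (\<lambda>n. X V Neg (fst p) n (vm (snd p)))))"
      using low_step_span[OF IH] FC z(1) by blast
    have P: "fst p \<in> Idx D \<and> vm (snd p) \<in> Car V \<and> eig {0} (mc (snd p)) (vm (snd p))" if "p \<in> {j} \<times> ?F" for p
      using that FC[of "snd p"] j by auto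
    have "z \<notin> {0}" using z(2) by simp
    from level_eigenvector[OF finF P stable_zero zs this z(3)]
    obtain p a where p: "p \<in> {j} \<times> ?F" "a \<noteq> 0" "\<forall>l\<in>Idx D \<times> UNIV. \<eta> l = mc (mshift Neg (snd p) (fst p) a) l" by blast
    then have n: "snd p \<in> ?F" "fst p = j" by auto
    have m: "snd p \<in> monoms D" "snd p - M \<in> Acl j" using n(1) \<M> by (auto simp: str_def lv_def)
    have "mshift Neg (snd p) j a - M \<in> Acl j"
      using Acl_diff[OF m(2) Acl_A[OF p(2)]] by (simp add: mshift_def algebra_simps)
    then show ?thesis using p(3) n(2) mshift_monoms[OF m(1) j p(2), of Neg] by (intro bexI[of _ "mshift Neg (snd p) j a"]) auto
  qed
  moreover have "low {j} v (Suc k) \<subseteq> vs.span (vm ` {n \<in> str (dM + Suc k). vm n \<in> low {j} v (Suc k)})" if sd: "dM + Suc k \<le> d"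
  proof -
    have "low {j} v (Suc k) \<subseteq> vs.span (vm ` {n \<in> lv (dM + Suc k). vm n \<in> low {j} v (Suc k)})"
    proof (rule stable_span_eigenvectors[where \<chi> = mc])
      show "stable (low {j} v (Suc k))" by (rule low_stable[OF J v(1,3)])
      show "low {j} v (Suc k) \<subseteq> vs.span (vm ` lv (dM + Suc k))" using low_sub[of "Suc k"] lev'[OF sd] by (rule order_trans)
      show "n = n'" if "n \<in> lv (dM + Suc k)" "n' \<in> lv (dM + Suc k)" "\<forall>l\<in>Idx D \<times> UNIV. mc n l = mc n' l" for n n'
        by (rule lv_distinct[OF that])
      show "vm n \<in> Car V \<and> eig {0} (mc n) (vm n)" if "n \<in> lv (dM + Suc k)" for n
        by (rule vm'[OF that sd])
    qed
    moreover have "{n \<in> lv (dM + Suc k). vm n \<in> low {j} v (Suc k)} \<subseteq> {n \<in> str (dM + Suc k). vm n \<in> low {j} v (Suc k)}"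
    proof
      fix n assume n: "n \<in> {n \<in> lv (dM + Suc k). vm n \<in> low {j} v (Suc k)}"
      then have n1: "n \<in> lv (dM + Suc k)" "vm n \<in> low {j} v (Suc k)" by auto
      obtain n' where n': "n' \<in> monoms D" "n' - M \<in> Acl j" "\<forall>l\<in>Idx D \<times> UNIV. mc n l = mc n' l"
        using C[OF n1(2) vm_nz[OF n1(1) sd]] vm'[OF n1(1) sd] by blast
      have "n = n'" by (rule mc_inj) (use n1 n' \<M> in \<open>auto simp: lv_def\<close>)
      then show "n \<in> {n \<in> str (dM + Suc k). vm n \<in> low {j} v (Suc k)}" using n1 n' by (simp add: str_def)
    qed
    ultimately show ?thesis using vs.span_mono image_mono by (meson order_trans)
  qed
  ultimately show ?case by blast
qed

lemma low_str: "dM + k \<le> d \<Longrightarrow> low {j} v k \<subseteq> vs.span (vm ` {n \<in> str (dM + k). vm n \<in> low {j} v k})"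
  using string_chars[of k] by simp

lemma str_inj_j:
  assumes "n - M \<in> Acl j" "n' - M \<in> Acl j" "\<forall>l\<in>{j} \<times> UNIV. mc n l = mc n' l"
  shows "n = n'"
proof (rule string_inj[OF j])
  show "n - n' \<in> group_closure {Amon D j a | a. a \<noteq> 0}"
    using Acl_trans[OF assms(1) Acl_sym[OF assms(2)]] by (simp add: Acl_def)
  show "hchar D n j (int i) = hchar D n' j (int i)" for i using assms(3) by (simp add: mc_def)
qed

lemma W_vector:
  assumes n: "n \<in> \<M>" "n - M \<in> Acl j"
  shows "\<exists>k y. ht (wt n) = ht (wt M) - real k \<and> y \<in> W.low {j} w k \<and> y \<noteq> 0 \<and> (\<forall>l. W.hh (j, l) y = W.sc (hchar D n j l) y)"
proof -
  have nm: "n \<in> monoms D" using n \<M> by blast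
  obtain y where y: "y \<in> Car W" "y \<noteq> 0" "W.eig {0} (W.mc (beta j n)) y"
    using W.lspace_eigenvector[OF beta_monoms[OF nm] W_str[OF n]] by blast
  have hy: "W.hh (j, l) y = W.sc (hchar D n j l) y" for l using W.eig1[OF jW y(3)] by (simp add: hchar_beta)
  obtain k where k: "wt n j = wt M j - 2 * int k" "y \<in> W.low {j} w k" using W_level[OF y(1,2) hy] by blast
  have "ht (wt n) = ht (wt M) - real_of_int (int k)" by (rule ht_string(1)[OF j n(2)[unfolded Acl_def] k(1)])
  then show ?thesis using k y hy by (intro exI[of _ k] exI[of _ y]) simp
qed

lemma lift_vector:
  assumes n: "n \<in> str (dM + k)"
  shows "\<exists>z\<in>low {j} v k. z \<notin> Kr k \<and> Jf.eig (Kr k) (mc n) z"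
proof -
  have n1: "n \<in> \<M>" "n - M \<in> Acl j" "ht (wt n) = ht (wt mp) - real (dM + k)" using n by (auto simp: str_def lv_def)
  obtain k' y where y: "ht (wt n) = ht (wt M) - real k'" "y \<in> W.low {j} w k'" "y \<noteq> 0" "\<forall>l. W.hh (j, l) y = W.sc (hchar D n j l) y"
    using W_vector[OF n1(1,2)] by blast
  have "k' = k" using y(1) n1(3) Mv(3) by simp
  then obtain z where z: "G k z y" using G_ran y(2) by blast
  have "z \<notin> Kr k" using G_uniq[OF z] y(3) by (auto simp: Kr_def)
  moreover have "G k (hh (j, l) z - sc (hchar D n j l) z) 0" for l
    using G_diff[OF G_hh[OF z, of l] G_scale[OF z, of "hchar D n j l"]] y(4) by simp
  ultimately show ?thesis using G_low[OF z] by (intro bexI[of _ z]) (auto simp: Jf.eig_def Kr_def mc_def)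
qed

lemma Jf_eig: "eig U \<chi> z \<Longrightarrow> Jf.eig U \<chi> z"
  using j by (auto simp: eig_def Jf.eig_def)

text \<open>The l-weight beta_j(n) occurs in \<open>W\<close>, so it lifts to an eigenvector modulo
  the kernel. Within a string the currents of j alone separate monomials, so the only basis vector
  that can account for it is \<open>vm n\<close>.\<close>

lemma str_vectors:
  assumes k: "dM + k \<le> d" and n: "n \<in> str (dM + k)"
  shows "vm n \<in> low {j} v k" and "vm n \<notin> Kr k"
proof -
  let ?F = "{n \<in> str (dM + k). vm n \<in> low {j} v k}"
  obtain z where z: "z \<in> low {j} v k" "z \<notin> Kr k" "Jf.eig (Kr k) (mc n) z" using lift_vector[OF n] by blast
  have f: "vm n \<in> Car V \<and> Jf.eig {0} (mc n) (vm n)" if "n \<in> ?F" for n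
  proof -
    have "n \<in> lv (dM + k)" using that by (simp add: str_def)
    from vm'[OF this k] show ?thesis by (simp add: Jf_eig)
  qed
  have zC: "z \<in> Car V" using z(1) low_Car[OF J v(1)] by blast
  have zz: "z - z \<in> Kr k" using G_0 by (simp add: Kr_def)
  have zF: "z \<in> vs.span (vm ` ?F)" by (rule subsetD[OF low_str[OF k] z(1)])
  have "\<exists>n'\<in>?F. vm n' \<notin> Kr k \<and> (\<forall>l\<in>{j} \<times> UNIV. mc n' l = mc n l)"
    by (rule Jf.eig_in_span[where F = ?F and f = vm and \<chi> = mc, OF _ Kr_stable zC z(2,3) zz zF]) (rule f)
  then obtain n' where n': "n' \<in> ?F" "vm n' \<notin> Kr k" "\<forall>l\<in>{j} \<times> UNIV. mc n' l = mc n l" by (elim bexE conjE)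
  have m: "n' - M \<in> Acl j" "n - M \<in> Acl j" using n' n by (simp_all add: str_def)
  have e: "n' = n" by (rule str_inj_j[OF m n'(3)])
  show "vm n \<in> low {j} v k" using n'(1) unfolding e by simp
  show "vm n \<notin> Kr k" using n'(2) unfolding e .
qed

text \<open>The kernel at a known level is spanned by the basis vectors it contains, and none of
  them lies in it.\<close>

lemma Kr_zero:
  assumes k: "dM + k \<le> d"
  shows "Kr k = {0}"
proof (rule ccontr)
  assume "Kr k \<noteq> {0}"
  moreover have "0 \<in> Kr k" using G_0 by (simp add: Kr_def)
  ultimately have "\<not> Kr k \<subseteq> {0}" by blast
  let ?F = "{n \<in> str (dM + k). vm n \<in> low {j} v k}"
  have f: "vm n \<in> Car V \<and> Jf.eig {0} (mc n) (vm n)" if "n \<in> ?F" for n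
  proof -
    have "n \<in> lv (dM + k)" using that by (simp add: str_def)
    from vm'[OF this k] show ?thesis by (simp add: Jf_eig)
  qed
  have ds: "n = n'" if "n \<in> ?F" "n' \<in> ?F" "\<forall>l\<in>{j} \<times> UNIV. mc n l = mc n' l" for n n'
  proof (rule str_inj_j[OF _ _ that(3)])
    show "n - M \<in> Acl j" "n' - M \<in> Acl j" using that(1,2) by (simp_all add: str_def)
  qed
  have sub: "Kr k \<subseteq> vs.span (vm ` ?F)" using Kr_low low_str[OF k] by (rule order_trans)
  have S: "Kr k \<subseteq> vs.span (vm ` {n \<in> ?F. vm n \<in> Kr k})"
    by (rule Jf.stable_span_eigenvectors[OF f ds Kr_stable sub])
  have e: "{n \<in> ?F. vm n \<in> Kr k} = {}" using str_vectors(2)[OF k] by blast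
  have "Kr k \<subseteq> vs.span {}" using S unfolding e image_empty .
  then show False using \<open>\<not> Kr k \<subseteq> {0}\<close> unfolding vs.span_empty by contradiction
qed

text \<open>Comparison with \<open>W\<close> yields only an eigenvector for the currents of j. These
  commute with all currents, so their eigenspace contains a joint eigenvector; its l-weight lies in
  the string and agrees with n at j, hence is n.\<close>

lemma new_vector:
  assumes k: "dM + k \<le> Suc d" and n: "n \<in> str (dM + k)"
  shows "\<exists>z\<in>low {j} v k. z \<noteq> 0 \<and> eig {0} (mc n) z"
proof -
  obtain z where z: "z \<in> low {j} v k" "z \<notin> Kr k" "Jf.eig (Kr k) (mc n) z" using lift_vector[OF n] by blast
  have "{0} \<subseteq> Kr k" using G_0 by (simp add: Kr_def)
  from Jf.eig_lift[OF low_Jf Kr_stable Jf.stable_zero this z]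
  obtain z' where z': "z' \<in> low {j} v k" "z' \<notin> {0}" "Jf.eig {0} (mc n) z'" by blast
  define S where "S = {a \<in> low {j} v k. Jf.eig {0} (mc n) a}"
  note st = low_stable[OF J v(1,3), of k]
  have SC: "a \<in> Car V" if "a \<in> S" for a using that stableD(2)[OF st] by (auto simp: S_def)
  have s0: "vs.subspace {0}" by simp
  have "stable S" unfolding stable_def
  proof (intro conjI ballI)
    show "vs.subspace S"
    proof (rule vs.subspaceI)
      show "0 \<in> S" using vs.subspace_0[OF low_subspace] Jf.eig_scale[OF s0, of z' "mc n" 0] z'(3) stableD(2)[OF st] z'(1) by (auto simp: S_def)
      show "a + b \<in> S" if "a \<in> S" "b \<in> S" for a b
        using that Jf.eig_add[OF s0 SC[OF that(1)] SC[OF that(2)]] vs.subspace_add[OF low_subspace] by (simp add: S_def)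
      show "sc c a \<in> S" if "a \<in> S" for c a
        using that Jf.eig_scale[OF s0 SC[OF that]] vs.subspace_scale[OF low_subspace] by (simp add: S_def)
    qed
    show "S \<subseteq> Car V" using SC by blast
    fix l a assume l: "l \<in> Idx D \<times> (UNIV :: int set)" and a: "a \<in> S"
    obtain i p where l': "l = (i, p)" "i \<in> Idx D" using l by auto
    have "hh (j, r) (hh l a) = sc (mc n (j, r)) (hh l a)" for r
    proof -
      have "hh (j, r) a = sc (mc n (j, r)) a" using a by (auto simp: S_def Jf.eig_def)
      then show ?thesis unfolding l'(1) using hh_comm[OF j l'(2) SC[OF a], of r p] hh_scale[OF l'(2) SC[OF a]] by simp
    qed
    then show "hh l a \<in> S" using a stableD(3)[OF st l] by (auto simp: S_def Jf.eig_def)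
  qed
  moreover have "\<not> S \<subseteq> {0}" using z' by (auto simp: S_def)
  ultimately obtain y \<eta> where y: "y \<in> S" "y \<notin> {0}" "eig {0} \<eta> y" using joint_eigenvector_mod[OF _ stable_zero] by blast
  have yl: "y \<in> low {j} v k" "Jf.eig {0} (mc n) y" "y \<noteq> 0" using y by (auto simp: S_def)
  obtain n' where n': "n' \<in> monoms D" "n' - M \<in> Acl j" "\<forall>l\<in>Idx D \<times> UNIV. \<eta> l = mc n' l"
    using string_chars[OF k] yl(1,3) y(3) by blast
  have "\<forall>l\<in>{j} \<times> UNIV. mc n' l = mc n l"
  proof
    fix l :: "nat \<times> int" assume l: "l \<in> {j} \<times> UNIV"
    have "\<eta> l = mc n l" by (rule Jf.eig_uniq[OF s0 l Jf_eig[OF y(3)] yl(2) y(2)])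
    then show "mc n' l = mc n l" using n'(3) l j by auto
  qed
  moreover have "n - M \<in> Acl j" using n by (simp add: str_def)
  ultimately have "n' = n" using str_inj_j[OF n'(2)] by blast
  then have "eig {0} (mc n) y" using y(3) n'(3) eig_cong[of \<eta> "mc n"] by simp
  then show ?thesis using yl by blast
qed

text \<open>Raising sends the kernel to the kernel one level up, which is already known to
  vanish.\<close>

lemma Kr_Xpos: "g \<in> Kr (Suc k) \<Longrightarrow> dM + k \<le> d \<Longrightarrow> X V Pos j n g = 0"
  using G_Xpos_Suc[of k g 0 n] Kr_zero[of k] W.X_zero[OF jW] by (auto simp: Kr_def)

lemma low_weight_j:
  assumes "g \<in> vs.span (range (\<lambda>n. X V Neg i n (vm m)))" "i \<in> Idx D" "vm m \<in> Car V" "eig {0} (mc m) (vm m)"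
  shows "K V j g = sc (q powi (int (rr D j) * (wt m j - Cart D j i))) g"
proof -
  have "g \<in> low {i} (vm m) 1"
  proof -
    have "range (\<lambda>n. X V Neg i n (vm m)) \<subseteq> low {i} (vm m) 1" using low_X[of i "{i}" "vm m" "vm m" 0] vs.span_base[of "vm m" "{vm m}"] by auto
    then show ?thesis using assms(1) vs.span_minimal[OF _ low_subspace] by blast
  qed
  then show ?thesis using low1_weight[OF assms(2-4) j, of g 1] by simp
qed

text \<open>Modulo the module generated by \<open>v\<close> under the vertex j, such a
  \<open>g\<close> is killed by all x^+_j. Outside that module it would therefore make m'
  j-dominant. Allowing \<open>g\<close> to be an eigenvector only modulo the module admits Jordan
  blocks.\<close>

lemma in_string_module:
  assumes m': "m' \<in> monoms D" "m' - M \<in> Acl j" "\<not> j_dominant j m'"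
    and g: "g \<in> low (Idx D) vp (Suc d)" "eig (ltot {j} v) (mc m') g" "K V j g = sc \<kappa> g" and ht': "ht (wt m') = ht (wt mp) - real (Suc d)"
  shows "g \<in> ltot {j} v"
proof (rule ccontr)
  assume gZ: "g \<notin> ltot {j} v"
  let ?Z = "ltot {j} v"
  note Z = ltot_stable[OF J v(1,3)]
  note sZ = stableD(1)[OF Z]
  have gC: "g \<in> Car V" using g(1) low_Car[OF subset_refl vp(1)] by blast
  have ZX: "X V s j n u \<in> ?Z" if "u \<in> ?Z" for s n u
    using ltot_Xneg[OF J v(1), of j u n] ltot_Xpos[OF J v(1,3) j v(4) that, of n] that by (cases s) auto
  \<comment> \<open>A raised vector surviving modulo \<open>?Z\<close> would give an l-weight m'
    A_{j,a} on level d. By the known basis this is a monomial of the string of \<open>M\<close>,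
    whose vector already lies in \<open>?Z\<close>.\<close>
  have kill: "X V Pos j n g \<in> ?Z" for n
  proof (rule ccontr)
    assume nX: "X V Pos j n g \<notin> ?Z"
    let ?R = "range (\<lambda>n. X V Pos j n g)"
    let ?S = "vs.span (?Z \<union> ?R)"
    have "stable ?S"
    proof (rule span_stable)
      show "?Z \<union> ?R \<subseteq> Car V" using stableD(2)[OF Z] X_in[OF j gC] by blast
      fix x and l :: "nat \<times> int" assume x: "x \<in> ?Z \<union> ?R" and l: "l \<in> Idx D \<times> UNIV"
      show "hh l x \<in> ?S"
      proof (cases "x \<in> ?Z")
        case True
        then show ?thesis using stableD(3)[OF Z l] by (intro vs.span_base) blast
      next
        case False
        then obtain r where r: "x = X V Pos j r g" using x by blast
        obtain i p where l': "l = (i, p)" "i \<in> Idx D" using l by auto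
        let ?u = "hh (i, p) g - sc (mc m' (i, p)) g"
        have uZ: "?u \<in> ?Z" using g(2) l l' by (auto simp: eig_def)
        have Xs: "X V Pos j r' g \<in> ?S" "X V Pos j r' ?u \<in> ?S" for r' using ZX[OF uZ] by (auto intro: vs.span_base)
        have "X V Pos j r (hh (i, p) g) = X V Pos j r ?u + sc (mc m' (i, p)) (X V Pos j r g)"
          using X_diff[OF j hh_in[OF l'(2) gC] vs.subspace_scale[OF subC gC], of Pos r p "mc m' (i, p)"] X_scale[OF j gC] by simp
        then have "X V Pos j r (hh (i, p) g) \<in> ?S" using Xs by (simp add: vs.span_add vs.span_scale)
        then show ?thesis unfolding r l'(1) hh_X[OF l'(2) j gC] using Xs(1) by (auto intro!: vs.span_add vs.span_scale)
      qed
    qed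
    moreover have "\<not> ?S \<subseteq> ?Z" using nX vs.span_base[of "X V Pos j n g" "?Z \<union> ?R"] by blast
    ultimately obtain z \<eta> where z: "z \<in> ?S" "z \<notin> ?Z" "eig ?Z \<eta> z" using joint_eigenvector_mod[OF _ Z] by blast
    have zC: "z \<in> Car V" using z(1) stableD(2)[OF \<open>stable ?S\<close>] by blast
    obtain y where y: "y \<in> vs.span ?R" "z - y \<in> ?Z" using z(1) subspace_sum_span[OF sZ] by blast
    obtain a where a: "a \<noteq> 0" "\<forall>l\<in>Idx D \<times> UNIV. \<eta> l = mc (mshift Pos m' j a) l"
      using current_eigenvector[OF j Z ZX stableD(2)[OF Z] gC g(2) zC z(2,3) y(2,1)] by blast
    have "?R \<subseteq> low (Idx D) vp d" using low_Xpos[OF subset_refl vp(1,2) j vp(3)[OF j] g(1)] by auto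
    then have "y \<in> low (Idx D) vp d" using y(1) vs.span_minimal[OF _ low_subspace] by blast
    then have ys: "y \<in> vs.span (vm ` lv d)" using lev'[of d] by blast
    obtain n' where n': "n' \<in> lv d" "vm n' \<notin> ?Z" "\<forall>l\<in>Idx D \<times> UNIV. mc n' l = \<eta> l"
      using eig_in_span[OF vm'[OF _ order_refl] Z zC z(2,3) y(2) ys] by blast
    have "n' = mshift Pos m' j a"
      by (rule mc_inj) (use n' a \<M> mshift_monoms[OF m'(1) j a(1)] in \<open>auto simp: lv_def\<close>)
    then have n'M: "n' - M \<in> Acl j" using Acl_add[OF m'(2) Acl_A[OF a(1)]] by (simp add: mshift_def algebra_simps)
    have "ht (wt n') = ht (wt mp) - real d" "n' \<in> \<M>" using n'(1) by (auto simp: lv_def)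
    moreover obtain k where "ht (wt n') = ht (wt M) - real k" using W_vector[OF \<open>n' \<in> \<M>\<close> n'M] by blast
    ultimately have k: "dM + k = d" using Mv(3) by linarith
    then have "vm n' \<in> low {j} v k" using str_vectors(1)[of k n'] n'(1) n'M by (simp add: str_def)
    then show False using n'(2) low_ltot by blast
  qed
  have "j_dominant j m'"
  proof (rule highest_j_dominant[OF m'(1) _ _ _ gC gZ kill _ g(3)])
    show "stab1 j ?Z" using Z ltot_Kinv[OF J v(1,3) j] j stableD[OF Z] by (auto simp: stab1_def)
    show "x n u \<in> ?Z" if "u \<in> ?Z" for n u using ZX[OF that, of Neg n] by (simp add: x_def)
    show "X V Pos j 0 u \<in> ?Z" if "u \<in> ?Z" for u by (rule ZX[OF that])
    show "hh (j, n) g - sc (hchar D m' j n) g \<in> ?Z" for n using g(2) j by (auto simp: eig_def mc_def)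
  qed
  then show False using m'(3) by blast
qed

end

context qdat
begin

text \<open>Hypothesis (iii) with the equality of q-characters resolved into statements on single
  l-weight spaces, and with M itself in the string.\<close>

definition string_module :: "monom set \<Rightarrow> nat \<Rightarrow> monom \<Rightarrow> (nat \<Rightarrow>\<^sub>0 complex) qmodule \<Rightarrow> bool" where
  "string_module \<M> j M W \<longleftrightarrow> is_L (sl2_data D j) (beta j M) W \<and>
     (\<forall>n\<in>\<M>. n - M \<in> Acl j \<longrightarrow> lspace (sl2_data D j) W (beta j n) \<noteq> {0} \<and>
        vector_space.dim (scl W) (lspace (sl2_data D j) W (beta j n)) = 1) \<and>
     (\<forall>\<mu>\<in>monoms (sl2_data D j). lspace (sl2_data D j) W \<mu> \<noteq> {0} \<longrightarrow> (\<exists>n\<in>\<M>. n - M \<in> Acl j \<and> \<mu> = beta j n))"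

lemma sl2_qmod: "j \<in> Idx D \<Longrightarrow> is_L (sl2_data D j) \<mu> W \<Longrightarrow> qmod (sl2_data D j) W"
  by (intro qmod.intro qmod_axioms.intro qdat_sl2) (simp_all add: is_L_def)

text \<open>The restricted monomial occurs as an l-weight of \<open>W\<close>, hence in one level of
  words in x^-_j; the j-weight of that level fixes the difference of heights. Level 0 is the line of
  the highest vector.\<close>

lemma string_level:
  assumes j: "j \<in> Idx D" and L: "is_L (sl2_data D j) (beta j M) W" and M: "M \<in> monoms D" and n: "n \<in> monoms D" "n - M \<in> Acl j"
    and ne: "lspace (sl2_data D j) W (beta j n) \<noteq> {0}"
  shows "\<exists>k. ht (wt n) = ht (wt M) - real k \<and> (k = 0 \<longrightarrow> n = M)"
proof -
  interpret W: qmod "sl2_data D j" W by (rule sl2_qmod[OF j L])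
  have jW: "j \<in> Idx (sl2_data D j)" by simp
  have hL: "highest_lweight (sl2_data D j) W (beta j M)" using L by (simp add: is_L_def)
  obtain w where w: "w \<in> Car W" "w \<noteq> 0" "\<forall>i\<in>Idx (sl2_data D j). \<forall>n. X W Pos i n w = 0" "W.eig {0} (W.mc (beta j M)) w"
    "\<forall>U. submodule (sl2_data D j) W U \<and> w \<in> U \<longrightarrow> U = Car W"
    using W.highest_vector[OF beta_monoms[OF M] hL] by blast
  obtain y where y: "y \<in> Car W" "y \<noteq> 0" "W.eig {0} (W.mc (beta j n)) y"
    using W.lspace_eigenvector[OF beta_monoms[OF n(1)] ne] by blast
  have "W.ltot (Idx (sl2_data D j)) w = Car W"
  proof (rule W.ltot_Car[OF w(1,4)])
    show "X W Pos i n w = 0" if "i \<in> Idx (sl2_data D j)" for i n using w(3) that by blast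
    show "U = Car W" if "submodule (sl2_data D j) W U" "w \<in> U" for U using w(5) that by blast
  qed
  then have tot: "y \<in> W.vs.span (\<Union>d. W.low {j} w d)" using y(1) by (simp add: W.ltot_def)
  have "K W j y = W.sc (qq (sl2_data D j) powi (int (rr (sl2_data D j) j) * wt (beta j n) j)) y"
    using W.eig1[OF jW y(3), of 0] by (simp add: W.hh_def hchar_beta hchar_def qi_powi wt_beta)
  from W.low1_proj[OF jW w(1,4) order_refl tot y(2) this]
  obtain k where k: "wt n j = wt M j - 2 * int k" "y \<in> W.vs.span (W.low {j} w k)" by (auto simp: wt_beta)
  have "ht (wt n) = ht (wt M) - real_of_int (int k)" by (rule ht_string(1)[OF j n(2)[unfolded Acl_def] k(1)])
  moreover have "n = M" if "k = 0"
  proof (rule beta_string_inj[OF j n(2)[unfolded Acl_def]])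
    have "y \<in> W.vs.span {w}" using k(2) that by (simp add: W.vs.span_span)
    then obtain c where c: "y = W.sc c w" by (auto simp: W.vs.span_singleton)
    have s0: "W.vs.subspace {0}" by simp
    have e: "W.eig {0} (W.mc (beta j M)) y" unfolding c by (rule W.eig_scale[OF s0 w(1,4)])
    have y0: "y \<notin> {0}" using y(2) by simp
    show "beta j n = beta j M"
      by (rule W.mc_inj[OF beta_monoms[OF n(1)] beta_monoms[OF M] W.eig_uniq[OF s0 _ y(3) e y0]])
  qed
  ultimately show ?thesis by auto
qed

text \<open>The M given by (iii) need not lie in the string of m. But beta_j(M) is an l-weight of
  \<open>W\<close> and therefore equals beta_j(M') for some M' in the string, which replaces M.
  Since beta_j is injective on a string, the coefficients of the sum are all 1.\<close>

lemma string_moduleI: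
  fixes W :: "(nat \<Rightarrow>\<^sub>0 complex) qmodule"
  assumes j: "j \<in> Idx D" and \<M>: "finite \<M>" "\<M> \<subseteq> monoms D" and m: "m \<in> \<M>" and M: "M \<in> \<M>" "j_dominant j M"
    and L: "is_L (sl2_data D j) (beta j M) W"
    and ch: "qchar (sl2_data D j) W = (\<Sum>m' | m' \<in> \<M> \<and> m' - m \<in> Acl j. Poly_Mapping.single (beta j m') 1)"
  shows "\<exists>M'\<in>\<M>. M' - m \<in> Acl j \<and> j_dominant j M' \<and> string_module \<M> j M' W"
proof -
  let ?Dj = "sl2_data D j" and ?S = "{m' \<in> \<M>. m' - m \<in> Acl j}"
  interpret W: qmod ?Dj W by (rule sl2_qmod[OF j L])
  have jW: "j \<in> Idx ?Dj" by simp
  have fS: "finite ?S" using \<M>(1) by simp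
  have inj: "n = n'" if n: "n \<in> ?S" "n' \<in> ?S" and e: "beta j n = beta j n'" for n n'
  proof (rule beta_string_inj[OF j _ e])
    have "n - n' \<in> Acl j" using Acl_trans[of n m j n'] Acl_sym[of n' m j] n by simp
    then show "n - n' \<in> group_closure {Amon D j a | a. a \<noteq> 0}" by (simp add: Acl_def)
  qed
  have lk: "Poly_Mapping.lookup (qchar ?Dj W) (beta j n) = 1" if n: "n \<in> ?S" for n
  proof -
    have "Poly_Mapping.lookup (qchar ?Dj W) (beta j n) = (\<Sum>m'\<in>?S. if m' = n then 1 else 0)"
      unfolding ch lookup_sum by (rule sum.cong) (use inj n in \<open>auto simp: lookup_single when_def\<close>)
    then show ?thesis using n fS by simp
  qed
  have lk0: "\<mu> \<in> beta j ` ?S" if "Poly_Mapping.lookup (qchar ?Dj W) \<mu> \<noteq> 0" for \<mu>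
  proof (rule ccontr)
    assume "\<mu> \<notin> beta j ` ?S"
    then have "Poly_Mapping.lookup (qchar ?Dj W) \<mu> = (\<Sum>m'\<in>?S. 0)"
      unfolding ch lookup_sum by (intro sum.cong) (auto simp: lookup_single when_def)
    then show False using that by simp
  qed
  let ?A = "{\<mu> \<in> monoms ?Dj. lspace ?Dj W \<mu> \<noteq> {0}}" and ?dim = "\<lambda>\<mu>. W.vs.dim (lspace ?Dj W \<mu>)"
  have mS: "m \<in> ?S" using m Acl_0 by simp
  \<comment> \<open>A sum over an infinite set is 0 by convention, which contradicts the coefficient
    1 at beta_j(m).\<close>
  have fA: "finite ?A"
  proof (rule ccontr)
    assume "infinite ?A"
    then have "qchar ?Dj W = 0" unfolding qchar_def by (rule sum.infinite)
    then show False using lk[OF mS] by simp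
  qed
  have lq: "Poly_Mapping.lookup (qchar ?Dj W) \<mu> = (if \<mu> \<in> ?A then int (?dim \<mu>) else 0)" for \<mu>
  proof -
    have "Poly_Mapping.lookup (qchar ?Dj W) \<mu> = (\<Sum>\<nu>\<in>?A. if \<nu> = \<mu> then int (?dim \<mu>) else 0)"
      unfolding qchar_def lookup_sum by (rule sum.cong) (auto simp: lookup_single when_def)
    then show ?thesis using fA by (simp add: sum.delta)
  qed
  have A1: "\<mu> \<in> beta j ` ?S" if "\<mu> \<in> ?A" for \<mu>
  proof -
    have "lspace ?Dj W \<mu> = W.ph.gen (\<lambda>(s, i, n). gamma ?Dj \<mu> s i n)" by (rule W.lweight_space_gen)
    then have st: "W.ph.stable (lspace ?Dj W \<mu>)" using W.ph.gen_stable by simp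
    have z: "0 \<in> lspace ?Dj W \<mu>" by (rule W.vs.subspace_0[OF W.ph.stableD(1)[OF st]])
    obtain E where E: "finite E" "E \<subseteq> Car W" "W.vs.span E = Car W" using W.fin_dim_V unfolding fin_dim_def by blast
    have s: "lspace ?Dj W \<mu> \<subseteq> W.vs.span E" unfolding E(3) by (rule W.ph.stableD(2)[OF st])
    have "lspace ?Dj W \<mu> \<noteq> {0}" using that by simp
    then have "{0} \<subset> lspace ?Dj W \<mu>" using z by blast
    then have "?dim \<mu> \<noteq> 0" using W.vs.dim_strict_mono_subspace[OF E(1) s, of "{0}"] by simp
    then show ?thesis using lk0[of \<mu>] lq[of \<mu>] that by simp
  qed
  have MD: "M \<in> monoms D" using M \<M> by blast
  have hL: "highest_lweight ?Dj W (beta j M)" using L by (simp add: is_L_def)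
  obtain w where w: "w \<in> Car W" "w \<noteq> 0" "W.eig {0} (W.mc (beta j M)) w"
    using W.highest_vector[OF beta_monoms[OF MD] hL] by blast
  have z0: "{0} \<subseteq> W.vs.span {w}" using W.vs.span_zero by simp
  have "w \<in> lspace ?Dj W (beta j M)"
    by (rule W.eigenvector_lspace[OF beta_monoms[OF MD] w(1,3) w(1) W.eig_mono[OF w(3) z0]])
  then have "beta j M \<in> ?A" using w(2) beta_monoms[OF MD] by auto
  then obtain M' where M': "M' \<in> ?S" "beta j M = beta j M'" using A1 by blast
  have trn: "n - M' \<in> Acl j \<longleftrightarrow> n - m \<in> Acl j" for n
    using Acl_trans[of n M' j m] Acl_trans[of n m j M'] Acl_sym[of M' m j] M'(1) by auto
  have "string_module \<M> j M' W"
    unfolding string_module_def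
  proof (intro conjI ballI impI)
    show "is_L ?Dj (beta j M') W" using L M'(2) by simp
    fix n assume n: "n \<in> \<M>" "n - M' \<in> Acl j"
    then have "Poly_Mapping.lookup (qchar ?Dj W) (beta j n) = 1" using lk[of n] trn[of n] by simp
    then show "lspace ?Dj W (beta j n) \<noteq> {0}" "?dim (beta j n) = 1" unfolding lq by (simp_all split: if_splits)
  next
    fix \<mu> assume "\<mu> \<in> monoms ?Dj" "lspace ?Dj W \<mu> \<noteq> {0}"
    then obtain n where "n \<in> ?S" "\<mu> = beta j n" using A1 by blast
    then show "\<exists>n\<in>\<M>. n - M' \<in> Acl j \<and> \<mu> = beta j n" using trn[of n] by auto
  qed
  moreover have "j_dominant j M'" using j_dominant_beta[OF M'(2)] M(2) by simp
  ultimately show ?thesis using M'(1) by auto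
qed

end

subsection \<open>Construction of the module level by level\<close>

locale monomial_set = qmod D V for D and V :: "'v::ab_group_add qmodule" +
  fixes mp :: monom and \<M> :: "monom set" and vp
  assumes vp: "vp \<in> Car V" "vp \<noteq> 0" "eig {0} (mc mp) vp" "\<And>i n. i \<in> Idx D \<Longrightarrow> X V Pos i n vp = 0"
    and vp_gen: "\<And>U. submodule D V U \<Longrightarrow> vp \<in> U \<Longrightarrow> U = Car V"
    and irr: "irreducible_module D V"
    and fin\<M>: "finite \<M>" and \<M>: "\<M> \<subseteq> monoms D" and mp: "mp \<in> \<M>"
    and dom: "\<And>m. m \<in> \<M> \<Longrightarrow> m \<noteq> mp \<Longrightarrow> \<exists>j\<in>Idx D. \<not> j_dominant j m"
    and ii: "\<And>m i a j b. m \<in> \<M> \<Longrightarrow> i \<in> Idx D \<Longrightarrow> a \<noteq> 0 \<Longrightarrow> m - Amon D i a \<notin> \<M> \<Longrightarrow> j \<in> Idx D \<Longrightarrow> b \<noteq> 0 \<Longrightarrow>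
      m - Amon D i a + Amon D j b \<in> \<M> \<Longrightarrow> j = i"
    and strs: "\<And>m j. m \<in> \<M> \<Longrightarrow> j \<in> Idx D \<Longrightarrow> \<exists>M\<in>\<M>. \<exists>W. M - m \<in> Acl j \<and> j_dominant j M \<and> string_module \<M> j M W"
begin

definition "L e = {n \<in> \<M>. ht (wt n) = ht (wt mp) - real e}"

text \<open>One choice serves all stages of the induction, because the height of n determines the
  level e.\<close>

definition "vm n = (SOME u. \<exists>e. ht (wt n) = ht (wt mp) - real e \<and> u \<noteq> 0 \<and> u \<in> low (Idx D) vp e \<and> eig {0} (mc n) u)"

definition "good e \<longleftrightarrow> low (Idx D) vp e \<subseteq> vs.span (vm ` L e) \<and>
  (\<forall>n\<in>L e. vm n \<noteq> 0 \<and> vm n \<in> low (Idx D) vp e \<and> eig {0} (mc n) (vm n))"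

abbreviation "Inv d \<equiv> \<forall>e\<le>d. good e"

lemma vm_some:
  assumes "ht (wt n) = ht (wt mp) - real e" "u \<noteq> 0" "u \<in> low (Idx D) vp e" "eig {0} (mc n) u"
  shows "vm n \<noteq> 0 \<and> vm n \<in> low (Idx D) vp e \<and> eig {0} (mc n) (vm n)"
proof -
  have "\<exists>e. ht (wt n) = ht (wt mp) - real e \<and> vm n \<noteq> 0 \<and> vm n \<in> low (Idx D) vp e \<and> eig {0} (mc n) (vm n)"
    unfolding vm_def by (rule someI[of _ u]) (use assms in blast)
  then obtain e' where e': "ht (wt n) = ht (wt mp) - real e'" "vm n \<noteq> 0 \<and> vm n \<in> low (Idx D) vp e' \<and> eig {0} (mc n) (vm n)" by blast
  have "e' = e" using e'(1) assms(1) by simp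
  then show ?thesis using e'(2) by simp
qed

lemma good_vm: "good e \<Longrightarrow> n \<in> L e \<Longrightarrow> vm n \<in> Car V \<and> eig {0} (mc n) (vm n)"
  and good_nz: "good e \<Longrightarrow> n \<in> L e \<Longrightarrow> vm n \<noteq> 0"
  and good_low: "good e \<Longrightarrow> n \<in> L e \<Longrightarrow> vm n \<in> low (Idx D) vp e"
  using low_Car[OF subset_refl vp(1), of e] by (auto simp: good_def)

lemma string_exists:
  assumes m: "m \<in> \<M>" and j: "j \<in> Idx D"
  shows "\<exists>M\<in>\<M>. \<exists>W k. string_module \<M> j M W \<and> j_dominant j M \<and> m - M \<in> Acl j \<and>
    ht (wt m) = ht (wt M) - real k \<and> (k = 0 \<longrightarrow> m = M)"
proof -
  obtain M W where M: "M \<in> \<M>" "M - m \<in> Acl j" "j_dominant j M" "string_module \<M> j M W" using strs[OF m j] by blast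
  have mM: "m - M \<in> Acl j" by (rule Acl_sym[OF M(2)])
  have L: "is_L (sl2_data D j) (beta j M) W" "lspace (sl2_data D j) W (beta j m) \<noteq> {0}"
    using M(4) m mM by (auto simp: string_module_def)
  have "\<exists>k. ht (wt m) = ht (wt M) - real k \<and> (k = 0 \<longrightarrow> m = M)"
    by (rule string_level[OF j L(1) _ _ mM L(2)]) (use m M(1) \<M> in blast)+
  then show ?thesis using M mM by blast
qed

text \<open>A monomial other than m_+ is not j-dominant for some j, so the j-dominant head of its
  j-string is strictly higher. Iterating must end at m_+, as the number of higher monomials
  decreases.\<close>

lemma ht_level: "m \<in> \<M> \<Longrightarrow> \<exists>e. ht (wt m) = ht (wt mp) - real e \<and> (e = 0 \<longrightarrow> m = mp)"
proof (induction "card {n \<in> \<M>. ht (wt n) > ht (wt m)}" arbitrary: m rule: less_induct)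
  case less
  show ?case
  proof (cases "m = mp")
    case True
    then show ?thesis by (intro exI[of _ 0]) simp
  next
    case False
    then obtain j where j: "j \<in> Idx D" "\<not> j_dominant j m" using dom less.prems by blast
    obtain M k where M: "M \<in> \<M>" "j_dominant j M" "ht (wt m) = ht (wt M) - real k" "k = 0 \<longrightarrow> m = M"
      using string_exists[OF less.prems j(1)] by blast
    have "k \<noteq> 0" using M(2,4) j(2) by blast
    then have lt: "ht (wt m) < ht (wt M)" using M(3) by simp
    have "{n \<in> \<M>. ht (wt n) > ht (wt M)} \<subset> {n \<in> \<M>. ht (wt n) > ht (wt m)}" using lt M(1) by auto
    then have "card {n \<in> \<M>. ht (wt n) > ht (wt M)} < card {n \<in> \<M>. ht (wt n) > ht (wt m)}"
      using fin\<M> by (intro psubset_card_mono) auto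
    from less.hyps[OF this M(1)] obtain e where "ht (wt M) = ht (wt mp) - real e" by blast
    then have "ht (wt m) = ht (wt mp) - real (e + k)" using M(3) by simp
    then show ?thesis using \<open>k \<noteq> 0\<close> by (intro exI[of _ "e + k"]) simp
  qed
qed

lemma L_0: "L 0 = {mp}"
proof
  show "L 0 \<subseteq> {mp}"
  proof
    fix n assume n: "n \<in> L 0"
    then obtain e where "ht (wt n) = ht (wt mp) - real e \<and> (e = 0 \<longrightarrow> n = mp)" using ht_level[of n] by (auto simp: L_def)
    then show "n \<in> {mp}" using n by (simp add: L_def)
  qed
qed (use mp in \<open>simp add: L_def\<close>)

lemma L_cover: "(\<Union>e. L e) = \<M>"
proof
  show "\<M> \<subseteq> (\<Union>e. L e)"
  proof
    fix n assume n: "n \<in> \<M>"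
    then obtain e where "ht (wt n) = ht (wt mp) - real e" using ht_level by blast
    then have "n \<in> L e" using n by (simp add: L_def)
    then show "n \<in> (\<Union>e. L e)" by blast
  qed
qed (auto simp: L_def)

lemma good_0: "good 0"
proof -
  have v: "vp \<in> low (Idx D) vp 0" by (simp add: vs.span_base)
  have vm: "vm mp \<noteq> 0 \<and> vm mp \<in> low (Idx D) vp 0 \<and> eig {0} (mc mp) (vm mp)" by (rule vm_some[OF _ vp(2) v vp(3)]) simp
  then obtain c where c: "vm mp = sc c vp" by (auto simp: vs.span_singleton)
  then have "c \<noteq> 0" using vm by auto
  then have "vp = sc (inverse c) (vm mp)" using c by simp
  moreover have "sc (inverse c) (vm mp) \<in> vs.span {vm mp}" by (intro vs.span_scale vs.span_base) simp
  ultimately have "vp \<in> vs.span {vm mp}" by (simp only:)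
  then have "low (Idx D) vp 0 \<subseteq> vs.span {vm mp}" using vs.span_minimal[of "{vp}" "vs.span {vm mp}"] by simp
  then show ?thesis using vm by (simp add: good_def L_0)
qed

text \<open>The span of the raised vectors contains a joint eigenvector with l-weight m A_{k,b}, and
  the basis of the previous level shows that this monomial belongs to \<open>\<M>\<close>.\<close>

lemma raise:
  assumes I: "Inv d" and u: "u \<in> low (Idx D) vp e" "e \<le> Suc d" "eig {0} (mc m) u" and m: "m \<in> monoms D"
    and k: "k \<in> Idx D" "X V Pos k n u \<noteq> 0"
  shows "\<exists>e' b. e = Suc e' \<and> b \<noteq> 0 \<and> m + Amon D k b \<in> L e'"
proof -
  have up: "case e of 0 \<Rightarrow> X V Pos k p u = 0 | Suc e \<Rightarrow> X V Pos k p u \<in> low (Idx D) vp e" for p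
    by (rule low_Xpos[OF subset_refl vp(1,3) k(1) vp(4)[OF k(1)] u(1)])
  then obtain e' where e': "e = Suc e'" using up[of n] k(2) by (cases e) auto
  have up': "X V Pos k p u \<in> low (Idx D) vp e'" for p using up[of p] e' by simp
  have uC: "u \<in> Car V" by (rule subsetD[OF low_Car[OF subset_refl vp(1)] u(1)])
  have g: "good e'" using I u(2) e' by simp
  let ?S = "vs.span (range (\<lambda>p. X V Pos k p u))"
  have st: "stable ?S" by (rule span_current_stable[OF k(1) uC u(3)])
  have nX: "X V Pos k n u \<in> ?S" by (rule vs.span_base) blast
  have "\<not> ?S \<subseteq> {0}" using nX k(2) by blast
  then obtain z \<eta> where z: "z \<in> ?S" "z \<notin> {0}" "eig {0} \<eta> z" using joint_eigenvector_mod[OF st stable_zero] by blast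
  have zC: "z \<in> Car V" by (rule subsetD[OF stableD(2)[OF st] z(1)])
  have z0: "z - z \<in> {0}" by simp
  have X0: "X V Pos k p x \<in> {0}" if "x \<in> {0}" for p x using that X_zero[OF k(1)] by simp
  have C0: "{0} \<subseteq> Car V" using stableD(2)[OF stable_zero] .
  obtain a where a: "a \<noteq> 0" "\<forall>l\<in>Idx D \<times> UNIV. \<eta> l = mc (mshift Pos m k a) l"
    using current_eigenvector[OF k(1) stable_zero X0 C0 uC u(3) zC z(2,3) z0 z(1)] by blast
  have "?S \<subseteq> low (Idx D) vp e'" by (rule vs.span_minimal[OF _ low_subspace]) (use up' in blast)
  then have zs: "z \<in> vs.span (vm ` L e')" using z(1) g unfolding good_def by blast
  have "\<exists>n'\<in>L e'. vm n' \<notin> {0} \<and> (\<forall>l\<in>Idx D \<times> UNIV. mc n' l = \<eta> l)"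
    by (rule eig_in_span[where F = "L e'" and f = vm and \<chi> = mc, OF _ stable_zero zC z(2,3) z0 zs]) (rule good_vm[OF g])
  then obtain n' where n': "n' \<in> L e'" "\<forall>l\<in>Idx D \<times> UNIV. mc n' l = \<eta> l" by blast
  have n'm: "n' \<in> monoms D" using n'(1) \<M> by (auto simp: L_def)
  have "n' = mshift Pos m k a"
  proof (rule mc_inj[OF n'm mshift_monoms[OF m k(1) a(1)]])
    show "mc n' l = mc (mshift Pos m k a) l" if "l \<in> Idx D \<times> UNIV" for l
      using n'(2)[rule_format, OF that] a(2)[rule_format, OF that] by simp
  qed
  then have "n' = m + Amon D k a" by (simp add: mshift_def)
  then show ?thesis using n'(1) e' a(1) by blast
qed

text \<open>The comparison needs the head \<open>M\<close> on a known level. This can fail only if m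
  is on the new level and equals M; the last hypothesis excludes it, since M is j-dominant.\<close>

lemma string_setup:
  assumes I: "Inv d" and m: "m \<in> L e" "e \<le> Suc d" and j: "j \<in> Idx D" and c: "e \<le> d \<or> \<not> j_dominant j m"
  shows "\<exists>M W w k dM. string_data D V j W M (vm M) w vp mp \<M> vm d dM \<and> dM + k = e \<and> dM \<le> d \<and> m - M \<in> Acl j \<and>
    string_module \<M> j M W"
proof -
  have m1: "m \<in> \<M>" "ht (wt m) = ht (wt mp) - real e" using m by (auto simp: L_def)
  obtain M W k where M: "M \<in> \<M>" "string_module \<M> j M W" "j_dominant j M" "m - M \<in> Acl j"
    "ht (wt m) = ht (wt M) - real k" "k = 0 \<longrightarrow> m = M" using string_exists[OF m1(1) j] by blast
  obtain dM where dM: "ht (wt M) = ht (wt mp) - real dM" using ht_level[OF M(1)] by blast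
  have de: "dM + k = e" using M(5) dM m1(2) by linarith
  have dd: "dM \<le> d"
  proof (cases "k = 0")
    case True
    then show ?thesis using M(3,6) c de by auto
  next
    case False
    then show ?thesis using de m(2) by linarith
  qed
  have g: "good e'" if "e' \<le> d" for e' using I that by blast
  have LM: "M \<in> L dM" using M(1) dM by (simp add: L_def)
  have MD: "M \<in> monoms D" using M(1) \<M> by blast
  note vM = good_vm[OF g[OF dd] LM] good_nz[OF g[OF dd] LM] good_low[OF g[OF dd] LM]
  \<comment> \<open>Otherwise M A_{j,b} lies in \<open>\<M>\<close>, hence in the string, one level
    above M; but all monomials of the string are at or below the level of M.\<close>
  have high: "X V Pos j n (vm M) = 0" for n
  proof (rule ccontr)
    assume nz: "X V Pos j n (vm M) \<noteq> 0"
    have "dM \<le> Suc d" using dd by simp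
    from raise[OF I vM(3) this conjunct2[OF vM(1)] MD j nz]
    obtain e' b where e': "dM = Suc e'" "b \<noteq> 0" "M + Amon D j b \<in> L e'" by blast
    have n': "M + Amon D j b \<in> \<M>" "ht (wt (M + Amon D j b)) = ht (wt mp) - real e'" using e'(3) by (auto simp: L_def)
    have nA: "M + Amon D j b - M \<in> Acl j" using Acl_A[OF e'(2)] by simp
    have Ls: "is_L (sl2_data D j) (beta j M) W" "lspace (sl2_data D j) W (beta j (M + Amon D j b)) \<noteq> {0}"
      using M(2) n'(1) nA by (auto simp: string_module_def)
    obtain k' where "ht (wt (M + Amon D j b)) = ht (wt M) - real k'"
      using string_level[OF j Ls(1) MD subsetD[OF \<M> n'(1)] nA Ls(2)] by blast
    then show False using n'(2) dM e'(1) by simp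
  qed
  have L: "is_L (sl2_data D j) (beta j M) W" using M(2) by (simp add: string_module_def)
  interpret W: qmod "sl2_data D j" W by (rule sl2_qmod[OF j L])
  have hL: "highest_lweight (sl2_data D j) W (beta j M)" using L by (simp add: is_L_def)
  obtain w where w: "w \<in> Car W" "w \<noteq> 0" "\<forall>i\<in>Idx (sl2_data D j). \<forall>n. X W Pos i n w = 0" "W.eig {0} (W.mc (beta j M)) w"
    "\<forall>U. submodule (sl2_data D j) W U \<and> w \<in> U \<longrightarrow> U = Car W"
    using W.highest_vector[OF beta_monoms[OF MD] hL] by blast
  have "qpair D V j W M (vm M) w"
  proof (intro qpair.intro qpair_axioms.intro qmod_vertex.intro qmod_vertex_axioms.intro)
    show "qmod D V" "qmod (sl2_data D j) W" by unfold_locales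
    show "irreducible_module (sl2_data D j) W" using L by (simp add: is_L_def)
    show "X W Pos j n w = 0" for n using w(3) by simp
    show "U = Car W" if "submodule (sl2_data D j) W U" "w \<in> U" for U using w(5) that by blast
  qed (use j MD vM high w in auto)
  moreover have "string_data_axioms D V j W M (vm M) vp mp \<M> vm d dM"
  proof (intro string_data_axioms.intro)
    show "low (Idx D) vp e' \<subseteq> vs.span (vm ` {n \<in> \<M>. ht (wt n) = ht (wt mp) - real e'})" if "e' \<le> d" for e'
      using g[OF that] by (simp add: good_def L_def)
    show "vm n \<noteq> 0 \<and> vm n \<in> low (Idx D) vp e' \<and> eig {0} (mc n) (vm n)"
      if "n \<in> \<M>" "e' \<le> d" "ht (wt n) = ht (wt mp) - real e'" for n e'
      using g[OF that(2)] that by (simp add: good_def L_def)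
    show "lspace (sl2_data D j) W (beta j n) \<noteq> {0}" if "n \<in> \<M>" "n - M \<in> Acl j" for n
      using M(2) that by (simp add: string_module_def)
  qed (use vp M dM dd \<M> fin\<M> in auto)
  ultimately have "string_data D V j W M (vm M) w vp mp \<M> vm d dM" by (intro string_data.intro)
  then show ?thesis using de dd M by blast
qed

lemma new_vm:
  assumes I: "Inv d" and n: "n \<in> L (Suc d)"
  shows "vm n \<noteq> 0 \<and> vm n \<in> low (Idx D) vp (Suc d) \<and> eig {0} (mc n) (vm n)"
proof -
  have n1: "n \<in> \<M>" "ht (wt n) = ht (wt mp) - real (Suc d)" using n by (auto simp: L_def)
  then have "n \<noteq> mp" by auto
  then obtain j where j: "j \<in> Idx D" "\<not> j_dominant j n" using dom n1 by blast
  obtain M and W :: "(nat \<Rightarrow>\<^sub>0 complex) qmodule" and w k dM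
    where s: "string_data D V j W M (vm M) w vp mp \<M> vm d dM" "dM + k = Suc d" "n - M \<in> Acl j"
    using string_setup[OF I n order_refl j(1) disjI2[OF j(2)]] by blast
  interpret S: string_data D V j W M "vm M" w vp mp \<M> vm d dM by (rule s(1))
  have "n \<in> S.str (dM + k)" using n1 s(2,3) by (simp add: S.str_def S.lv_def)
  then obtain z where z: "z \<in> low {j} (vm M) k" "z \<noteq> 0" "eig {0} (mc n) z" using S.new_vector[of k n] s(2) by auto
  have "z \<in> low (Idx D) vp (Suc d)" using subsetD[OF S.low_sub z(1)] s(2) by simp
  then show ?thesis by (rule vm_some[OF n1(2) z(2) _ z(3)])
qed

end

context monomial_set
begin

text \<open>A vector killed by all raising operators would generate everything by lowering
  operators, by irreducibility. Being below the top level, it generates only lower levels, which do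
  not contain \<open>vp\<close>.\<close>

lemma no_extra_highest:
  assumes g: "g \<in> low (Idx D) vp (Suc d)" "g \<noteq> 0" "eig {0} (mc m) g"
  shows "\<exists>i\<in>Idx D. \<exists>n. X V Pos i n g \<noteq> 0"
proof (rule ccontr)
  assume "\<not> ?thesis"
  then have X0: "X V Pos i n g = 0" if "i \<in> Idx D" for i n using that by blast
  have gC: "g \<in> Car V" by (rule subsetD[OF low_Car[OF subset_refl vp(1)] g(1)])
  have sm: "submodule D V (ltot (Idx D) g)" by (rule ltot_submodule[OF gC g(3) X0])
  have "g \<in> ltot (Idx D) g" by (rule low_ltot[of _ _ _ 0]) (simp add: vs.span_base)
  then have "ltot (Idx D) g \<noteq> {0}" using g(2) by blast
  then have "ltot (Idx D) g = Car V" using irr sm unfolding irreducible_module_def by blast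
  then have v: "vp \<in> ltot (Idx D) g" using vp(1) by simp
  let ?P = "\<Union>d\<in>{0<..}. low (Idx D) vp d"
  have "low (Idx D) g e \<subseteq> low (Idx D) vp (Suc (d + e))" for e
  proof (induction e)
    case 0
    have "vs.span {g} \<subseteq> low (Idx D) vp (Suc d)" by (rule vs.span_minimal[OF _ low_subspace]) (use g(1) in blast)
    then show ?case by (simp only: low.simps(1) add_0_right)
  next
    case (Suc e)
    have "{X V Neg i n u | i n u. i \<in> Idx D \<and> u \<in> low (Idx D) g e} \<subseteq> low (Idx D) vp (Suc (Suc (d + e)))"
    proof
      fix x assume "x \<in> {X V Neg i n u | i n u. i \<in> Idx D \<and> u \<in> low (Idx D) g e}"
      then obtain i n u where x: "x = X V Neg i n u" "i \<in> Idx D" "u \<in> low (Idx D) g e" by blast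
      show "x \<in> low (Idx D) vp (Suc (Suc (d + e)))" unfolding x(1) by (rule low_X[OF x(2) subsetD[OF Suc x(3)]])
    qed
    then have "low (Idx D) g (Suc e) \<subseteq> low (Idx D) vp (Suc (Suc (d + e)))"
      unfolding low.simps(2)[of "Idx D" g] by (rule vs.span_minimal[OF _ low_subspace])
    then show ?case by (simp only: add_Suc_right)
  qed
  then have "(\<Union>e. low (Idx D) g e) \<subseteq> ?P" by blast
  then have "ltot (Idx D) g \<subseteq> vs.span ?P" unfolding ltot_def by (rule vs.span_mono)
  then have "vp \<in> vs.span ?P" using v by blast
  then have "vp = 0" by (rule low_top[OF vp(1,3)]) (simp add: vs.span_base)
  then show False using vp(2) by simp
qed

lemma no_lweight_outside:
  assumes I: "Inv d" and m: "m \<in> L d" and i: "i \<in> Idx D" and a: "a \<noteq> 0" and out: "m - Amon D i a \<notin> \<M>"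
    and g: "g \<in> vs.span (range (\<lambda>n. X V Neg i n (vm m)))" "g \<noteq> 0" "eig {0} (mc (m - Amon D i a)) g"
  shows False
proof -
  let ?m = "m - Amon D i a"
  have gd: "good d" using I by blast
  have m1: "m \<in> \<M>" "ht (wt m) = ht (wt mp) - real d" using m by (auto simp: L_def)
  have mD: "?m \<in> monoms D" using mshift_monoms[OF _ i a, of m Neg] m1 \<M> by (auto simp: mshift_def)
  have low: "g \<in> low (Idx D) vp (Suc d)"
  proof -
    have "range (\<lambda>n. X V Neg i n (vm m)) \<subseteq> low (Idx D) vp (Suc d)" using low_X[OF i good_low[OF gd m]] by blast
    then show ?thesis using g(1) vs.span_minimal[OF _ low_subspace] by blast
  qed
  obtain M W w k dM where s: "string_data D V i W M (vm M) w vp mp \<M> vm d dM" "dM + k = d" "m - M \<in> Acl i"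
    and sm: "string_module \<M> i M W"
    using string_setup[OF I m _ i] by auto
  interpret S: string_data D V i W M "vm M" w vp mp \<M> vm d dM by (rule s(1))
  have ms: "m \<in> S.str (dM + k)" using m1 s(2,3) by (simp add: S.str_def S.lv_def)
  have ml: "vm m \<in> low {i} (vm M) k" by (rule S.str_vectors(1)[OF _ ms]) (use s(2) in simp)
  have gl: "g \<in> low {i} (vm M) (Suc k)"
  proof -
    have "range (\<lambda>n. X V Neg i n (vm m)) \<subseteq> low {i} (vm M) (Suc k)" using low_X[OF _ ml, of i] by blast
    then show ?thesis using g(1) vs.span_minimal[OF _ low_subspace] by blast
  qed
  obtain b where b: "S.G (Suc k) g b" using S.G_dom[OF gl] by blast
  have mA: "?m - M \<in> Acl i" using Acl_diff[OF s(3) Acl_A[OF a]] by (simp add: algebra_simps)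
  \<comment> \<open>A nonzero image in \<open>W\<close> would have l-weight beta_i(n) with n in the
    string. Injectivity of beta_i on the string gives m A_{i,a}^-1 = n, which is excluded.\<close>
  have "b = 0"
  proof (rule ccontr)
    assume b0: "b \<noteq> 0"
    have bC: "b \<in> Car W" by (rule S.G_Car(2)[OF b])
    have hb: "S.W.hh (i, n) b = S.W.sc (hchar D ?m i n) b" for n by (rule S.G_eig[OF b eig1[OF i g(3)]])
    have be: "S.W.eig {0} (S.W.mc (beta i ?m)) b" unfolding S.W.eig_def by (auto simp: S.W.mc_def hchar_beta hb)
    have z0: "{0} \<subseteq> S.W.vs.span {b}" using S.W.vs.span_zero by simp
    have "b \<in> lspace (sl2_data D i) W (beta i ?m)"
      by (rule S.W.eigenvector_lspace[OF beta_monoms[OF mD] bC be bC S.W.eig_mono[OF be z0]])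
    then have "lspace (sl2_data D i) W (beta i ?m) \<noteq> {0}" using b0 by blast
    then obtain n where n: "n \<in> \<M>" "n - M \<in> Acl i" "beta i ?m = beta i n"
      using sm beta_monoms[OF mD] unfolding string_module_def by blast
    have "?m - n \<in> Acl i" by (rule Acl_trans[OF mA Acl_sym[OF n(2)]])
    then have "?m = n" by (intro beta_string_inj[OF i _ n(3)]) (simp add: Acl_def)
    then show False using n(1) out by simp
  qed
  then have K: "g \<in> S.Kr (Suc k)" using b by (simp add: S.Kr_def)
  obtain k' n where k': "k' \<in> Idx D" "X V Pos k' n g \<noteq> 0" using no_extra_highest[OF low g(2,3)] by blast
  have "X V Pos i n g = 0" by (rule S.Kr_Xpos[OF K]) (use s(2) in simp)
  then have ne: "k' \<noteq> i" using k'(2) by blast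
  obtain e' b' where "Suc d = Suc e'" "b' \<noteq> 0" "?m + Amon D k' b' \<in> L e'"
    using raise[OF I low order_refl g(3) mD k'] by blast
  then show False using ii[OF m1(1) i a out k'(1)] ne by (auto simp: L_def)
qed

text \<open>A second occurrence of the l-weight may be an independent eigenvector or extend the
  known one to a Jordan block. Both are covered by an eigenvector modulo the line of the known
  vector.\<close>

lemma lweight_not_repeated:
  assumes I: "Inv d" and m: "m \<in> L d" and i: "i \<in> Idx D" and a: "a \<noteq> 0" and m': "m - Amon D i a \<in> \<M>"
    and g: "g \<in> vs.span (range (\<lambda>n. X V Neg i n (vm m)))" "g \<notin> vs.span {vm (m - Amon D i a)}"
      "eig (vs.span {vm (m - Amon D i a)}) (mc (m - Amon D i a)) g"
  shows False
proof -
  let ?m = "m - Amon D i a" let ?u = "vm ?m" let ?U = "vs.span {?u}"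
  have gd: "good d" using I by blast
  have m1: "m \<in> \<M>" "ht (wt m) = ht (wt mp) - real d" using m by (auto simp: L_def)
  have hm: "ht (wt ?m) = ht (wt mp) - real (Suc d)" using m1(2) ht_Amon[OF i, of m a] by simp
  have mL: "?m \<in> L (Suc d)" using m' hm by (simp add: L_def)
  have mD: "?m \<in> monoms D" using m' \<M> by blast
  have low: "g \<in> low (Idx D) vp (Suc d)"
  proof -
    have "range (\<lambda>n. X V Neg i n (vm m)) \<subseteq> low (Idx D) vp (Suc d)" using low_X[OF i good_low[OF gd m]] by blast
    then show ?thesis using g(1) vs.span_minimal[OF _ low_subspace] by blast
  qed
  have u: "?u \<noteq> 0" "?u \<in> low (Idx D) vp (Suc d)" "eig {0} (mc ?m) ?u" using new_vm[OF I mL] by auto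
  have "?m \<noteq> mp" using hm by auto
  then obtain j where j: "j \<in> Idx D" "\<not> j_dominant j ?m" using dom m' by blast
  obtain M W w k dM where s: "string_data D V j W M (vm M) w vp mp \<M> vm d dM" "dM + k = Suc d" "dM \<le> d" "?m - M \<in> Acl j"
    and sm: "string_module \<M> j M W"
    using string_setup[OF I mL order_refl j(1) disjI2[OF j(2)]] by blast
  interpret S: string_data D V j W M "vm M" w vp mp \<M> vm d dM by (rule s(1))
  obtain k0 where k0: "k = Suc k0" using s(2,3) by (cases k) auto
  have dk0: "dM + k0 \<le> d" using s(2) k0 by simp
  let ?Z = "ltot {j} (vm M)"
  have Zst: "stable ?Z" by (rule ltot_stable[OF S.J S.v(1,3)])
  note sZ = stableD(1)[OF Zst]
  have wj: "wt ?m j = wt m j - Cart D j i" using wt_Amon[OF j(1) i] by (simp add: wt_def esum_diff)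
  have Ku: "K V j ?u = sc (q powi (int (rr D j) * wt ?m j)) ?u"
    using eig1[OF j(1) u(3), of 0] by (simp add: hh_def hchar_def)
  have Kg: "K V j g = sc (q powi (int (rr D j) * wt ?m j)) g"
    unfolding wj using good_vm[OF gd m] by (intro S.low_weight_j[OF g(1) i]) auto
  have z0: "{0} \<subseteq> ?Z" using vs.subspace_0[OF sZ] by simp
  \<comment> \<open>Both vectors must come from the string module of \<open>M\<close>; otherwise
    their images in \<open>W\<close> would not be defined.\<close>
  have uZ: "?u \<in> ?Z" by (rule S.in_string_module[OF mD s(4) j(2) u(2) eig_mono[OF u(3) z0] Ku hm])
  have UZ: "?U \<subseteq> ?Z" by (rule vs.span_minimal[OF _ sZ]) (use uZ in simp)
  have gZ: "g \<in> ?Z" by (rule S.in_string_module[OF mD s(4) j(2) low eig_mono[OF g(3) UZ] Kg hm])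
  have g0: "g \<noteq> 0" using g(2) vs.span_zero by blast
  have lev: "z \<in> low {j} (vm M) k" if z: "z \<in> ?Z" "z \<noteq> 0" "K V j z = sc (q powi (int (rr D j) * wt ?m j)) z" for z
  proof -
    have "z \<in> vs.span (\<Union>d. low {j} (vm M) d)" using z(1) by (simp add: ltot_def)
    from low1_proj[OF j(1) S.v(1,3) order_refl this z(2,3)]
    obtain k' where k': "wt ?m j = wt M j - 2 * int k'" "z \<in> vs.span (low {j} (vm M) k')" by blast
    have "ht (wt ?m) = ht (wt M) - real_of_int (int k')" by (rule ht_string(1)[OF j(1) s(4)[unfolded Acl_def] k'(1)])
    then have "k' = k" using hm S.Mv(3) s(2) by simp
    moreover have "vs.span (low {j} (vm M) k') \<subseteq> low {j} (vm M) k'" by (rule vs.span_minimal[OF order_refl low_subspace])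
    ultimately show ?thesis using k'(2) by blast
  qed
  have ul: "?u \<in> low {j} (vm M) k" and gl: "g \<in> low {j} (vm M) k" using lev uZ u(1) Ku gZ g0 Kg by blast+
  obtain b where b: "S.G k g b" using S.G_dom[OF gl] by blast
  obtain b' where b': "S.G k ?u b'" using S.G_dom[OF ul] by blast
  have hu: "hh (j, n) ?u = sc (hchar D ?m j n) ?u" for n by (rule eig1[OF j(1) u(3)])
  \<comment> \<open>If the known vector maps to 0, it is itself in the kernel. If not, multiplicity
    one in \<open>W\<close> makes the two images proportional, and a combination of the vectors lies
    in the kernel.\<close>
  have ex: "\<exists>x. x \<noteq> 0 \<and> x \<in> S.Kr k \<and> (\<forall>n. hh (j, n) x = sc (hchar D ?m j n) x)"
  proof (cases "b' = 0")
    case True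
    then show ?thesis using u(1) b' hu by (intro exI[of _ ?u]) (simp add: S.Kr_def)
  next
    case False
    have hb': "S.W.hh (j, n) b' = S.W.sc (hchar D ?m j n) b'" for n by (rule S.G_eig[OF b' hu])
    have be': "S.W.eig {0} (S.W.mc (beta j ?m)) b'" unfolding S.W.eig_def by (auto simp: S.W.mc_def hchar_beta hb')
    have be: "S.W.eig (S.W.vs.span {b'}) (S.W.mc (beta j ?m)) b"
      unfolding S.W.eig_def
    proof
      fix l assume "l \<in> Idx (sl2_data D j) \<times> (UNIV :: int set)"
      then obtain n where l: "l = (j, n)" by auto
      have "hh (j, n) g - sc (hchar D ?m j n) g \<in> ?U" using g(3) j(1) by (auto simp: eig_def mc_def)
      then obtain c where c: "hh (j, n) g - sc (hchar D ?m j n) g = sc c ?u" by (auto simp: vs.span_singleton)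
      have "S.W.hh (j, n) b - S.W.sc (hchar D ?m j n) b = S.W.sc c b'"
        by (rule S.G_uniq[OF S.G_diff[OF S.G_hh[OF b] S.G_scale[OF b]]]) (simp only: c S.G_scale[OF b'])
      then show "S.W.hh l b - S.W.sc (S.W.mc (beta j ?m) l) b \<in> S.W.vs.span {b'}"
        by (simp add: l S.W.mc_def hchar_beta S.W.vs.span_scale S.W.vs.span_base)
    qed
    have bC: "b \<in> Car W" "b' \<in> Car W" by (rule S.G_Car(2)[OF b], rule S.G_Car(2)[OF b'])
    have z0: "{0} \<subseteq> S.W.vs.span {b'}" using S.W.vs.span_zero by simp
    let ?l = "lspace (sl2_data D j) W (beta j ?m)"
    have bl: "b \<in> ?l" by (rule S.W.eigenvector_lspace[OF beta_monoms[OF mD] bC(2) be' bC(1) be])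
    have bl': "b' \<in> ?l"
      by (rule S.W.eigenvector_lspace[OF beta_monoms[OF mD] bC(2) be' bC(2) S.W.eig_mono[OF be' z0]])
    have dim1: "S.W.vs.dim ?l = 1" using sm m' s(4) by (simp add: string_module_def)
    have st: "S.W.ph.stable ?l" unfolding S.W.lweight_space_gen by (rule S.W.ph.gen_stable)
    obtain E where E: "finite E" "S.W.vs.span E = Car W" using S.W.fin_dim_V unfolding fin_dim_def by blast
    have "b \<in> S.W.vs.span {b'}"
    proof (rule ccontr)
      assume nb: "b \<notin> S.W.vs.span {b'}"
      have "S.W.vs.span {b'} \<subseteq> ?l" by (rule S.W.vs.span_minimal[OF _ S.W.ph.stableD(1)[OF st]]) (use bl' in simp)
      then have "S.W.vs.span {b'} \<subset> ?l" using nb bl by blast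
      then have "S.W.vs.dim (S.W.vs.span {b'}) < S.W.vs.dim ?l"
        using S.W.vs.dim_strict_mono_subspace[OF E(1), of ?l "S.W.vs.span {b'}"] S.W.ph.stableD(2)[OF st] by (simp add: E(2))
      then have "S.W.vs.dim (S.W.vs.span {b'}) = 0" using dim1 by simp
      moreover have "S.W.vs.dim (S.W.vs.span {b'}) = card {b'}"
        using False by (intro S.W.vs.dim_span_eq_card_independent) simp
      ultimately show False by simp
    qed
    then obtain c where c: "b = S.W.sc c b'" by (auto simp: S.W.vs.span_singleton)
    let ?x = "g - sc c ?u"
    have cu: "sc c ?u \<in> ?U" by (intro vs.span_scale vs.span_base) simp
    have "g = ?x + sc c ?u" by simp
    then have xU: "?x \<notin> ?U" using g(2) cu vs.span_add[of ?x "{?u}" "sc c ?u"] by auto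
    have xK: "?x \<in> S.Kr k" using S.G_diff[OF b S.G_scale[OF b', of c]] c by (simp add: S.Kr_def)
    have KrS: "vs.subspace (S.Kr k)" by (rule S.Jf.stableD(1)[OF S.Kr_stable])
    \<comment> \<open>So far \<open>?x\<close> is an eigenvector only modulo the line of
      \<open>?u\<close>. The defect is a multiple of \<open>?u\<close> in the kernel, and it
      vanishes because \<open>?u\<close> has a nonzero image.\<close>
    have "hh (j, n) ?x = sc (hchar D ?m j n) ?x" for n
    proof -
      let ?y = "hh (j, n) ?x - sc (hchar D ?m j n) ?x"
      have uC: "?u \<in> Car V" by (rule S.G_Car(1)[OF b'])
      have gC: "g \<in> Car V" by (rule S.G_Car(1)[OF b])
      have "?y = hh (j, n) g - sc (hchar D ?m j n) g"
        using T_diff[of "(j, n)" g "sc c ?u"] T_scale[of "(j, n)" ?u c] j(1) gC uC vs.subspace_scale[OF subC uC]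
        by (simp add: hu vs.scale_right_diff_distrib vs.scale_left_commute)
      then have "?y \<in> ?U" using g(3) j(1) by (auto simp: eig_def mc_def)
      then obtain e where e: "?y = sc e ?u" by (auto simp: vs.span_singleton)
      have "hh (j, n) ?x \<in> S.Kr k" by (rule S.Jf.stableD(3)[OF S.Kr_stable _ xK]) simp
      then have "?y \<in> S.Kr k" by (intro vs.subspace_diff[OF KrS] vs.subspace_scale[OF KrS] xK)
      then have "S.G k (sc e ?u) 0" by (simp add: e S.Kr_def)
      then have "S.W.sc e b' = 0" by (rule S.G_uniq[OF S.G_scale[OF b']])
      then have "e = 0" using False by simp
      then show ?thesis using e by simp
    qed
    moreover have "?x \<noteq> 0" using xU vs.span_zero[of "{?u}"] by metis
    ultimately show ?thesis using xK by blast
  qed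
  obtain x where x: "x \<noteq> 0" "x \<in> S.Kr k" "\<And>n. hh (j, n) x = sc (hchar D ?m j n) x" using ex by blast
  have X0: "X V Pos j n x = 0" for n by (rule S.Kr_Xpos[OF _ dk0]) (use x(2) k0 in simp)
  have "j_dominant j ?m"
  proof (rule S.highest_j_dominant[where U = "{0}", OF mD])
    show "stab1 j {0}" by (rule stab1_zero[OF j(1)])
    show "x \<in> Car V" using x(2) S.G_Car(1) by (simp add: S.Kr_def)
    show "x \<notin> {0}" using x(1) by simp
    show "X V Pos j 0 x \<in> {0}" by (simp add: X0)
    show "hh (j, n) x - sc (hchar D ?m j n) x \<in> {0}" for n by (simp add: x(3))
    show "K V j x = sc (hchar D ?m j 0) x" using x(3)[of 0] by (simp add: hh_def)
    show "S.x n u \<in> {0}" if "u \<in> {0}" for n u using that X_zero[OF j(1)] by (simp add: S.x_def)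
    show "X V Pos j 0 u \<in> {0}" if "u \<in> {0}" for u using that X_zero[OF j(1)] by simp
  qed
  then show False using j(2) by blast
qed

lemma good_Suc:
  assumes I: "Inv d"
  shows "good (Suc d)"
  unfolding good_def
proof (intro conjI ballI)
  let ?T = "vs.span (vm ` L (Suc d))"
  have gd: "good d" using I by blast
  have nv: "vm n \<in> Car V \<and> eig {0} (mc n) (vm n)" if "n \<in> L (Suc d)" for n
    using new_vm[OF I that] low_Car[OF subset_refl vp(1), of "Suc d"] by blast
  have T: "stable ?T" by (rule eigspan_stable[where \<chi> = mc]) (rule nv)
  have XT: "X V Neg i n (vm m) \<in> ?T" if m: "m \<in> L d" and i: "i \<in> Idx D" for i n m
  proof (rule ccontr)
    assume out: "X V Neg i n (vm m) \<notin> ?T"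
    let ?S = "vs.span (range (\<lambda>n. X V Neg i n (vm m)))"
    note vmm = good_vm[OF gd m]
    have m1: "m \<in> \<M>" "ht (wt m) = ht (wt mp) - real d" using m by (auto simp: L_def)
    have mD: "m \<in> monoms D" using m1 \<M> by blast
    have st: "stable ?S" by (rule span_current_stable[OF i conjunct1[OF vmm] conjunct2[OF vmm]])
    have "X V Neg i n (vm m) \<in> ?S" by (rule vs.span_base) blast
    then have "\<not> ?S \<subseteq> ?T" using out by blast
    then obtain z \<eta> where z: "z \<in> ?S" "z \<notin> ?T" "eig ?T \<eta> z" using joint_eigenvector_mod[OF st T] by blast
    have zC: "z \<in> Car V" by (rule subsetD[OF stableD(2)[OF st] z(1)])
    have zz: "z - z \<in> ?T" using vs.span_zero by simp
    have X0: "X V Neg i p x \<in> ?T" if "x \<in> {0}" for p x using that X_zero[OF i] vs.span_zero by simp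
    obtain a where a: "a \<noteq> 0" "\<forall>l\<in>Idx D \<times> UNIV. \<eta> l = mc (mshift Neg m i a) l"
      using current_eigenvector[OF i T X0 stableD(2)[OF stable_zero] conjunct1[OF vmm] conjunct2[OF vmm] zC z(2,3) zz z(1)] by blast
    let ?m = "m - Amon D i a"
    have e: "\<eta> l = mc ?m l" if "l \<in> Idx D \<times> UNIV" for l using a(2)[rule_format, OF that] by (simp add: mshift_def)
    have zm: "eig ?T (mc ?m) z" using z(3) eig_cong[of \<eta> "mc ?m" ?T z] e by blast
    \<comment> \<open>The vector z is an eigenvector only modulo the whole span of the new level. It
      is lifted to a true eigenvector if the monomial is outside \<open>\<M>\<close>, and to one
      modulo the line of the known vector otherwise.\<close>
    show False
    proof (cases "?m \<in> \<M>")
      case False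
      have "{0} \<subseteq> ?T" using vs.span_zero by simp
      from eig_lift[OF st T stable_zero this z(1,2) zm]
      obtain g where g: "g \<in> ?S" "g \<notin> {0}" "eig {0} (mc ?m) g" by blast
      have g0: "g \<noteq> 0" using g(2) by simp
      show False by (rule no_lweight_outside[OF I m i a(1) False g(1) g0 g(3)])
    next
      case True
      have mL: "?m \<in> L (Suc d)" using True m1(2) ht_Amon[OF i, of m a] by (simp add: L_def)
      have "stable (vs.span (vm ` {?m}))" by (rule eigspan_stable[where \<chi> = mc]) (use nv[OF mL] in blast)
      then have U: "stable (vs.span {vm ?m})" by simp
      have "vs.span {vm ?m} \<subseteq> ?T" by (rule vs.span_mono) (use mL in blast)
      from eig_lift[OF st T U this z(1,2) zm]
      obtain g where g: "g \<in> ?S" "g \<notin> vs.span {vm ?m}" "eig (vs.span {vm ?m}) (mc ?m) g" by blast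
      show False by (rule lweight_not_repeated[OF I m i a(1) True g])
    qed
  qed
  have "X V Neg i n u \<in> ?T" if i: "i \<in> Idx D" and u: "u \<in> low (Idx D) vp d" for i n u
  proof (rule X_span_into[OF i])
    show "vm ` L d \<subseteq> Car V" using good_vm[OF gd] by blast
    show "vs.subspace ?T" by simp
    show "u \<in> vs.span (vm ` L d)" using gd u unfolding good_def by blast
    show "X V Neg i n x \<in> ?T" if "x \<in> vm ` L d" for x using that XT[OF _ i] by blast
  qed
  then have "{X V Neg i n u | i n u. i \<in> Idx D \<and> u \<in> low (Idx D) vp d} \<subseteq> ?T" by blast
  then show "low (Idx D) vp (Suc d) \<subseteq> ?T" unfolding low.simps(2) by (rule vs.span_minimal) simp
next
  fix n assume n: "n \<in> L (Suc d)"
  show "vm n \<noteq> 0" "vm n \<in> low (Idx D) vp (Suc d)" "eig {0} (mc n) (vm n)" using new_vm[OF I n] by auto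
qed

lemma all_good: "good e"
proof (induction e rule: less_induct)
  case (less e)
  then show ?case using good_0 good_Suc[of "e - 1"] by (cases e) auto
qed

end

section \<open>The q-character, thinness and specialness\<close>

context monomial_set
begin

lemma vm_eig: "n \<in> \<M> \<Longrightarrow> vm n \<in> Car V \<and> eig {0} (mc n) (vm n)"
  and vm_nz: "n \<in> \<M> \<Longrightarrow> vm n \<noteq> 0"
proof -
  assume "n \<in> \<M>"
  then obtain e where "n \<in> L e" using L_cover by blast
  then show "vm n \<in> Car V \<and> eig {0} (mc n) (vm n)" "vm n \<noteq> 0" using good_vm[OF all_good] good_nz[OF all_good] by auto
qed

lemma Car_span: "Car V = vs.span (vm ` \<M>)"
proof
  have "ltot (Idx D) vp = Car V" by (rule ltot_Car[OF vp(1,3,4) vp_gen])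
  moreover have "low (Idx D) vp e \<subseteq> vs.span (vm ` \<M>)" for e
  proof -
    have "vs.span (vm ` L e) \<subseteq> vs.span (vm ` \<M>)" by (rule vs.span_mono) (auto simp: L_def)
    then show ?thesis using all_good[of e] unfolding good_def by blast
  qed
  then have "(\<Union>e. low (Idx D) vp e) \<subseteq> vs.span (vm ` \<M>)" by blast
  then have "ltot (Idx D) vp \<subseteq> vs.span (vm ` \<M>)" unfolding ltot_def by (rule vs.span_minimal) simp
  ultimately show "Car V \<subseteq> vs.span (vm ` \<M>)" by simp
  show "vs.span (vm ` \<M>) \<subseteq> Car V" by (rule vs.span_minimal[OF _ subC]) (use vm_eig in blast)
qed

definition gch :: "monom \<Rightarrow> sign \<times> nat \<times> nat \<Rightarrow> complex" where
  "gch m l = (case l of (s, i, n) \<Rightarrow> gamma D m s i n)"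

lemma vm_ph: "n \<in> \<M> \<Longrightarrow> vm n \<in> Car V \<and> ph.eig {0} (gch n) (vm n)"
proof -
  assume n: "n \<in> \<M>"
  have "phi D V s i (sg s * int p) (vm n) = sc (gamma D n s i p) (vm n)" if i: "i \<in> Idx D" for s i p
    by (rule phi_eigen[OF i _ subsetD[OF \<M> n] eig1[OF i]]) (use vm_eig[OF n] in auto)
  then show ?thesis using vm_eig[OF n] by (auto simp: ph.eig_def gch_def phis_def)
qed

text \<open>Thinness concerns eigenvalues of the phi, whereas monomials were separated by the
  h_{i,n}. The nonzero vector \<open>vm n\<close> carries the comparison, since inverting the
  exponential on it gives both sets of eigenvalues.\<close>

lemma gch_inj:
  assumes n: "n \<in> \<M>" "n' \<in> \<M>" and e: "\<forall>l\<in>UNIV \<times> Idx D \<times> UNIV. gch n l = gch n' l"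
  shows "n = n'"
proof (rule mc_inj)
  show "n \<in> monoms D" "n' \<in> monoms D" using n \<M> by auto
  have vC: "vm n \<in> Car V" using vm_eig[OF n(1)] by blast
  fix l assume "l \<in> Idx D \<times> (UNIV :: int set)"
  then obtain i p where l: "l = (i, p)" "i \<in> Idx D" by auto
  have "phi D V s i (sg s * int q) (vm n) = sc (gamma D n' s i q) (vm n)" for s q
  proof -
    have "gch n (s, i, q) = gch n' (s, i, q)" using e l(2) by blast
    moreover have "phi D V s i (sg s * int q) (vm n) = sc (gamma D n s i q) (vm n)"
      by (rule phi_eigen[OF l(2) vC subsetD[OF \<M> n(1)] eig1[OF l(2)]]) (use vm_eig[OF n(1)] in blast)
    ultimately show ?thesis by (simp add: gch_def)
  qed
  then have "hh (i, p) (vm n) = sc (hchar D n' i p) (vm n)" by (intro hh_of_phi[OF l(2) vC subsetD[OF \<M> n(2)]])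
  moreover have "hh (i, p) (vm n) = sc (hchar D n i p) (vm n)" by (rule eig1[OF l(2)]) (use vm_eig[OF n(1)] in blast)
  ultimately show "mc n l = mc n' l" using vm_nz[OF n(1)] by (simp add: mc_def l(1))
qed

lemma gen_char:
  assumes n: "n \<in> \<M>" and g: "vm n \<in> ph.gen \<eta>" and l: "l \<in> UNIV \<times> Idx D \<times> UNIV"
  shows "gch n l = \<eta> l"
proof (rule ccontr)
  assume ne: "gch n l \<noteq> \<eta> l"
  obtain k :: nat where k: "(ph.shf l (\<eta> l) ^^ k) (vm n) = 0" using g l unfolding ph.gen_def by blast
  have "phis l (vm n) - sc (gch n l) (vm n) \<in> {0}" using vm_ph[OF n] l unfolding ph.eig_def by blast
  from ph.shf_pow_eig[where a = "\<eta> l" and n = k, OF l ph.stable_zero _ this]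
  have "sc ((gch n l - \<eta> l) ^ k) (vm n) = 0" using k vm_eig[OF n] by simp
  then show False using ne vm_nz[OF n] by simp
qed

text \<open>Each generalized eigenspace is stable under the phi, hence spanned by the vectors
  \<open>vm n\<close> inside it. Membership forces the character of n, so there is at most one such
  vector, for monomial and non-monomial l-weights alike.\<close>

lemma thin: "thin D V"
  unfolding thin_def
proof
  fix g :: "sign \<Rightarrow> nat \<Rightarrow> nat \<Rightarrow> complex"
  let ?\<eta> = "\<lambda>(s, i, n). g s i n"
  let ?F = "{n \<in> \<M>. vm n \<in> ph.gen ?\<eta>}"
  have s: "ph.gen ?\<eta> \<subseteq> vs.span (vm ` ?F)"
  proof (rule ph.stable_span_eigenvectors[where \<chi> = gch])
    show "vm n \<in> Car V \<and> ph.eig {0} (gch n) (vm n)" if "n \<in> \<M>" for n by (rule vm_ph[OF that])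
    show "n = n'" if "n \<in> \<M>" "n' \<in> \<M>" "\<forall>l\<in>UNIV \<times> Idx D \<times> UNIV. gch n l = gch n' l" for n n' by (rule gch_inj[OF that])
    show "ph.stable (ph.gen ?\<eta>)" by (rule ph.gen_stable)
    show "ph.gen ?\<eta> \<subseteq> vs.span (vm ` \<M>)" using ph.stableD(2)[OF ph.gen_stable] unfolding Car_span .
  qed
  have "n = n'" if n: "n \<in> ?F" "n' \<in> ?F" for n n'
  proof (rule gch_inj)
    show "\<forall>l\<in>UNIV \<times> Idx D \<times> UNIV. gch n l = gch n' l" using gen_char[of n ?\<eta>] gen_char[of n' ?\<eta>] n by simp
  qed (use n in auto)
  then have "card ?F \<le> 1" using card_le_Suc0_iff_eq[of ?F] fin\<M> by simp
  moreover have "card (vm ` ?F) \<le> card ?F" by (rule card_image_le) (simp add: fin\<M>)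
  moreover have "vs.dim (ph.gen ?\<eta>) \<le> card (vm ` ?F)" by (rule vs.dim_le_card[OF s]) (simp add: fin\<M>)
  ultimately show "vs.dim (lweight_space D V g) \<le> 1" unfolding lweight_space_gen by linarith
qed

lemma lspace_iff: "m \<in> monoms D \<Longrightarrow> lspace D V m \<noteq> {0} \<longleftrightarrow> m \<in> \<M>"
proof
  assume m: "m \<in> monoms D" and "lspace D V m \<noteq> {0}"
  then obtain y where y: "y \<in> Car V" "y \<noteq> 0" "eig {0} (mc m) y" using lspace_eigenvector by blast
  have ys: "y \<in> vs.span (vm ` \<M>)" using y(1) Car_span by simp
  have "y - y \<in> {0}" "y \<notin> {0}" using y(2) by simp_all
  then have "\<exists>n\<in>\<M>. vm n \<notin> {0} \<and> (\<forall>l\<in>Idx D \<times> UNIV. mc n l = mc m l)"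
    by (intro eig_in_span[where F = \<M> and f = vm and \<chi> = mc, OF _ stable_zero y(1) _ y(3) _ ys] vm_eig)
  then obtain n where n: "n \<in> \<M>" "\<forall>l\<in>Idx D \<times> UNIV. mc n l = mc m l" by blast
  have "n = m" by (rule mc_inj[OF subsetD[OF \<M> n(1)] m]) (use n(2) in blast)
  then show "m \<in> \<M>" using n(1) by simp
next
  assume m: "m \<in> monoms D" and n: "m \<in> \<M>"
  have z: "{0} \<subseteq> vs.span {vm m}" using vs.span_zero by simp
  note v = vm_eig[OF n]
  have "vm m \<in> lspace D V m"
    by (rule eigenvector_lspace[OF m conjunct1[OF v] conjunct2[OF v] conjunct1[OF v] eig_mono[OF conjunct2[OF v] z]])
  then show "lspace D V m \<noteq> {0}" using vm_nz[OF n] by blast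
qed

lemma qchar: "qchar D V = (\<Sum>m\<in>\<M>. Poly_Mapping.single m 1)"
proof -
  have A: "{m \<in> monoms D. lspace D V m \<noteq> {0}} = \<M>" using lspace_iff \<M> by blast
  have d: "vs.dim (lspace D V m) = 1" if m: "m \<in> \<M>" for m
  proof -
    have st: "ph.stable (lspace D V m)" unfolding lweight_space_gen by (rule ph.gen_stable)
    obtain E where E: "finite E" "vs.span E = Car V" using fin_dim_V unfolding fin_dim_def by blast
    have "lspace D V m \<subseteq> vs.span E" unfolding E(2) by (rule ph.stableD(2)[OF st])
    moreover have "{0} \<subset> lspace D V m"
      using lspace_iff[of m] m \<M> vs.subspace_0[OF ph.stableD(1)[OF st]] by blast
    ultimately have "vs.dim {0} < vs.dim (lspace D V m)" by (intro vs.dim_strict_mono_subspace[OF E(1)]) simp_all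
    then show ?thesis using thin unfolding thin_def by (metis less_one linorder_neqE_nat not_le not_less0)
  qed
  show ?thesis unfolding qchar_def A by (rule sum.cong) (simp_all add: d)
qed

lemma special: assumes "{mp} = dom_monoms D \<inter> \<M>" shows "special D V"
proof -
  have "Poly_Mapping.lookup (qchar D V) m = (if m \<in> \<M> then 1 else 0)" for m
    unfolding qchar lookup_sum using fin\<M> by (simp add: lookup_single when_def)
  then have "m \<in> Poly_Mapping.keys (qchar D V) \<longleftrightarrow> m \<in> \<M>" for m by (simp add: in_keys_iff)
  then have "m \<in> Poly_Mapping.keys (qchar D V) \<and> dominant D m \<longleftrightarrow> m = mp" for m
    using assms \<M> unfolding dom_monoms_def by blast
  then show ?thesis unfolding special_def by simp
qed

end

theorem theorem3p4:
  fixes N :: nat and \<Phi> :: "'e::euclidean_space set" and \<alpha> :: "nat \<Rightarrow> 'e"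
    and C :: "nat \<Rightarrow> nat \<Rightarrow> int" and r :: "nat \<Rightarrow> nat" and q :: complex
    and D :: qdata and mp :: monom and \<M> :: "monom set"
    and V :: "'v::ab_group_add qmodule"
  assumes g: "simple_lie_data N \<Phi> \<alpha> C r"
    and q: "q \<noteq> 0" "\<And>n::nat. n > 0 \<Longrightarrow> q ^ n \<noteq> 1"
    and D: "D = \<lparr>Idx = {1..N}, Cart = C, rr = r, qq = q\<rparr>"
    and m_plus: "mp \<in> dom_monoms D"
    and \<M>: "finite \<M>" "\<M> \<subseteq> monoms D"
    and i: "{mp} = dom_monoms D \<inter> \<M>"
    and ii: "\<And>m i a. m \<in> \<M> \<Longrightarrow> i \<in> {1..N} \<Longrightarrow> a \<noteq> 0 \<Longrightarrow> m - Amon D i a \<notin> \<M> \<Longrightarrow>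
        (\<forall>j\<in>{1..N}. \<forall>b. b \<noteq> 0 \<and> (j, b) \<noteq> (i, a) \<longrightarrow> m - Amon D i a + Amon D j b \<notin> \<M>)"
    and iii: "\<And>m i. m \<in> \<M> \<Longrightarrow> i \<in> {1..N} \<Longrightarrow>
        (\<exists>M\<in>\<M>. j_dominant i M \<and>
           qchar_L_eq (sl2_data D i) (beta i M)
             (\<Sum>m' | m' \<in> \<M> \<and> m' - m \<in> group_closure {Amon D i a | a. a \<noteq> 0}.
                Poly_Mapping.single (beta i m') 1))"
    and V: "is_L D mp V"
  shows "qchar D V = (\<Sum>m\<in>\<M>. Poly_Mapping.single m 1) \<and> thin D V \<and> special D V"
proof -
  interpret lie: lie_data N \<Phi> \<alpha> C r by unfold_locales (rule g)
  interpret qdat D unfolding D by (rule lie.qdat) (use q in auto)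
  have Idx: "Idx D = {1..N}" by (simp add: D)
  interpret qmod D V using V by unfold_locales (simp_all add: is_L_def)
  have mpM: "mp \<in> \<M>" "mp \<in> monoms D" using i \<M>(2) by auto
  obtain vp where vp: "vp \<in> Car V" "vp \<noteq> 0" "\<forall>i\<in>Idx D. \<forall>n. X V Pos i n vp = 0" "eig {0} (mc mp) vp"
    "\<forall>U. submodule D V U \<and> vp \<in> U \<longrightarrow> U = Car V"
    using highest_vector[OF mpM(2)] V unfolding is_L_def by blast
  interpret monomial_set D V mp \<M> vp
  proof unfold_locales
    show "X V Pos i n vp = 0" if "i \<in> Idx D" for i n using vp(3) that by blast
    show "U = Car V" if "submodule D V U" "vp \<in> U" for U using vp(5) that by blast
    show "irreducible_module D V" using V by (simp add: is_L_def)
    show "\<exists>j\<in>Idx D. \<not> j_dominant j m" if "m \<in> \<M>" "m \<noteq> mp" for m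
      using i \<M>(2) that unfolding dom_monoms_def dominant_def by blast
    show "j = i" if "m \<in> \<M>" "i \<in> Idx D" "a \<noteq> 0" "m - Amon D i a \<notin> \<M>" "j \<in> Idx D" "b \<noteq> 0"
      "m - Amon D i a + Amon D j b \<in> \<M>" for m i a j b
      using ii[of m i a] that unfolding Idx by blast
    show "\<exists>M\<in>\<M>. \<exists>W. M - m \<in> Acl j \<and> j_dominant j M \<and> string_module \<M> j M W" if m: "m \<in> \<M>" and j: "j \<in> Idx D" for m j
    proof -
      obtain M W where "M \<in> \<M>" "j_dominant j M" "is_L (sl2_data D j) (beta j M) (W :: (nat \<Rightarrow>\<^sub>0 complex) qmodule)"
        "qchar (sl2_data D j) W = (\<Sum>m' | m' \<in> \<M> \<and> m' - m \<in> Acl j. Poly_Mapping.single (beta j m') 1)"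
        using iii[OF m j[unfolded Idx]] unfolding qchar_L_eq_def Acl_def by blast
      from string_moduleI[OF j \<M> m this] show ?thesis by blast
    qed
  qed (use vp mpM \<M> in simp_all)
  show ?thesis using qchar thin special[OF i] by blast
qed

end
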